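(* Let $a,b:\mathbb{R}\to\mathbb{R}$ and $\xi:\mathbb{R}\to\mathbb{R}$ satisfy, for some constant $K>0$: (a) $a$ and $b$ are continuous on $\mathbb{R}$; (b) $a^2(u)\le K(1+u^2)$ and $b^2(u)\le K(1+u^2)$ for all $u\in\mathbb{R}$; (c) $\xi$ is continuous, nonrandom, and bounded on $\mathbb{R}$. For $\epsilon_1,\epsilon_2>0$ consider the SPDE $$\frac{\partial U}{\partial t}=\frac{\epsilon_1}{2}\Delta U+b(U)+\epsilon_2a(U)\frac{\partial^2W}{\partial t\partial x},\quad (t,x)\in(0,T]\times\mathbb{R};\qquad U(0,x)=\xi(x),\ x\in\mathbb{R}.\qquad( * )$$ (i) Suppose that there are constants $K_l,K_L>0$ such that $K_l\le a(u)\le K_L$ for all $u\in\mathbb{R}$. If $\epsilon_1,\epsilon_2\searrow0$ (or $\epsilon_1,\epsilon_2\nearrow\infty$) in such a way that $\epsilon_2/\epsilon_1^{1/4}\to\infty$, then $$\sup_{0\le s\le T}\sup_{x\in\mathbb{R}}\mathbb{E}\,U_{\epsilon_1,\epsilon_2}^2(s,x)\nearrow\infty$$ for any $T>0$ and for any SDDEs weak limit solution $U_{\epsilon_1,\epsilon_2}$ to $( * )$. (ii) Suppose that, in addition to (a)-(c), $b$ is Lipschitz and $a$ is bounded. Let $U_{\epsilon_1}(t,x)$ be the solution to the deterministic PDE obtained from $( * )$ by setting $a\equiv0$, and let $U_{\epsilon_1,\epsilon_2}$ be a SDDEs weak limit solution to $( * )$. Then for every $q\ge1$ $$\sup_{0\le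 t\le T}\sup_{x\in\mathbb{R}}\mathbb{E}\left|U_{\epsilon_1,\epsilon_2}(t,x)-U_{\epsilon_1}(t,x)\right|^{2q}\longrightarrow0$$ as $\epsilon_1$, $\epsilon_2$ and $\epsilon_2/\epsilon_1^{1/4}\to0$. Also, if $\{\tilde U^x_{n,\epsilon_1,\epsilon_2}(t)\}$ is a solution to the SDDE system associated with $(a,b,\xi)$ and $\{\tilde U_{n,\epsilon_1}\}$ is a solution to the deterministic system obtained from it by setting $a\equiv0$, then for every $q,n\ge1$ $$\sup_{0\le t\le T}\sup_{x\in\mathbb{R}}\mathbb{E}\left|\tilde U^x_{n,\epsilon_1,\epsilon_2}(t)-\tilde U_{n,\epsilon_1}(t,x)\right|^{2q}\longrightarrow0$$ as $\epsilon_1$, $\epsilon_2$ and $\epsilon_2/\epsilon_1^{1/4}\to0$.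
   Context: $T>0$ is fixed but arbitrary. $W$ is the Brownian sheet corresponding to the driving space-time white noise, which is regarded (as in Walsh) as a continuous orthogonal martingale measure with intensity Lebesgue measure. Lattices: $\mathbb{X}_n=\{\dots,-2\delta_n,-\delta_n,0,\delta_n,2\delta_n,\dots\}$ with $\delta_n>0$, $\delta_n\to0$. Discrete Laplacian: $\Delta_nf(x)=\frac{f(x+\delta_n)-2f(x)+f(x-\delta_n)}{\delta_n^2}$. For each $n$, $\{W^x_n(t)\}_{x\in\mathbb{X}_n}$ are independent standard Brownian motions; it is also assumed that $W_m^x=W_n^x$ if $m\ne n$ and $x\in\mathbb{X}_m\cap\mathbb{X}_n$, and that $W_m^x=0$ if $n>m$ and $x\in\mathbb{X}_n\setminus\mathbb{X}_m$. SDDE (stochastic differential-difference equation) system associated with $(a,b,\xi)$: for $n\in\mathbb{N}$, $$d\tilde U_{n,\epsilon_1,\epsilon_2}^x(t)=\Big[\frac{\epsilon_1}{2}\Delta_n\tilde U_{n,\epsilon_1,\epsilon_2}^x(t)+b(\tilde U_{n,\epsilon_1,\epsilon_2}^x(t))\Big]dt+\epsilon_2a(\tilde U_{n,\epsilon_1,\epsilon_2}^x(t))\frac{dW_n^x(t)}{\delta_n^{1/2}},\ (t,x)\in(0,T]\times\mathbb{X}_n;\qquad \tilde U_{n,\epsilon_1,\epsilon_2}^x(0)=\xi(x),\ x\in\mathbb{X}_n.$$ A solution, on a filtered probability space $(\Omega,\mathcal{F},\{\mathcal{F}_t\},\mathbb{P})$ with respect to the Brownian system $\{W_n^x\}$,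 is a sequence of real-valued processes $\tilde U_n=\{\tilde U_n^x(t);(t,x)\in[0,T]\times\mathbb{X}_n\}$, $n\ge1$, with paths continuous in $t$ for each $x$ and $n$, each $\tilde U_n^x(t)$ being $\mathcal{F}_t$-adapted, satisfying the integrated form of the system a.s. The solution is weak if one is free to choose the filtered probability space (satisfying the usual conditions) and the Brownian system on it. Under (a)-(c) the system is equivalent to the Green function formulation $$\tilde U_n^x(t)=\sum_{y\in\mathbb{X}_n}\int_0^tQ^{t-s;x-y}_{\delta_n,\epsilon_1}\Big[\epsilon_2a(\tilde U_n^y(s))\frac{dW_n^y(s)}{\delta_n^{1/2}}+b(\tilde U_n^y(s))\,ds\Big]+\sum_{y\in\mathbb{X}_n}Q^{t;x-y}_{\delta_n,\epsilon_1}\xi(y),$$ where $Q^{t;x}_{\delta_n,\epsilon_1}$ is the fundamental solution of $\frac{d}{dt}u^x(t)=\frac{\epsilon_1}{2}\Delta_nu^x(t)$ on $\mathbb{X}_n$ (the transition probability of the symmetric nearest-neighbour random walk with exponential holding times of mean $\delta_n^2/\epsilon_1$); solutions are understood in this equivalent form. Each $\tilde U_n$ is extended by linear interpolation in $x$ to a continuous process on $[0,T]\times\mathbb{R}$, denoted by the same symbol; the resulting sequence is called a continuous solution. A random field $U$ is a (continuous) SDDE limit solution of $( * )$ on $[0,T]\times\mathbb{R}$ if there is a continuous solution $\{\tilde U_n\}$ of the SDDE system, on some filtered probability space satisfying the usual conditions and with respect to some Brownian system, such that $U$ has a.s. continuous paths and $U$ is the limit, or a modification of the limit, of $\tilde U_n$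 or of a subsequence $\tilde U_{n_k}$. It is a SDDEs weak limit solution if the limit is in the sense of weak convergence (convergence in law). *)

theory Defs
  imports "HOL-Probability.Probability"
begin

section \<open>Lattices and the fundamental solution of the lattice heat equation\<close>

definition lattice :: "real \<Rightarrow> real set" where
  "lattice \<delta> = range (\<lambda>k::int. of_int k * \<delta>)"

definition disc_laplacian :: "real \<Rightarrow> (real \<Rightarrow> real) \<Rightarrow> real \<Rightarrow> real" where
  "disc_laplacian \<delta> f x = (f (x + \<delta>) - 2 * f x + f (x - \<delta>)) / \<delta>\<^sup>2"

text \<open>Law of the position after \<open>j\<close> steps of the symmetric nearest-neighbour walk on
  \<^term>\<open>lattice \<delta>\<close> started at \<open>0\<close>.\<close>

primrec srw_pmf :: "real \<Rightarrow> nat \<Rightarrow> real pmf" where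
  "srw_pmf \<delta> 0 = return_pmf 0"
| "srw_pmf \<delta> (Suc j) =
     bind_pmf (srw_pmf \<delta> j) (\<lambda>y. map_pmf (\<lambda>up. if up then y + \<delta> else y - \<delta>) (bernoulli_pmf (1/2)))"

text \<open>Transition probability from \<open>0\<close> to \<open>x\<close> in time \<open>t\<close> of the walk with exponential holding
  times of mean \<open>\<delta>\<^sup>2 / \<epsilon>\<close>: the number of jumps up to time \<open>t\<close> is Poisson with parameter
  \<open>\<epsilon> t / \<delta>\<^sup>2\<close>.\<close>

definition lattice_green :: "real \<Rightarrow> real \<Rightarrow> real \<Rightarrow> real \<Rightarrow> real" where
  "lattice_green \<delta> \<epsilon> t x =
     (\<Sum>j. exp (- (\<epsilon> * t / \<delta>\<^sup>2)) * (\<epsilon> * t / \<delta>\<^sup>2) ^ j / fact j * pmf (srw_pmf \<delta> j) x)"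

text \<open>It is the fundamental solution of \<open>du/dt = (\<epsilon>/2) \<Delta>u\<close> on the lattice.\<close>

lemma pmf_srw_Suc:
  assumes "\<delta> \<noteq> 0"
  shows "pmf (srw_pmf \<delta> (Suc j)) x = (pmf (srw_pmf \<delta> j) (x - \<delta>) + pmf (srw_pmf \<delta> j) (x + \<delta>)) / 2"
proof -
  have *: "pmf (map_pmf (\<lambda>up. if up then y + \<delta> else y - \<delta>) (bernoulli_pmf (1/2))) x
      = (indicator {x - \<delta>} y + indicator {x + \<delta>} y) / 2" for y :: real
    using assms by (auto simp: map_pmf_def pmf_bind indicator_def)
  have "pmf (srw_pmf \<delta> (Suc j)) x
      = measure_pmf.expectation (srw_pmf \<delta> j) (\<lambda>y. (indicator {x - \<delta>} y + indicator {x + \<delta>} y) / 2)"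
    by (simp add: pmf_bind *)
  also have "\<dots> = (pmf (srw_pmf \<delta> j) (x - \<delta>) + pmf (srw_pmf \<delta> j) (x + \<delta>)) / 2"
    by (simp add: measure_pmf_single Bochner_Integration.integral_add
        integrable_real_indicator measure_pmf.emeasure_eq_measure)
  finally show ?thesis .
qed

lemma lattice_green_0: "lattice_green \<delta> \<epsilon> 0 x = (if x = 0 then 1 else 0)"
proof -
  have *: "(\<lambda>j. exp (- (\<epsilon> * 0 / \<delta>\<^sup>2)) * (\<epsilon> * 0 / \<delta>\<^sup>2) ^ j / fact j * pmf (srw_pmf \<delta> j) x)
      = (\<lambda>j. if j = 0 then (if x = 0 then 1 else 0) else 0)"
    by (auto simp: fun_eq_iff power_0_left indicator_def)
  then show ?thesis
    unfolding lattice_green_def * by (subst suminf_finite[of "{0}"]) auto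
qed

lemma lattice_green_solves:
  assumes "\<delta> \<noteq> 0"
  shows "((\<lambda>t. lattice_green \<delta> \<epsilon> t x) has_real_derivative
           \<epsilon> / 2 * disc_laplacian \<delta> (lattice_green \<delta> \<epsilon> t) x) (at t)"
proof -
  define c where "c x j = pmf (srw_pmf \<delta> j) x / fact j" for x j
  define f where "f x z = (\<Sum>j. c x j * z ^ j)" for x z
  define r where "r = \<epsilon> / \<delta>\<^sup>2"
  have summ: "summable (\<lambda>j. c x j * z ^ j)" for x and z :: real
  proof (rule summable_comparison_test)
    show "summable (\<lambda>j. inverse (fact j) * \<bar>z\<bar> ^ j)" by (rule summable_exp)
    show "\<exists>N. \<forall>n\<ge>N. norm (c x n * z ^ n) \<le> inverse (fact n) * \<bar>z\<bar> ^ n"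
      by (auto simp: c_def abs_mult power_abs field_simps pmf_le_1 intro!: mult_left_le)
  qed
  have Q: "lattice_green \<delta> \<epsilon> t x = exp (- (r * t)) * f x (r * t)" for t x
  proof -
    have "lattice_green \<delta> \<epsilon> t x = (\<Sum>j. exp (- (r * t)) * (c x j * (r * t) ^ j))"
      unfolding lattice_green_def c_def r_def by (intro suminf_cong) (simp add: field_simps)
    also have "\<dots> = exp (- (r * t)) * f x (r * t)"
      unfolding f_def by (rule suminf_mult[OF summ])
    finally show ?thesis .
  qed
  have diffs: "diffs (c x) j = (c (x - \<delta>) j + c (x + \<delta>) j) / 2" for j
  proof -
    have "diffs (c x) j = pmf (srw_pmf \<delta> (Suc j)) x / fact j"
      unfolding diffs_def c_def by (simp add: divide_simps del: srw_pmf.simps)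
    then show ?thesis
      using pmf_srw_Suc[OF assms, of j x] by (simp add: c_def add_divide_distrib)
  qed
  have df: "(f x has_real_derivative (f (x - \<delta>) z + f (x + \<delta>) z) / 2) (at z)" for z
  proof -
    have "(f x has_real_derivative (\<Sum>j. diffs (c x) j * z ^ j)) (at z)"
      unfolding f_def by (rule termdiffs_strong_converges_everywhere) (rule summ)
    also have "(\<Sum>j. diffs (c x) j * z ^ j) = (\<Sum>j. (c (x - \<delta>) j * z ^ j + c (x + \<delta>) j * z ^ j) / 2)"
      by (intro suminf_cong) (simp add: diffs algebra_simps)
    also have "\<dots> = (f (x - \<delta>) z + f (x + \<delta>) z) / 2"
      unfolding f_def
      by (subst suminf_add[OF summ summ]) (rule suminf_divide[OF summable_add[OF summ summ]])
    finally show ?thesis .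
  qed
  have "((\<lambda>t. exp (- (r * t)) * f x (r * t)) has_real_derivative
      exp (- (r * t)) * ((f (x - \<delta>) (r * t) + f (x + \<delta>) (r * t)) / 2 * r)
      + exp (- (r * t)) * (- r) * f x (r * t)) (at t)"
    by (rule derivative_eq_intros DERIV_chain2[OF df] | simp)+
  also have "exp (- (r * t)) * ((f (x - \<delta>) (r * t) + f (x + \<delta>) (r * t)) / 2 * r)
      + exp (- (r * t)) * (- r) * f x (r * t) = \<epsilon> / 2 * disc_laplacian \<delta> (lattice_green \<delta> \<epsilon> t) x"
    using assms unfolding disc_laplacian_def Q by (simp add: r_def field_simps)
  finally show ?thesis unfolding Q .
qed

section \<open>Filtered probability spaces, Brownian systems, stochastic integrals\<close>

text \<open>Time is \<open>[0, \<infinity>)\<close>; the values of a filtration at negative indices play no role.\<close>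

definition filtered_prob_space :: "'a measure \<Rightarrow> (real \<Rightarrow> 'a measure) \<Rightarrow> bool" where
  "filtered_prob_space M F \<longleftrightarrow>
     prob_space M \<and> filtration (space M) F \<and> (\<forall>t\<ge>0. subalgebra M (F t))"

definition usual_conditions :: "'a measure \<Rightarrow> (real \<Rightarrow> 'a measure) \<Rightarrow> bool" where
  "usual_conditions M F \<longleftrightarrow>
     (\<forall>N\<in>null_sets M. \<forall>A\<subseteq>N. A \<in> sets (F 0)) \<and>
     (\<forall>t\<ge>0. sets (F t) = (\<Inter>u\<in>{t<..}. sets (F u)))"

text \<open>Independent standard Brownian motions indexed by \<open>X\<close>, with respect to the filtration.\<close>

definition brownian_family ::
  "'a measure \<Rightarrow> (real \<Rightarrow> 'a measure) \<Rightarrow> real set \<Rightarrow> (real \<Rightarrow> real \<Rightarrow> 'a \<Rightarrow> real) \<Rightarrow> bool" where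
  "brownian_family M F X W \<longleftrightarrow>
     (\<forall>x\<in>X. (AE \<omega> in M. W x 0 \<omega> = 0 \<and> continuous_on {0..} (\<lambda>t. W x t \<omega>)) \<and>
        (\<forall>t\<ge>0. W x t \<in> borel_measurable (F t)) \<and>
        (\<forall>s t. 0 \<le> s \<and> s < t \<longrightarrow>
           distributed M lborel (\<lambda>\<omega>. W x t \<omega> - W x s \<omega>) (normal_density 0 (sqrt (t - s))))) \<and>
     prob_space.indep_vars M (\<lambda>_. PiM {0..} (\<lambda>_. borel)) (\<lambda>x \<omega>. \<lambda>t\<in>{0..}. W x t \<omega>) X \<and>
     (\<forall>s\<ge>0. prob_space.indep_set M (sets (F s))
        (sets (vimage_algebra (space M) (\<lambda>\<omega>. \<lambda>(x, t)\<in>X \<times> {s..}. W x t \<omega> - W x s \<omega>)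
           (PiM (X \<times> {s..}) (\<lambda>_. borel)))))"

definition brownian_system ::
  "'a measure \<Rightarrow> (real \<Rightarrow> 'a measure) \<Rightarrow> (nat \<Rightarrow> real) \<Rightarrow> (nat \<Rightarrow> real \<Rightarrow> real \<Rightarrow> 'a \<Rightarrow> real) \<Rightarrow> bool" where
  "brownian_system M F \<delta> W \<longleftrightarrow>
     (\<forall>n. brownian_family M F (lattice (\<delta> n)) (W n)) \<and>
     (\<forall>m n. \<forall>x\<in>lattice (\<delta> m) \<inter> lattice (\<delta> n). W m x = W n x) \<and>
     (\<forall>m n. m < n \<longrightarrow> (\<forall>x\<in>lattice (\<delta> n) - lattice (\<delta> m). W m x = (\<lambda>t \<omega>. 0)))"

definition tendsto_in_prob :: "'a measure \<Rightarrow> ('i \<Rightarrow> 'a \<Rightarrow> real) \<Rightarrow> ('a \<Rightarrow> real) \<Rightarrow> 'i filter \<Rightarrow> bool" where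
  "tendsto_in_prob M X Y G \<longleftrightarrow>
     (\<forall>\<eta>>0. ((\<lambda>i. measure M {\<omega>\<in>space M. \<bar>X i \<omega> - Y \<omega>\<bar> > \<eta>}) \<longlongrightarrow> 0) G)"

text \<open>An elementary integrand on \<open>[0, t]\<close> is given by a partition \<open>\<tau> 0 \<le> \<dots> \<le> \<tau> k\<close> of a
  subinterval and bounded \<^term>\<open>F (\<tau> i)\<close>-measurable heights \<open>h i\<close> on \<open>(\<tau> i, \<tau> (i + 1)]\<close>.\<close>

definition elementary ::
  "'a measure \<Rightarrow> (real \<Rightarrow> 'a measure) \<Rightarrow> real \<Rightarrow> nat \<Rightarrow> (nat \<Rightarrow> real) \<Rightarrow> (nat \<Rightarrow> 'a \<Rightarrow> real) \<Rightarrow> bool" where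
  "elementary M F t k \<tau> h \<longleftrightarrow>
     0 \<le> \<tau> 0 \<and> mono_on {..k} \<tau> \<and> \<tau> k \<le> t \<and>
     (\<forall>i<k. h i \<in> borel_measurable (F (\<tau> i)) \<and> bounded (h i ` space M))"

definition elementary_fun :: "nat \<Rightarrow> (nat \<Rightarrow> real) \<Rightarrow> (nat \<Rightarrow> 'a \<Rightarrow> real) \<Rightarrow> real \<Rightarrow> 'a \<Rightarrow> real" where
  "elementary_fun k \<tau> h s \<omega> = (\<Sum>i<k. h i \<omega> * indicator {\<tau> i<..\<tau> (Suc i)} s)"

definition elementary_integral ::
  "(real \<Rightarrow> 'a \<Rightarrow> real) \<Rightarrow> nat \<Rightarrow> (nat \<Rightarrow> real) \<Rightarrow> (nat \<Rightarrow> 'a \<Rightarrow> real) \<Rightarrow> 'a \<Rightarrow> real" where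
  "elementary_integral B k \<tau> h \<omega> = (\<Sum>i<k. h i \<omega> * (B (\<tau> (Suc i)) \<omega> - B (\<tau> i) \<omega>))"

text \<open>\<open>J\<close> is (a version of) the Ito integral of \<open>H\<close> over \<open>[0, t]\<close> with respect to \<open>B\<close>, for
  integrands that are almost surely square integrable: \<open>H\<close> is approximated by elementary
  integrands in \<open>L\<^sup>2([0, t])\<close> in probability. Joint measurability of \<open>H\<close> makes the
  probability of the approximation error meaningful.\<close>

definition has_ito_integral ::
  "'a measure \<Rightarrow> (real \<Rightarrow> 'a measure) \<Rightarrow> (real \<Rightarrow> 'a \<Rightarrow> real) \<Rightarrow> (real \<Rightarrow> 'a \<Rightarrow> real) \<Rightarrow> real
     \<Rightarrow> ('a \<Rightarrow> real) \<Rightarrow> bool" where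
  "has_ito_integral M F B H t J \<longleftrightarrow>
     (\<lambda>(s, \<omega>). H s \<omega>) \<in> borel_measurable (restrict_space lborel {0..t} \<Otimes>\<^sub>M M) \<and>
     J \<in> borel_measurable M \<and>
     (\<exists>k \<tau> h. (\<forall>m. elementary M F t (k m) (\<tau> m) (h m)) \<and>
        (\<forall>\<eta>>0. (\<lambda>m. measure M {\<omega>\<in>space M.
            (\<integral>\<^sup>+s\<in>{0..t}. ennreal ((H s \<omega> - elementary_fun (k m) (\<tau> m) (h m) s \<omega>)\<^sup>2) \<partial>lborel)
              > ennreal \<eta>}) \<longlonglongrightarrow> 0) \<and>
        tendsto_in_prob M (\<lambda>m. elementary_integral B (k m) (\<tau> m) (h m)) J sequentially)"

section \<open>The SDDE system in Green function form\<close>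

definition green_initial :: "real \<Rightarrow> real \<Rightarrow> (real \<Rightarrow> real) \<Rightarrow> real \<Rightarrow> real \<Rightarrow> real" where
  "green_initial \<delta> \<epsilon> \<xi> t x = (\<Sum>\<^sub>\<infinity>y\<in>lattice \<delta>. lattice_green \<delta> \<epsilon> t (x - y) * \<xi> y)"

definition has_green_drift ::
  "real \<Rightarrow> real \<Rightarrow> (real \<Rightarrow> real) \<Rightarrow> (real \<Rightarrow> real \<Rightarrow> real) \<Rightarrow> real \<Rightarrow> real \<Rightarrow> real \<Rightarrow> bool" where
  "has_green_drift \<delta> \<epsilon> b v t x D \<longleftrightarrow>
     (\<lambda>y. LBINT s:{0..t}. lattice_green \<delta> \<epsilon> (t - s) (x - y) * \<bar>b (v y s)\<bar>) summable_on lattice \<delta> \<and>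
     D = (\<Sum>\<^sub>\<infinity>y\<in>lattice \<delta>. LBINT s:{0..t}. lattice_green \<delta> \<epsilon> (t - s) (x - y) * b (v y s))"

text \<open>\<open>S\<close> is the sum over the lattice of the stochastic integrals of
  \<open>lattice_green \<delta> \<epsilon> (t - s) (x - y) * g (v y s \<omega>)\<close> with respect to \<open>W y\<close>; the sum over the
  independent Brownian motions is an unconditional limit in probability.\<close>

definition has_green_noise ::
  "'a measure \<Rightarrow> (real \<Rightarrow> 'a measure) \<Rightarrow> (real \<Rightarrow> real \<Rightarrow> 'a \<Rightarrow> real) \<Rightarrow> real \<Rightarrow> real \<Rightarrow> (real \<Rightarrow> real)
     \<Rightarrow> (real \<Rightarrow> real \<Rightarrow> 'a \<Rightarrow> real) \<Rightarrow> real \<Rightarrow> real \<Rightarrow> ('a \<Rightarrow> real) \<Rightarrow> bool" where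
  "has_green_noise M F W \<delta> \<epsilon> g v t x S \<longleftrightarrow>
     (AE \<omega> in M. (\<lambda>y. LBINT s:{0..t}. (lattice_green \<delta> \<epsilon> (t - s) (x - y) * g (v y s \<omega>))\<^sup>2)
        summable_on lattice \<delta>) \<and>
     S \<in> borel_measurable M \<and>
     (\<exists>I. (\<forall>y\<in>lattice \<delta>. has_ito_integral M F (W y)
             (\<lambda>s \<omega>. lattice_green \<delta> \<epsilon> (t - s) (x - y) * g (v y s \<omega>)) t (I y)) \<and>
        tendsto_in_prob M (\<lambda>A \<omega>. \<Sum>y\<in>A. I y \<omega>) S (finite_subsets_at_top (lattice \<delta>)))"

definition sdde_solution ::
  "'a measure \<Rightarrow> (real \<Rightarrow> 'a measure) \<Rightarrow> (nat \<Rightarrow> real \<Rightarrow> real \<Rightarrow> 'a \<Rightarrow> real) \<Rightarrow> (nat \<Rightarrow> real) \<Rightarrow> real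
     \<Rightarrow> real \<Rightarrow> real \<Rightarrow> (real \<Rightarrow> real) \<Rightarrow> (real \<Rightarrow> real) \<Rightarrow> (real \<Rightarrow> real)
     \<Rightarrow> (nat \<Rightarrow> real \<Rightarrow> real \<Rightarrow> 'a \<Rightarrow> real) \<Rightarrow> bool" where
  "sdde_solution M F W \<delta> T \<epsilon>1 \<epsilon>2 a b \<xi> U \<longleftrightarrow>
     filtered_prob_space M F \<and> brownian_system M F \<delta> W \<and>
     (\<forall>n. \<forall>x\<in>lattice (\<delta> n).
        (\<forall>\<omega>\<in>space M. continuous_on {0..T} (\<lambda>t. U n x t \<omega>)) \<and>
        (\<forall>t\<in>{0..T}. U n x t \<in> borel_measurable (F t)) \<and>
        (\<forall>t\<in>{0..T}. \<exists>S.
           has_green_noise M F (W n) (\<delta> n) \<epsilon>1 (\<lambda>u. \<epsilon>2 * a u / sqrt (\<delta> n)) (U n) t x S \<and>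
           (AE \<omega> in M. has_green_drift (\<delta> n) \<epsilon>1 b (\<lambda>y s. U n y s \<omega>) t x
              (U n x t \<omega> - S \<omega> - green_initial (\<delta> n) \<epsilon>1 \<xi> t x))))"

text \<open>The deterministic system obtained by setting \<open>a = 0\<close>.\<close>

definition deterministic_system_solution ::
  "(nat \<Rightarrow> real) \<Rightarrow> real \<Rightarrow> real \<Rightarrow> (real \<Rightarrow> real) \<Rightarrow> (real \<Rightarrow> real) \<Rightarrow> (nat \<Rightarrow> real \<Rightarrow> real \<Rightarrow> real) \<Rightarrow> bool"
  where
  "deterministic_system_solution \<delta> T \<epsilon>1 b \<xi> v \<longleftrightarrow>
     (\<forall>n. \<forall>x\<in>lattice (\<delta> n).
        continuous_on {0..T} (v n x) \<and>
        (\<forall>t\<in>{0..T}. has_green_drift (\<delta> n) \<epsilon>1 b (v n) t x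
           (v n x t - green_initial (\<delta> n) \<epsilon>1 \<xi> t x)))"

definition lin_interp :: "real \<Rightarrow> (real \<Rightarrow> real) \<Rightarrow> real \<Rightarrow> real" where
  "lin_interp \<delta> f x =
     (1 - frac (x / \<delta>)) * f (of_int \<lfloor>x / \<delta>\<rfloor> * \<delta>) + frac (x / \<delta>) * f (of_int (\<lfloor>x / \<delta>\<rfloor> + 1) * \<delta>)"

section \<open>Weak limit solutions\<close>

text \<open>Continuous real functionals on \<open>C([0,T] \<times> \<real>)\<close> with the (metrizable) topology of locally
  uniform convergence. Constant sequences show that such a functional depends only on the
  restriction of its argument to \<open>[0,T] \<times> \<real>\<close>.\<close>

definition bounded_continuous_functional :: "real \<Rightarrow> ((real \<times> real \<Rightarrow> real) \<Rightarrow> real) \<Rightarrow> bool" where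
  "bounded_continuous_functional T \<phi> \<longleftrightarrow>
     bounded (\<phi> ` {f. continuous_on ({0..T} \<times> UNIV) f}) \<and>
     (\<forall>fs f. (\<forall>k. continuous_on ({0..T} \<times> UNIV) (fs k)) \<and> continuous_on ({0..T} \<times> UNIV) f \<and>
        (\<forall>R. uniform_limit ({0..T} \<times> {-R..R}) fs f sequentially) \<longrightarrow>
        (\<lambda>k. \<phi> (fs k)) \<longlonglongrightarrow> \<phi> f)"

text \<open>Convergence in law on \<open>C([0,T] \<times> \<real>)\<close>, for random fields all of whose paths are
  continuous.\<close>

definition converges_in_law ::
  "real \<Rightarrow> 'a measure \<Rightarrow> (nat \<Rightarrow> real \<Rightarrow> real \<Rightarrow> 'a \<Rightarrow> real) \<Rightarrow> 'b measure \<Rightarrow> (real \<Rightarrow> real \<Rightarrow> 'b \<Rightarrow> real)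
     \<Rightarrow> bool" where
  "converges_in_law T N Y M V \<longleftrightarrow>
     (\<forall>\<phi>. bounded_continuous_functional T \<phi> \<longrightarrow>
        (\<lambda>k. \<integral>\<omega>. \<phi> (\<lambda>(t, x). Y k t x \<omega>) \<partial>N) \<longlonglongrightarrow> (\<integral>\<omega>. \<phi> (\<lambda>(t, x). V t x \<omega>) \<partial>M))"

text \<open>\<open>U\<close> is a random field on \<open>M\<close>; \<open>V\<close> is the limit in law, of which \<open>U\<close> is a modification.
  The type argument is the sample type of the space carrying the solution of the SDDE system.
  A subsequence \<open>r\<close> includes the full sequence \<open>r = id\<close>.\<close>

definition sdde_weak_limit_solution ::
  "'v itself \<Rightarrow> (nat \<Rightarrow> real) \<Rightarrow> real \<Rightarrow> real \<Rightarrow> real \<Rightarrow> (real \<Rightarrow> real) \<Rightarrow> (real \<Rightarrow> real) \<Rightarrow> (real \<Rightarrow> real)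
     \<Rightarrow> 'w measure \<Rightarrow> (real \<Rightarrow> real \<Rightarrow> 'w \<Rightarrow> real) \<Rightarrow> bool" where
  "sdde_weak_limit_solution _ \<delta> T \<epsilon>1 \<epsilon>2 a b \<xi> M U \<longleftrightarrow>
     prob_space M \<and>
     (\<forall>t\<in>{0..T}. \<forall>x. U t x \<in> borel_measurable M) \<and>
     (AE \<omega> in M. continuous_on ({0..T} \<times> UNIV) (\<lambda>(t, x). U t x \<omega>)) \<and>
     (\<exists>(N :: 'v measure) F W X r V.
        usual_conditions N F \<and>
        sdde_solution N F W \<delta> T \<epsilon>1 \<epsilon>2 a b \<xi> X \<and>
        strict_mono r \<and>
        (\<forall>t\<in>{0..T}. \<forall>x. V t x \<in> borel_measurable M) \<and>
        (\<forall>\<omega>\<in>space M. continuous_on ({0..T} \<times> UNIV) (\<lambda>(t, x). V t x \<omega>)) \<and>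
        (\<forall>t\<in>{0..T}. \<forall>x. AE \<omega> in M. U t x \<omega> = V t x \<omega>) \<and>
        converges_in_law T N (\<lambda>k t x \<omega>. lin_interp (\<delta> (r k)) (\<lambda>y. X (r k) y t \<omega>) x) M V)"

section \<open>The deterministic PDE\<close>

text \<open>Continuous solution of \<open>\<partial>u/\<partial>t = (\<epsilon>/2) \<Delta>u + b(u)\<close>, \<open>u(0,\<cdot>) = \<xi>\<close>, in Green function form.
  The Gaussian density with variance \<open>\<epsilon> t\<close> is the fundamental solution of
  \<open>\<partial>u/\<partial>t = (\<epsilon>/2) \<Delta>u\<close>.\<close>

definition deterministic_pde_solution ::
  "real \<Rightarrow> real \<Rightarrow> (real \<Rightarrow> real) \<Rightarrow> (real \<Rightarrow> real) \<Rightarrow> (real \<Rightarrow> real \<Rightarrow> real) \<Rightarrow> bool" where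
  "deterministic_pde_solution T \<epsilon> b \<xi> u \<longleftrightarrow>
     continuous_on ({0..T} \<times> UNIV) (\<lambda>(t, x). u t x) \<and>
     (\<forall>x. u 0 x = \<xi> x) \<and>
     (\<forall>t\<in>{0<..T}. \<forall>x.
        set_integrable lborel ({0<..<t} \<times> UNIV)
          (\<lambda>(s, y). normal_density 0 (sqrt (\<epsilon> * (t - s))) (x - y) * b (u s y)) \<and>
        u t x = (LBINT y. normal_density 0 (sqrt (\<epsilon> * t)) (x - y) * \<xi> y)
          + (LINT (s, y):{0<..<t} \<times> UNIV|lborel.
               normal_density 0 (sqrt (\<epsilon> * (t - s))) (x - y) * b (u s y)))"

end

theory Submission
  imports Defs
begin

text \<open>
  The solution is the heat flow of \<open>\<xi>\<close>, plus the Duhamel integral of \<open>b(U)\<close>, plus a stochastic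
  convolution. On the lattice, truncating the integrands at a level of quadratic variation makes the
  exponential martingale \<open>exp (l S - l\<^sup>2 \<langle>S\<rangle> / 2)\<close> a true martingale. With \<open>gl \<le> a\<^sup>2 \<le> gu\<close>, the
  Laplace transform of the stochastic convolution \<open>S\<close> therefore lies between those of centred Gaussians
  of variances \<open>gl v\<close> and \<open>gu v\<close>, where \<open>v = (\<epsilon>2\<^sup>2 / \<delta>) \<integral> \<Sum> Q\<^sup>2\<close>. Up to constants depending on
  \<open>T\<close>, this is \<open>\<epsilon>2\<^sup>2 / sqrt \<epsilon>1 = (\<epsilon>2 / \<epsilon>1 powr (1/4))\<^sup>2\<close>, uniformly as \<open>\<delta>\<close> tends to \<open>0\<close>.

  The stochastic convolution is the continuous functional \<open>U - heat flow - Duhamel integral\<close> of the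
  solution, up to a spatial cutoff of the drift. Convergence in law thus carries the Gaussian bounds
  over to the limit, without any stochastic integral in the limit. Part (i) follows from the lower bound
  and the linear growth of \<open>b\<close>; part (ii) follows from the upper bound and Gronwall's inequality.
\<close>

text \<open>Elementary approximations of an Ito integrand converge in probability, which gives no
  uniform bound on their quadratic variation, and mass of the exponential martingale could escape in
  the limit. Capping the variation one unit above the deterministic bound of the limit keeps the
  exponentials bounded in \<open>L^2\<close>, and the cap is eventually invisible. A solution comes
  with no moment bound. Gronwall's inequality is therefore run pathwise along the transition kernel
  towards one space-time point. On the lattice, the absolute summability built into the drift
  supplies the finiteness that absorption needs; moments are taken afterwards. Two obstacles stand
  between lattice and limit. The Duhamel term is not continuous for locally uniform convergence,
  because the drift far away is uncontrolled: hence the spatial cutoff, whose removal is paid for by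
  first moments uniform in lattice and space. And the functional changes with the lattice through
  the walk kernel, so convergence in law has to be extended to equicontinuous sequences of
  functionals.\<close>

section \<open>Exponential martingales of elementary integrals\<close>

lemma nn_integral_exp_normal:
  fixes g d :: real
  assumes "0 < d"
  shows "(\<integral>\<^sup>+z. ennreal (exp (g * z - g\<^sup>2 * d / 2)) \<partial>density lborel (normal_density 0 (sqrt d))) = 1"
proof -
  \<comment> \<open>Exponential tilting: completing the square moves the mean to
    \<open>g * d\<close> and keeps the variance.\<close>
  have *: "normal_density 0 (sqrt d) z * exp (g * z - g\<^sup>2 * d / 2) = normal_density (g * d) (sqrt d) z" for z
  proof -
    have "- (z\<^sup>2 / (2 * d)) + (g * z - g\<^sup>2 * d / 2) = - ((z - g * d)\<^sup>2 / (2 * d))"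
      using assms by (simp add: field_simps power2_eq_square)
    then show ?thesis
      using assms by (simp add: normal_density_def flip: exp_add)
  qed
  have "(\<integral>\<^sup>+z. ennreal (exp (g * z - g\<^sup>2 * d / 2)) \<partial>density lborel (normal_density 0 (sqrt d)))
     = (\<integral>\<^sup>+z. ennreal (normal_density (g * d) (sqrt d) z) \<partial>lborel)"
    by (subst nn_integral_density) (auto simp: * ennreal_mult'[symmetric] intro!: nn_integral_cong)
  also have "\<dots> = 1"
    using assms by (subst nn_integral_eq_integral) auto
  finally show ?thesis .
qed

text \<open>Independence of Brownian increments from the past is given between sigma-algebras. As a
  product law it can be used with Tonelli; checking rectangles suffices.\<close>

lemma (in prob_space) distr_pair_indep_set:
  assumes sub: "subalgebra M F"
    and X: "X \<in> F \<rightarrow>\<^sub>M S" and Y: "Y \<in> M \<rightarrow>\<^sub>M T"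
    and ind: "indep_set (sets F) (sets (vimage_algebra (space M) Y T))"
  shows "distr M S X \<Otimes>\<^sub>M distr M T Y = distr M (S \<Otimes>\<^sub>M T) (\<lambda>\<omega>. (X \<omega>, Y \<omega>))"
proof -
  have sF: "space F = space M" using sub by (auto simp: subalgebra_def)
  have XM: "X \<in> M \<rightarrow>\<^sub>M S"
    by (rule measurable_from_subalg[OF sub X])
  interpret X: prob_space "distr M S X" by (rule prob_space_distr) fact
  interpret Y: prob_space "distr M T Y" by (rule prob_space_distr) fact
  show ?thesis
  proof (rule pair_measure_eqI)
    show "sigma_finite_measure (distr M S X)" "sigma_finite_measure (distr M T Y)" ..
    show "sets (distr M S X \<Otimes>\<^sub>M distr M T Y) = sets (distr M (S \<Otimes>\<^sub>M T) (\<lambda>\<omega>. (X \<omega>, Y \<omega>)))"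
      by (simp cong: sets_pair_measure_cong)
  next
    fix A B assume "A \<in> sets (distr M S X)" "B \<in> sets (distr M T Y)"
    then have A: "A \<in> sets S" and B: "B \<in> sets T" by auto
    have XF: "X -` A \<inter> space M \<in> sets F" using measurable_sets[OF X A] by (simp add: sF)
    have YF: "Y -` B \<inter> space M \<in> sets (vimage_algebra (space M) Y T)"
      using B by (rule in_vimage_algebra)
    have "prob ((X -` A \<inter> space M) \<inter> (Y -` B \<inter> space M)) = prob (X -` A \<inter> space M) * prob (Y -` B \<inter> space M)"
      using ind XF YF unfolding indep_sets2_eq by blast
    moreover have "(\<lambda>\<omega>. (X \<omega>, Y \<omega>)) -` (A \<times> B) \<inter> space M = (X -` A \<inter> space M) \<inter> (Y -` B \<inter> space M)" by auto
    ultimately show "emeasure (distr M S X) A * emeasure (distr M T Y) B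
       = emeasure (distr M (S \<Otimes>\<^sub>M T) (\<lambda>\<omega>. (X \<omega>, Y \<omega>))) (A \<times> B)"
      using A B XM Y by (subst (1 2 3) emeasure_distr) (auto simp: emeasure_eq_measure ennreal_mult')
  qed
qed

text \<open>Given the past \<open>F\<close>, the coefficients are constants and the increments
  remain independent centred Gaussians, so the inner integral factors into exponential moments equal
  to \<open>1\<close>. Taking the weight \<open>Y\<close> in \<open>ennreal\<close> makes this a
  Tonelli argument without integrability conditions.\<close>

lemma (in prob_space) nn_integral_exp_step:
  fixes D g :: "'y \<Rightarrow> 'a \<Rightarrow> real" and Y :: "'a \<Rightarrow> ennreal"
  assumes fin: "finite A" and d: "0 < d"
    and ind: "A \<noteq> {} \<Longrightarrow> indep_vars (\<lambda>_. borel) D A"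
    and nd: "\<And>y. y \<in> A \<Longrightarrow> distributed M lborel (D y) (normal_density 0 (sqrt d))"
    and sub: "subalgebra M F"
    and ind2: "indep_set (sets F)
      (sets (vimage_algebra (space M) (\<lambda>\<omega>. \<lambda>y\<in>A. D y \<omega>) (PiM A (\<lambda>_. borel))))"
    and Y: "Y \<in> borel_measurable F" and g: "\<And>y. y \<in> A \<Longrightarrow> g y \<in> borel_measurable F"
  shows "(\<integral>\<^sup>+\<omega>. Y \<omega> * ennreal (exp (\<Sum>y\<in>A. g y \<omega> * D y \<omega> - (g y \<omega>)\<^sup>2 * d / 2)) \<partial>M) = (\<integral>\<^sup>+\<omega>. Y \<omega> \<partial>M)"
proof (cases "A = {}")
  case True then show ?thesis by simp
next
  case False
  let ?P = "PiM A (\<lambda>_. borel :: real measure)"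
  let ?N = "\<lambda>_. density lborel (\<lambda>x. ennreal (normal_density 0 (sqrt d) x))"
  define DD where "DD \<omega> = (\<lambda>y\<in>A. D y \<omega>)" for \<omega>
  define G where "G \<omega> = (Y \<omega>, \<lambda>y\<in>A. g y \<omega>)" for \<omega>
  have sF: "space F = space M" using sub by (auto simp: subalgebra_def)
  have DM: "y \<in> A \<Longrightarrow> D y \<in> borel_measurable M" for y
    using ind[OF False] by (auto simp: indep_vars_def)
  have DDm: "DD \<in> M \<rightarrow>\<^sub>M ?P"
    unfolding DD_def using DM by (intro measurable_restrict) auto
  have GF: "G \<in> F \<rightarrow>\<^sub>M borel \<Otimes>\<^sub>M ?P"
    unfolding G_def using Y g by (intro measurable_Pair measurable_restrict) auto
  have Gm: "G \<in> M \<rightarrow>\<^sub>M borel \<Otimes>\<^sub>M ?P"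
    by (rule measurable_from_subalg[OF sub GF])
  have dist: "distr M (borel \<Otimes>\<^sub>M ?P) G \<Otimes>\<^sub>M distr M ?P DD
       = distr M ((borel \<Otimes>\<^sub>M ?P) \<Otimes>\<^sub>M ?P) (\<lambda>x. (G x, DD x))"
    using DDm ind2 unfolding DD_def by (intro distr_pair_indep_set[OF sub GF]) auto
  have dD: "distr M borel (D y) = ?N y" if "y \<in> A" for y
    using nd[OF that] by (simp add: distributed_def cong: distr_cong)
  have distD: "distr M ?P DD = PiM A ?N"
  proof -
    have "distr M ?P DD = PiM A (\<lambda>y. distr M borel (D y))"
      unfolding DD_def using ind[OF False] indep_vars_iff_distr_eq_PiM'[OF False, where M'="\<lambda>_. borel" and X=D] DM by auto
    also have "\<dots> = PiM A ?N" by (intro PiM_cong) (auto simp: dD)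
    finally show ?thesis .
  qed
  interpret PN: product_prob_space ?N A
    using d by (intro product_prob_spaceI) (auto intro!: prob_space_normal_density)
  interpret PD: product_sigma_finite ?N by standard
  have PS: "prob_space (PiM A ?N)" using d by (intro prob_space_PiM prob_space_normal_density) auto
  define \<Phi> where "\<Phi> x z = (\<Sum>y\<in>A. x y * z y - (x y)\<^sup>2 * d / 2)" for x z :: "'y \<Rightarrow> real"
  define H where "H p = ennreal (exp (\<Phi> (snd (fst p)) (snd p))) * fst (fst p)" for p
  have Phim: "H
      \<in> borel_measurable ((borel \<Otimes>\<^sub>M ?P) \<Otimes>\<^sub>M ?P)"
  proof -
    have [measurable]: "(\<lambda>p. snd (fst p) y) \<in> borel_measurable ((borel \<Otimes>\<^sub>M ?P) \<Otimes>\<^sub>M ?P)"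
      "(\<lambda>p. snd p y) \<in> borel_measurable ((borel \<Otimes>\<^sub>M ?P) \<Otimes>\<^sub>M ?P)" if "y \<in> A" for y
      using that by (auto intro!: measurable_compose[OF _ measurable_component_singleton])
    show ?thesis unfolding H_def \<Phi>_def by measurable
  qed
  have "(\<integral>\<^sup>+\<omega>. Y \<omega> * ennreal (exp (\<Sum>y\<in>A. g y \<omega> * D y \<omega> - (g y \<omega>)\<^sup>2 * d / 2)) \<partial>M)
     = (\<integral>\<^sup>+\<omega>. H (G \<omega>, DD \<omega>) \<partial>M)"
    by (intro nn_integral_cong) (simp add: H_def G_def DD_def \<Phi>_def mult.commute[of "Y _"])
  also have "\<dots> = (\<integral>\<^sup>+w. H w \<partial>distr M ((borel \<Otimes>\<^sub>M ?P) \<Otimes>\<^sub>M ?P) (\<lambda>x. (G x, DD x)))"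
    using Gm DDm Phim by (subst nn_integral_distr) auto
  also have "\<dots> = (\<integral>\<^sup>+w. H w \<partial>(distr M (borel \<Otimes>\<^sub>M ?P) G \<Otimes>\<^sub>M PiM A ?N))"
    by (simp add: dist[symmetric] distD)
  also have "\<dots> = (\<integral>\<^sup>+w. (\<integral>\<^sup>+z. H (w, z) \<partial>PiM A ?N) \<partial>distr M (borel \<Otimes>\<^sub>M ?P) G)"
  proof (rule sigma_finite_measure.nn_integral_fst[OF prob_space_imp_sigma_finite[OF PS], symmetric])
    have "sets (distr M (borel \<Otimes>\<^sub>M ?P) G \<Otimes>\<^sub>M PiM A ?N) = sets ((borel \<Otimes>\<^sub>M ?P) \<Otimes>\<^sub>M ?P)"
      by (intro sets_pair_measure_cong sets_PiM_cong) auto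
    then show "H \<in> borel_measurable (distr M (borel \<Otimes>\<^sub>M ?P) G \<Otimes>\<^sub>M PiM A ?N)"
      using Phim by (simp cong: measurable_cong_sets)
  qed
  also have "\<dots> = (\<integral>\<^sup>+w. fst w \<partial>distr M (borel \<Otimes>\<^sub>M ?P) G)"
  proof (intro nn_integral_cong)
    fix w :: "ennreal \<times> ('y \<Rightarrow> real)"
    obtain a x where w: "w = (a, x)" by (cases w)
    have "(\<integral>\<^sup>+z. ennreal (exp (\<Phi> x z)) \<partial>PiM A ?N)
       = (\<integral>\<^sup>+z. (\<Prod>y\<in>A. ennreal (exp (x y * z y - (x y)\<^sup>2 * d / 2))) \<partial>PiM A ?N)"
      by (intro nn_integral_cong) (simp add: \<Phi>_def exp_sum fin prod_ennreal)
    also have "\<dots> = (\<Prod>y\<in>A. (\<integral>\<^sup>+z. ennreal (exp (x y * z - (x y)\<^sup>2 * d / 2)) \<partial>?N y))"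
      by (intro PD.product_nn_integral_prod fin) auto
    also have "\<dots> = 1" using d by (simp add: nn_integral_exp_normal)
    finally have 1: "(\<integral>\<^sup>+z. ennreal (exp (\<Phi> x z)) \<partial>PiM A ?N) = 1" .
    have m: "(\<lambda>z. ennreal (exp (\<Phi> x z))) \<in> borel_measurable (PiM A ?N)"
    proof -
      have "(\<lambda>z. ennreal (exp (\<Phi> x z))) \<in> borel_measurable ?P" unfolding \<Phi>_def by measurable
      moreover have "sets (PiM A ?N) = sets ?P" by (intro sets_PiM_cong) auto
      ultimately show ?thesis by (simp cong: measurable_cong_sets)
    qed
    show "(\<integral>\<^sup>+z. H (w, z) \<partial>PiM A ?N) = fst w"
      using m by (simp add: w H_def nn_integral_multc 1)
  qed
  also have "\<dots> = (\<integral>\<^sup>+\<omega>. Y \<omega> \<partial>M)"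
    using Gm by (subst nn_integral_distr) (auto simp: G_def)
  finally show ?thesis .
qed

lemma brownian_increment_step:
  assumes fps: "filtered_prob_space M F" and bf: "brownian_family M F X W"
    and A: "finite A" "A \<subseteq> X" and pu: "0 \<le> p" "p < u"
    and Y: "Y \<in> borel_measurable (F p)" and g: "\<And>y. y \<in> A \<Longrightarrow> g y \<in> borel_measurable (F p)"
  shows "(\<integral>\<^sup>+\<omega>. Y \<omega> * ennreal (exp (\<Sum>y\<in>A. g y \<omega> * (W y u \<omega> - W y p \<omega>) - (g y \<omega>)\<^sup>2 * (u - p) / 2)) \<partial>M)
    = (\<integral>\<^sup>+\<omega>. Y \<omega> \<partial>M)"
proof -
  interpret prob_space M using fps by (simp add: filtered_prob_space_def)
  let ?D = "\<lambda>y \<omega>. W y u \<omega> - W y p \<omega>"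
  have sub: "subalgebra M (F p)" using fps pu by (simp add: filtered_prob_space_def)
  show ?thesis
  proof (rule nn_integral_exp_step[where F="F p"])
    show "finite A" "0 < u - p" using A pu by auto
    show "subalgebra M (F p)" by (rule sub)
    show "Y \<in> borel_measurable (F p)" by fact
    show "g y \<in> borel_measurable (F p)" if "y \<in> A" for y using g that .
    show "distributed M lborel (?D y) (normal_density 0 (sqrt (u - p)))" if "y \<in> A" for y
      using bf A pu that by (auto simp: brownian_family_def)
    show "indep_vars (\<lambda>_. borel) ?D A"
    proof -
      have "indep_vars (\<lambda>_. PiM {0..} (\<lambda>_. borel)) (\<lambda>x \<omega>. \<lambda>t\<in>{0..}. W x t \<omega>) A"
        using bf A by (auto simp: brownian_family_def intro: indep_vars_subset)
      then have "indep_vars (\<lambda>_. borel) (\<lambda>y \<omega>. (\<lambda>f. f u - f p) (\<lambda>t\<in>{0..}. W y t \<omega>)) A"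
        by (rule indep_vars_compose2)
          (use pu in \<open>auto intro!: borel_measurable_diff measurable_component_singleton\<close>)
      then show ?thesis using pu by simp
    qed
    let ?big = "\<lambda>\<omega>. \<lambda>(x, t)\<in>X \<times> {p..}. W x t \<omega> - W x p \<omega>"
    let ?PB = "PiM (X \<times> {p..}) (\<lambda>_. borel :: real measure)"
    let ?h = "\<lambda>f. \<lambda>y\<in>A. f (y, u)"
    have big: "indep_set (sets (F p)) (sets (vimage_algebra (space M) ?big ?PB))"
      using bf pu by (simp add: brownian_family_def)
    have h: "?h \<in> ?PB \<rightarrow>\<^sub>M PiM A (\<lambda>_. borel)"
      using A pu by (intro measurable_restrict measurable_component_singleton) auto
    have bs: "?big \<omega> \<in> space ?PB" for \<omega> by (auto simp: space_PiM PiE_def extensional_def)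
    have hb: "?h (?big \<omega>) = (\<lambda>y\<in>A. ?D y \<omega>)" for \<omega>
      using A pu by (auto simp: restrict_def fun_eq_iff)
    \<comment> \<open>The increments up to the single time \<open>u\<close> over finitely many sites
      are a measurable image of the whole increment field after \<open>p\<close>. They generate a
      smaller sigma-algebra, and independence is inherited.\<close>
    have "sets (vimage_algebra (space M) (\<lambda>\<omega>. \<lambda>y\<in>A. ?D y \<omega>) (PiM A (\<lambda>_. borel)))
      \<subseteq> sets (vimage_algebra (space M) ?big ?PB)"
    proof -
      have "(\<lambda>\<omega>. \<lambda>y\<in>A. ?D y \<omega>) -` B \<inter> space M \<in> sets (vimage_algebra (space M) ?big ?PB)"
        if "B \<in> sets (PiM A (\<lambda>_. borel))" for B
      proof -
        have "(\<lambda>\<omega>. \<lambda>y\<in>A. ?D y \<omega>) -` B \<inter> space M = ?big -` (?h -` B \<inter> space ?PB) \<inter> space M"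
          using hb bs by auto
        then show ?thesis using in_vimage_algebra[OF measurable_sets[OF h that]] by simp
      qed
      then show ?thesis
        by (subst sets_vimage_algebra)
          (intro sets.sigma_sets_subset', use sets.top[of "vimage_algebra (space M) ?big ?PB"] in \<open>auto\<close>)
    qed
    with big show "indep_set (sets (F p)) (sets (vimage_algebra (space M) (\<lambda>\<omega>. \<lambda>y\<in>A. ?D y \<omega>) (PiM A (\<lambda>_. borel))))"
      unfolding indep_sets2_eq by blast
  qed
qed

lemma sum_power2_disjoint:
  fixes c :: "'i \<Rightarrow> real"
  assumes "finite I" "\<And>i j. i \<in> I \<Longrightarrow> j \<in> I \<Longrightarrow> i \<noteq> j \<Longrightarrow> c i * c j = 0"
  shows "(\<Sum>i\<in>I. c i)\<^sup>2 = (\<Sum>i\<in>I. (c i)\<^sup>2)"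
proof -
  have "(\<Sum>i\<in>I. c i)\<^sup>2 = (\<Sum>i\<in>I. \<Sum>j\<in>I. c i * c j)"
    by (simp add: power2_eq_square sum_product)
  also have "\<dots> = (\<Sum>i\<in>I. \<Sum>j\<in>I. if j = i then (c i)\<^sup>2 else 0)"
    using assms(2) by (intro sum.cong) (auto simp: power2_eq_square)
  finally show ?thesis using assms(1) by simp
qed

lemma measurable_filtration_mono:
  assumes "filtered_prob_space M F" "f \<in> F s \<rightarrow>\<^sub>M N" "s \<le> t"
  shows "f \<in> F t \<rightarrow>\<^sub>M N"
proof -
  have "filtration (space M) F" using assms by (simp add: filtered_prob_space_def)
  then have "subalgebra (F t) (F s)" using assms(3) by (simp add: filtration_def subalgebra_def)
  then show ?thesis using assms(2) by (rule measurable_from_subalg)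
qed

lemma measurable_filtration_space:
  assumes "filtered_prob_space M F" "f \<in> F s \<rightarrow>\<^sub>M N" "0 \<le> s"
  shows "f \<in> M \<rightarrow>\<^sub>M N"
  using assms by (auto simp: filtered_prob_space_def intro: measurable_from_subalg)

lemma elementaryD:
  assumes "elementary M F t k \<tau> h"
  shows "\<And>i. i \<le> k \<Longrightarrow> 0 \<le> \<tau> i" "\<And>i. i \<le> k \<Longrightarrow> \<tau> i \<le> t" "\<And>i j. i \<le> j \<Longrightarrow> j \<le> k \<Longrightarrow> \<tau> i \<le> \<tau> j"
    "\<And>i. i < k \<Longrightarrow> h i \<in> borel_measurable (F (\<tau> i))" "\<And>i. i < k \<Longrightarrow> bounded (h i ` space M)"
proof -
  have m: "mono_on {..k} \<tau>" using assms by (simp add: elementary_def)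
  show mono: "\<tau> i \<le> \<tau> j" if "i \<le> j" "j \<le> k" for i j
    using m that by (auto simp: mono_on_def)
  show "0 \<le> \<tau> i" if "i \<le> k" for i using mono[of 0 i] assms that by (auto simp: elementary_def)
  show "\<tau> i \<le> t" if "i \<le> k" for i using mono[of i k] assms that by (auto simp: elementary_def)
qed (use assms in \<open>auto simp: elementary_def\<close>)

text \<open>The quadratic variation of the elementary integral; by
  \<open>nn_integral_elementary_fun\<close> it is also the squared \<open>L^2\<close> norm of the
  elementary integrand.\<close>

definition elem_var :: "nat \<Rightarrow> (nat \<Rightarrow> real) \<Rightarrow> (nat \<Rightarrow> 'a \<Rightarrow> real) \<Rightarrow> 'a \<Rightarrow> real" where
  "elem_var k \<tau> h \<omega> = (\<Sum>i<k. (h i \<omega>)\<^sup>2 * (\<tau> (Suc i) - \<tau> i))"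

text \<open>Each site has its own partition. Stopping all integrals at \<open>u\<close> replaces a
  common refinement: the induction runs over the number of partition points below \<open>u\<close>,
  and between the last of them and \<open>u\<close> every integrand is frozen.\<close>

lemma exp_martingale_stopped:
  assumes fps: "filtered_prob_space M F" and bf: "brownian_family M F X W"
    and A: "finite A" "A \<subseteq> X"
    and el: "\<And>y. y \<in> A \<Longrightarrow> elementary M F t (k y) (\<tau> y) (h y)" and "0 \<le> u"
  shows "(\<integral>\<^sup>+\<omega>. ennreal (exp (
      (\<Sum>y\<in>A. \<Sum>i<k y. h y i \<omega> * (W y (min u (\<tau> y (Suc i))) \<omega> - W y (min u (\<tau> y i)) \<omega>))
      - (\<Sum>y\<in>A. \<Sum>i<k y. (h y i \<omega>)\<^sup>2 * (min u (\<tau> y (Suc i)) - min u (\<tau> y i))) / 2)) \<partial>M) = 1"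
    (is "?I u = 1")
proof -
  interpret prob_space M using fps by (simp add: filtered_prob_space_def)
  \<comment> \<open>Adding \<open>0\<close> guarantees a last point below any
    \<open>u > 0\<close>.\<close>
  define P where "P = insert 0 (\<Union>y\<in>A. \<tau> y ` {..k y})"
  have finP: "finite P" using A by (simp add: P_def)
  have tP: "\<tau> y i \<in> P" if "y \<in> A" "i \<le> k y" for y i using that by (auto simp: P_def)
  have Wm: "W y s \<in> borel_measurable (F s)" if "y \<in> A" "0 \<le> s" for y s
    using bf A that by (auto simp: brownian_family_def)
  define X where "X u \<omega> = (\<Sum>y\<in>A. \<Sum>i<k y. h y i \<omega> * (W y (min u (\<tau> y (Suc i))) \<omega> - W y (min u (\<tau> y i)) \<omega>))" for u \<omega>
  define V where "V u \<omega> = (\<Sum>y\<in>A. \<Sum>i<k y. (h y i \<omega>)\<^sup>2 * (min u (\<tau> y (Suc i)) - min u (\<tau> y i)))" for u \<omega>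
  have "(\<integral>\<^sup>+\<omega>. ennreal (exp (X u \<omega> - V u \<omega> / 2)) \<partial>M) = 1"
    using \<open>0 \<le> u\<close>
  proof (induction "card {q \<in> P. q < u}" arbitrary: u rule: less_induct)
    case less
    show ?case
    proof (cases "u = 0")
      case True
      have "X u \<omega> = 0" "V u \<omega> = 0" for \<omega>
        unfolding X_def V_def using True elementaryD(1)[OF el]
        by (auto intro!: sum.neutral simp: min_def Suc_le_eq order.antisym)
      then show ?thesis by (simp add: emeasure_space_1)
    next
      case False
      with less have "0 < u" by simp
      define S where "S = {q \<in> P. q < u}"
      have S: "finite S" "0 \<in> S" using \<open>0 < u\<close> finite_subset[OF _ finP, of S] by (auto simp: S_def P_def)
      define p where "p = Max S"
      have pS: "p \<in> S" unfolding p_def using S by (intro Max_in) auto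
      have p0: "0 \<le> p" and pu: "p < u" using S pS by (auto simp: p_def S_def)
      \<comment> \<open>No partition point lies strictly between \<open>p\<close> and
        \<open>u\<close>, by maximality of \<open>p\<close>.\<close>
      have dich: "\<tau> y i \<le> p \<or> u \<le> \<tau> y i" if "y \<in> A" "i \<le> k y" for y i
        using tP[OF that] S(1) by (auto simp: p_def S_def not_le[symmetric])
      have "{q \<in> P. q < p} \<subset> S" using pS pu by (auto simp: S_def)
      then have IH: "(\<integral>\<^sup>+\<omega>. ennreal (exp (X p \<omega> - V p \<omega> / 2)) \<partial>M) = 1"
        using S(1) p0 less.hyps[of p] unfolding S_def by (simp add: psubset_card_mono)
      \<comment> \<open>The height of piece \<open>i\<close> if that piece covers the interval from
        \<open>p\<close> to \<open>u\<close>, and \<open>0\<close> otherwise. Pieces of one site are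
        disjoint, so at most one of them contributes to \<open>g y\<close>.\<close>
      define c where "c y i \<omega> = (if \<tau> y i \<le> p \<and> u \<le> \<tau> y (Suc i) then h y i \<omega> else 0)" for y i \<omega>
      define g where "g y \<omega> = (\<Sum>i<k y. c y i \<omega>)" for y \<omega>
      have gsq: "(g y \<omega>)\<^sup>2 = (\<Sum>i<k y. (c y i \<omega>)\<^sup>2)" if y: "y \<in> A" for y \<omega>
        unfolding g_def
      proof (rule sum_power2_disjoint)
        fix i j assume ij: "i \<in> {..<k y}" "j \<in> {..<k y}" "i \<noteq> j"
        have *: "c y i \<omega> * c y j \<omega> = 0" if "i < j" "j < k y" for i j
        proof -
          have "\<tau> y (Suc i) \<le> \<tau> y j" using elementaryD(3)[OF el[OF y], of "Suc i" j] that by simp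
          then show ?thesis using pu by (auto simp: c_def)
        qed
        from ij show "c y i \<omega> * c y j \<omega> = 0"
          using *[of i j] *[of j i] by (cases "i < j") (auto simp: mult.commute)
      qed simp
      have cm: "c y i \<in> borel_measurable (F p)" if "y \<in> A" "i < k y" for y i
        using measurable_filtration_mono[OF fps elementaryD(4)[OF el[OF that(1)] that(2)], of p]
        unfolding c_def by (cases "\<tau> y i \<le> p \<and> u \<le> \<tau> y (Suc i)") auto
      have Xinc: "X u \<omega> = X p \<omega> + (\<Sum>y\<in>A. g y \<omega> * (W y u \<omega> - W y p \<omega>))" for \<omega>
        unfolding X_def g_def sum_distrib_right sum.distrib[symmetric]
      proof (intro sum.cong refl)
        fix y i assume "y \<in> A" "i \<in> {..<k y}"
        then show "h y i \<omega> * (W y (min u (\<tau> y (Suc i))) \<omega> - W y (min u (\<tau> y i)) \<omega>) =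
          h y i \<omega> * (W y (min p (\<tau> y (Suc i))) \<omega> - W y (min p (\<tau> y i)) \<omega>) + c y i \<omega> * (W y u \<omega> - W y p \<omega>)"
          using dich[of y i] dich[of y "Suc i"] elementaryD(3)[OF el, of y i "Suc i"] pu
          by (auto simp: c_def min_def algebra_simps)
      qed
      have Vinc: "V u \<omega> = V p \<omega> + (\<Sum>y\<in>A. (g y \<omega>)\<^sup>2 * (u - p))" for \<omega>
      proof -
        have "V u \<omega> = V p \<omega> + (\<Sum>y\<in>A. \<Sum>i<k y. (c y i \<omega>)\<^sup>2 * (u - p))"
          unfolding V_def sum.distrib[symmetric]
        proof (intro sum.cong refl)
          fix y i assume "y \<in> A" "i \<in> {..<k y}"
          then show "(h y i \<omega>)\<^sup>2 * (min u (\<tau> y (Suc i)) - min u (\<tau> y i)) =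
            (h y i \<omega>)\<^sup>2 * (min p (\<tau> y (Suc i)) - min p (\<tau> y i)) + (c y i \<omega>)\<^sup>2 * (u - p)"
            using dich[of y i] dich[of y "Suc i"] elementaryD(3)[OF el, of y i "Suc i"] pu
            by (auto simp: c_def min_def algebra_simps)
        qed
        then show ?thesis by (simp add: gsq sum_distrib_right)
      qed
      have hd: "(\<lambda>\<omega>. h y i \<omega> * (W y (min p (\<tau> y (Suc i))) \<omega> - W y (min p (\<tau> y i)) \<omega>)) \<in> borel_measurable (F p)"
        if "y \<in> A" "i < k y" for y i
      proof (cases "\<tau> y i \<le> p")
        case True
        have [measurable]: "h y i \<in> borel_measurable (F p)"
          using measurable_filtration_mono[OF fps elementaryD(4)[OF el[OF that(1)] that(2)] True] .
        have [measurable]: "W y (min p r) \<in> borel_measurable (F p)" if "0 \<le> r" for r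
          using measurable_filtration_mono[OF fps Wm[OF \<open>y \<in> A\<close>, of "min p r"]] p0 that by auto
        show ?thesis using elementaryD(1)[OF el[OF that(1)], of i] elementaryD(1)[OF el[OF that(1)], of "Suc i"] that
          by (intro borel_measurable_times borel_measurable_diff) (auto simp: Suc_le_eq)
      next
        \<comment> \<open>A piece starting after \<open>p\<close> is still empty at time
          \<open>p\<close>, so its height, which may fail to be \<open>F p\<close>-measurable, does
          not enter.\<close>
        case False
        then have "(\<lambda>\<omega>. h y i \<omega> * (W y (min p (\<tau> y (Suc i))) \<omega> - W y (min p (\<tau> y i)) \<omega>)) = (\<lambda>_. 0)"
          using elementaryD(3)[OF el[OF that(1)], of i "Suc i"] that(2) by (auto simp: min_def)
        then show ?thesis by simp
      qed
      have vd: "(\<lambda>\<omega>. (h y i \<omega>)\<^sup>2 * (min p (\<tau> y (Suc i)) - min p (\<tau> y i))) \<in> borel_measurable (F p)"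
        if "y \<in> A" "i < k y" for y i
      proof (cases "\<tau> y i \<le> p")
        case True
        have [measurable]: "h y i \<in> borel_measurable (F p)"
          using measurable_filtration_mono[OF fps elementaryD(4)[OF el[OF that(1)] that(2)] True] .
        show ?thesis by measurable
      next
        case False
        then have "(\<lambda>\<omega>. (h y i \<omega>)\<^sup>2 * (min p (\<tau> y (Suc i)) - min p (\<tau> y i))) = (\<lambda>_. 0)"
          using elementaryD(3)[OF el[OF that(1)], of i "Suc i"] that(2) by (auto simp: min_def)
        then show ?thesis by simp
      qed
      have [measurable]: "X p \<in> borel_measurable (F p)" "V p \<in> borel_measurable (F p)"
        unfolding X_def V_def using hd vd by (auto intro!: borel_measurable_sum)
      have "(\<integral>\<^sup>+\<omega>. ennreal (exp (X u \<omega> - V u \<omega> / 2)) \<partial>M) =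
        (\<integral>\<^sup>+\<omega>. ennreal (exp (X p \<omega> - V p \<omega> / 2)) *
          ennreal (exp (\<Sum>y\<in>A. g y \<omega> * (W y u \<omega> - W y p \<omega>) - (g y \<omega>)\<^sup>2 * (u - p) / 2)) \<partial>M)"
      proof (intro nn_integral_cong)
        fix \<omega>
        have "X u \<omega> - V u \<omega> / 2 = (X p \<omega> - V p \<omega> / 2) + (\<Sum>y\<in>A. g y \<omega> * (W y u \<omega> - W y p \<omega>) - (g y \<omega>)\<^sup>2 * (u - p) / 2)"
          unfolding Xinc Vinc sum_subtractf sum_divide_distrib[symmetric] by (simp add: field_simps)
        then show "ennreal (exp (X u \<omega> - V u \<omega> / 2)) = ennreal (exp (X p \<omega> - V p \<omega> / 2)) *
          ennreal (exp (\<Sum>y\<in>A. g y \<omega> * (W y u \<omega> - W y p \<omega>) - (g y \<omega>)\<^sup>2 * (u - p) / 2))"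
          by (simp only: exp_add ennreal_mult' exp_ge_zero)
      qed
      also have "\<dots> = (\<integral>\<^sup>+\<omega>. ennreal (exp (X p \<omega> - V p \<omega> / 2)) \<partial>M)"
        using cm by (intro brownian_increment_step[OF fps bf A p0 pu]) (auto simp: g_def intro!: borel_measurable_sum)
      finally show ?thesis using IH by simp
    qed
  qed
  then show ?thesis by (simp add: X_def V_def)
qed

lemma exp_martingale_elementary:
  assumes fps: "filtered_prob_space M F" and bf: "brownian_family M F X W"
    and A: "finite A" "A \<subseteq> X"
    and el: "\<And>y. y \<in> A \<Longrightarrow> elementary M F t (k y) (\<tau> y) (h y)"
  shows "(\<integral>\<^sup>+\<omega>. ennreal (exp (l * (\<Sum>y\<in>A. elementary_integral (W y) (k y) (\<tau> y) (h y) \<omega>)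
      - l\<^sup>2 * (\<Sum>y\<in>A. elem_var (k y) (\<tau> y) (h y) \<omega>) / 2)) \<partial>M) = 1"
proof -
  have el': "elementary M F t (k y) (\<tau> y) (\<lambda>i \<omega>. l * h y i \<omega>)" if y: "y \<in> A" for y
  proof -
    have "bounded ((\<lambda>\<omega>. l * h y i \<omega>) ` space M)" if i: "i < k y" for i
    proof -
      obtain B where "\<And>\<omega>. \<omega> \<in> space M \<Longrightarrow> \<bar>h y i \<omega>\<bar> \<le> B"
        using elementaryD(5)[OF el[OF y] i] by (auto simp: bounded_iff)
      then have "\<forall>z\<in>(\<lambda>\<omega>. l * h y i \<omega>) ` space M. norm z \<le> \<bar>l\<bar> * B"
        by (auto simp: abs_mult intro!: mult_left_mono)
      then show ?thesis unfolding bounded_iff by blast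
    qed
    then show ?thesis using el[OF y] unfolding elementary_def by auto
  qed
  \<comment> \<open>The maximum covers the empty family of sites, where nothing forces
    \<open>0 <= t\<close>.\<close>
  let ?u = "max 0 t"
  have mu: "min ?u (\<tau> y i) = \<tau> y i" if "y \<in> A" "i \<le> k y" for y i
    using elementaryD(2)[OF el[OF that(1)] that(2)] by simp
  have 1: "(\<Sum>y\<in>A. \<Sum>i<k y. (l * h y i \<omega>) * (W y (min ?u (\<tau> y (Suc i))) \<omega> - W y (min ?u (\<tau> y i)) \<omega>))
     = l * (\<Sum>y\<in>A. elementary_integral (W y) (k y) (\<tau> y) (h y) \<omega>)" for \<omega>
    unfolding elementary_integral_def sum_distrib_left
    by (intro sum.cong refl) (simp add: mu Suc_leI mult.assoc)
  have 2: "(\<Sum>y\<in>A. \<Sum>i<k y. (l * h y i \<omega>)\<^sup>2 * (min ?u (\<tau> y (Suc i)) - min ?u (\<tau> y i)))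
     = l\<^sup>2 * (\<Sum>y\<in>A. elem_var (k y) (\<tau> y) (h y) \<omega>)" for \<omega>
    unfolding elem_var_def sum_distrib_left
    by (intro sum.cong refl) (simp add: mu Suc_leI mult.assoc power_mult_distrib)
  show ?thesis
    using exp_martingale_stopped[where k = k and \<tau> = \<tau> and h = "\<lambda>y i \<omega>. l * h y i \<omega>" and u = "?u", OF fps bf A el']
    unfolding 1 2 by simp
qed

section \<open>From convergence in probability to almost sure subsequences\<close>

text \<open>Borel-Cantelli along indices whose error probability is below \<open>(1/2) ^ m\<close>.
  Values lie in \<open>ennreal\<close> because the \<open>L^2\<close> error of an integrand may be
  infinite.\<close>

lemma (in finite_measure) AE_subseq_of_in_measure:
  fixes f :: "nat \<Rightarrow> 'a \<Rightarrow> ennreal"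
  assumes [measurable]: "\<And>m. f m \<in> borel_measurable M"
    and conv: "\<And>\<eta>::real. 0 < \<eta> \<Longrightarrow> (\<lambda>m. measure M {\<omega>\<in>space M. f m \<omega> > ennreal \<eta>}) \<longlonglongrightarrow> 0"
  shows "\<exists>r. strict_mono r \<and> (AE \<omega> in M. (\<lambda>m. f (r m) \<omega>) \<longlonglongrightarrow> 0)"
proof -
  define q :: "nat \<Rightarrow> real" where "q m = (1/2) ^ m" for m
  have q0: "0 < q m" for m by (simp add: q_def)
  have ev: "\<exists>k>n. measure M {\<omega>\<in>space M. f k \<omega> > ennreal (q m)} < q m" for n m
  proof -
    have "eventually (\<lambda>k. measure M {\<omega>\<in>space M. f k \<omega> > ennreal (q m)} < q m) sequentially"
      using conv[OF q0] q0 by (rule order_tendstoD)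
    moreover have "eventually (\<lambda>k. k > n) sequentially" by (rule eventually_gt_at_top)
    ultimately have "eventually (\<lambda>k. k > n \<and> measure M {\<omega>\<in>space M. f k \<omega> > ennreal (q m)} < q m) sequentially"
      by eventually_elim simp
    then show ?thesis using eventually_happens' trivial_limit_sequentially by blast
  qed
  have "\<exists>r. \<forall>m. measure M {\<omega>\<in>space M. f (r m) \<omega> > ennreal (q m)} < q m \<and> r m < r (Suc m)"
  proof (rule dependent_nat_choice)
    show "\<exists>k. measure M {\<omega>\<in>space M. f k \<omega> > ennreal (q 0)} < q 0" using ev[of 0 0] by blast
    show "\<exists>k'. measure M {\<omega>\<in>space M. f k' \<omega> > ennreal (q (Suc m))} < q (Suc m) \<and> k < k'" for k m
      using ev[of k "Suc m"] by blast
  qed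
  then obtain r where r: "\<And>m. measure M {\<omega>\<in>space M. f (r m) \<omega> > ennreal (q m)} < q m" "\<And>m. r m < r (Suc m)"
    by blast
  have "AE \<omega> in M. eventually (\<lambda>m. \<omega> \<in> space M - {\<omega>\<in>space M. f (r m) \<omega> > ennreal (q m)}) sequentially"
  proof (rule borel_cantelli_AE1)
    show "summable (\<lambda>m. measure M {\<omega>\<in>space M. f (r m) \<omega> > ennreal (q m)})"
    proof (rule summable_comparison_test)
      show "summable q" unfolding q_def by (simp add: summable_geometric)
      show "\<exists>N. \<forall>n\<ge>N. norm (measure M {\<omega>\<in>space M. f (r n) \<omega> > ennreal (q n)}) \<le> q n"
        using r(1) by (auto intro: less_imp_le)
    qed
  qed (auto simp: less_top[symmetric])
  then have "AE \<omega> in M. (\<lambda>m. f (r m) \<omega>) \<longlonglongrightarrow> 0"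
  proof eventually_elim
    fix \<omega> assume "eventually (\<lambda>m. \<omega> \<in> space M - {\<omega>\<in>space M. f (r m) \<omega> > ennreal (q m)}) sequentially"
    then have "eventually (\<lambda>m. f (r m) \<omega> \<le> ennreal (q m)) sequentially"
      by eventually_elim auto
    moreover have "(\<lambda>m. ennreal (q m)) \<longlonglongrightarrow> ennreal 0"
      unfolding q_def by (intro tendsto_ennrealI LIMSEQ_realpow_zero) auto
    ultimately show "(\<lambda>m. f (r m) \<omega>) \<longlonglongrightarrow> 0"
      using tendsto_sandwich[of "\<lambda>_. 0" "\<lambda>m. f (r m) \<omega>" sequentially "\<lambda>m. ennreal (q m)" 0] by simp
  qed
  moreover have "strict_mono r" using r(2) by (simp add: strict_mono_Suc_iff)
  ultimately show ?thesis by blast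
qed

text \<open>Thinning once more for each index preserves the limits already obtained.\<close>

lemma (in finite_measure) AE_subseq_of_in_measure_finite:
  fixes f :: "'i \<Rightarrow> nat \<Rightarrow> 'a \<Rightarrow> ennreal"
  assumes "finite I" and "\<And>i m. i \<in> I \<Longrightarrow> f i m \<in> borel_measurable M"
    and "\<And>i \<eta>::real. i \<in> I \<Longrightarrow> 0 < \<eta> \<Longrightarrow> (\<lambda>m. measure M {\<omega>\<in>space M. f i m \<omega> > ennreal \<eta>}) \<longlonglongrightarrow> 0"
  shows "\<exists>r. strict_mono r \<and> (AE \<omega> in M. \<forall>i\<in>I. (\<lambda>m. f i (r m) \<omega>) \<longlonglongrightarrow> 0)"
  using assms
proof (induction I)
  case empty
  show ?case by (intro exI[of _ id]) (auto simp: strict_mono_def)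
next
  case (insert i I)
  then obtain r where r: "strict_mono r" "AE \<omega> in M. \<forall>i\<in>I. (\<lambda>m. f i (r m) \<omega>) \<longlonglongrightarrow> 0" by auto
  have "\<exists>r'. strict_mono r' \<and> (AE \<omega> in M. (\<lambda>m. f i (r (r' m)) \<omega>) \<longlonglongrightarrow> 0)"
  proof (rule AE_subseq_of_in_measure)
    show "f i (r m) \<in> borel_measurable M" for m using insert by auto
    show "(\<lambda>m. measure M {\<omega>\<in>space M. f i (r m) \<omega> > ennreal \<eta>}) \<longlonglongrightarrow> 0" if "0 < \<eta>" for \<eta>
      using LIMSEQ_subseq_LIMSEQ[OF insert.prems(2)[of i \<eta>] r(1)] that by (simp add: o_def)
  qed
  then obtain r' where r': "strict_mono r'" "AE \<omega> in M. (\<lambda>m. f i (r (r' m)) \<omega>) \<longlonglongrightarrow> 0" by auto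
  have "AE \<omega> in M. \<forall>j\<in>insert i I. (\<lambda>m. f j ((r \<circ> r') m) \<omega>) \<longlonglongrightarrow> 0"
    using r(2) r'(2)
  proof eventually_elim
    case (elim \<omega>)
    then show ?case using LIMSEQ_subseq_LIMSEQ[OF _ r'(1)] by (auto simp: o_def)
  qed
  then show ?case using strict_mono_o[OF r(1) r'(1)] by blast
qed

lemma tendsto_in_prob_AE_subseq:
  assumes "prob_space M" "\<And>m. X m \<in> borel_measurable M" "Y \<in> borel_measurable M"
    and "tendsto_in_prob M X Y sequentially"
  shows "\<exists>r. strict_mono r \<and> (AE \<omega> in M. (\<lambda>m. X (r m) \<omega>) \<longlonglongrightarrow> Y \<omega>)"
proof -
  interpret prob_space M by fact
  have "\<exists>r. strict_mono r \<and> (AE \<omega> in M. (\<lambda>m. ennreal \<bar>X (r m) \<omega> - Y \<omega>\<bar>) \<longlonglongrightarrow> 0)"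
    using assms by (intro AE_subseq_of_in_measure)
      (auto simp: tendsto_in_prob_def ennreal_less_iff)
  moreover have "(\<lambda>m. X (r m) \<omega>) \<longlonglongrightarrow> Y \<omega>" if "(\<lambda>m. ennreal \<bar>X (r m) \<omega> - Y \<omega>\<bar>) \<longlonglongrightarrow> 0" for r \<omega>
    using that unfolding ennreal_0[symmetric]
    by (subst (asm) tendsto_ennreal_iff) (auto simp: tendsto_rabs_zero_iff LIM_zero_iff)
  ultimately show ?thesis by (metis (mono_tags, lifting) eventually_mono)
qed

section \<open>Exponential moments of Ito integrals\<close>

text \<open>The upper bound controls all moments of \<open>X\<close>; letting \<open>l\<close> tend to \<open>0\<close> in the lower one shows
  that its second moment is at least \<open>v\<close>.\<close>

definition sub_exp :: "'a measure \<Rightarrow> ('a \<Rightarrow> real) \<Rightarrow> real \<Rightarrow> real \<Rightarrow> bool" where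
  "sub_exp M X v L \<longleftrightarrow> X \<in> borel_measurable M \<and>
     (\<forall>l. ennreal (exp (l\<^sup>2 * v / 2)) \<le> (\<integral>\<^sup>+\<omega>. ennreal (exp (l * X \<omega>)) \<partial>M) \<and>
          (\<integral>\<^sup>+\<omega>. ennreal (exp (l * X \<omega>)) \<partial>M) \<le> ennreal (exp (l\<^sup>2 * L / 2)))"

text \<open>Fatou's lemma through the test functions \<open>min z N\<close>. The space may change
  with \<open>m\<close>, so the same argument serves almost sure limits and limits in law.\<close>

lemma truncated_limit_upper:
  fixes Z :: "nat \<Rightarrow> 'a \<Rightarrow> ennreal" and Z' :: "'b \<Rightarrow> ennreal"
  assumes [measurable]: "Z' \<in> borel_measurable M'"
    and conv: "\<And>N::nat. (\<lambda>m. \<integral>\<^sup>+\<omega>. min (Z m \<omega>) (of_nat N) \<partial>M m) \<longlonglongrightarrow> (\<integral>\<^sup>+\<omega>. min (Z' \<omega>) (of_nat N) \<partial>M')"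
    and le: "\<And>m. (\<integral>\<^sup>+\<omega>. Z m \<omega> \<partial>M m) \<le> C"
  shows "(\<integral>\<^sup>+\<omega>. Z' \<omega> \<partial>M') \<le> C"
proof -
  have "(SUP N::nat. min z (of_nat N)) = z" for z :: ennreal
  proof -
    have "(SUP N::nat. min z (of_nat N)) = min z (SUP N::nat. of_nat N)"
      by (simp add: inf_min[symmetric] inf_SUP)
    then show ?thesis by (simp add: ennreal_SUP_of_nat_eq_top)
  qed
  then have "(\<integral>\<^sup>+\<omega>. Z' \<omega> \<partial>M') = (\<integral>\<^sup>+\<omega>. (SUP N::nat. min (Z' \<omega>) (of_nat N)) \<partial>M')" by simp
  also have "\<dots> = (SUP N::nat. \<integral>\<^sup>+\<omega>. min (Z' \<omega>) (of_nat N) \<partial>M')"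
    by (intro nn_integral_monotone_convergence_SUP)
      (auto simp: incseq_def le_fun_def intro!: min.coboundedI2 of_nat_mono)
  also have "\<dots> \<le> C"
  proof (intro SUP_least)
    fix N :: nat
    have "(\<integral>\<^sup>+\<omega>. min (Z m \<omega>) (of_nat N) \<partial>M m) \<le> C" for m
      by (rule order_trans[OF nn_integral_mono le]) simp
    then show "(\<integral>\<^sup>+\<omega>. min (Z' \<omega>) (of_nat N) \<partial>M') \<le> C"
      by (intro LIMSEQ_le_const2[OF conv]) auto
  qed
  finally show ?thesis .
qed

text \<open>A bounded second moment makes the variables uniformly integrable. Quantitatively,
  \<open>z <= min z N + z^2 / N\<close>, so truncation at \<open>N\<close> costs at most
  \<open>C / N\<close>.\<close>

lemma truncated_limit_lower:
  fixes Z :: "nat \<Rightarrow> 'a \<Rightarrow> ennreal" and Z' :: "'b \<Rightarrow> ennreal"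
  assumes mZ [measurable]: "\<And>m. Z m \<in> borel_measurable (M m)" "Z' \<in> borel_measurable M'"
    and conv: "\<And>N::nat. (\<lambda>m. \<integral>\<^sup>+\<omega>. min (Z m \<omega>) (of_nat N) \<partial>M m) \<longlonglongrightarrow> (\<integral>\<^sup>+\<omega>. min (Z' \<omega>) (of_nat N) \<partial>M')"
    and le: "\<And>m. c m \<le> (\<integral>\<^sup>+\<omega>. Z m \<omega> \<partial>M m)" and c: "c \<longlonglongrightarrow> c'"
    and sq: "\<And>m. (\<integral>\<^sup>+\<omega>. (Z m \<omega>)\<^sup>2 \<partial>M m) \<le> ennreal C"
  shows "c' \<le> (\<integral>\<^sup>+\<omega>. Z' \<omega> \<partial>M')"
proof -
  have *: "c' \<le> (\<integral>\<^sup>+\<omega>. Z' \<omega> \<partial>M') + ennreal (C / real N)" if "0 < N" for N :: nat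
  proof -
    have pt: "z \<le> min z (of_nat N) + z\<^sup>2 * ennreal (1 / real N)" for z :: ennreal
    proof (cases "z \<le> of_nat N")
      case False
      show ?thesis
      proof (cases z)
        case (real x)
        then have "real N < x" using False by (auto simp: ennreal_of_nat_eq_real_of_nat not_le ennreal_less_iff)
        then have "x \<le> x\<^sup>2 * (1 / real N)" using that by (simp add: field_simps power2_eq_square)
        then have "z \<le> z\<^sup>2 * ennreal (1 / real N)"
          using real by (simp add: ennreal_power ennreal_mult'[symmetric])
        then show ?thesis by (metis add_increasing zero_le)
      next
        case top
        then show ?thesis using that by (simp add: ennreal_top_mult power2_eq_square)
      qed
    qed (simp add: min_def)
    have "c m \<le> (\<integral>\<^sup>+\<omega>. min (Z m \<omega>) (of_nat N) \<partial>M m) + ennreal (C / real N)" for m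
    proof -
      have "c m \<le> (\<integral>\<^sup>+\<omega>. min (Z m \<omega>) (of_nat N) + (Z m \<omega>)\<^sup>2 * ennreal (1 / real N) \<partial>M m)"
        by (rule order_trans[OF le nn_integral_mono]) (rule pt)
      also have "\<dots> = (\<integral>\<^sup>+\<omega>. min (Z m \<omega>) (of_nat N) \<partial>M m) + (\<integral>\<^sup>+\<omega>. (Z m \<omega>)\<^sup>2 \<partial>M m) * ennreal (1 / real N)"
        by (subst nn_integral_add) (auto simp: nn_integral_multc)
      also have "\<dots> \<le> (\<integral>\<^sup>+\<omega>. min (Z m \<omega>) (of_nat N) \<partial>M m) + ennreal C * ennreal (1 / real N)"
        by (intro add_mono mult_right_mono sq) auto
      also have "ennreal C * ennreal (1 / real N) = ennreal (C / real N)"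
        by (simp flip: ennreal_mult'')
      finally show ?thesis .
    qed
    then have "c' \<le> (\<integral>\<^sup>+\<omega>. min (Z' \<omega>) (of_nat N) \<partial>M') + ennreal (C / real N)"
      by (intro LIMSEQ_le[OF c tendsto_add[OF conv tendsto_const]]) auto
    also have "\<dots> \<le> (\<integral>\<^sup>+\<omega>. Z' \<omega> \<partial>M') + ennreal (C / real N)"
      by (intro add_mono nn_integral_mono) auto
    finally show ?thesis .
  qed
  have lim: "(\<lambda>N. (\<integral>\<^sup>+\<omega>. Z' \<omega> \<partial>M') + ennreal (C / real N)) \<longlonglongrightarrow> (\<integral>\<^sup>+\<omega>. Z' \<omega> \<partial>M') + ennreal 0"
    by (intro tendsto_add tendsto_const tendsto_ennrealI lim_const_over_n)
  show ?thesis
  proof -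
    have "\<exists>N. \<forall>n\<ge>N. c' \<le> (\<integral>\<^sup>+\<omega>. Z' \<omega> \<partial>M') + ennreal (C / real n)"
      using * by (intro exI[of _ 1]) auto
    then show ?thesis using LIMSEQ_le_const[OF lim] by simp
  qed
qed

text \<open>The square of \<open>exp (l * X)\<close> is \<open>exp (2 * l * X)\<close>, so the upper
  bound at \<open>2 * l\<close> supplies the second moment that prevents loss of mass in the lower
  bound at \<open>l\<close>.\<close>

lemma sub_exp_limit:
  assumes se: "\<And>m. sub_exp (M m) (X m) (v m) L" and v: "v \<longlonglongrightarrow> v'" and X': "X' \<in> borel_measurable M'"
    and conv: "\<And>l (N::nat). (\<lambda>m. \<integral>\<^sup>+\<omega>. min (ennreal (exp (l * X m \<omega>))) (of_nat N) \<partial>M m)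
        \<longlonglongrightarrow> (\<integral>\<^sup>+\<omega>. min (ennreal (exp (l * X' \<omega>))) (of_nat N) \<partial>M')"
  shows "sub_exp M' X' v' L"
  unfolding sub_exp_def
proof (intro conjI allI X')
  have [measurable]: "X m \<in> borel_measurable (M m)" for m using se by (auto simp: sub_exp_def)
  note [measurable] = X'
  fix l :: real
  show "(\<integral>\<^sup>+\<omega>. ennreal (exp (l * X' \<omega>)) \<partial>M') \<le> ennreal (exp (l\<^sup>2 * L / 2))"
    by (rule truncated_limit_upper[OF _ conv]) (use se X' in \<open>auto simp: sub_exp_def\<close>)
  show "ennreal (exp (l\<^sup>2 * v' / 2)) \<le> (\<integral>\<^sup>+\<omega>. ennreal (exp (l * X' \<omega>)) \<partial>M')"
  proof (rule truncated_limit_lower[OF _ _ conv])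
    show "(\<lambda>m. ennreal (exp (l\<^sup>2 * v m / 2))) \<longlonglongrightarrow> ennreal (exp (l\<^sup>2 * v' / 2))"
      using v by (intro tendsto_intros) auto
    show "(\<integral>\<^sup>+\<omega>. (ennreal (exp (l * X m \<omega>)))\<^sup>2 \<partial>M m) \<le> ennreal (exp ((2 * l)\<^sup>2 * L / 2))" for m
    proof -
      have "(\<integral>\<^sup>+\<omega>. (ennreal (exp (l * X m \<omega>)))\<^sup>2 \<partial>M m) = (\<integral>\<^sup>+\<omega>. ennreal (exp ((2 * l) * X m \<omega>)) \<partial>M m)"
        by (intro nn_integral_cong) (simp add: ennreal_power mult.assoc flip: exp_double)
      then show ?thesis using se[of m] unfolding sub_exp_def by metis
    qed
    show "ennreal (exp (l\<^sup>2 * v m / 2)) \<le> (\<integral>\<^sup>+\<omega>. ennreal (exp (l * X m \<omega>)) \<partial>M m)" for m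
      using se[of m] by (simp add: sub_exp_def)
  qed measurable
qed

lemma sub_exp_AE_limit:
  assumes "prob_space M" and se: "\<And>m. sub_exp M (X m) (v m) L" and v: "v \<longlonglongrightarrow> v'"
    and X': "X' \<in> borel_measurable M" and lim: "AE \<omega> in M. (\<lambda>m. X m \<omega>) \<longlonglongrightarrow> X' \<omega>"
  shows "sub_exp M X' v' L"
proof (rule sub_exp_limit[OF se v X'])
  interpret prob_space M by fact
  have [measurable]: "X m \<in> borel_measurable M" for m using se by (auto simp: sub_exp_def)
  note [measurable] = X'
  fix l :: real and N :: nat
  show "(\<lambda>m. \<integral>\<^sup>+\<omega>. min (ennreal (exp (l * X m \<omega>))) (of_nat N) \<partial>M)
        \<longlonglongrightarrow> (\<integral>\<^sup>+\<omega>. min (ennreal (exp (l * X' \<omega>))) (of_nat N) \<partial>M)"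
  proof (rule nn_integral_dominated_convergence[where w="\<lambda>_. of_nat N"])
    show "AE \<omega> in M. (\<lambda>m. min (ennreal (exp (l * X m \<omega>))) (of_nat N)) \<longlonglongrightarrow> min (ennreal (exp (l * X' \<omega>))) (of_nat N)"
      using lim by eventually_elim (intro tendsto_intros tendsto_min tendsto_ennrealI)
    show "(\<integral>\<^sup>+\<omega>. of_nat N \<partial>M) < \<infinity>" by (simp add: emeasure_space_1 less_top[symmetric])
  qed auto
qed

section \<open>Capped quadratic variation and the passage to Ito integrals\<close>

text \<open>Continuity of the squared \<open>L^2\<close> norm. The inequality
  \<open>x^2 <= (1 + \<eta>) * y^2 + (1 + 1/\<eta>) * (x - y)^2\<close> takes the place of
  Minkowski's and stays inside nonnegative integrals.\<close>

lemma nn_integral_square_tendsto: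
  fixes H :: "real \<Rightarrow> real" and e :: "nat \<Rightarrow> real \<Rightarrow> real"
  assumes [measurable]: "H \<in> borel_measurable N" "\<And>m. e m \<in> borel_measurable N"
    and VH: "(\<integral>\<^sup>+s. ennreal ((H s)\<^sup>2) \<partial>N) = ennreal VH" "0 \<le> VH"
    and Ve: "\<And>m. (\<integral>\<^sup>+s. ennreal ((e m s)\<^sup>2) \<partial>N) = ennreal (Ve m)" "\<And>m. 0 \<le> Ve m"
    and err: "(\<lambda>m. \<integral>\<^sup>+s. ennreal ((H s - e m s)\<^sup>2) \<partial>N) \<longlonglongrightarrow> 0"
  shows "Ve \<longlonglongrightarrow> VH"
proof -
  have basic: "A \<le> (1 + \<eta>) * B + (1 + 1/\<eta>) * E"
    if "0 < \<eta>" "0 \<le> A" "0 \<le> B" "0 \<le> E" and f: "f \<in> borel_measurable N" and g: "g \<in> borel_measurable N" 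
      and "(\<integral>\<^sup>+s. ennreal ((f s)\<^sup>2) \<partial>N) = ennreal A" "(\<integral>\<^sup>+s. ennreal ((g s)\<^sup>2) \<partial>N) = ennreal B"
      "(\<integral>\<^sup>+s. ennreal ((f s - g s)\<^sup>2) \<partial>N) = ennreal E" for f g :: "real \<Rightarrow> real" and \<eta> A B E :: real
  proof -
    note [measurable] = f g
    have pt: "x\<^sup>2 \<le> (1 + \<eta>) * y\<^sup>2 + (1 + 1/\<eta>) * (x - y)\<^sup>2" for x y :: real
    proof -
      have "0 \<le> (sqrt \<eta> * y - (x - y) / sqrt \<eta>)\<^sup>2" by simp
      also have "\<dots> = \<eta> * y\<^sup>2 + (x - y)\<^sup>2 / \<eta> - 2 * y * (x - y)"
        using that(1) by (simp add: power2_diff power_mult_distrib power_divide)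
      finally have "2 * y * (x - y) \<le> \<eta> * y\<^sup>2 + (x - y)\<^sup>2 / \<eta>" by simp
      moreover have "x\<^sup>2 = (x - y)\<^sup>2 + 2 * y * (x - y) + y\<^sup>2" by (simp add: power2_eq_square algebra_simps)
      moreover have "(1 + \<eta>) * y\<^sup>2 = y\<^sup>2 + \<eta> * y\<^sup>2" "(1 + 1/\<eta>) * (x - y)\<^sup>2 = (x - y)\<^sup>2 + (x - y)\<^sup>2 / \<eta>"
        by (simp_all add: distrib_right)
      ultimately show ?thesis by linarith
    qed
    have "ennreal A \<le> (\<integral>\<^sup>+s. ennreal (1 + \<eta>) * ennreal ((g s)\<^sup>2) + ennreal (1 + 1/\<eta>) * ennreal ((f s - g s)\<^sup>2) \<partial>N)"
      unfolding that(7)[symmetric] using that(1) pt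
      by (intro nn_integral_mono) (simp add: ennreal_mult'[symmetric] ennreal_plus[symmetric] del: ennreal_plus)
    also have "\<dots> = ennreal (1 + \<eta>) * ennreal B + ennreal (1 + 1/\<eta>) * ennreal E"
      unfolding that(8,9)[symmetric] by (subst nn_integral_add) (auto simp: nn_integral_cmult)
    also have "\<dots> = ennreal ((1 + \<eta>) * B + (1 + 1/\<eta>) * E)"
      using that(1-4) by (simp add: ennreal_mult')
    finally show ?thesis using that(1-4) by (subst (asm) ennreal_le_iff) auto
  qed
  show ?thesis
  proof (rule LIMSEQ_I)
    fix \<epsilon> :: real assume "0 < \<epsilon>"
    \<comment> \<open>Small against \<open>2 * VH + 1\<close>, because that number will bound
      \<open>Ve m\<close>; the threshold \<open>\<kappa>\<close> below then keeps the error term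
      under \<open>min 1 (\<epsilon> / 4)\<close>.\<close>
    define \<eta> where "\<eta> = min 1 (\<epsilon> / (4 * (2 * VH + 1)))"
    have \<eta>: "0 < \<eta>" "\<eta> \<le> 1" "\<eta> * (2 * VH + 1) \<le> \<epsilon> / 4"
    proof -
      show "0 < \<eta>" "\<eta> \<le> 1" using \<open>0 < \<epsilon>\<close> VH(2) by (auto simp: \<eta>_def)
      have "\<eta> * (2 * VH + 1) \<le> \<epsilon> / (4 * (2 * VH + 1)) * (2 * VH + 1)"
        using VH(2) by (intro mult_right_mono) (auto simp: \<eta>_def)
      also have "\<dots> = \<epsilon> / 4"
      proof -
        have "2 * VH + 1 \<noteq> 0" using VH(2) by linarith
        then show ?thesis by (metis (no_types, opaque_lifting) divide_divide_eq_left nonzero_eq_divide_eq mult.commute)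
      qed
      finally show "\<eta> * (2 * VH + 1) \<le> \<epsilon> / 4" .
    qed
    define \<kappa> where "\<kappa> = min 1 (\<epsilon> / 4) / (1 + 1 / \<eta>)"
    have \<kappa>: "0 < \<kappa>" using \<open>0 < \<epsilon>\<close> \<eta> by (auto simp: \<kappa>_def intro!: divide_pos_pos add_pos_pos)
    have k1: "(1 + 1/\<eta>) * \<kappa> \<le> 1" "(1 + 1/\<eta>) * \<kappa> \<le> \<epsilon> / 4"
    proof -
      have "1 + 1/\<eta> \<noteq> 0" using \<eta>(1) by (metis add_pos_pos divide_pos_pos less_irrefl zero_less_one)
      then have "(1 + 1/\<eta>) * \<kappa> = min 1 (\<epsilon>/4)" unfolding \<kappa>_def by (metis nonzero_mult_div_cancel_left times_divide_eq_right)
      then show "(1 + 1/\<eta>) * \<kappa> \<le> 1" "(1 + 1/\<eta>) * \<kappa> \<le> \<epsilon> / 4" by auto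
    qed
    have "eventually (\<lambda>m. (\<integral>\<^sup>+s. ennreal ((H s - e m s)\<^sup>2) \<partial>N) < ennreal \<kappa>) sequentially"
      using err \<kappa> by (intro order_tendstoD(2)[OF err]) auto
    then have "eventually (\<lambda>m. \<bar>Ve m - VH\<bar> < \<epsilon>) sequentially"
    proof eventually_elim
      fix m assume lt: "(\<integral>\<^sup>+s. ennreal ((H s - e m s)\<^sup>2) \<partial>N) < ennreal \<kappa>"
      then obtain E where E: "0 \<le> E" "(\<integral>\<^sup>+s. ennreal ((H s - e m s)\<^sup>2) \<partial>N) = ennreal E"
        by (metis ennreal_cases less_irrefl top.extremum_strict)
      have Ek: "E < \<kappa>" using lt E by (simp add: ennreal_less_iff)
      have E': "(\<integral>\<^sup>+s. ennreal ((e m s - H s)\<^sup>2) \<partial>N) = ennreal E"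
        using E(2) by (simp add: power2_commute)
      have D: "(1 + 1/\<eta>) * E \<le> (1 + 1/\<eta>) * \<kappa>" using Ek \<eta> by (intro mult_left_mono) auto
      have 1: "Ve m \<le> (1 + \<eta>) * VH + (1 + 1/\<eta>) * E"
        by (rule basic[OF \<eta>(1) Ve(2) VH(2) E(1) _ _ Ve(1) VH(1) E']) auto
      have 2: "VH \<le> (1 + \<eta>) * Ve m + (1 + 1/\<eta>) * E"
        by (rule basic[OF \<eta>(1) VH(2) Ve(2) E(1) _ _ VH(1) Ve(1) E(2)]) auto
      have "(1 + \<eta>) * VH \<le> 2 * VH" using \<eta> VH(2) by (intro mult_right_mono) auto
      then have "Ve m \<le> 2 * VH + 1" using 1 D k1 by linarith
      then have "\<eta> * Ve m \<le> \<epsilon> / 4" using \<eta> by (meson mult_left_mono less_imp_le order_trans)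
      moreover have "\<eta> * VH \<le> \<eta> * (2 * VH + 1)" using \<eta> VH(2) by (intro mult_left_mono) auto
      moreover have "(1 + \<eta>) * VH = VH + \<eta> * VH" "(1 + \<eta>) * Ve m = Ve m + \<eta> * Ve m" by (simp_all add: distrib_right)
      ultimately have "Ve m - VH < \<epsilon>" "VH - Ve m < \<epsilon>" using 1 2 D k1 \<eta>(3) \<open>0 < \<epsilon>\<close> by linarith+
      then show "\<bar>Ve m - VH\<bar> < \<epsilon>" by (simp add: abs_less_iff)
    qed
    then show "\<exists>no. \<forall>n\<ge>no. norm (Ve n - VH) < \<epsilon>" by (simp add: eventually_sequentially)
  qed
qed

text \<open>Piece \<open>i\<close> survives if the variation up to and including it is at most
  \<open>C\<close>. The partition is deterministic, so this variation is already known at the left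
  end \<open>\<tau> i\<close>: the cut is adapted and does not overshoot \<open>C\<close>.\<close>

definition stop_elem :: "real \<Rightarrow> (nat \<Rightarrow> real) \<Rightarrow> (nat \<Rightarrow> 'a \<Rightarrow> real) \<Rightarrow> nat \<Rightarrow> 'a \<Rightarrow> real" where
  "stop_elem C \<tau> h i \<omega> = (if elem_var (Suc i) \<tau> h \<omega> \<le> C then h i \<omega> else 0)"

lemma elementary_stop_elem:
  assumes fps: "filtered_prob_space M F" and el: "elementary M F t k \<tau> h"
  shows "elementary M F t k \<tau> (stop_elem C \<tau> h)"
proof -
  have "stop_elem C \<tau> h i \<in> borel_measurable (F (\<tau> i))" if i: "i < k" for i
  proof -
    have [measurable]: "h j \<in> borel_measurable (F (\<tau> i))" if "j < Suc i" for j
      using measurable_filtration_mono[OF fps elementaryD(4)[OF el, of j], of "\<tau> i"]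
        that i elementaryD(3)[OF el, of j i] by auto
    have "(\<lambda>\<omega>. elem_var (Suc i) \<tau> h \<omega>) \<in> borel_measurable (F (\<tau> i))"
      unfolding elem_var_def by (intro borel_measurable_sum) auto
    then show ?thesis unfolding stop_elem_def by measurable
  qed
  moreover have "bounded (stop_elem C \<tau> h i ` space M)" if i: "i < k" for i
  proof -
    obtain B where B: "\<And>\<omega>. \<omega> \<in> space M \<Longrightarrow> \<bar>h i \<omega>\<bar> \<le> B"
      using elementaryD(5)[OF el i] by (auto simp: bounded_iff)
    then have "\<forall>z\<in>stop_elem C \<tau> h i ` space M. norm z \<le> max 0 B"
      by (auto simp: stop_elem_def le_max_iff_disj)
    then show ?thesis unfolding bounded_iff by blast
  qed
  ultimately show ?thesis using el by (auto simp: elementary_def)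
qed

lemma elem_var_mono:
  assumes "elementary M F t k \<tau> h" "i \<le> k"
  shows "elem_var i \<tau> h \<omega> \<le> elem_var k \<tau> h \<omega>"
  unfolding elem_var_def using assms elementaryD(3)[OF assms(1)]
  by (intro sum_mono2) (auto intro!: mult_nonneg_nonneg)

lemma elem_var_nonneg:
  assumes "elementary M F t k \<tau> h" 
  shows "0 \<le> elem_var k \<tau> h \<omega>"
  unfolding elem_var_def using elementaryD(3)[OF assms]
  by (intro sum_nonneg) (auto intro!: mult_nonneg_nonneg)

lemma elem_var_stop_elem_le:
  assumes el: "elementary M F t k \<tau> h" and C: "0 \<le> C"
  shows "elem_var k \<tau> (stop_elem C \<tau> h) \<omega> \<le> C"
proof -
  \<comment> \<open>The comparison with the uncut variation is part of the induction: it turns the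
    test, which looks at \<open>h\<close>, into a bound for the surviving heights.\<close>
  have "elem_var i \<tau> (stop_elem C \<tau> h) \<omega> \<le> C \<and> elem_var i \<tau> (stop_elem C \<tau> h) \<omega> \<le> elem_var i \<tau> h \<omega>"
    if "i \<le> k" for i using that
  proof (induction i)
    case 0 then show ?case using C by (simp add: elem_var_def)
  next
    case (Suc i)
    have nn: "0 \<le> (h i \<omega>)\<^sup>2 * (\<tau> (Suc i) - \<tau> i)" using elementaryD(3)[OF el, of i "Suc i"] Suc.prems by simp
    have step: "elem_var (Suc i) \<tau> f \<omega> = elem_var i \<tau> f \<omega> + (f i \<omega>)\<^sup>2 * (\<tau> (Suc i) - \<tau> i)" for f
      by (simp add: elem_var_def)
    show ?case
    proof (cases "elem_var (Suc i) \<tau> h \<omega> \<le> C")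
      case True
      then have "stop_elem C \<tau> h i \<omega> = h i \<omega>" by (simp add: stop_elem_def)
      then show ?thesis using Suc True by (simp add: step)
    next
      case False
      then have "stop_elem C \<tau> h i \<omega> = 0" by (simp add: stop_elem_def)
      then show ?thesis using Suc nn by (simp add: step)
    qed
  qed
  then show ?thesis by auto
qed

lemma stop_elem_eq:
  assumes el: "elementary M F t k \<tau> h" and le: "elem_var k \<tau> h \<omega> \<le> C" and i: "i < k"
  shows "stop_elem C \<tau> h i \<omega> = h i \<omega>"
  using elem_var_mono[OF el, of "Suc i" \<omega>] le i by (simp add: stop_elem_def)

lemma nn_integral_elementary_fun:
  assumes el: "elementary M F t k \<tau> h"
  shows "(\<integral>\<^sup>+s\<in>{0..t}. ennreal ((elementary_fun k \<tau> h s \<omega>)\<^sup>2) \<partial>lborel) = ennreal (elem_var k \<tau> h \<omega>)"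
proof -
  have sq: "(elementary_fun k \<tau> h s \<omega>)\<^sup>2 = (\<Sum>i<k. (h i \<omega>)\<^sup>2 * indicator {\<tau> i<..\<tau> (Suc i)} s)" for s
  proof -
    have "(elementary_fun k \<tau> h s \<omega>)\<^sup>2 = (\<Sum>i<k. (h i \<omega> * indicator {\<tau> i<..\<tau> (Suc i)} s)\<^sup>2)"
      unfolding elementary_fun_def
    proof (rule sum_power2_disjoint)
      fix i j assume ij: "i \<in> {..<k}" "j \<in> {..<k}" "i \<noteq> j"
      have "indicator {\<tau> i<..\<tau> (Suc i)} s * (indicator {\<tau> j<..\<tau> (Suc j)} s :: real) = 0" if "i < j" "j < k" for i j
        using elementaryD(3)[OF el, of "Suc i" j] that by (auto simp: indicator_def)
      from this[of i j] this[of j i] ij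
      show "h i \<omega> * indicator {\<tau> i<..\<tau> (Suc i)} s * (h j \<omega> * indicator {\<tau> j<..\<tau> (Suc j)} s) = 0"
        by (cases "i < j") auto
    qed simp
    also have "\<dots> = (\<Sum>i<k. (h i \<omega>)\<^sup>2 * indicator {\<tau> i<..\<tau> (Suc i)} s)"
      by (intro sum.cong refl) (simp add: indicator_def)
    finally show ?thesis .
  qed
  have "(\<integral>\<^sup>+s\<in>{0..t}. ennreal ((elementary_fun k \<tau> h s \<omega>)\<^sup>2) \<partial>lborel)
     = (\<integral>\<^sup>+s. (\<Sum>i<k. ennreal ((h i \<omega>)\<^sup>2) * indicator {\<tau> i<..\<tau> (Suc i)} s) \<partial>lborel)"
  proof (intro nn_integral_cong)
    fix s
    have ind: "s \<in> {0..t}" if "i < k" "s \<in> {\<tau> i<..\<tau> (Suc i)}" for i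
      using elementaryD(1)[OF el, of i] elementaryD(2)[OF el, of "Suc i"] that by auto
    have "ennreal ((elementary_fun k \<tau> h s \<omega>)\<^sup>2) = (\<Sum>i<k. ennreal ((h i \<omega>)\<^sup>2) * indicator {\<tau> i<..\<tau> (Suc i)} s)"
      unfolding sq by (subst sum_ennreal[symmetric]) (auto simp: ennreal_mult' ennreal_indicator intro!: sum.cong)
    then show "ennreal ((elementary_fun k \<tau> h s \<omega>)\<^sup>2) * indicator {0..t} s
       = (\<Sum>i<k. ennreal ((h i \<omega>)\<^sup>2) * indicator {\<tau> i<..\<tau> (Suc i)} s)"
    proof (cases "s \<in> {0..t}")
      case False
      then have "s \<notin> {\<tau> i<..\<tau> (Suc i)}" if "i < k" for i using ind[OF that] by blast
      then have "(\<Sum>i<k. ennreal ((h i \<omega>)\<^sup>2) * indicator {\<tau> i<..\<tau> (Suc i)} s) = 0"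
        by (intro sum.neutral) (simp add: indicator_def)
      then show ?thesis using False by simp
    qed simp
  qed
  also have "\<dots> = (\<Sum>i<k. ennreal ((h i \<omega>)\<^sup>2) * ennreal (\<tau> (Suc i) - \<tau> i))"
    using elementaryD(3)[OF el] by (subst nn_integral_sum) (auto simp: nn_integral_cmult_indicator)
  also have "\<dots> = ennreal (elem_var k \<tau> h \<omega>)"
    unfolding elem_var_def using elementaryD(3)[OF el]
    by (subst sum_ennreal[symmetric]) (auto simp: ennreal_mult')
  finally show ?thesis .
qed

lemma elementary_measurable:
  assumes fps: "filtered_prob_space M F" and el: "elementary M F t k \<tau> h"
  shows "i < k \<Longrightarrow> h i \<in> borel_measurable M"
    and "(\<lambda>\<omega>. elem_var k \<tau> h \<omega>) \<in> borel_measurable M"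
    and "(\<And>s. 0 \<le> s \<Longrightarrow> B s \<in> borel_measurable (F s)) \<Longrightarrow>
       (\<lambda>\<omega>. elementary_integral B k \<tau> h \<omega>) \<in> borel_measurable M"
    and "(\<lambda>(s, \<omega>). elementary_fun k \<tau> h s \<omega>) \<in> borel_measurable (borel \<Otimes>\<^sub>M M)"
proof -
  show h: "h i \<in> borel_measurable M" if "i < k" for i
    using measurable_filtration_space[OF fps elementaryD(4)[OF el that]] elementaryD(1)[OF el, of i] that by auto
  show "(\<lambda>\<omega>. elem_var k \<tau> h \<omega>) \<in> borel_measurable M"
    unfolding elem_var_def using h by (intro borel_measurable_sum) auto
  show "(\<lambda>\<omega>. elementary_integral B k \<tau> h \<omega>) \<in> borel_measurable M"
    if B: "\<And>s. 0 \<le> s \<Longrightarrow> B s \<in> borel_measurable (F s)"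
  proof -
    have "B s \<in> borel_measurable M" if "0 \<le> s" for s
      using measurable_filtration_space[OF fps B[OF that] that] .
    then show ?thesis unfolding elementary_integral_def using h elementaryD(1)[OF el]
      by (intro borel_measurable_sum borel_measurable_times borel_measurable_diff) auto
  qed
  have "(\<lambda>x. elementary_fun k \<tau> h (fst x) (snd x)) \<in> borel_measurable (borel \<Otimes>\<^sub>M M)"
    unfolding elementary_fun_def using h
    by (intro borel_measurable_sum borel_measurable_times) (auto intro: measurable_compose[OF measurable_snd])
  then show "(\<lambda>(s, \<omega>). elementary_fun k \<tau> h s \<omega>) \<in> borel_measurable (borel \<Otimes>\<^sub>M M)"
    by (simp add: case_prod_unfold)
qed

text \<open>The identity \<open>E exp (l * S - l^2 * VS / 2) = 1\<close>, with deterministic bounds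
  on the quadratic variation \<open>VS\<close> inserted on either side. Independence of the Brownian
  motions is what leaves \<open>VS\<close> without cross terms.\<close>

lemma ito_finite_sum_sub_exp:
  assumes fps: "filtered_prob_space M F" and bf: "brownian_family M F X W"
    and A: "finite A" "A \<subseteq> X"
    and ito: "\<And>y. y \<in> A \<Longrightarrow> has_ito_integral M F (W y) (H y) t (I y)"
    and Hb: "\<And>y \<omega>. y \<in> A \<Longrightarrow> \<omega> \<in> space M \<Longrightarrow> ennreal (v y) \<le> (\<integral>\<^sup>+s\<in>{0..t}. ennreal ((H y s \<omega>)\<^sup>2) \<partial>lborel)"
      "\<And>y \<omega>. y \<in> A \<Longrightarrow> \<omega> \<in> space M \<Longrightarrow> (\<integral>\<^sup>+s\<in>{0..t}. ennreal ((H y s \<omega>)\<^sup>2) \<partial>lborel) \<le> ennreal (L y)"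
      "\<And>y. y \<in> A \<Longrightarrow> 0 \<le> L y"
  shows "sub_exp M (\<lambda>\<omega>. \<Sum>y\<in>A. I y \<omega>) (\<Sum>y\<in>A. v y) (\<Sum>y\<in>A. L y)"
proof -
  interpret prob_space M using fps by (simp add: filtered_prob_space_def)
  have Hm: "(\<lambda>(s, \<omega>). H y s \<omega>) \<in> borel_measurable (restrict_space lborel {0..t} \<Otimes>\<^sub>M M)"
    and Im: "I y \<in> borel_measurable M" if "y \<in> A" for y
    using ito[OF that] by (auto simp: has_ito_integral_def)
  let ?R = "restrict_space lborel {0..t}"
  define E where "E y k \<tau> h \<longleftrightarrow> (\<forall>m. elementary M F t (k m) (\<tau> m) (h m)) \<and>
        (\<forall>\<eta>>0. (\<lambda>m. measure M {\<omega>\<in>space M.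
            (\<integral>\<^sup>+s\<in>{0..t}. ennreal ((H y s \<omega> - elementary_fun (k m) (\<tau> m) (h m) s \<omega>)\<^sup>2) \<partial>lborel)
              > ennreal \<eta>}) \<longlonglongrightarrow> 0) \<and>
        tendsto_in_prob M (\<lambda>m. elementary_integral (W y) (k m) (\<tau> m) (h m)) (I y) sequentially" for y k \<tau> h
  have "\<forall>y\<in>A. \<exists>k \<tau> h. E y k \<tau> h"
    using ito unfolding has_ito_integral_def E_def by blast
  then obtain k \<tau> h where "\<And>y. y \<in> A \<Longrightarrow> E y (k y) (\<tau> y) (h y)" by metis
  then have
    el: "\<And>y m. y \<in> A \<Longrightarrow> elementary M F t (k y m) (\<tau> y m) (h y m)" and
    err: "\<And>y \<eta>. y \<in> A \<Longrightarrow> 0 < \<eta> \<Longrightarrow> (\<lambda>m. measure M {\<omega>\<in>space M.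
            (\<integral>\<^sup>+s\<in>{0..t}. ennreal ((H y s \<omega> - elementary_fun (k y m) (\<tau> y m) (h y m) s \<omega>)\<^sup>2) \<partial>lborel)
              > ennreal \<eta>}) \<longlonglongrightarrow> 0" and
    J: "\<And>y. y \<in> A \<Longrightarrow> tendsto_in_prob M (\<lambda>m. elementary_integral (W y) (k y m) (\<tau> y m) (h y m)) (I y) sequentially"
    unfolding E_def by blast+
  have Wm: "\<And>y s. y \<in> A \<Longrightarrow> 0 \<le> s \<Longrightarrow> W y s \<in> borel_measurable (F s)"
    using bf A by (auto simp: brownian_family_def)
  have resI: "(\<integral>\<^sup>+s\<in>{0..t}. f s \<partial>lborel) = (\<integral>\<^sup>+s. f s \<partial>?R)" for f
    by (simp add: nn_integral_restrict_space)
  have Hsec: "(\<lambda>s. H y s \<omega>) \<in> borel_measurable ?R" if "y \<in> A" "\<omega> \<in> space M" for y \<omega>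
    using measurable_compose[OF measurable_Pair2'[OF that(2)] Hm[OF that(1)]] by simp
  have em: "(\<lambda>(s, \<omega>). elementary_fun (k y m) (\<tau> y m) (h y m) s \<omega>) \<in> borel_measurable (?R \<Otimes>\<^sub>M M)" if "y \<in> A" for y m
  proof -
    have "(\<lambda>x. (fst x, snd x)) \<in> ?R \<Otimes>\<^sub>M M \<rightarrow>\<^sub>M borel \<Otimes>\<^sub>M M"
      by (intro measurable_Pair measurable_compose[OF measurable_fst] measurable_snd measurable_restrict_space1) auto
    from measurable_compose[OF this elementary_measurable(4)[OF fps el[OF that]]] show ?thesis
      by (simp add: case_prod_unfold)
  qed
  have esec: "(\<lambda>s. elementary_fun (k y m) (\<tau> y m) (h y m) s \<omega>) \<in> borel_measurable ?R" if "y \<in> A" "\<omega> \<in> space M" for y m \<omega>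
    using measurable_compose[OF measurable_Pair2'[OF that(2)] em[OF that(1)]] by simp
  interpret R: sigma_finite_measure ?R by (intro sigma_finite_measure_restrict_space) (auto intro: sigma_finite_lborel)
  have errm: "(\<lambda>\<omega>. \<integral>\<^sup>+s\<in>{0..t}. ennreal ((H y s \<omega> - elementary_fun (k y m) (\<tau> y m) (h y m) s \<omega>)\<^sup>2) \<partial>lborel) \<in> borel_measurable M"
    if "y \<in> A" for y m
  proof -
    have "(\<lambda>x. (case (snd x, fst x) of (s, \<omega>) \<Rightarrow> H y s \<omega>)) \<in> borel_measurable (M \<Otimes>\<^sub>M ?R)"
      "(\<lambda>x. (case (snd x, fst x) of (s, \<omega>) \<Rightarrow> elementary_fun (k y m) (\<tau> y m) (h y m) s \<omega>)) \<in> borel_measurable (M \<Otimes>\<^sub>M ?R)"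
      by (intro measurable_compose[OF _ Hm[OF that]] measurable_compose[OF _ em[OF that]] measurable_Pair measurable_fst measurable_snd)+
    then have "(\<lambda>x. ennreal ((H y (snd x) (fst x) - elementary_fun (k y m) (\<tau> y m) (h y m) (snd x) (fst x))\<^sup>2)) \<in> borel_measurable (M \<Otimes>\<^sub>M ?R)"
      by simp
    then show ?thesis unfolding resI by (intro R.borel_measurable_nn_integral) (simp add: case_prod_unfold)
  qed
  \<comment> \<open>The flag selects the error: \<open>True\<close> for the integral,
    \<open>False\<close> for the integrand. One subsequence then serves both kinds and all
    sites.\<close>
  define f where "f = (\<lambda>(y, c) m \<omega>. if c then ennreal \<bar>elementary_integral (W y) (k y m) (\<tau> y m) (h y m) \<omega> - I y \<omega>\<bar>
     else (\<integral>\<^sup>+s\<in>{0..t}. ennreal ((H y s \<omega> - elementary_fun (k y m) (\<tau> y m) (h y m) s \<omega>)\<^sup>2) \<partial>lborel))"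
  have "\<exists>r. strict_mono r \<and> (AE \<omega> in M. \<forall>i\<in>A \<times> UNIV. (\<lambda>m. f i (r m) \<omega>) \<longlonglongrightarrow> 0)"
  proof (rule AE_subseq_of_in_measure_finite)
    show "finite (A \<times> (UNIV :: bool set))" using A by simp
    fix i :: "real \<times> bool" assume i: "i \<in> A \<times> UNIV"
    then obtain y c where yc: "i = (y, c)" "y \<in> A" by auto
    note [measurable] = elementary_measurable(3)[OF fps el[OF yc(2)] Wm[OF yc(2)]] Im[OF yc(2)] errm[OF yc(2)]
    show "f i m \<in> borel_measurable M" for m
      using errm[OF yc(2), of m] by (cases c) (auto simp: f_def yc(1))
    show "(\<lambda>m. measure M {\<omega>\<in>space M. f i m \<omega> > ennreal \<eta>}) \<longlonglongrightarrow> 0" if "0 < \<eta>" for \<eta>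
      using err[OF yc(2) that] J[OF yc(2)] that
      by (cases c) (auto simp: f_def yc(1) tendsto_in_prob_def ennreal_less_iff)
  qed
  then obtain r where r: "AE \<omega> in M. \<forall>i\<in>A \<times> UNIV. (\<lambda>m. f i (r m) \<omega>) \<longlonglongrightarrow> 0" by blast
  define V where "V y \<omega> = enn2real (\<integral>\<^sup>+s\<in>{0..t}. ennreal ((H y s \<omega>)\<^sup>2) \<partial>lborel)" for y \<omega>
  have Vfin: "(\<integral>\<^sup>+s\<in>{0..t}. ennreal ((H y s \<omega>)\<^sup>2) \<partial>lborel) = ennreal (V y \<omega>)" if "y \<in> A" "\<omega> \<in> space M" for y \<omega>
    using Hb(2)[OF that] unfolding V_def by (metis ennreal_enn2real ennreal_less_top le_less_trans)
  have V0: "0 \<le> V y \<omega>" for y \<omega> by (simp add: V_def)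
  have VL: "V y \<omega> \<le> L y" and Vv: "v y \<le> V y \<omega>" if "y \<in> A" "\<omega> \<in> space M" for y \<omega>
    using Hb(1,2)[OF that] Hb(3)[OF that(1)] V0[of y \<omega>] unfolding Vfin[OF that] by (auto simp: ennreal_le_iff2)
  have Vm: "V y \<in> borel_measurable M" if "y \<in> A" for y
  proof -
    have "(\<lambda>x. (case (snd x, fst x) of (s, \<omega>) \<Rightarrow> H y s \<omega>)) \<in> borel_measurable (M \<Otimes>\<^sub>M ?R)"
      by (intro measurable_compose[OF _ Hm[OF that]] measurable_Pair measurable_fst measurable_snd)
    then have "(\<lambda>x. ennreal ((H y (snd x) (fst x))\<^sup>2)) \<in> borel_measurable (M \<Otimes>\<^sub>M ?R)"
      by simp
    then have "(\<lambda>\<omega>. (\<integral>\<^sup>+s. ennreal ((H y s \<omega>)\<^sup>2) \<partial>?R)) \<in> borel_measurable M"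
      by (intro R.borel_measurable_nn_integral) (simp add: case_prod_unfold)
    then show ?thesis unfolding V_def[abs_def] resI by simp
  qed
  define h' where "h' y m = stop_elem (L y + 1) (\<tau> y m) (h y m)" for y m
  have el': "elementary M F t (k y m) (\<tau> y m) (h' y m)" if "y \<in> A" for y m
    unfolding h'_def by (rule elementary_stop_elem[OF fps el[OF that]])
  define XX where "XX m \<omega> = (\<Sum>y\<in>A. elementary_integral (W y) (k y (r m)) (\<tau> y (r m)) (h' y (r m)) \<omega>)" for m \<omega>
  define VV where "VV m \<omega> = (\<Sum>y\<in>A. elem_var (k y (r m)) (\<tau> y (r m)) (h' y (r m)) \<omega>)" for m \<omega>
  define S where "S \<omega> = (\<Sum>y\<in>A. I y \<omega>)" for \<omega>
  define VS where "VS \<omega> = (\<Sum>y\<in>A. V y \<omega>)" for \<omega>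
  define C where "C = (\<Sum>y\<in>A. L y + 1)"
  have [measurable]: "XX m \<in> borel_measurable M" "VV m \<in> borel_measurable M" for m
    unfolding XX_def VV_def using elementary_measurable[OF fps el'] Wm by (auto intro!: borel_measurable_sum)
  have [measurable]: "S \<in> borel_measurable M" "VS \<in> borel_measurable M"
    unfolding S_def VS_def using Im Vm by (auto intro!: borel_measurable_sum)
  have VVC: "VV m \<omega> \<le> C" for m \<omega>
    unfolding VV_def C_def h'_def using Hb(3) by (intro sum_mono elem_var_stop_elem_le[OF el]) (auto intro: add_nonneg_nonneg)
  have mart: "(\<integral>\<^sup>+\<omega>. ennreal (exp (l * XX m \<omega> - l\<^sup>2 * VV m \<omega> / 2)) \<partial>M) = 1" for l m
    unfolding XX_def VV_def by (rule exp_martingale_elementary[OF fps bf A el'])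
  have lim: "AE \<omega> in M. (\<lambda>m. XX m \<omega>) \<longlonglongrightarrow> S \<omega> \<and> (\<lambda>m. VV m \<omega>) \<longlonglongrightarrow> VS \<omega>"
    using r AE_space
  proof eventually_elim
    case (elim \<omega>)
    have "(\<lambda>m. elementary_integral (W y) (k y (r m)) (\<tau> y (r m)) (h' y (r m)) \<omega>) \<longlonglongrightarrow> I y \<omega> \<and>
       (\<lambda>m. elem_var (k y (r m)) (\<tau> y (r m)) (h' y (r m)) \<omega>) \<longlonglongrightarrow> V y \<omega>" if y: "y \<in> A" for y
    proof -
      let ?e = "\<lambda>m s. elementary_fun (k y (r m)) (\<tau> y (r m)) (h y (r m)) s \<omega>"
      let ?v = "\<lambda>m. elem_var (k y (r m)) (\<tau> y (r m)) (h y (r m)) \<omega>"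
      have e0: "(\<lambda>m. \<integral>\<^sup>+s. ennreal ((H y s \<omega> - ?e m s)\<^sup>2) \<partial>?R) \<longlonglongrightarrow> 0"
        using elim(1)[rule_format, of "(y, False)"] y by (simp add: f_def resI)
      have vl: "?v \<longlonglongrightarrow> V y \<omega>"
      proof (rule nn_integral_square_tendsto[OF Hsec[OF y elim(2)] esec[OF y elim(2)] _ V0 _ _ e0])
        show "(\<integral>\<^sup>+s. ennreal ((H y s \<omega>)\<^sup>2) \<partial>?R) = ennreal (V y \<omega>)"
          using Vfin[OF y elim(2)] by (simp add: resI)
        show "(\<integral>\<^sup>+s. ennreal ((?e m s)\<^sup>2) \<partial>?R) = ennreal (?v m)" for m
          using nn_integral_elementary_fun[OF el[OF y]] by (simp add: resI)
        show "0 \<le> ?v m" for m by (rule elem_var_nonneg[OF el[OF y]])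
      qed
      have il: "(\<lambda>m. elementary_integral (W y) (k y (r m)) (\<tau> y (r m)) (h y (r m)) \<omega>) \<longlonglongrightarrow> I y \<omega>"
      proof -
        have "(\<lambda>m. ennreal \<bar>elementary_integral (W y) (k y (r m)) (\<tau> y (r m)) (h y (r m)) \<omega> - I y \<omega>\<bar>) \<longlonglongrightarrow> ennreal 0"
          using elim(1)[rule_format, of "(y, True)"] y by (simp add: f_def)
        then show ?thesis
          by (subst (asm) tendsto_ennreal_iff) (auto simp: tendsto_rabs_zero_iff LIM_zero_iff)
      qed
      \<comment> \<open>The uncut variations tend to \<open>V y \<omega> <= L y\<close>; the spare
        unit in the cap makes it inactive along the tail, where capped and original sums
        agree.\<close>
      have "eventually (\<lambda>m. ?v m < L y + 1) sequentially"
        using vl VL[OF y elim(2)] by (intro order_tendstoD(2)[OF vl]) auto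
      then have ev: "eventually (\<lambda>m. \<forall>i<k y (r m). h' y (r m) i \<omega> = h y (r m) i \<omega>) sequentially"
      proof eventually_elim
        case (elim m)
        then show ?case unfolding h'_def using stop_elem_eq[OF el[OF y, of "r m"], of \<omega> "L y + 1"] by auto
      qed
      have "eventually (\<lambda>m. elementary_integral (W y) (k y (r m)) (\<tau> y (r m)) (h y (r m)) \<omega>
          = elementary_integral (W y) (k y (r m)) (\<tau> y (r m)) (h' y (r m)) \<omega>) sequentially"
        using ev by eventually_elim (auto simp: elementary_integral_def intro!: sum.cong)
      moreover have "eventually (\<lambda>m. ?v m = elem_var (k y (r m)) (\<tau> y (r m)) (h' y (r m)) \<omega>) sequentially"
        using ev by eventually_elim (auto simp: elem_var_def intro!: sum.cong)
      ultimately show ?thesis using il vl by (auto intro: Lim_transform_eventually)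
    qed
    then show ?case unfolding XX_def VV_def S_def VS_def by (auto intro!: tendsto_sum)
  qed
  define Z where "Z l \<omega> = ennreal (exp (l * S \<omega> - l\<^sup>2 * VS \<omega> / 2))" for l \<omega>
  define Zm where "Zm l m \<omega> = ennreal (exp (l * XX m \<omega> - l\<^sup>2 * VV m \<omega> / 2))" for l m \<omega>
  have [measurable]: "Z l \<in> borel_measurable M" "Zm l m \<in> borel_measurable M" for l m
    unfolding Z_def[abs_def] Zm_def[abs_def] by measurable
  have conv: "(\<lambda>m. \<integral>\<^sup>+\<omega>. min (Zm l m \<omega>) (of_nat N) \<partial>M) \<longlonglongrightarrow> (\<integral>\<^sup>+\<omega>. min (Z l \<omega>) (of_nat N) \<partial>M)" for l and N :: nat
  proof (rule nn_integral_dominated_convergence[where w="\<lambda>_. of_nat N"])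
    show "AE \<omega> in M. (\<lambda>m. min (Zm l m \<omega>) (of_nat N)) \<longlonglongrightarrow> min (Z l \<omega>) (of_nat N)"
      using lim unfolding Z_def Zm_def by eventually_elim (intro tendsto_intros tendsto_min tendsto_ennrealI, auto)
    show "(\<integral>\<^sup>+\<omega>. of_nat N \<partial>M) < \<infinity>" by (simp add: emeasure_space_1 less_top[symmetric])
  qed auto
  have EZ: "(\<integral>\<^sup>+\<omega>. Zm l m \<omega> \<partial>M) = 1" for l m by (simp only: Zm_def mart)
  have ZU: "(\<integral>\<^sup>+\<omega>. Z l \<omega> \<partial>M) \<le> 1" for l
    by (rule truncated_limit_upper[OF _ conv]) (auto simp: Zm_def mart)
  have ZL: "1 \<le> (\<integral>\<^sup>+\<omega>. Z l \<omega> \<partial>M)" for l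
  proof (rule truncated_limit_lower[OF _ _ conv])
    show "(\<lambda>m. 1::ennreal) \<longlonglongrightarrow> 1" by simp
    show "1 \<le> (\<integral>\<^sup>+\<omega>. Zm l m \<omega> \<partial>M)" for m by (simp add: Zm_def mart)
    show "(\<integral>\<^sup>+\<omega>. (Zm l m \<omega>)\<^sup>2 \<partial>M) \<le> ennreal (exp (l\<^sup>2 * C))" for m
    proof -
      have "(\<integral>\<^sup>+\<omega>. (Zm l m \<omega>)\<^sup>2 \<partial>M) \<le> (\<integral>\<^sup>+\<omega>. ennreal (exp (l\<^sup>2 * C)) * Zm (2 * l) m \<omega> \<partial>M)"
      \<comment> \<open>The square of \<open>Zm l m\<close> is \<open>Zm (2 * l) m\<close> times
        \<open>exp (l^2 * VV m)\<close>, and the cap bounds the last factor. This uniform second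
        moment keeps the mass in the limit.\<close>
      proof (rule nn_integral_mono)
        fix \<omega>
        have "l\<^sup>2 * VV m \<omega> \<le> l\<^sup>2 * C" using VVC by (intro mult_left_mono) auto
        then have "2 * (l * XX m \<omega> - l\<^sup>2 * VV m \<omega> / 2) \<le> l\<^sup>2 * C + (2 * l * XX m \<omega> - (2 * l)\<^sup>2 * VV m \<omega> / 2)"
          by (simp add: power2_eq_square algebra_simps)
        then show "(Zm l m \<omega>)\<^sup>2 \<le> ennreal (exp (l\<^sup>2 * C)) * Zm (2 * l) m \<omega>"
          unfolding Zm_def by (simp add: ennreal_power flip: exp_double exp_add ennreal_mult')
      qed
      also have "\<dots> = ennreal (exp (l\<^sup>2 * C))"
        by (subst nn_integral_cmult) (auto simp: EZ)
      finally show ?thesis .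
    qed
  qed auto
  have VSb: "(\<Sum>y\<in>A. v y) \<le> VS \<omega>" "VS \<omega> \<le> (\<Sum>y\<in>A. L y)" if "\<omega> \<in> space M" for \<omega>
    unfolding VS_def using VL Vv that by (auto intro!: sum_mono)
  \<comment> \<open>Bounding the second factor from either side yields the two inequalities.\<close>
  have ES: "ennreal (exp (l * S \<omega>)) = Z l \<omega> * ennreal (exp (l\<^sup>2 * VS \<omega> / 2))" for l \<omega>
    unfolding Z_def by (simp flip: ennreal_mult' exp_add)
  have "sub_exp M S (\<Sum>y\<in>A. v y) (\<Sum>y\<in>A. L y)"
    unfolding sub_exp_def
  proof (intro conjI allI)
    fix l :: real
    have "(\<integral>\<^sup>+\<omega>. ennreal (exp (l * S \<omega>)) \<partial>M) \<le> (\<integral>\<^sup>+\<omega>. Z l \<omega> * ennreal (exp (l\<^sup>2 * (\<Sum>y\<in>A. L y) / 2)) \<partial>M)"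
      unfolding ES by (intro nn_integral_mono mult_left_mono ennreal_leI) (auto intro!: divide_right_mono mult_left_mono VSb)
    also have "\<dots> \<le> 1 * ennreal (exp (l\<^sup>2 * (\<Sum>y\<in>A. L y) / 2))"
      by (subst nn_integral_multc) (measurable, rule mult_right_mono[OF ZU], simp)
    finally show "(\<integral>\<^sup>+\<omega>. ennreal (exp (l * S \<omega>)) \<partial>M) \<le> ennreal (exp (l\<^sup>2 * (\<Sum>y\<in>A. L y) / 2))" by simp
    have "1 * ennreal (exp (l\<^sup>2 * (\<Sum>y\<in>A. v y) / 2)) \<le> (\<integral>\<^sup>+\<omega>. Z l \<omega> * ennreal (exp (l\<^sup>2 * (\<Sum>y\<in>A. v y) / 2)) \<partial>M)"
      by (subst nn_integral_multc) (measurable, rule mult_right_mono[OF ZL], simp)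
    also have "\<dots> \<le> (\<integral>\<^sup>+\<omega>. ennreal (exp (l * S \<omega>)) \<partial>M)"
      unfolding ES by (intro nn_integral_mono mult_left_mono ennreal_leI) (auto intro!: divide_right_mono mult_left_mono VSb)
    finally show "ennreal (exp (l\<^sup>2 * (\<Sum>y\<in>A. v y) / 2)) \<le> (\<integral>\<^sup>+\<omega>. ennreal (exp (l * S \<omega>)) \<partial>M)" by simp
  qed measurable
  then show ?thesis by (simp add: S_def[abs_def])
qed

section \<open>From Laplace transforms to moments\<close>

lemma sub_exp_mono:
  assumes "sub_exp M X v L" "v' \<le> v" "L \<le> L'"
  shows "sub_exp M X v' L'"
  unfolding sub_exp_def
proof (intro conjI allI)
  show "X \<in> borel_measurable M" using assms by (simp add: sub_exp_def)
  fix l :: real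
  have "l\<^sup>2 * v' / 2 \<le> l\<^sup>2 * v / 2" "l\<^sup>2 * L / 2 \<le> l\<^sup>2 * L' / 2"
    using assms by (auto intro!: mult_left_mono divide_right_mono)
  then have "ennreal (exp (l\<^sup>2 * v' / 2)) \<le> ennreal (exp (l\<^sup>2 * v / 2))" "ennreal (exp (l\<^sup>2 * L / 2)) \<le> ennreal (exp (l\<^sup>2 * L' / 2))"
    by (auto intro!: ennreal_leI)
  then show "ennreal (exp (l\<^sup>2 * v' / 2)) \<le> (\<integral>\<^sup>+\<omega>. ennreal (exp (l * X \<omega>)) \<partial>M)"
    "(\<integral>\<^sup>+\<omega>. ennreal (exp (l * X \<omega>)) \<partial>M) \<le> ennreal (exp (l\<^sup>2 * L' / 2))"
    using assms(1) unfolding sub_exp_def by (meson order_trans)+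
qed

lemma power_div_fact_le_exp:
  fixes x :: real assumes "0 \<le> x" shows "x ^ n / fact n \<le> exp x"
proof -
  have "(\<lambda>k. x ^ k /\<^sub>R fact k) sums exp x" by (rule exp_converges)
  then have "sum (\<lambda>k. x ^ k /\<^sub>R fact k) {n} \<le> exp x"
    using sum_le_suminf[of "\<lambda>k. x ^ k /\<^sub>R fact k" "{n}"] assms
    by (auto simp: sums_iff)
  then show ?thesis by (simp add: field_simps)
qed

lemma exp_abs_le: "exp \<bar>x :: real\<bar> \<le> exp x + exp (- x)"
  by (cases "0 \<le> x") auto

text \<open>Odd terms cancel in \<open>exp z + exp (- z)\<close>, so after the quadratic term the
  remainder is of order \<open>l^4\<close>. Its coefficient is expressed by exponentials at
  \<open>2 * x\<close> and \<open>- (2 * x)\<close>, whose means \<open>sub_exp\<close>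
  controls.\<close>

lemma exp_scaled_bound:
  fixes x l :: real
  assumes l: "0 \<le> l" "l \<le> 1"
  shows "exp (l * x) + exp (- (l * x)) \<le> 2 + l\<^sup>2 * x\<^sup>2 + 2 * l ^ 4 * (exp (2 * x) + exp (- (2 * x)))"
proof -
  define z where "z = l * x"
  obtain t where t: "\<bar>t\<bar> \<le> \<bar>z\<bar>" "exp z = (\<Sum>m<4. z ^ m / fact m) + exp t / fact 4 * z ^ 4"
    using Maclaurin_exp_le by blast
  obtain t' where t': "\<bar>t'\<bar> \<le> \<bar>- z\<bar>" "exp (- z) = (\<Sum>m<4. (- z) ^ m / fact m) + exp t' / fact 4 * (- z) ^ 4"
    using Maclaurin_exp_le by blast
  have zx: "\<bar>z\<bar> \<le> \<bar>x\<bar>" using l by (simp add: z_def abs_mult mult_left_le_one_le)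
  have "exp t \<le> exp \<bar>x\<bar>" "exp t' \<le> exp \<bar>x\<bar>" using t t' zx by auto
  have f4: "fact 4 = (24::real)" by (simp add: fact_numeral)
  have "exp z + exp (- z) = 2 + z\<^sup>2 + z ^ 4 * ((exp t + exp t') / 24)"
    unfolding t(2) t'(2) f4 by (simp add: numeral_eq_Suc algebra_simps add_divide_distrib)
  also have "\<dots> \<le> 2 + z\<^sup>2 + z ^ 4 * (exp \<bar>x\<bar> / 12)"
  proof -
    have "(exp t + exp t') / 24 \<le> exp \<bar>x\<bar> / 12"
    proof -
      have "(exp t + exp t') / 24 \<le> (exp \<bar>x\<bar> + exp \<bar>x\<bar>) / 24"
        by (intro divide_right_mono add_mono \<open>exp t \<le> exp \<bar>x\<bar>\<close> \<open>exp t' \<le> exp \<bar>x\<bar>\<close>) simp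
      also have "\<dots> = exp \<bar>x\<bar> / 12" by simp
      finally show ?thesis .
    qed
    then show ?thesis by (intro add_left_mono mult_left_mono) auto
  qed
  also have "z ^ 4 * (exp \<bar>x\<bar> / 12) \<le> 2 * l ^ 4 * (exp (2 * x) + exp (- (2 * x)))"
  proof -
    \<comment> \<open>The fourth power is absorbed into one more factor \<open>exp |x|\<close>,
      which raises the exponent to \<open>2 * |x|\<close>.\<close>
    have "\<bar>x\<bar> ^ 4 / fact 4 \<le> exp \<bar>x\<bar>" by (rule power_div_fact_le_exp) simp
    then have "x ^ 4 \<le> 24 * exp \<bar>x\<bar>" by (simp add: f4)
    then have "x ^ 4 * exp \<bar>x\<bar> \<le> 24 * (exp \<bar>x\<bar> * exp \<bar>x\<bar>)" by (simp add: mult_right_mono)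
    also have "exp \<bar>x\<bar> * exp \<bar>x\<bar> = exp \<bar>2 * x\<bar>" by (simp flip: exp_add)
    also have "\<dots> \<le> exp (2 * x) + exp (- (2 * x))" by (rule exp_abs_le)
    finally have "x ^ 4 * (exp \<bar>x\<bar> / 12) \<le> 2 * (exp (2 * x) + exp (- (2 * x)))" by simp
    then have "l ^ 4 * (x ^ 4 * (exp \<bar>x\<bar> / 12)) \<le> l ^ 4 * (2 * (exp (2 * x) + exp (- (2 * x))))"
      by (intro mult_left_mono) auto
    moreover have "z ^ 4 * (exp \<bar>x\<bar> / 12) = l ^ 4 * (x ^ 4 * (exp \<bar>x\<bar> / 12))"
      by (simp only: z_def power_mult_distrib mult.assoc)
    moreover have "2 * l ^ 4 * (exp (2 * x) + exp (- (2 * x))) = l ^ 4 * (2 * (exp (2 * x) + exp (- (2 * x))))"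
      by (simp only: mult.assoc mult.left_commute)
    ultimately show ?thesis by (simp only:)
  qed
  finally show ?thesis by (simp add: z_def power_mult_distrib)
qed

text \<open>Adding the lower bounds at \<open>l\<close> and \<open>- l\<close> and comparing with
  the Taylor bound gives \<open>l^2 * v <= l^2 * m\<close> up to order \<open>l^4\<close>; divide by
  \<open>l^2\<close> and let \<open>l\<close> tend to \<open>0\<close>.\<close>

lemma sub_exp_second_moment:
  assumes ps: "prob_space M" and se: "sub_exp M X v L"
  shows "ennreal v \<le> (\<integral>\<^sup>+\<omega>. ennreal ((X \<omega>)\<^sup>2) \<partial>M)"
proof (cases "(\<integral>\<^sup>+\<omega>. ennreal ((X \<omega>)\<^sup>2) \<partial>M)")
  case (real m)
  interpret prob_space M by fact
  have [measurable]: "X \<in> borel_measurable M" using se by (simp add: sub_exp_def)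
  have U: "(\<integral>\<^sup>+\<omega>. ennreal (exp (l * X \<omega>)) \<partial>M) \<le> ennreal (exp (l\<^sup>2 * L / 2))"
    and Lo: "ennreal (exp (l\<^sup>2 * v / 2)) \<le> (\<integral>\<^sup>+\<omega>. ennreal (exp (l * X \<omega>)) \<partial>M)" for l
    using se by (auto simp: sub_exp_def)
  have key: "v \<le> m + 4 * exp (2 * L) * l\<^sup>2" if l: "0 < l" "l \<le> 1" for l
  proof -
    have "ennreal (2 * exp (l\<^sup>2 * v / 2)) = ennreal (exp (l\<^sup>2 * v / 2)) + ennreal (exp ((-l)\<^sup>2 * v / 2))"
      by (simp flip: ennreal_plus)
    also have "\<dots> \<le> (\<integral>\<^sup>+\<omega>. ennreal (exp (l * X \<omega>)) \<partial>M) + (\<integral>\<^sup>+\<omega>. ennreal (exp ((-l) * X \<omega>)) \<partial>M)"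
      by (intro add_mono Lo)
    also have "\<dots> = (\<integral>\<^sup>+\<omega>. ennreal (exp (l * X \<omega>)) + ennreal (exp ((-l) * X \<omega>)) \<partial>M)"
      by (subst nn_integral_add) auto
    also have "\<dots> \<le> (\<integral>\<^sup>+\<omega>. 2 + ennreal (l\<^sup>2) * ennreal ((X \<omega>)\<^sup>2) +
        ennreal (2 * l ^ 4) * (ennreal (exp (2 * X \<omega>)) + ennreal (exp ((-2) * X \<omega>))) \<partial>M)"
    proof (rule nn_integral_mono)
      fix \<omega>
      have "ennreal (exp (l * X \<omega>)) + ennreal (exp ((-l) * X \<omega>)) \<le>
         ennreal (2 + l\<^sup>2 * (X \<omega>)\<^sup>2 + 2 * l ^ 4 * (exp (2 * X \<omega>) + exp (- (2 * X \<omega>))))"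
        using exp_scaled_bound[of l "X \<omega>"] l by (simp flip: ennreal_plus)
      also have "\<dots> = 2 + ennreal (l\<^sup>2) * ennreal ((X \<omega>)\<^sup>2) +
        ennreal (2 * l ^ 4) * (ennreal (exp (2 * X \<omega>)) + ennreal (exp ((-2) * X \<omega>)))"
        using l by (subst ennreal_plus; simp add: ennreal_mult')
      finally show "ennreal (exp (l * X \<omega>)) + ennreal (exp ((-l) * X \<omega>)) \<le> \<dots>" .
    qed
    also have "\<dots> = 2 + ennreal (l\<^sup>2) * (\<integral>\<^sup>+\<omega>. ennreal ((X \<omega>)\<^sup>2) \<partial>M) +
        ennreal (2 * l ^ 4) * ((\<integral>\<^sup>+\<omega>. ennreal (exp (2 * X \<omega>)) \<partial>M) + (\<integral>\<^sup>+\<omega>. ennreal (exp ((-2) * X \<omega>)) \<partial>M))"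
      by (simp add: nn_integral_add nn_integral_cmult emeasure_space_1)
    also have "\<dots> \<le> 2 + ennreal (l\<^sup>2) * ennreal m +
        ennreal (2 * l ^ 4) * (ennreal (exp (2\<^sup>2 * L / 2)) + ennreal (exp ((-2)\<^sup>2 * L / 2)))"
      unfolding real(2) by (intro add_mono mult_left_mono U) auto
    also have "\<dots> = ennreal (2 + l\<^sup>2 * m + 2 * l ^ 4 * (2 * exp (2 * L)))"
      using real(1) l by (simp add: ennreal_mult'[symmetric] ennreal_plus[symmetric] ennreal_numeral[symmetric] del: ennreal_plus ennreal_numeral)
    finally have "2 * exp (l\<^sup>2 * v / 2) \<le> 2 + l\<^sup>2 * m + 2 * l ^ 4 * (2 * exp (2 * L))"
      using real(1) by (subst (asm) ennreal_le_iff) auto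
    moreover have "1 + l\<^sup>2 * v / 2 \<le> exp (l\<^sup>2 * v / 2)" by (rule exp_ge_add_one_self)
    ultimately have "l\<^sup>2 * v \<le> l\<^sup>2 * m + 4 * l ^ 4 * exp (2 * L)" by linarith
    also have "\<dots> = l\<^sup>2 * (m + 4 * exp (2 * L) * l\<^sup>2)" by (simp add: algebra_simps power2_eq_square power4_eq_xxxx)
    finally show ?thesis using l by (subst (asm) mult_le_cancel_left_pos) auto
  qed
  have "v \<le> m"
  proof (rule field_le_epsilon)
    fix e :: real assume e: "0 < e"
    define l where "l = min 1 (sqrt (e / (4 * exp (2 * L))))"
    have l: "0 < l" "l \<le> 1" using e by (auto simp: l_def)
    have "l\<^sup>2 \<le> (sqrt (e / (4 * exp (2 * L))))\<^sup>2" using l by (intro power_mono) (auto simp: l_def)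
    also have "\<dots> = e / (4 * exp (2 * L))" using e by simp
    finally have "4 * exp (2 * L) * l\<^sup>2 \<le> e" by (simp add: field_simps)
    then show "v \<le> m + e" using key[OF l] by linarith
  qed
  then show ?thesis unfolding real(2) by (rule ennreal_leI)
qed simp

text \<open>Comes from \<open>|z|^p <= (1 + n!) * (exp z + exp (- z))\<close> with \<open>n\<close>
  the ceiling of \<open>p\<close>, applied to \<open>z = X / sqrt L\<close>, where both exponential
  moments are at most \<open>exp (1/2)\<close>.\<close>

definition moment_const :: "real \<Rightarrow> real" where
  "moment_const p = 2 * (1 + fact (nat \<lceil>p\<rceil>)) * exp (1/2)"

lemma powr_le_exp:
  fixes x p :: real assumes "0 < p"
  shows "\<bar>x\<bar> powr p \<le> (1 + fact (nat \<lceil>p\<rceil>)) * (exp x + exp (- x))"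
proof -
  define n where "n = nat \<lceil>p\<rceil>"
  have pn: "p \<le> real n" unfolding n_def by linarith
  have "\<bar>x\<bar> powr p \<le> 1 + \<bar>x\<bar> ^ n"
  proof (cases "\<bar>x\<bar> \<le> 1")
    case True
    then have "\<bar>x\<bar> powr p \<le> 1" using assms by (intro powr_le1) auto
    then show ?thesis by (smt (verit) zero_le_power abs_ge_zero)
  next
    case False
    then have "\<bar>x\<bar> powr p \<le> \<bar>x\<bar> powr real n" using pn by (intro powr_mono) auto
    also have "\<dots> = \<bar>x\<bar> ^ n" using False by (subst powr_realpow) auto
    finally show ?thesis by simp
  qed
  also have "\<bar>x\<bar> ^ n \<le> fact n * exp \<bar>x\<bar>"
    using power_div_fact_le_exp[of "\<bar>x\<bar>" n] by (simp add: field_simps)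
  also have "1 + fact n * exp \<bar>x\<bar> \<le> (1 + fact n) * exp \<bar>x\<bar>" by (simp add: algebra_simps)
  also have "\<dots> \<le> (1 + fact n) * (exp x + exp (- x))"
    by (intro mult_left_mono exp_abs_le) auto
  finally show ?thesis by (simp add: n_def)
qed

lemma sub_exp_moment:
  assumes se: "sub_exp M X v L" and "0 < L" "0 < p"
  shows "(\<integral>\<^sup>+\<omega>. ennreal (\<bar>X \<omega>\<bar> powr p) \<partial>M) \<le> ennreal (moment_const p * L powr (p / 2))"
proof -
  have [measurable]: "X \<in> borel_measurable M" using se by (simp add: sub_exp_def)
  define c where "c = 1 / sqrt L"
  define D where "D = (1 + fact (nat \<lceil>p\<rceil>) :: real)"
  have D0: "0 \<le> D" by (simp add: D_def)
  have c: "0 < c" "c\<^sup>2 * L = 1" using \<open>0 < L\<close> by (auto simp: c_def power_divide)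
  have U: "(\<integral>\<^sup>+\<omega>. ennreal (exp (l * X \<omega>)) \<partial>M) \<le> ennreal (exp (1/2))" if "l = c \<or> l = - c" for l
  proof -
    have "(\<integral>\<^sup>+\<omega>. ennreal (exp (l * X \<omega>)) \<partial>M) \<le> ennreal (exp (l\<^sup>2 * L / 2))"
      using se by (simp add: sub_exp_def)
    also have "l\<^sup>2 * L = 1" using that c by auto
    finally show ?thesis .
  qed
  have "(\<integral>\<^sup>+\<omega>. ennreal (\<bar>X \<omega>\<bar> powr p) \<partial>M) \<le> (\<integral>\<^sup>+\<omega>. ennreal (L powr (p/2) * D) * (ennreal (exp (c * X \<omega>)) + ennreal (exp ((- c) * X \<omega>))) \<partial>M)"
  proof (rule nn_integral_mono)
    fix \<omega>
    have "\<bar>X \<omega>\<bar> = sqrt L * \<bar>c * X \<omega>\<bar>" using \<open>0 < L\<close> by (simp add: c_def abs_mult)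
    then have "\<bar>X \<omega>\<bar> powr p = (sqrt L) powr p * \<bar>c * X \<omega>\<bar> powr p" using \<open>0 < L\<close> by (simp add: powr_mult)
    also have "(sqrt L) powr p = L powr (p / 2)" using \<open>0 < L\<close> by (simp add: powr_half_sqrt[symmetric] powr_powr)
    also have "L powr (p / 2) * \<bar>c * X \<omega>\<bar> powr p \<le> L powr (p / 2) * (D * (exp (c * X \<omega>) + exp (- (c * X \<omega>))))"
      unfolding D_def by (intro mult_left_mono powr_le_exp \<open>0 < p\<close>) auto
    finally have "\<bar>X \<omega>\<bar> powr p \<le> L powr (p / 2) * D * (exp (c * X \<omega>) + exp (- (c * X \<omega>)))" by (simp add: mult.assoc)
    then show "ennreal (\<bar>X \<omega>\<bar> powr p) \<le> ennreal (L powr (p/2) * D) * (ennreal (exp (c * X \<omega>)) + ennreal (exp ((- c) * X \<omega>)))"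
      using D0 by (simp flip: ennreal_plus ennreal_mult')
  qed
  also have "\<dots> = ennreal (L powr (p/2) * D) * ((\<integral>\<^sup>+\<omega>. ennreal (exp (c * X \<omega>)) \<partial>M) + (\<integral>\<^sup>+\<omega>. ennreal (exp ((- c) * X \<omega>)) \<partial>M))"
    by (simp add: nn_integral_cmult nn_integral_add)
  also have "\<dots> \<le> ennreal (L powr (p/2) * D) * (ennreal (exp (1/2)) + ennreal (exp (1/2)))"
    by (intro mult_left_mono add_mono U) auto
  also have "\<dots> = ennreal (moment_const p * L powr (p / 2))"
    using D0 by (simp add: moment_const_def D_def mult_ac flip: ennreal_plus ennreal_mult')
  finally show ?thesis .
qed

section \<open>The noise summed over the whole lattice\<close>

text \<open>Symmetric windows are cofinal among finite sets of sites, which turns the unconditional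
  limit of \<open>has_green_noise\<close> into one along a sequence.\<close>

lemma lattice_exhaustion:
  "filterlim (\<lambda>n::nat. (\<lambda>k::int. of_int k * \<delta>) ` {- int n..int n}) (finite_subsets_at_top (lattice \<delta>)) sequentially"
  unfolding filterlim_finite_subsets_at_top
proof (intro allI impI)
  fix X assume X: "finite X \<and> X \<subseteq> lattice \<delta>"
  then obtain Y where Y: "finite Y" "X = (\<lambda>k::int. of_int k * \<delta>) ` Y"
    unfolding lattice_def by (meson finite_subset_image)
  obtain n0 :: nat where n0: "\<forall>k\<in>Y. \<bar>k\<bar> \<le> int n0"
  proof -
    have "\<forall>k\<in>Y. \<bar>k\<bar> \<le> int (nat (\<Sum>k\<in>Y. \<bar>k\<bar>))"
      using Y(1) by (auto intro!: member_le_sum[of _ Y "\<lambda>k. \<bar>k\<bar>"] simp: sum_nonneg)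
    then show ?thesis using that by blast
  qed
  show "\<forall>\<^sub>F n in sequentially. finite ((\<lambda>k::int. of_int k * \<delta>) ` {- int n..int n}) \<and>
       X \<subseteq> (\<lambda>k. of_int k * \<delta>) ` {- int n..int n} \<and> (\<lambda>k. of_int k * \<delta>) ` {- int n..int n} \<subseteq> lattice \<delta>"
    using eventually_ge_at_top[of n0]
  proof eventually_elim
    case (elim n)
    have "Y \<subseteq> {- int n..int n}" using n0 elim by force
    then show ?case unfolding Y(2) lattice_def by auto
  qed
qed

lemma lattice_green_measurable [measurable]:
  assumes "\<delta> \<noteq> 0"
  shows "(\<lambda>t. lattice_green \<delta> \<epsilon> t x) \<in> borel_measurable borel"
proof -
  have "isCont (\<lambda>t. lattice_green \<delta> \<epsilon> t x) t" for t
    using lattice_green_solves[OF assms] by (rule DERIV_isCont)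
  then show ?thesis by (intro borel_measurable_continuous_onI) (simp add: continuous_at_imp_continuous_on)
qed

text \<open>Bounds on \<open>g^2\<close> squeeze each quadratic variation between multiples of
  \<open>q y\<close>. Finite windows obey the Gaussian bounds, and an almost surely convergent
  subsequence of windows carries them to \<open>S\<close>.\<close>

lemma green_noise_sub_exp:
  assumes fps: "filtered_prob_space M F" and bf: "brownian_family M F (lattice \<delta>) W" and \<delta>: "\<delta> \<noteq> 0"
    and gn: "has_green_noise M F W \<delta> \<epsilon> g v t x S"
    and g: "\<And>u. gl \<le> (g u)\<^sup>2" "\<And>u. (g u)\<^sup>2 \<le> gu" "0 \<le> gl"
    and q: "\<And>y. y \<in> lattice \<delta> \<Longrightarrow> (\<integral>\<^sup>+s\<in>{0..t}. ennreal ((lattice_green \<delta> \<epsilon> (t - s) (x - y))\<^sup>2) \<partial>lborel) = ennreal (q y)"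
      "\<And>y. y \<in> lattice \<delta> \<Longrightarrow> 0 \<le> q y" and qs: "(q has_sum qs) (lattice \<delta>)"
  shows "sub_exp M S (gl * qs) (gu * qs)"
proof -
  interpret prob_space M using fps by (simp add: filtered_prob_space_def)
  have gu0: "0 \<le> gu" using g(1,2,3) by (meson order_trans)
  obtain I where I: "\<And>y. y \<in> lattice \<delta> \<Longrightarrow> has_ito_integral M F (W y)
             (\<lambda>s \<omega>. lattice_green \<delta> \<epsilon> (t - s) (x - y) * g (v y s \<omega>)) t (I y)"
    and lim: "tendsto_in_prob M (\<lambda>A \<omega>. \<Sum>y\<in>A. I y \<omega>) S (finite_subsets_at_top (lattice \<delta>))"
    and Sm: "S \<in> borel_measurable M"
    using gn unfolding has_green_noise_def by blast
  define A where "A n = (\<lambda>k::int. of_int k * \<delta>) ` {- int n..int n}" for n :: nat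
  have A: "finite (A n)" "A n \<subseteq> lattice \<delta>" for n unfolding A_def lattice_def by auto
  have fl: "filterlim A (finite_subsets_at_top (lattice \<delta>)) sequentially"
    unfolding A_def by (rule lattice_exhaustion)
  have [measurable]: "(\<lambda>s. lattice_green \<delta> \<epsilon> (t - s) z) \<in> borel_measurable lborel" for z
    using measurable_compose[OF _ lattice_green_measurable[OF \<delta>], of "\<lambda>s. t - s" lborel \<epsilon> z] by simp
  have cq: "(\<integral>\<^sup>+s\<in>{0..t}. ennreal (c * (lattice_green \<delta> \<epsilon> (t - s) (x - y))\<^sup>2) \<partial>lborel) = ennreal (c * q y)"
    if "0 \<le> c" "y \<in> lattice \<delta>" for c y
  proof -
    have "(\<integral>\<^sup>+s\<in>{0..t}. ennreal (c * (lattice_green \<delta> \<epsilon> (t - s) (x - y))\<^sup>2) \<partial>lborel)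
      = (\<integral>\<^sup>+s. ennreal c * (ennreal ((lattice_green \<delta> \<epsilon> (t - s) (x - y))\<^sup>2) * indicator {0..t} s) \<partial>lborel)"
      using that by (intro nn_integral_cong) (simp add: ennreal_mult' mult.assoc)
    also have "\<dots> = ennreal c * ennreal (q y)"
      by (subst nn_integral_cmult) (auto simp: q(1)[OF that(2)])
    finally show ?thesis using that q(2) by (simp add: ennreal_mult')
  qed
  have fin: "sub_exp M (\<lambda>\<omega>. \<Sum>y\<in>A n. I y \<omega>) (\<Sum>y\<in>A n. gl * q y) (\<Sum>y\<in>A n. gu * q y)" for n
  proof (rule ito_finite_sum_sub_exp[OF fps bf A I])
    fix y \<omega> assume "y \<in> A n" 
    then have y: "y \<in> lattice \<delta>" using A by auto
    show "0 \<le> gu * q y" using gu0 q(2)[OF y] by simp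
    have "(\<integral>\<^sup>+s\<in>{0..t}. ennreal (gl * (lattice_green \<delta> \<epsilon> (t - s) (x - y))\<^sup>2) \<partial>lborel) \<le>
       (\<integral>\<^sup>+s\<in>{0..t}. ennreal ((lattice_green \<delta> \<epsilon> (t - s) (x - y) * g (v y s \<omega>))\<^sup>2) \<partial>lborel)"
      using g by (intro nn_integral_mono mult_right_mono ennreal_leI)
        (auto simp: power_mult_distrib mult.commute intro!: mult_right_mono)
    then show "ennreal (gl * q y) \<le> (\<integral>\<^sup>+s\<in>{0..t}. ennreal ((lattice_green \<delta> \<epsilon> (t - s) (x - y) * g (v y s \<omega>))\<^sup>2) \<partial>lborel)"
      using cq[OF g(3) y] by simp
    have "(\<integral>\<^sup>+s\<in>{0..t}. ennreal ((lattice_green \<delta> \<epsilon> (t - s) (x - y) * g (v y s \<omega>))\<^sup>2) \<partial>lborel)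
       \<le> (\<integral>\<^sup>+s\<in>{0..t}. ennreal (gu * (lattice_green \<delta> \<epsilon> (t - s) (x - y))\<^sup>2) \<partial>lborel)"
      using g by (intro nn_integral_mono mult_right_mono ennreal_leI)
        (auto simp: power_mult_distrib mult.commute intro!: mult_right_mono)
    then show "(\<integral>\<^sup>+s\<in>{0..t}. ennreal ((lattice_green \<delta> \<epsilon> (t - s) (x - y) * g (v y s \<omega>))\<^sup>2) \<partial>lborel) \<le> ennreal (gu * q y)"
      using cq[OF gu0 y] by simp
  qed (use A in auto)
  have qle: "(\<Sum>y\<in>A n. q y) \<le> qs" for n
    using has_sum_mono_neutral[OF has_sum_finite[OF A(1)[of n], of q] qs] A q(2) by (auto simp: subset_eq)
  \<comment> \<open>The upper constant is raised to the full sum at once, since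
    \<open>sub_exp_AE_limit\<close> works with one upper constant and a convergent lower
    variance.\<close>
  have fin': "sub_exp M (\<lambda>\<omega>. \<Sum>y\<in>A n. I y \<omega>) (gl * (\<Sum>y\<in>A n. q y)) (gu * qs)" for n
    using qle gu0 by (intro sub_exp_mono[OF fin]) (auto simp: sum_distrib_left[symmetric] intro!: mult_left_mono)
  have qlim: "(\<lambda>n. \<Sum>y\<in>A n. q y) \<longlonglongrightarrow> qs"
    using filterlim_compose[OF qs[unfolded has_sum_def] fl] .
  have "tendsto_in_prob M (\<lambda>n \<omega>. \<Sum>y\<in>A n. I y \<omega>) S sequentially"
    using lim unfolding tendsto_in_prob_def by (auto intro!: filterlim_compose[OF _ fl])
  moreover have "(\<lambda>\<omega>. \<Sum>y\<in>A n. I y \<omega>) \<in> borel_measurable M" for n using fin by (auto simp: sub_exp_def)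
  ultimately obtain r where r: "strict_mono r" "AE \<omega> in M. (\<lambda>n. \<Sum>y\<in>A (r n). I y \<omega>) \<longlonglongrightarrow> S \<omega>"
    using tendsto_in_prob_AE_subseq[of M "\<lambda>n \<omega>. \<Sum>y\<in>A n. I y \<omega>" S] Sm prob_space_axioms by blast
  show ?thesis
  proof (rule sub_exp_AE_limit[OF prob_space_axioms fin' _ Sm r(2)])
    show "(\<lambda>n. gl * (\<Sum>y\<in>A (r n). q y)) \<longlonglongrightarrow> gl * qs"
      using LIMSEQ_subseq_LIMSEQ[OF qlim r(1)] by (intro tendsto_intros) (simp add: o_def)
  qed
qed

section \<open>Convolution kernels and the Gronwall inequality\<close>

text \<open>By Levy's uniqueness theorem a convolution is determined by its characteristic function.
  Both the walk and the Gaussian kernel obtain their semigroup law this way.\<close>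

lemma nn_integral_convolution_char:
  assumes M: "real_distribution M" and N: "real_distribution N" and K: "real_distribution K"
    and ch: "\<And>u. char M u * char N u = char K u" and f [measurable]: "f \<in> borel_measurable borel"
  shows "(\<integral>\<^sup>+x. (\<integral>\<^sup>+y. f (x + y) \<partial>N) \<partial>M) = (\<integral>\<^sup>+z. f z \<partial>K :: ennreal)"
proof -
  interpret M: real_distribution M by fact
  interpret N: real_distribution N by fact
  interpret P: pair_prob_space M N ..
  have sM [measurable_cong]: "sets M = sets borel" and sN [measurable_cong]: "sets N = sets borel" by simp_all
  define C where "C = distr (M \<Otimes>\<^sub>M N) borel (\<lambda>p. fst p + snd p)"
  have pm [measurable]: "(\<lambda>p. fst p + snd p) \<in> borel_measurable (M \<Otimes>\<^sub>M N)" by measurable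
  interpret C: real_distribution C
    unfolding C_def by (rule P.P.real_distribution_distr[OF pm])
  have "char C u = char K u" for u
  proof -
    have "char C u = (CLINT p|M \<Otimes>\<^sub>M N. iexp (u * (fst p + snd p)))"
      unfolding C_def char_def by (subst integral_distr) auto
    also have "\<dots> = (CLINT p|M \<Otimes>\<^sub>M N. iexp (u * fst p) * iexp (u * snd p))"
      by (intro Bochner_Integration.integral_cong refl) (simp add: algebra_simps exp_add)
    also have "\<dots> = (CLINT x|M. CLINT y|N. iexp (u * x) * iexp (u * y))"
    proof (subst P.integral_fst'[symmetric])
      show "integrable (M \<Otimes>\<^sub>M N) (\<lambda>p. iexp (u * fst p) * iexp (u * snd p))"
        by (intro P.P.integrable_const_bound[where B=1]) (auto simp: norm_mult)
    qed simp
    also have "\<dots> = char M u * char N u" unfolding char_def by simp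
    finally show ?thesis using ch by simp
  qed
  then have "C = K" by (intro Levy_uniqueness) (use K C.real_distribution_axioms in auto)
  then have "(\<integral>\<^sup>+z. f z \<partial>K) = (\<integral>\<^sup>+p. f (fst p + snd p) \<partial>(M \<Otimes>\<^sub>M N))"
    by (auto simp: C_def nn_integral_distr)
  also have "\<dots> = (\<integral>\<^sup>+x. (\<integral>\<^sup>+y. f (x + y) \<partial>N) \<partial>M)"
    by (subst N.nn_integral_fst[symmetric]) auto
  finally show ?thesis by simp
qed

text \<open>The Duhamel integral of a nonnegative source, \<open>\<nu>\<close> being the law of the
  displacement over the elapsed time. With values in \<open>ennreal\<close>, Tonelli applies without
  integrability conditions.\<close>

definition duh :: "(real \<Rightarrow> real measure) \<Rightarrow> (real \<Rightarrow> real \<Rightarrow> ennreal) \<Rightarrow> real \<Rightarrow> real \<Rightarrow> ennreal" where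
  "duh \<nu> f t x = (\<integral>\<^sup>+r\<in>{0..t}. (\<integral>\<^sup>+z. f r (x - z) \<partial>\<nu> (t - r)) \<partial>lborel)"

lemma duh_0: "duh \<nu> f 0 x = 0"
proof -
  have "AE r in lborel. r \<noteq> (0::real)" by (rule AE_lborel_singleton)
  then have "AE r in lborel. (\<integral>\<^sup>+z. f r (x - z) \<partial>\<nu> (0 - r)) * indicator {0..0} r = 0"
    by eventually_elim (simp add: indicator_def)
  from nn_integral_cong_AE[OF this] show ?thesis unfolding duh_def by simp
qed

text \<open>Common ground of the lattice walk and the heat semigroup, so that the Duhamel calculus
  and Gronwall are proved once. Measurability is asked on the whole line; at negative times the
  kernels have a conventional value.\<close>

locale conv_kernel =
  fixes \<nu> :: "real \<Rightarrow> real measure"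
  assumes kernel_measurable: "\<nu> \<in> borel \<rightarrow>\<^sub>M prob_algebra borel"
    and semigroup: "\<And>s t f. 0 \<le> s \<Longrightarrow> 0 \<le> t \<Longrightarrow> f \<in> borel_measurable borel \<Longrightarrow>
      (\<integral>\<^sup>+x. (\<integral>\<^sup>+y. f (x + y) \<partial>\<nu> t) \<partial>\<nu> s) = (\<integral>\<^sup>+z. f z \<partial>\<nu> (s + t) :: ennreal)"
begin

lemma sets_kernel [simp, measurable_cong]: "sets (\<nu> t) = sets borel"
  and prob_space_kernel: "prob_space (\<nu> t)"
  using measurable_space[OF kernel_measurable, of t] by (auto simp: space_prob_algebra)

lemma space_kernel [simp]: "space (\<nu> t) = UNIV"
  using sets_eq_imp_space_eq[OF sets_kernel, of t] by simp

lemma emeasure_kernel_UNIV [simp]: "emeasure (\<nu> t) UNIV = 1"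
  using prob_space.emeasure_space_1[OF prob_space_kernel, of t] by simp

lemma kernel_subprob: "\<nu> \<in> borel \<rightarrow>\<^sub>M subprob_algebra borel"
  by (rule measurable_prob_algebraD[OF kernel_measurable])

lemma measurable_kernel_integral:
  assumes f: "(\<lambda>(w, y). f w y) \<in> borel_measurable (N \<Otimes>\<^sub>M borel)"
    and [measurable]: "\<tau> \<in> borel_measurable N" "\<xi> \<in> borel_measurable N"
  shows "(\<lambda>w. \<integral>\<^sup>+z. f w (\<xi> w - z) \<partial>\<nu> (\<tau> w)) \<in> borel_measurable N"
proof (rule nn_integral_measurable_subprob_algebra2[where N=borel])
  show "(\<lambda>w. \<nu> (\<tau> w)) \<in> N \<rightarrow>\<^sub>M subprob_algebra borel"
    using measurable_compose[OF assms(2) kernel_subprob] .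
  have "(\<lambda>p. (fst p, \<xi> (fst p) - snd p)) \<in> N \<Otimes>\<^sub>M borel \<rightarrow>\<^sub>M N \<Otimes>\<^sub>M borel" by measurable
  from measurable_compose[OF this f]
  show "(\<lambda>(w, z). f w (\<xi> w - z)) \<in> borel_measurable (N \<Otimes>\<^sub>M borel)"
    by (simp add: case_prod_unfold)
qed

text \<open>The parameter \<open>w\<close> may collect sample point, time and position, which gives
  joint measurability of Duhamel integrals of random fields.\<close>

lemma measurable_duh:
  assumes f: "(\<lambda>(w, r, y). f w r y) \<in> borel_measurable (N \<Otimes>\<^sub>M (borel \<Otimes>\<^sub>M borel))"
    and [measurable]: "\<tau> \<in> borel_measurable N" "\<xi> \<in> borel_measurable N"
  shows "(\<lambda>w. duh \<nu> (f w) (\<tau> w) (\<xi> w)) \<in> borel_measurable N"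
proof -
  have "(\<lambda>p. (fst (fst p), snd (fst p), snd p)) \<in> (N \<Otimes>\<^sub>M borel) \<Otimes>\<^sub>M borel \<rightarrow>\<^sub>M N \<Otimes>\<^sub>M (borel \<Otimes>\<^sub>M borel)"
    by measurable
  from measurable_compose[OF this f]
  have "(\<lambda>(p, y). f (fst p) (snd p) y) \<in> borel_measurable ((N \<Otimes>\<^sub>M borel) \<Otimes>\<^sub>M borel)"
    by (simp add: case_prod_unfold)
  then have "(\<lambda>p. \<integral>\<^sup>+z. f (fst p) (snd p) (\<xi> (fst p) - z) \<partial>\<nu> (\<tau> (fst p) - snd p)) \<in> borel_measurable (N \<Otimes>\<^sub>M borel)"
    by (rule measurable_kernel_integral) measurable
  then have [measurable]: "(\<lambda>p. \<integral>\<^sup>+z. f (fst p) (snd p) (\<xi> (fst p) - z) \<partial>\<nu> (\<tau> (fst p) - snd p)) \<in> borel_measurable (N \<Otimes>\<^sub>M lborel)"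
    by (simp cong: measurable_cong_sets)
  have [measurable]: "(\<lambda>p. indicator {0..\<tau> (fst p)} (snd p) :: ennreal) \<in> borel_measurable (N \<Otimes>\<^sub>M lborel)"
  proof -
    have "(\<lambda>p. indicator {0..\<tau> (fst p)} (snd p) :: ennreal) = (\<lambda>p. if 0 \<le> snd p \<and> snd p \<le> \<tau> (fst p) then 1 else 0)"
      by (auto simp: indicator_def fun_eq_iff)
    also have "\<dots> \<in> borel_measurable (N \<Otimes>\<^sub>M lborel)" by measurable
    finally show ?thesis .
  qed
  have "(\<lambda>(w, r). (\<integral>\<^sup>+z. f w r (\<xi> w - z) \<partial>\<nu> (\<tau> w - r)) * indicator {0..\<tau> w} r) \<in> borel_measurable (N \<Otimes>\<^sub>M lborel)"
    unfolding case_prod_unfold by measurable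
  then show ?thesis unfolding duh_def
    by (rule sigma_finite_measure.borel_measurable_nn_integral[OF sigma_finite_lborel])
qed

lemma duh_mono:
  assumes "\<And>r y. 0 \<le> r \<Longrightarrow> r \<le> t \<Longrightarrow> f r y \<le> g r y"
  shows "duh \<nu> f t x \<le> duh \<nu> g t x"
  unfolding duh_def using assms
  by (intro nn_integral_mono) (auto simp: indicator_def intro!: nn_integral_mono)

lemma measurable_kernel_slice:
  assumes "(\<lambda>(r, y). f r y) \<in> borel_measurable (borel \<Otimes>\<^sub>M borel)"
    and "\<tau> \<in> borel_measurable borel"
  shows "(\<lambda>r. \<integral>\<^sup>+z. f r (x - z) \<partial>\<nu> (\<tau> r)) \<in> borel_measurable borel"
  using measurable_kernel_integral[OF assms, of "\<lambda>_. x"] by simp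

lemma measurable_slice:
  assumes "(\<lambda>(r, y). f r y) \<in> borel_measurable (borel \<Otimes>\<^sub>M borel)"
  shows "(\<lambda>y. f r y) \<in> borel_measurable borel"
  using measurable_compose[OF measurable_Pair1'[of r borel borel] assms] by simp

lemma duh_add:
  assumes f: "(\<lambda>(r, y). f r y) \<in> borel_measurable (borel \<Otimes>\<^sub>M borel)"
    and g: "(\<lambda>(r, y). g r y) \<in> borel_measurable (borel \<Otimes>\<^sub>M borel)"
  shows "duh \<nu> (\<lambda>r y. f r y + g r y) t x = duh \<nu> f t x + duh \<nu> g t x"
proof -
  note [measurable] = measurable_slice[OF f] measurable_slice[OF g]
    measurable_kernel_slice[OF f] measurable_kernel_slice[OF g]
  have "(\<integral>\<^sup>+z. f r (x - z) + g r (x - z) \<partial>\<nu> (t - r)) =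
    (\<integral>\<^sup>+z. f r (x - z) \<partial>\<nu> (t - r)) + (\<integral>\<^sup>+z. g r (x - z) \<partial>\<nu> (t - r))" for r
    by (intro nn_integral_add) measurable
  then show ?thesis unfolding duh_def by (simp add: distrib_right nn_integral_add)
qed

lemma duh_cmult:
  assumes f: "(\<lambda>(r, y). f r y) \<in> borel_measurable (borel \<Otimes>\<^sub>M borel)"
  shows "duh \<nu> (\<lambda>r y. c * f r y) t x = c * duh \<nu> f t x"
proof -
  note [measurable] = measurable_slice[OF f] measurable_kernel_slice[OF f]
  have "(\<integral>\<^sup>+z. c * f r (x - z) \<partial>\<nu> (t - r)) = c * (\<integral>\<^sup>+z. f r (x - z) \<partial>\<nu> (t - r))" for r
    by (intro nn_integral_cmult) measurable
  then show ?thesis unfolding duh_def by (simp add: mult.assoc nn_integral_cmult)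
qed

lemma duh_const:
  assumes "0 \<le> t" shows "duh \<nu> (\<lambda>r y. c) t x = c * ennreal t"
  unfolding duh_def using assms by (simp add: nn_integral_cmult)

text \<open>Running the Duhamel integral at time \<open>s\<close> through the kernel for
  \<open>t - s\<close> extends every transition to length \<open>t - r\<close>, by the semigroup law
  and Tonelli. All averages then point to one endpoint, which makes Gronwall a scalar
  problem.\<close>

lemma kernel_duh:
  assumes f: "(\<lambda>(r, y). f r y) \<in> borel_measurable (borel \<Otimes>\<^sub>M borel)" and st: "0 \<le> s" "s \<le> t"
  shows "(\<integral>\<^sup>+z. duh \<nu> f s (x - z) \<partial>\<nu> (t - s)) = (\<integral>\<^sup>+r\<in>{0..s}. (\<integral>\<^sup>+z. f r (x - z) \<partial>\<nu> (t - r)) \<partial>lborel)"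
proof -
  note [measurable] = measurable_slice[OF f]
  have "(\<lambda>(p, y). f (snd p) y) \<in> borel_measurable ((borel \<Otimes>\<^sub>M borel) \<Otimes>\<^sub>M borel)"
    using measurable_compose[OF _ f, of "\<lambda>p. (snd (fst p), snd p)" "(borel \<Otimes>\<^sub>M borel) \<Otimes>\<^sub>M borel"]
    by (simp add: case_prod_unfold)
  from measurable_kernel_integral[OF this, of "\<lambda>p. s - snd p" "\<lambda>p. x - fst p"]
  have m1: "(\<lambda>p. \<integral>\<^sup>+w. f (snd p) (x - fst p - w) \<partial>\<nu> (s - snd p)) \<in> borel_measurable (borel \<Otimes>\<^sub>M borel)"
    by simp
  have st1: "sets (\<nu> (t - s) \<Otimes>\<^sub>M lborel) = sets (borel \<Otimes>\<^sub>M borel)"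
    by (intro sets_pair_measure_cong) auto
  have m2: "(\<lambda>(z, r). (\<integral>\<^sup>+w. f r (x - z - w) \<partial>\<nu> (s - r)) * indicator {0..s} r) \<in> borel_measurable (\<nu> (t - s) \<Otimes>\<^sub>M lborel)"
    using m1 by (simp add: case_prod_unfold cong: measurable_cong_sets[OF st1 refl])
  interpret pair_sigma_finite "\<nu> (t - s)" lborel
    by (intro pair_sigma_finite.intro prob_space_imp_sigma_finite prob_space_kernel sigma_finite_lborel)
  have "(\<integral>\<^sup>+z. duh \<nu> f s (x - z) \<partial>\<nu> (t - s)) =
      (\<integral>\<^sup>+z. \<integral>\<^sup>+r. (\<integral>\<^sup>+w. f r (x - z - w) \<partial>\<nu> (s - r)) * indicator {0..s} r \<partial>lborel \<partial>\<nu> (t - s))"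
    by (simp add: duh_def)
  also have "\<dots> = (\<integral>\<^sup>+r. \<integral>\<^sup>+z. (\<integral>\<^sup>+w. f r (x - z - w) \<partial>\<nu> (s - r)) * indicator {0..s} r \<partial>\<nu> (t - s) \<partial>lborel)"
    by (rule Fubini'[symmetric]) (rule m2)
  also have "\<dots> = (\<integral>\<^sup>+r\<in>{0..s}. (\<integral>\<^sup>+z. f r (x - z) \<partial>\<nu> (t - r)) \<partial>lborel)"
  proof (intro nn_integral_cong)
    fix r
    show "(\<integral>\<^sup>+z. (\<integral>\<^sup>+w. f r (x - z - w) \<partial>\<nu> (s - r)) * indicator {0..s} r \<partial>\<nu> (t - s)) =
      (\<integral>\<^sup>+z. f r (x - z) \<partial>\<nu> (t - r)) * indicator {0..s} r"
    proof (cases "r \<in> {0..s}")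
      case True
      have "(\<integral>\<^sup>+z. (\<integral>\<^sup>+w. f r (x - (z + w)) \<partial>\<nu> (s - r)) \<partial>\<nu> (t - s)) = (\<integral>\<^sup>+z. f r (x - z) \<partial>\<nu> ((t - s) + (s - r)))"
        using True st by (intro semigroup) auto
      then show ?thesis using True by (simp add: diff_diff_add)
    qed simp
  qed
  finally show ?thesis .
qed

text \<open>No supremum over space is known to be finite, so everything is averaged towards the
  fixed endpoint \<open>(t, x)\<close>: \<open>\<beta>\<close> and \<open>\<rho>\<close> are kernel
  averages of \<open>B\<close> and \<open>R\<close>, and the accumulated \<open>\<Gamma>\<close>
  obeys an integral inequality in time alone. Finiteness at that endpoint is enough for
  absorption.\<close>

lemma gronwall:
  assumes B: "(\<lambda>(r, y). B r y) \<in> borel_measurable (borel \<Otimes>\<^sub>M borel)"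
    and R: "(\<lambda>(r, y). R r y) \<in> borel_measurable (borel \<Otimes>\<^sub>M borel)"
    and c: "0 < c" and t: "0 \<le> t"
    and le: "\<And>s y. 0 \<le> s \<Longrightarrow> s \<le> t \<Longrightarrow> B s y \<le> R s y + ennreal c * duh \<nu> B s y"
    and fin: "duh \<nu> B t x < \<infinity>"
  shows "duh \<nu> B t x \<le> ennreal (2 * exp (2 * c * t)) * duh \<nu> R t x"
proof -
  note [measurable] = measurable_slice[OF B] measurable_slice[OF R]
  define \<beta> where "\<beta> s = (\<integral>\<^sup>+z. B s (x - z) \<partial>\<nu> (t - s))" for s
  define \<rho> where "\<rho> s = (\<integral>\<^sup>+z. R s (x - z) \<partial>\<nu> (t - s))" for s
  define \<Gamma> where "\<Gamma> s = (\<integral>\<^sup>+r\<in>{0..s}. \<beta> r \<partial>lborel)" for s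
  define A where "A = duh \<nu> R t x"
  have [measurable]: "\<beta> \<in> borel_measurable borel" "\<rho> \<in> borel_measurable borel"
    unfolding \<beta>_def[abs_def] \<rho>_def[abs_def] by (intro measurable_kernel_slice B R; simp)+
  have Am: "A = (\<integral>\<^sup>+r\<in>{0..t}. \<rho> r \<partial>lborel)" by (simp add: A_def duh_def \<rho>_def)
  have Gt: "\<Gamma> t = duh \<nu> B t x" by (simp add: \<Gamma>_def duh_def \<beta>_def)
  have [measurable]: "\<Gamma> \<in> borel_measurable borel"
  proof -
    have "(\<lambda>p :: real \<times> real. indicator {0..fst p} (snd p) :: ennreal) = (\<lambda>p. if 0 \<le> snd p \<and> snd p \<le> fst p then 1 else 0)"
      by (auto simp: indicator_def fun_eq_iff)
    also have "\<dots> \<in> borel_measurable (borel \<Otimes>\<^sub>M lborel)" by measurable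
    finally have [measurable]: "(\<lambda>p :: real \<times> real. indicator {0..fst p} (snd p) :: ennreal) \<in> borel_measurable (borel \<Otimes>\<^sub>M lborel)" .
    have "(\<lambda>(s, r). \<beta> r * indicator {0..s} r) \<in> borel_measurable (borel \<Otimes>\<^sub>M lborel)"
      unfolding case_prod_unfold by measurable
    then show ?thesis unfolding \<Gamma>_def
      by (rule sigma_finite_measure.borel_measurable_nn_integral[OF sigma_finite_lborel])
  qed
  have dB: "(\<lambda>z. duh \<nu> B s (x - z)) \<in> borel_measurable borel" for s
  proof -
    have "(\<lambda>(w, r, y). B r y) \<in> borel_measurable (borel \<Otimes>\<^sub>M (borel \<Otimes>\<^sub>M borel))"
      using measurable_compose[OF measurable_snd B] by (simp add: case_prod_unfold)
    from measurable_duh[OF this, of "\<lambda>_. s" "\<lambda>z. x - z"] show ?thesis by simp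
  qed
  have b1: "\<beta> s \<le> \<rho> s + ennreal c * \<Gamma> s" if "0 \<le> s" "s \<le> t" for s
  proof -
    have "\<beta> s \<le> (\<integral>\<^sup>+z. R s (x - z) + ennreal c * duh \<nu> B s (x - z) \<partial>\<nu> (t - s))"
      unfolding \<beta>_def by (intro nn_integral_mono le that)
    also have "\<dots> = \<rho> s + ennreal c * (\<integral>\<^sup>+z. duh \<nu> B s (x - z) \<partial>\<nu> (t - s))"
      unfolding \<rho>_def using dB by (subst nn_integral_add) (auto simp: nn_integral_cmult)
    finally show ?thesis using kernel_duh[OF B that, of x] by (simp add: \<Gamma>_def \<beta>_def)
  qed
  have b2: "\<Gamma> s \<le> A + ennreal c * (\<integral>\<^sup>+r\<in>{0..s}. \<Gamma> r \<partial>lborel)" if "0 \<le> s" "s \<le> t" for s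
  proof -
    have "\<Gamma> s \<le> (\<integral>\<^sup>+r. \<rho> r * indicator {0..t} r + ennreal c * (\<Gamma> r * indicator {0..s} r) \<partial>lborel)"
      unfolding \<Gamma>_def[of s]
    proof (rule nn_integral_mono)
      fix r show "\<beta> r * indicator {0..s} r \<le> \<rho> r * indicator {0..t} r + ennreal c * (\<Gamma> r * indicator {0..s} r)"
        using b1[of r] that by (auto simp: indicator_def)
    qed
    also have "\<dots> = A + ennreal c * (\<integral>\<^sup>+r\<in>{0..s}. \<Gamma> r \<partial>lborel)"
      unfolding Am by (subst nn_integral_add) (auto simp: nn_integral_cmult)
    finally show ?thesis .
  qed
  \<comment> \<open>The weight decays at rate \<open>2 * c\<close>, which limits the contribution of
    the integral term to half of \<open>m\<close>.\<close>
  define m where "m = (SUP s\<in>{0..t}. ennreal (exp (- 2 * c * s)) * \<Gamma> s)"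
  have Gmono: "\<Gamma> s \<le> \<Gamma> t" if "s \<le> t" for s
    unfolding \<Gamma>_def using that by (intro nn_integral_mono) (auto simp: indicator_def)
  have mfin: "m < \<infinity>"
  proof -
    have "m \<le> \<Gamma> t" unfolding m_def
    proof (rule SUP_least)
      fix s assume s: "s \<in> {0..t}"
      have "ennreal (exp (- 2 * c * s)) * \<Gamma> s \<le> ennreal 1 * \<Gamma> t"
        using s c by (intro mult_mono Gmono ennreal_leI) auto
      then show "ennreal (exp (- 2 * c * s)) * \<Gamma> s \<le> \<Gamma> t" by simp
    qed
    then show ?thesis using fin Gt by simp
  qed
  have Gm: "\<Gamma> r \<le> ennreal (exp (2 * c * r)) * m" if "0 \<le> r" "r \<le> t" for r
  proof -
    have "ennreal (exp (- 2 * c * r)) * \<Gamma> r \<le> m" unfolding m_def using that by (intro SUP_upper) auto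
    then have "ennreal (exp (2 * c * r)) * (ennreal (exp (- 2 * c * r)) * \<Gamma> r) \<le> ennreal (exp (2 * c * r)) * m"
      by (intro mult_left_mono) auto
    then show ?thesis by (simp add: mult.assoc[symmetric] flip: ennreal_mult' exp_add)
  qed
  have ie: "(\<integral>\<^sup>+r\<in>{0..s}. ennreal (exp (2 * c * r)) \<partial>lborel) \<le> ennreal (exp (2 * c * s) / (2 * c))" if "0 \<le> s" for s
  proof -
    have "(\<integral>\<^sup>+r. ennreal (exp (2 * c * r)) * indicator {0..s} r \<partial>lborel) = exp (2 * c * s) / (2 * c) - exp (2 * c * 0) / (2 * c)"
      using c that by (intro nn_integral_FTC_Icc) (auto intro!: derivative_eq_intros)
    also have "\<dots> \<le> ennreal (exp (2 * c * s) / (2 * c))" using c by (intro ennreal_leI) auto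
    finally show ?thesis .
  qed
  have b3: "ennreal (exp (- 2 * c * s)) * \<Gamma> s \<le> A + ennreal (1/2) * m" if "s \<in> {0..t}" for s
  proof -
    have s: "0 \<le> s" "s \<le> t" using that by auto
    have "(\<integral>\<^sup>+r\<in>{0..s}. \<Gamma> r \<partial>lborel) \<le> (\<integral>\<^sup>+r. m * (ennreal (exp (2 * c * r)) * indicator {0..s} r) \<partial>lborel)"
      using Gm s by (intro nn_integral_mono) (auto simp: indicator_def mult.commute)
    also have "\<dots> \<le> m * ennreal (exp (2 * c * s) / (2 * c))"
      by (subst nn_integral_cmult) (auto intro!: mult_left_mono ie s)
    finally have "\<Gamma> s \<le> A + ennreal c * (m * ennreal (exp (2 * c * s) / (2 * c)))"
      using b2[OF s] by (meson add_left_mono mult_left_mono order_trans zero_le)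
    also have "ennreal c * (m * ennreal (exp (2 * c * s) / (2 * c))) = ennreal (exp (2 * c * s)) * (ennreal (1/2) * m)"
    proof -
      have "ennreal c * (m * ennreal (exp (2 * c * s) / (2 * c))) = (ennreal c * ennreal (exp (2 * c * s) / (2 * c))) * m"
        by (simp only: mult_ac)
      also have "ennreal c * ennreal (exp (2 * c * s) / (2 * c)) = ennreal (c * (exp (2 * c * s) / (2 * c)))"
        using c by (intro ennreal_mult'[symmetric]) auto
      also have "c * (exp (2 * c * s) / (2 * c)) = exp (2 * c * s) * (1/2)" using c by simp
      also have "ennreal (exp (2 * c * s) * (1/2)) = ennreal (exp (2 * c * s)) * ennreal (1/2)"
        by (intro ennreal_mult') auto
      finally show ?thesis by (simp only: mult_ac)
    qed
    finally have "ennreal (exp (- 2 * c * s)) * \<Gamma> s \<le> ennreal (exp (- 2 * c * s)) * (A + ennreal (exp (2 * c * s)) * (ennreal (1/2) * m))"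
      by (intro mult_left_mono) auto
    also have "\<dots> = ennreal (exp (- 2 * c * s)) * A + ennreal (1/2) * m"
      by (simp add: distrib_left mult.assoc[symmetric] flip: ennreal_mult' exp_add)
    also have "ennreal (exp (- 2 * c * s)) * A \<le> ennreal 1 * A"
      using c s by (intro mult_right_mono ennreal_leI) auto
    finally show ?thesis by simp
  qed
  have "m \<le> A + ennreal (1/2) * m"
  proof -
    have "(SUP s\<in>{0..t}. ennreal (exp (- 2 * c * s)) * \<Gamma> s) \<le> A + ennreal (1/2) * m"
      by (rule SUP_least) (rule b3)
    then show ?thesis by (simp only: m_def[symmetric])
  qed
  \<comment> \<open>Absorbing \<open>m / 2\<close> is legitimate because \<open>m\<close> is finite;
    for infinite \<open>A\<close> there is nothing to show.\<close>
  then have mA: "m \<le> 2 * A"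
  proof (cases A)
    case (real a)
    obtain m' where m': "m = ennreal m'" "0 \<le> m'" using mfin by (cases m) auto
    have "ennreal m' \<le> ennreal (a + 1/2 * m')"
    proof -
      have "ennreal (1/2) * ennreal m' = ennreal (1/2 * m')" by (rule ennreal_mult'[symmetric]) simp
      moreover have "ennreal a + ennreal (1/2 * m') = ennreal (a + 1/2 * m')"
        using real m' by (intro ennreal_plus[symmetric]) auto
      ultimately show ?thesis
        using \<open>m \<le> A + ennreal (1/2) * m\<close> real m' by (simp only:)
    qed
    then have "m' \<le> 2 * a" using real m' by (subst (asm) ennreal_le_iff) auto
    then have "ennreal m' \<le> ennreal (2 * a)" by (rule ennreal_leI)
    then show ?thesis using real m' by (simp add: ennreal_mult')
  qed (simp add: ennreal_mult_top)
  have "\<Gamma> t \<le> ennreal (exp (2 * c * t)) * (2 * A)"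
    using Gm[OF t order_refl] mA by (meson mult_left_mono order_trans zero_le)
  also have "\<dots> = ennreal (2 * exp (2 * c * t)) * A" by (simp add: ennreal_mult' mult_ac)
  finally show ?thesis unfolding Gt A_def .
qed

end

section \<open>Random walk and Gaussian kernels\<close>

text \<open>The Dirac branch covers time \<open>0\<close> and gives negative times a harmless value,
  so that \<open>walk\<close> is a probability kernel on the whole line.\<close>

definition pois :: "real \<Rightarrow> nat pmf" where
  "pois r = (if 0 < r then poisson_pmf r else return_pmf 0)"

lemma pmf_pois: "0 \<le> r \<Longrightarrow> pmf (pois r) j = exp (- r) * r ^ j / fact j"
  by (cases "r = 0") (auto simp: pois_def power_0_left)

lemma nn_integral_pois:
  assumes "0 \<le> r"
  shows "(\<integral>\<^sup>+j. f j \<partial>pois r) = (\<Sum>j. ennreal (exp (- r) * r ^ j / fact j) * f j)"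
  by (simp add: nn_integral_measure_pmf nn_integral_count_space_nat pmf_pois[OF assms])

lemma pois_sums:
  assumes "(\<lambda>j. a j * r ^ j / fact j) sums s"
  shows "(\<lambda>j. exp (- r) * r ^ j / fact j * a j) sums (exp (- r) * s :: real)"
  using sums_mult[OF assms, of "exp (- r)"] by (simp add: mult_ac)

lemma exp_sums: "(\<lambda>j. r ^ j / fact j) sums exp (r :: real)"
  using exp_converges[of r] by (simp add: field_simps)

definition walk_pmf :: "real \<Rightarrow> real \<Rightarrow> real \<Rightarrow> real pmf" where
  "walk_pmf \<delta> \<epsilon> t = bind_pmf (pois (\<epsilon> * t / \<delta>\<^sup>2)) (srw_pmf \<delta>)"

text \<open>The discrete law read as a Borel measure, the form shared with
  \<open>gauss\<close>.\<close>

definition walk :: "real \<Rightarrow> real \<Rightarrow> real \<Rightarrow> real measure" where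
  "walk \<delta> \<epsilon> t = distr (measure_pmf (walk_pmf \<delta> \<epsilon> t)) borel (\<lambda>x. x)"

lemma nn_integral_walk:
  "f \<in> borel_measurable borel \<Longrightarrow> (\<integral>\<^sup>+x. f x \<partial>walk \<delta> \<epsilon> t) = (\<integral>\<^sup>+x. f x \<partial>walk_pmf \<delta> \<epsilon> t)"
  unfolding walk_def by (simp add: nn_integral_distr)

text \<open>The series in \<open>lattice_green\<close> is the Poisson mixture of the jump chain
  probabilities.\<close>

lemma pmf_walk:
  assumes "0 \<le> \<epsilon> * t"
  shows "pmf (walk_pmf \<delta> \<epsilon> t) x = lattice_green \<delta> \<epsilon> t x"
proof -
  let ?r = "\<epsilon> * t / \<delta>\<^sup>2"
  have r: "0 \<le> ?r" using assms by simp
  have s: "summable (\<lambda>j. exp (- ?r) * ?r ^ j / fact j * pmf (srw_pmf \<delta> j) x)"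
  proof (rule summable_comparison_test)
    show "summable (\<lambda>j. exp (- ?r) * ?r ^ j / fact j * 1)"
      using pois_sums[of "\<lambda>_. 1" ?r "exp ?r"] exp_sums[of ?r] by (auto simp: sums_iff)
    show "\<exists>N. \<forall>n\<ge>N. norm (exp (- ?r) * ?r ^ n / fact n * pmf (srw_pmf \<delta> n) x) \<le> exp (- ?r) * ?r ^ n / fact n * 1"
    proof (intro exI[of _ 0] allI impI)
      fix n
      have "0 \<le> exp (- ?r) * ?r ^ n / fact n" using r by simp
      then show "norm (exp (- ?r) * ?r ^ n / fact n * pmf (srw_pmf \<delta> n) x) \<le> exp (- ?r) * ?r ^ n / fact n * 1"
        by (simp only: real_norm_def abs_mult abs_of_nonneg pmf_nonneg) (intro mult_left_mono pmf_le_1)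
    qed
  qed
  have "ennreal (pmf (walk_pmf \<delta> \<epsilon> t) x) = (\<Sum>j. ennreal (exp (- ?r) * ?r ^ j / fact j * pmf (srw_pmf \<delta> j) x))"
    unfolding walk_pmf_def ennreal_pmf_bind nn_integral_pois[OF r] using r
    by (intro suminf_cong ennreal_mult'[symmetric]) auto
  also have "\<dots> = ennreal (lattice_green \<delta> \<epsilon> t x)"
    unfolding lattice_green_def using s r by (intro suminf_ennreal_eq summable_sums) auto
  finally show ?thesis
    using s r by (subst (asm) ennreal_inj) (auto simp: lattice_green_def intro!: suminf_nonneg)
qed

lemma lattice_green_nonneg: "0 \<le> \<epsilon> * t \<Longrightarrow> 0 \<le> lattice_green \<delta> \<epsilon> t x"
  by (simp add: pmf_walk[symmetric])

lemma lattice_green_le_1: "0 \<le> \<epsilon> * t \<Longrightarrow> lattice_green \<delta> \<epsilon> t x \<le> 1"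
  by (simp add: pmf_walk[symmetric] pmf_le_1)

lemma nn_integral_srw_Suc:
  "(\<integral>\<^sup>+x. f x \<partial>srw_pmf \<delta> (Suc j)) = (\<integral>\<^sup>+y. (f (y + \<delta>) + f (y - \<delta>)) * ennreal (1/2) \<partial>srw_pmf \<delta> j)"
  by (simp add: nn_integral_measure_pmf_support[of UNIV] UNIV_bool distrib_right add.commute)

text \<open>Adding \<open>1\<close> keeps the integrand nonnegative, so trigonometric moments are
  available as nonnegative integrals. One step multiplies the amplitude by
  \<open>cos (u * \<delta>)\<close>, which is why \<open>k\<close> is general; the phase
  \<open>\<phi>\<close> later yields cosine and sine together.\<close>

lemma nn_integral_srw_cos:
  assumes "\<bar>k\<bar> \<le> 1"
  shows "(\<integral>\<^sup>+y. ennreal (1 + k * cos (u * y + \<phi>)) \<partial>srw_pmf \<delta> j) = ennreal (1 + k * cos (u * \<delta>) ^ j * cos \<phi>)"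
  using assms
proof (induction j arbitrary: k)
  case (Suc j)
  have kc: "0 \<le> 1 + k * cos z" for z
  proof -
    have "\<bar>k * cos z\<bar> \<le> 1" using Suc.prems by (simp add: abs_mult mult_le_one)
    then show ?thesis by linarith
  qed
  have k': "\<bar>k * cos (u * \<delta>)\<bar> \<le> 1" using Suc.prems by (simp add: abs_mult mult_le_one)
  have "(ennreal (1 + k * cos (u * (y + \<delta>) + \<phi>)) + ennreal (1 + k * cos (u * (y - \<delta>) + \<phi>))) * ennreal (1/2)
     = ennreal (1 + (k * cos (u * \<delta>)) * cos (u * y + \<phi>))" for y
  proof -
    have "cos (u * (y + \<delta>) + \<phi>) + cos (u * (y - \<delta>) + \<phi>) = 2 * cos (u * \<delta>) * cos (u * y + \<phi>)"
      using cos_add[of "u * y + \<phi>" "u * \<delta>"] cos_diff[of "u * y + \<phi>" "u * \<delta>"] by (simp add: algebra_simps)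
    then have "((1 + k * cos (u * (y + \<delta>) + \<phi>)) + (1 + k * cos (u * (y - \<delta>) + \<phi>))) * (1/2)
       = 1 + (k * cos (u * \<delta>)) * cos (u * y + \<phi>)"
      by (simp add: field_simps) (metis distrib_left mult.assoc mult.left_commute)
    then show ?thesis using kc by (simp only: ennreal_plus[symmetric] ennreal_mult'[symmetric] add_nonneg_nonneg)
  qed
  then have "(\<integral>\<^sup>+y. ennreal (1 + k * cos (u * y + \<phi>)) \<partial>srw_pmf \<delta> (Suc j)) =
     (\<integral>\<^sup>+y. ennreal (1 + (k * cos (u * \<delta>)) * cos (u * y + \<phi>)) \<partial>srw_pmf \<delta> j)"
    by (simp only: nn_integral_srw_Suc)
  also have "\<dots> = ennreal (1 + (k * cos (u * \<delta>)) * cos (u * \<delta>) ^ j * cos \<phi>)"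
    by (rule Suc.IH[OF k'])
  finally show ?case by (simp add: mult.assoc)
qed simp

text \<open>Poisson mixing sums the powers of \<open>cos (u * \<delta>)\<close> to an
  exponential.\<close>

lemma nn_integral_walk_cos:
  assumes "0 \<le> \<epsilon> * t"
  shows "(\<integral>\<^sup>+y. ennreal (1 + cos (u * y + \<phi>)) \<partial>walk \<delta> \<epsilon> t) =
    ennreal (1 + exp (- (\<epsilon> * t / \<delta>\<^sup>2 * (1 - cos (u * \<delta>)))) * cos \<phi>)"
proof -
  let ?r = "\<epsilon> * t / \<delta>\<^sup>2" and ?c = "cos (u * \<delta>)"
  have r: "0 \<le> ?r" using assms by simp
  have nn: "0 \<le> 1 + ?c ^ j * cos \<phi>" for j
  proof -
    have "\<bar>?c ^ j * cos \<phi>\<bar> \<le> 1" by (simp add: abs_mult power_abs mult_le_one power_le_one)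
    then show ?thesis by linarith
  qed
  have "(\<integral>\<^sup>+y. ennreal (1 + cos (u * y + \<phi>)) \<partial>walk \<delta> \<epsilon> t) = (\<integral>\<^sup>+j. ennreal (1 + ?c ^ j * cos \<phi>) \<partial>pois ?r)"
    using nn_integral_srw_cos[where k=1 and u=u and \<phi>=\<phi> and \<delta>=\<delta>] by (simp add: nn_integral_walk walk_pmf_def)
  also have "\<dots> = (\<Sum>j. ennreal (exp (- ?r) * ?r ^ j / fact j * (1 + ?c ^ j * cos \<phi>)))"
    unfolding nn_integral_pois[OF r] using r by (intro suminf_cong ennreal_mult'[symmetric]) auto
  also have "\<dots> = ennreal (exp (- ?r) * (exp ?r + cos \<phi> * exp (?r * ?c)))"
  proof (intro suminf_ennreal_eq pois_sums)
    have "(\<lambda>j. ?r ^ j / fact j + cos \<phi> * ((?r * ?c) ^ j / fact j)) sums (exp ?r + cos \<phi> * exp (?r * ?c))"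
      by (intro sums_add sums_mult exp_sums)
    moreover have "r ^ j / fact j + k * ((r * c) ^ j / fact j) = (1 + c ^ j * k) * r ^ j / fact j" for r k c :: real and j
      by (simp add: power_mult_distrib field_simps)
    ultimately show "(\<lambda>j. (1 + ?c ^ j * cos \<phi>) * ?r ^ j / fact j) sums (exp ?r + cos \<phi> * exp (?r * ?c))"
      by (simp only:)
  next
    fix j show "0 \<le> exp (- ?r) * ?r ^ j / fact j * (1 + ?c ^ j * cos \<phi>)"
      using r nn[of j] by (intro mult_nonneg_nonneg divide_nonneg_nonneg) auto
  qed
  also have "exp (- ?r) * (exp ?r + cos \<phi> * exp (?r * ?c)) = 1 + exp (- (?r * (1 - ?c))) * cos \<phi>"
  proof -
    have "exp (- ?r) * exp ?r = 1" by (simp flip: exp_add)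
    moreover have "exp (- ?r) * exp (?r * ?c) = exp (- (?r * (1 - ?c)))" by (simp only: exp_add[symmetric] right_diff_distrib) simp
    ultimately show ?thesis by (simp add: distrib_left mult.left_commute[of _ "cos \<phi>"] mult.commute[of _ "cos \<phi>"])
  qed
  finally show ?thesis .
qed

lemma real_distribution_walk: "real_distribution (walk \<delta> \<epsilon> t)"
  unfolding walk_def by (intro prob_space.real_distribution_distr measure_pmf.prob_space_axioms) simp

lemma char_walk:
  assumes "0 \<le> \<epsilon> * t"
  shows "char (walk \<delta> \<epsilon> t) u = complex_of_real (exp (- (\<epsilon> * t / \<delta>\<^sup>2 * (1 - cos (u * \<delta>)))))"
proof -
  interpret real_distribution "walk \<delta> \<epsilon> t" by (rule real_distribution_walk)
  let ?W = "walk \<delta> \<epsilon> t" and ?E = "exp (- (\<epsilon> * t / \<delta>\<^sup>2 * (1 - cos (u * \<delta>))))"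
  have E1: "?E \<le> 1" using assms by (auto intro!: mult_nonneg_nonneg divide_nonneg_nonneg)
  have *: "(LINT y|?W. cos (u * y + \<phi>)) = ?E * cos \<phi>" for \<phi>
  proof -
    have i: "integrable ?W (\<lambda>y. cos (u * y + \<phi>))" by (intro integrable_const_bound[where B=1]) auto
    have c: "0 \<le> 1 + cos z" for z :: real using cos_ge_minus_one[of z] by linarith
    have "0 \<le> 1 + ?E * cos \<phi>"
    proof -
      have "\<bar>?E * cos \<phi>\<bar> \<le> 1" using E1 by (simp add: abs_mult mult_le_one)
      then show ?thesis by linarith
    qed
    moreover have "ennreal (LINT y|?W. 1 + cos (u * y + \<phi>)) = ennreal (1 + ?E * cos \<phi>)"
    proof -
      have "ennreal (LINT y|?W. 1 + cos (u * y + \<phi>)) = (\<integral>\<^sup>+y. ennreal (1 + cos (u * y + \<phi>)) \<partial>?W)"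
        using i c by (intro nn_integral_eq_integral[symmetric]) auto
      then show ?thesis using nn_integral_walk_cos[OF assms, where u=u and \<phi>=\<phi> and \<delta>=\<delta>] by (simp only:)
    qed
    ultimately have "(LINT y|?W. 1 + cos (u * y + \<phi>)) = 1 + ?E * cos \<phi>"
      using c by (subst (asm) ennreal_inj) (auto intro!: Bochner_Integration.integral_nonneg)
    then show ?thesis using i prob_space by (simp add: space_eq_univ)
  qed
  have i: "integrable ?W (\<lambda>y. iexp (u * y))" by (rule integrable_iexp) auto
  \<comment> \<open>The phase \<open>- (pi / 2)\<close> turns cosine into sine, so the imaginary
    part vanishes; phase \<open>0\<close> gives the real part.\<close>
  have "cos (u * y + - (pi / 2)) = sin (u * y)" for y using cos_diff[of "u * y" "pi / 2"] by simp
  then have s0: "(LINT y|?W. sin (u * y)) = 0" using *[of "- (pi / 2)"] by simp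
  have "Re (char ?W u) = (LINT y|?W. cos (u * y))" "Im (char ?W u) = (LINT y|?W. sin (u * y))"
    unfolding char_def using i by (simp_all add: Re_exp Im_exp flip: integral_Re integral_Im)
  then have "Re (char ?W u) = ?E" "Im (char ?W u) = 0" using *[of 0] s0 by simp_all
  then show ?thesis by (intro complex_eqI) auto
qed

text \<open>Defined by scaling rather than by a density, so that time \<open>0\<close> gives the
  point mass at \<open>0\<close>; the maximum extends this to negative times.\<close>

definition gauss :: "real \<Rightarrow> real \<Rightarrow> real measure" where
  "gauss \<epsilon> t = distr std_normal_distribution borel (\<lambda>z. sqrt (\<epsilon> * max 0 t) * z)"

lemma real_distribution_gauss: "real_distribution (gauss \<epsilon> t)"
  unfolding gauss_def
  by (intro prob_space.real_distribution_distr) (auto simp: prob_space_normal_density)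

lemma char_gauss:
  assumes "0 \<le> \<epsilon>" "0 \<le> t"
  shows "char (gauss \<epsilon> t) u = complex_of_real (exp (- (\<epsilon> * t * u\<^sup>2 / 2)))"
proof -
  have "char (gauss \<epsilon> t) u = char std_normal_distribution (sqrt (\<epsilon> * t) * u)"
    unfolding gauss_def char_def using assms by (subst integral_distr) (auto simp: mult_ac)
  then show ?thesis using assms by (simp add: char_std_normal_distribution power_mult_distrib)
qed

lemma conv_kernel_gauss:
  assumes "0 < \<epsilon>" shows "conv_kernel (gauss \<epsilon>)"
proof
  have "(\<lambda>t. std_normal_distribution) \<in> borel \<rightarrow>\<^sub>M prob_algebra borel"
    by (intro measurable_const) (auto simp: space_prob_algebra prob_space_normal_density)
  then show "gauss \<epsilon> \<in> borel \<rightarrow>\<^sub>M prob_algebra borel"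
    unfolding gauss_def[abs_def] by (rule measurable_distr_prob_space2) measurable
next
  fix s t :: real and f :: "real \<Rightarrow> ennreal"
  assume "0 \<le> s" "0 \<le> t" "f \<in> borel_measurable borel"
  then show "(\<integral>\<^sup>+x. (\<integral>\<^sup>+y. f (x + y) \<partial>gauss \<epsilon> t) \<partial>gauss \<epsilon> s) = (\<integral>\<^sup>+z. f z \<partial>gauss \<epsilon> (s + t))"
    using assms by (intro nn_integral_convolution_char real_distribution_gauss)
      (auto simp: char_gauss algebra_simps add_divide_distrib simp flip: exp_add of_real_mult)
qed

lemma conv_kernel_walk:
  assumes "0 < \<epsilon>" "0 < \<delta>" shows "conv_kernel (walk \<delta> \<epsilon>)"
proof
  have rd: "real_distribution (walk \<delta> \<epsilon> t)" for t by (rule real_distribution_walk)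
  show "walk \<delta> \<epsilon> \<in> borel \<rightarrow>\<^sub>M prob_algebra borel"
  proof (intro measurable_prob_algebraI measurable_subprob_algebra)
    show "prob_space (walk \<delta> \<epsilon> t)" for t using rd[of t] by (simp add: real_distribution_def)
    then show "subprob_space (walk \<delta> \<epsilon> t)" for t by (rule prob_space_imp_subprob_space)
    show "sets (walk \<delta> \<epsilon> t) = sets borel" for t by (simp add: walk_def)
    fix A :: "real set" assume "A \<in> sets borel"
    have "emeasure (walk \<delta> \<epsilon> t) A = (\<Sum>j. ennreal (pmf (pois (\<epsilon> * t / \<delta>\<^sup>2)) j) * emeasure (srw_pmf \<delta> j) A)" for t
      unfolding walk_def using \<open>A \<in> sets borel\<close>
      by (subst emeasure_distr) (auto simp: walk_pmf_def nn_integral_measure_pmf nn_integral_count_space_nat)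
    moreover have "(\<lambda>t. pmf (pois (\<epsilon> * t / \<delta>\<^sup>2)) j) \<in> borel_measurable borel" for j
    proof -
      have "pmf (pois r) j = (if 0 < r then exp (- r) * r ^ j / fact j else if j = 0 then 1 else 0)" for r
        by (auto simp: pois_def)
      then show ?thesis by simp
    qed
    ultimately show "(\<lambda>t. emeasure (walk \<delta> \<epsilon> t) A) \<in> borel_measurable borel" by simp
  qed
next
  fix s t :: real and f :: "real \<Rightarrow> ennreal"
  assume "0 \<le> s" "0 \<le> t" "f \<in> borel_measurable borel"
  then show "(\<integral>\<^sup>+x. (\<integral>\<^sup>+y. f (x + y) \<partial>walk \<delta> \<epsilon> t) \<partial>walk \<delta> \<epsilon> s) = (\<integral>\<^sup>+z. f z \<partial>walk \<delta> \<epsilon> (s + t))"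
    using assms by (intro nn_integral_convolution_char real_distribution_walk)
      (auto simp: char_walk algebra_simps add_divide_distrib simp flip: exp_add of_real_mult)
qed

lemma lattice_add: "x \<in> lattice \<delta> \<Longrightarrow> y \<in> lattice \<delta> \<Longrightarrow> x + y \<in> lattice \<delta>"
  unfolding lattice_def by (auto simp: distrib_right[symmetric] simp flip: of_int_add)

lemma lattice_uminus: "x \<in> lattice \<delta> \<Longrightarrow> - x \<in> lattice \<delta>"
proof -
  assume "x \<in> lattice \<delta>"
  then obtain k where "x = of_int k * \<delta>" by (auto simp: lattice_def)
  then have "- x = of_int (- k) * \<delta>" by simp
  then show ?thesis unfolding lattice_def by blast
qed

lemma lattice_diff: "x \<in> lattice \<delta> \<Longrightarrow> y \<in> lattice \<delta> \<Longrightarrow> x - y \<in> lattice \<delta>"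
  using lattice_add[of x \<delta> "- y"] lattice_uminus[of y] by simp

lemma delta_in_lattice: "\<delta> \<in> lattice \<delta>" and zero_in_lattice: "0 \<in> lattice \<delta>"
  unfolding lattice_def by (auto intro: image_eqI[of _ _ 1] image_eqI[of _ _ 0])

lemma countable_lattice: "countable (lattice \<delta>)"
  unfolding lattice_def by simp

lemma set_srw_pmf: "set_pmf (srw_pmf \<delta> j) \<subseteq> lattice \<delta>"
proof (induction j)
  case (Suc j)
  then show ?case
    using delta_in_lattice[of \<delta>] by (auto split: if_splits intro: lattice_add lattice_diff)
qed (simp add: zero_in_lattice)

lemma set_walk_pmf: "set_pmf (walk_pmf \<delta> \<epsilon> t) \<subseteq> lattice \<delta>"
  unfolding walk_pmf_def using set_srw_pmf by auto

text \<open>The substitution \<open>y = x - z\<close> maps the lattice onto itself because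
  \<open>x\<close> is a site, and \<open>pmf_walk\<close> identifies the point masses.\<close>

lemma nn_integral_walk_lattice:
  assumes f: "f \<in> borel_measurable borel" and x: "x \<in> lattice \<delta>" and t: "0 \<le> \<epsilon> * t"
  shows "(\<integral>\<^sup>+z. f (x - z) \<partial>walk \<delta> \<epsilon> t) = (\<integral>\<^sup>+y. ennreal (lattice_green \<delta> \<epsilon> t (x - y)) * f y \<partial>count_space (lattice \<delta>))"
proof -
  have bij: "bij_betw (\<lambda>z. x - z) (lattice \<delta>) (lattice \<delta>)"
    by (intro bij_betw_byWitness[where f'="\<lambda>z. x - z"]) (auto intro: lattice_diff x)
  have "(\<integral>\<^sup>+z. f (x - z) \<partial>walk \<delta> \<epsilon> t) = (\<integral>\<^sup>+z. ennreal (lattice_green \<delta> \<epsilon> t z) * f (x - z) \<partial>count_space UNIV)"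
    using f by (subst nn_integral_walk) (auto simp: nn_integral_measure_pmf pmf_walk[OF t])
  also have "\<dots> = (\<integral>\<^sup>+z. ennreal (lattice_green \<delta> \<epsilon> t z) * f (x - z) * indicator (lattice \<delta>) z \<partial>count_space UNIV)"
  proof (intro nn_integral_cong)
    fix z
    have "z \<notin> lattice \<delta> \<Longrightarrow> lattice_green \<delta> \<epsilon> t z = 0"
      using set_walk_pmf[of \<delta> \<epsilon> t] by (auto simp: pmf_walk[OF t, symmetric] pmf_eq_0_set_pmf)
    then show "ennreal (lattice_green \<delta> \<epsilon> t z) * f (x - z) = ennreal (lattice_green \<delta> \<epsilon> t z) * f (x - z) * indicator (lattice \<delta>) z"
      by (auto simp: indicator_def)
  qed
  also have "\<dots> = (\<integral>\<^sup>+z. ennreal (lattice_green \<delta> \<epsilon> t (x - (x - z))) * f (x - z) \<partial>count_space (lattice \<delta>))"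
    by (subst nn_integral_count_space_indicator) auto
  also have "\<dots> = (\<integral>\<^sup>+y. ennreal (lattice_green \<delta> \<epsilon> t (x - y)) * f y \<partial>count_space (lattice \<delta>))"
    using nn_integral_bij_count_space[OF bij, of "\<lambda>y. ennreal (lattice_green \<delta> \<epsilon> t (x - y)) * f y"] .
  finally show ?thesis .
qed

lemma srw_second_moment: "(\<integral>\<^sup>+x. ennreal (x\<^sup>2) \<partial>srw_pmf \<delta> j) = ennreal (real j * \<delta>\<^sup>2)"
proof (induction j)
  case (Suc j)
  have "(\<integral>\<^sup>+x. ennreal (x\<^sup>2) \<partial>srw_pmf \<delta> (Suc j)) = (\<integral>\<^sup>+y. ennreal (y\<^sup>2) + ennreal (\<delta>\<^sup>2) \<partial>srw_pmf \<delta> j)"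
    unfolding nn_integral_srw_Suc
  proof (intro nn_integral_cong)
    fix y
    have "((y + \<delta>)\<^sup>2 + (y - \<delta>)\<^sup>2) * (1/2) = y\<^sup>2 + \<delta>\<^sup>2" by (simp add: power2_eq_square algebra_simps)
    then show "(ennreal ((y + \<delta>)\<^sup>2) + ennreal ((y - \<delta>)\<^sup>2)) * ennreal (1/2) = ennreal (y\<^sup>2) + ennreal (\<delta>\<^sup>2)"
      by (simp only: ennreal_plus[symmetric] ennreal_mult'[symmetric] zero_le_power2 add_nonneg_nonneg)
  qed
  also have "\<dots> = ennreal (real j * \<delta>\<^sup>2) + ennreal (\<delta>\<^sup>2)"
    by (simp add: nn_integral_add Suc)
  also have "\<dots> = ennreal (real (Suc j) * \<delta>\<^sup>2)"
    by (simp add: distrib_right add.commute flip: ennreal_plus)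
  finally show ?case .
qed simp

lemma walk_second_moment:
  assumes "0 \<le> \<epsilon> * t" "\<delta> \<noteq> 0"
  shows "(\<integral>\<^sup>+x. ennreal (x\<^sup>2) \<partial>walk \<delta> \<epsilon> t) = ennreal (\<epsilon> * t)"
proof -
  let ?r = "\<epsilon> * t / \<delta>\<^sup>2"
  have r: "0 \<le> ?r" using assms by simp
  have "(\<integral>\<^sup>+x. ennreal (x\<^sup>2) \<partial>walk \<delta> \<epsilon> t) = (\<Sum>j. ennreal (exp (- ?r) * ?r ^ j / fact j) * ennreal (real j * \<delta>\<^sup>2))"
    by (simp add: nn_integral_walk walk_pmf_def srw_second_moment nn_integral_pois[OF r])
  also have "\<dots> = (\<Sum>j. ennreal (exp (- ?r) * ?r ^ j / fact j * (real j * \<delta>\<^sup>2)))"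
    using r by (intro suminf_cong ennreal_mult'[symmetric]) auto
  also have "\<dots> = ennreal (exp (- ?r) * (?r * \<delta>\<^sup>2 * exp ?r))"
  proof (intro suminf_ennreal_eq pois_sums)
    have "(\<lambda>j. ?r * \<delta>\<^sup>2 * (?r ^ j / fact j)) sums (?r * \<delta>\<^sup>2 * exp ?r)" by (intro sums_mult exp_sums)
    moreover have "r * d * (r ^ j / fact j) = (real (Suc j) * d) * r ^ Suc j / fact (Suc j)" for r d :: real and j
      by (simp add: field_simps del: of_nat_Suc)
    ultimately have "(\<lambda>j. (real (Suc j) * \<delta>\<^sup>2) * ?r ^ Suc j / fact (Suc j)) sums (?r * \<delta>\<^sup>2 * exp ?r)" by (simp only:)
    then show "(\<lambda>j. (real j * \<delta>\<^sup>2) * ?r ^ j / fact j) sums (?r * \<delta>\<^sup>2 * exp ?r)" by (subst (asm) sums_Suc_iff) simp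
  qed (use r in auto)
  also have "exp (- ?r) * (?r * \<delta>\<^sup>2 * exp ?r) = ?r * \<delta>\<^sup>2" by (simp add: exp_minus field_simps)
  finally show ?thesis using assms by simp
qed

lemma gauss_second_moment:
  assumes "0 \<le> \<epsilon>" "0 \<le> t"
  shows "(\<integral>\<^sup>+x. ennreal (x\<^sup>2) \<partial>gauss \<epsilon> t) = ennreal (\<epsilon> * t)"
proof -
  have "(\<integral>\<^sup>+x. ennreal (x\<^sup>2) \<partial>gauss \<epsilon> t) = (\<integral>\<^sup>+z. ennreal (\<epsilon> * t) * ennreal (z\<^sup>2) \<partial>std_normal_distribution)"
    unfolding gauss_def using assms
    by (subst nn_integral_distr) (auto simp: power_mult_distrib ennreal_mult')
  also have "\<dots> = ennreal (\<epsilon> * t) * ennreal (LINT z|std_normal_distribution. z\<^sup>2)"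
    using std_normal_distribution_even_moments(2)[of 1]
    by (subst nn_integral_cmult) (auto intro!: arg_cong2[where f="(*)"] nn_integral_eq_integral)
  also have "(LINT z|std_normal_distribution. z\<^sup>2) = 1"
    using std_normal_distribution_even_moments(1)[of 1] by (simp add: fact_numeral)
  finally show ?thesis by simp
qed

section \<open>Uniform bounds for the transition probabilities of the walk\<close>

text \<open>\<open>k\<close> counts the steps to the right among \<open>j\<close>, so the position
  is \<open>2 * k - j\<close> mesh units.\<close>

lemma srw_pmf_binomial:
  "srw_pmf \<delta> j = map_pmf (\<lambda>k. (2 * real k - real j) * \<delta>) (binomial_pmf j (1/2))"
proof (induction j)
  case 0 show ?case by (simp add: binomial_pmf_0)
next
  case (Suc j)
  show ?case
    unfolding srw_pmf.simps Suc
    by (subst binomial_pmf_Suc)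
      (auto simp: map_pmf_def bind_assoc_pmf bind_return_pmf bind_commute_pmf[of "bernoulli_pmf _"]
        algebra_simps intro!: bind_pmf_cong)
qed

text \<open>Induction on the ratio \<open>(2 * m + 1) / (2 * (m + 1))\<close> of successive terms;
  the step reduces to \<open>sqrt (a * (a + 2)) <= a + 1\<close> with
  \<open>a = 2 * m + 1\<close>.\<close>

lemma central_binomial_upper: "real ((2 * m) choose m) / 4 ^ m \<le> 1 / sqrt (real (2 * m + 1))"
proof (induction m)
  case (Suc m)
  have rec: "real ((2 * Suc m) choose Suc m) = real ((2 * m) choose m) * (2 * (2 * real m + 1) / (real m + 1))"
  proof -
    have f: "real ((2 * n) choose n) = fact (2 * n) / (fact n * fact n)" for n
      using binomial_fact[of n "2 * n", where 'a=real] by simp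
    have "fact (2 * Suc m) = (2 * real m + 2) * (2 * real m + 1) * (fact (2 * m) :: real)"
      by (simp add: algebra_simps)
    moreover have "(2 * a) * c * G / ((a * F) * (a * F)) = G / (F * F) * (2 * c / a)" if "a \<noteq> 0" "F \<noteq> 0" for a c F G :: real
      using that by (simp add: field_simps)
    from this[of "real m + 1" "fact m" "2 * real m + 1" "fact (2 * m)"]
    have "(2 * (real m + 1)) * (2 * real m + 1) * fact (2 * m) / (((real m + 1) * fact m) * ((real m + 1) * fact m))
       = fact (2 * m) / (fact m * fact m) * (2 * (2 * real m + 1) / (real m + 1))" by simp
    moreover have "fact (Suc m) = (real m + 1) * (fact m :: real)" by (simp add: add.commute)
    ultimately show ?thesis unfolding f by (simp only: distrib_left mult_1_right)
  qed
  have "real ((2 * Suc m) choose Suc m) / 4 ^ Suc m = (real ((2 * m) choose m) / 4 ^ m) * ((2 * real m + 1) / (2 * (real m + 1)))"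
  proof -
    have *: "C * (2 * c / a) / (4 * p) = (C / p) * (c / (2 * a))" if "a \<noteq> 0" "p \<noteq> 0" for C c a p :: real
      using that by (simp add: field_simps)
    show ?thesis unfolding rec power_Suc by (rule *) auto
  qed
  also have "\<dots> \<le> 1 / sqrt (real (2 * m + 1)) * ((2 * real m + 1) / (2 * (real m + 1)))"
    by (intro mult_right_mono Suc.IH) auto
  also have "\<dots> \<le> 1 / sqrt (real (2 * Suc m + 1))"
  proof -
    define a where "a = 2 * real m + 1"
    have a: "0 < a" by (simp add: a_def)
    have "sqrt a * sqrt (a + 2) \<le> a + 1"
    proof -
      have "sqrt (a * (a + 2)) \<le> sqrt ((a + 1)\<^sup>2)" by (intro real_sqrt_le_mono) (simp add: power2_eq_square algebra_simps)
      then show ?thesis using a by (simp add: real_sqrt_mult)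
    qed
    then have "sqrt a / (a + 1) \<le> 1 / sqrt (a + 2)" using a by (simp add: field_simps)
    moreover have "1 / sqrt a * (a / (a + 1)) = sqrt a / (a + 1)" using real_div_sqrt[of a] a by simp
    moreover have "2 * (real m + 1) = a + 1" "real (2 * Suc m + 1) = a + 2" "real (2 * m + 1) = a" "2 * real m + 1 = a"
      by (simp_all add: a_def)
    ultimately show ?thesis by (simp only:)
  qed
  finally show ?case .
qed simp

text \<open>The middle coefficient dominates its row. For odd \<open>n\<close> the two equal middle
  coefficients add up, by Pascal's rule, to the central one of row \<open>n + 1\<close>, and the
  powers of two match exactly.\<close>

lemma binomial_half_upper: "real (n choose k) / 2 ^ n \<le> 1 / sqrt (real n + 1)"
proof (cases "even n")
  case True
  then obtain m where m: "n = 2 * m" by auto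
  have "real (n choose k) / 2 ^ n \<le> real ((2 * m) choose m) / 2 ^ n"
    using binomial_maximum[of n k] by (intro divide_right_mono) (auto simp: m)
  also have "\<dots> \<le> 1 / sqrt (real (2 * m + 1))" using central_binomial_upper[of m] by (simp add: m power_mult)
  finally show ?thesis by (simp add: m add.commute)
next
  case False
  then obtain m where m: "n = 2 * m + 1" by (auto elim: oddE)
  have "real (n choose k) / 2 ^ n \<le> real ((2 * m + 1) choose m) / 2 ^ n"
    using binomial_maximum[of n k] by (intro divide_right_mono) (auto simp: m)
  also have "\<dots> = real ((2 * Suc m) choose Suc m) / 4 ^ Suc m"
  proof -
    have "(2 * Suc m) choose Suc m = ((2 * m + 1) choose m) + ((2 * m + 1) choose Suc m)" by simp
    also have "(2 * m + 1) choose Suc m = (2 * m + 1) choose m" using binomial_symmetric[of m "2 * m + 1"] by simp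
    finally show ?thesis by (simp add: m power_mult)
  qed
  also have "\<dots> \<le> 1 / sqrt (real (2 * Suc m + 1))" by (rule central_binomial_upper)
  also have "\<dots> \<le> 1 / sqrt (real n + 1)" by (intro divide_left_mono) (auto simp: m)
  finally show ?thesis .
qed

text \<open>Positions outside the binomial parametrisation, such as those of the wrong parity, carry
  no mass; at the others the coefficient bound applies.\<close>

lemma pmf_srw_le:
  assumes "\<delta> \<noteq> 0"
  shows "pmf (srw_pmf \<delta> j) x \<le> 1 / sqrt (real j + 1)"
proof (cases "\<exists>k. x = (2 * real k - real j) * \<delta>")
  case True
  then obtain k where x: "x = (2 * real k - real j) * \<delta>" by auto
  have "inj (\<lambda>k. (2 * real k - real j) * \<delta>)" using assms by (auto intro!: injI)
  then have "pmf (srw_pmf \<delta> j) x = pmf (binomial_pmf j (1/2)) k"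
    unfolding srw_pmf_binomial x by (rule pmf_map_inj')
  also have "\<dots> = (if k \<le> j then real (j choose k) / 2 ^ j else 0)"
    by (auto simp: power_add[symmetric] power_divide not_le binomial_eq_0)
  also have "\<dots> \<le> 1 / sqrt (real j + 1)" using binomial_half_upper by auto
  finally show ?thesis .
next
  case False
  then have "pmf (srw_pmf \<delta> j) x = 0"
    unfolding srw_pmf_binomial by (auto simp: pmf_eq_0_set_pmf)
  then show ?thesis by simp
qed

text \<open>The bound \<open>1 / sqrt (j + 1)\<close> is averaged over the Poisson number of jumps.
  The inequality between arithmetic and geometric mean replaces it by a combination of
  \<open>1 / (j + 1)\<close> and a constant, whose Poisson mean is explicit.\<close>

lemma lattice_green_upper:
  assumes "0 < \<epsilon> * t" "0 < \<delta>"
  shows "lattice_green \<delta> \<epsilon> t x \<le> \<delta> / sqrt (\<epsilon> * t)"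
proof -
  let ?r = "\<epsilon> * t / \<delta>\<^sup>2"
  have r: "0 < ?r" using assms by simp
  have le: "pmf (srw_pmf \<delta> j) x \<le> (1/2) * (sqrt ?r / real (Suc j) + 1 / sqrt ?r)" for j
  proof -
    define a where "a = real (Suc j)"
    have a: "0 < a" by (simp add: a_def)
    have "1 / sqrt a \<le> (1/2) * (sqrt r / a + 1 / sqrt r)" if "0 < r" for r
    proof -
      have "0 \<le> (sqrt (sqrt r) / sqrt a - 1 / sqrt (sqrt r))\<^sup>2" by simp
      also have "\<dots> = sqrt r / a + 1 / sqrt r - 2 * (1 / sqrt a)"
        using that a by (simp add: power2_diff power_divide)
      finally show ?thesis by simp
    qed
    from this[OF r] have "1 / sqrt a \<le> (1/2) * (sqrt ?r / a + 1 / sqrt ?r)" .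
    moreover have "pmf (srw_pmf \<delta> j) x \<le> 1 / sqrt a" using pmf_srw_le[of \<delta> j x] assms by (simp add: a_def add.commute)
    ultimately show ?thesis by (simp add: a_def)
  qed
  have "ennreal (lattice_green \<delta> \<epsilon> t x) = (\<integral>\<^sup>+j. ennreal (pmf (srw_pmf \<delta> j) x) \<partial>pois ?r)"
    using assms by (simp add: pmf_walk[symmetric] walk_pmf_def ennreal_pmf_bind)
  also have "\<dots> \<le> (\<integral>\<^sup>+j. ennreal ((1/2) * (sqrt ?r / real (Suc j) + 1 / sqrt ?r)) \<partial>pois ?r)"
    by (intro nn_integral_mono ennreal_leI le)
  also have "\<dots> = (\<Sum>j. ennreal (exp (- ?r) * ?r ^ j / fact j * ((1/2) * (sqrt ?r / real (Suc j) + 1 / sqrt ?r))))"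
    unfolding nn_integral_pois[OF less_imp_le[OF r]] using r
    by (intro suminf_cong ennreal_mult'[symmetric]) auto
  also have "\<dots> = ennreal (exp (- ?r) * ((1/2) * (sqrt ?r / ?r * (exp ?r - 1) + exp ?r / sqrt ?r)))"
  proof (intro suminf_ennreal_eq pois_sums)
    have "(\<lambda>j. ?r ^ Suc j / fact (Suc j)) sums (exp ?r - 1)"
      using exp_sums[of ?r] by (subst sums_Suc_iff) simp
    then have "(\<lambda>j. (1/2) * (sqrt ?r / ?r * (?r ^ Suc j / fact (Suc j)) + (?r ^ j / fact j) / sqrt ?r)) sums
       ((1/2) * (sqrt ?r / ?r * (exp ?r - 1) + exp ?r / sqrt ?r))"
      by (intro sums_mult sums_add sums_divide exp_sums)
    moreover have "(1/2) * (s / r * (r ^ Suc j / fact (Suc j)) + (r ^ j / fact j) / s) = (1/2) * (s / real (Suc j) + 1 / s) * r ^ j / fact j"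
      if "0 < r" for r s :: real and j
      using that by (simp add: field_simps del: of_nat_Suc)
    ultimately show "(\<lambda>j. (1/2) * (sqrt ?r / real (Suc j) + 1 / sqrt ?r) * ?r ^ j / fact j) sums
       ((1/2) * (sqrt ?r / ?r * (exp ?r - 1) + exp ?r / sqrt ?r))" using r by (simp only:)
  next
    fix j show "0 \<le> exp (- ?r) * ?r ^ j / fact j * ((1/2) * (sqrt ?r / real (Suc j) + 1 / sqrt ?r))"
      using r by (intro mult_nonneg_nonneg divide_nonneg_nonneg add_nonneg_nonneg) auto
  qed
  also have "\<dots> \<le> ennreal (1 / sqrt ?r)"
  proof (rule ennreal_leI)
    have "sqrt s / s = 1 / sqrt s" if "0 < s" for s using that by (simp add: field_simps)
    from this[OF r] have "sqrt ?r / ?r = 1 / sqrt ?r" .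
    then have "exp (- ?r) * ((1/2) * (sqrt ?r / ?r * (exp ?r - 1) + exp ?r / sqrt ?r)) = (1/2) * (1 / sqrt ?r) * (2 - exp (- ?r))"
      by (simp add: algebra_simps add_divide_distrib diff_divide_distrib flip: exp_add)
    also have "\<dots> \<le> (1/2) * (1 / sqrt ?r) * 2" using r by (intro mult_left_mono) auto
    finally show "exp (- ?r) * ((1/2) * (sqrt ?r / ?r * (exp ?r - 1) + exp ?r / sqrt ?r)) \<le> 1 / sqrt ?r" by simp
  qed
  also have "1 / sqrt ?r = \<delta> / sqrt (\<epsilon> * t)" using assms by (simp add: real_sqrt_divide)
  finally show ?thesis using assms by (subst (asm) ennreal_le_iff) auto
qed

lemma has_sum_of_nn_integral:
  assumes q: "\<And>y. y \<in> A \<Longrightarrow> 0 \<le> q y"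
    and i: "(\<integral>\<^sup>+y. ennreal (q y) \<partial>count_space A) = ennreal S" "0 \<le> S"
  shows "(q has_sum S) A"
proof -
  have int: "integrable (count_space A) q"
    using q i by (intro integrableI_nonneg) (auto simp: AE_count_space)
  then have s: "Infinite_Sum.abs_summable_on q A"
    unfolding abs_summable_equivalent Infinite_Set_Sum.abs_summable_on_def .
  have "infsum q A = infsetsum q A" using infsetsum_infsum[of q A] s abs_summable_equivalent by metis
  also have "\<dots> = (LINT y|count_space A. q y)" by (simp add: infsetsum_def)
  also have "\<dots> = S" using i q by (subst integral_eq_nn_integral) (auto simp: AE_count_space)
  finally show ?thesis using has_sum_infsum[OF abs_summable_summable[OF s]] by simp
qed

lemma nn_integral_inverse_sqrt:
  assumes "0 \<le> t"
  shows "(\<integral>\<^sup>+s\<in>{0..t}. ennreal (1 / sqrt (t - s)) \<partial>lborel) = ennreal (2 * sqrt t)"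
proof (rule nn_integral_has_integral_lebesgue')
  have "((\<lambda>s. 1 / sqrt (t - s)) has_integral (- 2 * sqrt (t - t) - (- 2 * sqrt (t - 0)))) {0..t}"
  proof (rule fundamental_theorem_of_calculus_interior[OF assms])
    show "continuous_on {0..t} (\<lambda>s. - 2 * sqrt (t - s))" by (intro continuous_intros)
    fix s assume "s \<in> {0<..<t}"
    then have "((\<lambda>s. - 2 * sqrt (t - s)) has_real_derivative 1 / sqrt (t - s)) (at s)"
      by (auto intro!: derivative_eq_intros simp: field_simps)
    then show "((\<lambda>s. - 2 * sqrt (t - s)) has_vector_derivative 1 / sqrt (t - s)) (at s)"
      by (simp add: has_real_derivative_iff_has_vector_derivative)
  qed
  then show "((\<lambda>s. 1 / sqrt (t - s)) has_integral 2 * sqrt t) {0..t}" by simp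
qed auto

section \<open>The square integral of the lattice heat kernel\<close>

text \<open>The sum of the squared transition probabilities, written as the mean of
  \<open>lattice_green\<close> under its own law: pointwise bounds on the kernel then transfer at
  once.\<close>

definition green_square :: "real \<Rightarrow> real \<Rightarrow> real \<Rightarrow> ennreal" where
  "green_square \<delta> \<epsilon> \<tau> = (\<integral>\<^sup>+z. ennreal (lattice_green \<delta> \<epsilon> \<tau> z) \<partial>walk \<delta> \<epsilon> \<tau>)"

lemma lattice_green_space_measurable [measurable]:
  assumes "0 \<le> \<epsilon> * \<tau>" shows "(\<lambda>z. lattice_green \<delta> \<epsilon> \<tau> z) \<in> borel_measurable borel"
proof -
  have "lattice_green \<delta> \<epsilon> \<tau> = (\<lambda>z. if z \<in> lattice \<delta> then lattice_green \<delta> \<epsilon> \<tau> z else 0)"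
    using set_walk_pmf[of \<delta> \<epsilon> \<tau>] by (auto simp: fun_eq_iff pmf_walk[OF assms, symmetric] pmf_eq_0_set_pmf)
  moreover have "\<dots> \<in> borel_measurable borel"
    by (rule measurable_discrete_difference[of "\<lambda>_. 0" _ _ "lattice \<delta>"]) (auto intro: countable_lattice)
  ultimately show ?thesis by simp
qed

lemma green_square_eq:
  assumes "x \<in> lattice \<delta>" "0 \<le> \<epsilon> * \<tau>"
  shows "(\<integral>\<^sup>+y. ennreal ((lattice_green \<delta> \<epsilon> \<tau> (x - y))\<^sup>2) \<partial>count_space (lattice \<delta>)) = green_square \<delta> \<epsilon> \<tau>"
proof -
  have [measurable]: "(\<lambda>y. lattice_green \<delta> \<epsilon> \<tau> (x - y)) \<in> borel_measurable borel"
    using measurable_compose[OF _ lattice_green_space_measurable[OF assms(2)], of "\<lambda>y. x - y" borel] by simp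
  have "green_square \<delta> \<epsilon> \<tau> = (\<integral>\<^sup>+z. ennreal (lattice_green \<delta> \<epsilon> \<tau> (x - (x - z))) \<partial>walk \<delta> \<epsilon> \<tau>)"
    by (simp add: green_square_def)
  also have "\<dots> = (\<integral>\<^sup>+y. ennreal (lattice_green \<delta> \<epsilon> \<tau> (x - y)) * ennreal (lattice_green \<delta> \<epsilon> \<tau> (x - y)) \<partial>count_space (lattice \<delta>))"
    using nn_integral_walk_lattice[of "\<lambda>y. ennreal (lattice_green \<delta> \<epsilon> \<tau> (x - y))" x \<delta> \<epsilon> \<tau>] assms by simp
  also have "\<dots> = (\<integral>\<^sup>+y. ennreal ((lattice_green \<delta> \<epsilon> \<tau> (x - y))\<^sup>2) \<partial>count_space (lattice \<delta>))"
    using lattice_green_nonneg[OF assms(2)] by (intro nn_integral_cong) (simp add: power2_eq_square ennreal_mult')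
  finally show ?thesis by simp
qed

lemma green_square_upper:
  assumes "0 < \<delta>" "0 < \<epsilon>" "0 \<le> \<tau>"
  shows "green_square \<delta> \<epsilon> \<tau> \<le> 1" "0 < \<tau> \<Longrightarrow> green_square \<delta> \<epsilon> \<tau> \<le> ennreal (\<delta> / sqrt (\<epsilon> * \<tau>))"
proof -
  interpret real_distribution "walk \<delta> \<epsilon> \<tau>" by (rule real_distribution_walk)
  have *: "green_square \<delta> \<epsilon> \<tau> \<le> c" if "\<And>z. ennreal (lattice_green \<delta> \<epsilon> \<tau> z) \<le> c" for c
  proof -
    have "green_square \<delta> \<epsilon> \<tau> \<le> (\<integral>\<^sup>+z. c \<partial>walk \<delta> \<epsilon> \<tau>)"
      unfolding green_square_def by (intro nn_integral_mono that)
    then show ?thesis using emeasure_space_1 by (simp add: space_eq_univ)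
  qed
  show "green_square \<delta> \<epsilon> \<tau> \<le> 1"
    using assms lattice_green_le_1 by (intro *) (auto intro!: ennreal_leI simp flip: ennreal_1)
  show "green_square \<delta> \<epsilon> \<tau> \<le> ennreal (\<delta> / sqrt (\<epsilon> * \<tau>))" if "0 < \<tau>"
    using assms that by (intro * ennreal_leI lattice_green_upper) auto
qed

text \<open>Chebyshev's inequality leaves probability at least \<open>3/4\<close> on the at most
  \<open>4 sqrt (\<epsilon> \<tau>) / \<delta> + 1\<close> lattice points within two standard deviations, over which
  Cauchy-Schwarz is applied.\<close>

lemma green_square_lower:
  assumes d: "0 < \<delta>" and e: "0 < \<epsilon>" and t: "0 \<le> \<tau>"
  shows "ennreal (9/16 * \<delta> / (4 * sqrt (\<epsilon> * \<tau>) + \<delta>)) \<le> green_square \<delta> \<epsilon> \<tau>"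
proof -
  let ?R = "2 * sqrt (\<epsilon> * \<tau>)" and ?Q = "lattice_green \<delta> \<epsilon> \<tau>" and ?W = "walk \<delta> \<epsilon> \<tau>"
  interpret real_distribution ?W by (rule real_distribution_walk)
  have et: "0 \<le> \<epsilon> * \<tau>" using e t by simp
  define m where "m = \<lfloor>?R / \<delta>\<rfloor>"
  define B where "B = (\<lambda>k::int. of_int k * \<delta>) ` {-m..m}"
  have m0: "0 \<le> m" using d et by (simp add: m_def)
  have B: "finite B" "B \<subseteq> lattice \<delta>" by (auto simp: B_def lattice_def)
  have cB: "real (card B) \<le> 4 * sqrt (\<epsilon> * \<tau>) / \<delta> + 1"
  proof -
    have "card B \<le> card {-m..m}" unfolding B_def by (rule card_image_le) simp
    also have "\<dots> = nat (2 * m + 1)" by simp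
    finally have "real (card B) \<le> 2 * of_int m + 1" using m0 by linarith
    moreover have "of_int m \<le> ?R / \<delta>" by (simp add: m_def)
    moreover have "4 * sqrt (\<epsilon> * \<tau>) / \<delta> = 2 * (?R / \<delta>)" by simp
    ultimately show ?thesis by linarith
  qed
  have inB: "z \<in> B" if z: "z \<in> lattice \<delta>" "\<bar>z\<bar> \<le> ?R" for z
  proof -
    obtain k :: int where k: "z = of_int k * \<delta>" using z(1) by (auto simp: lattice_def)
    have "\<bar>of_int k\<bar> \<le> ?R / \<delta>" using z(2) d by (simp add: k abs_mult field_simps)
    then have "\<bar>k\<bar> \<le> m" unfolding m_def by (metis le_floor_iff of_int_abs)
    then have "k \<in> {-m..m}" by auto
    then show ?thesis unfolding B_def k by (rule imageI)
  qed
  have mass: "3/4 \<le> (\<Sum>z\<in>B. ?Q z)"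
  proof -
    have sumB: "(\<Sum>z\<in>B. ?Q z) = measure (walk_pmf \<delta> \<epsilon> \<tau>) B"
      using B by (simp add: measure_measure_pmf_finite pmf_walk[OF et])
    have AE: "AE z in walk_pmf \<delta> \<epsilon> \<tau>. z \<in> lattice \<delta>"
      using set_walk_pmf[of \<delta> \<epsilon> \<tau>] by (auto simp: AE_measure_pmf_iff)
    have mom: "(\<integral>\<^sup>+z. ennreal (z\<^sup>2) \<partial>walk_pmf \<delta> \<epsilon> \<tau>) = ennreal (\<epsilon> * \<tau>)"
      using walk_second_moment[OF et, of \<delta>] d by (simp add: nn_integral_walk)
    show ?thesis
    \<comment> \<open>Chebyshev's bound divides by \<open>\<epsilon> * \<tau>\<close>; at time
      \<open>0\<close> all mass sits at \<open>0\<close>.\<close>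
    proof (cases "\<tau> = 0")
      case True
      have "0 \<in> B" using m0 by (auto simp: B_def intro!: image_eqI[of _ _ 0])
      then have "?Q 0 \<le> (\<Sum>z\<in>B. ?Q z)" using B lattice_green_nonneg[OF et] by (intro member_le_sum) auto
      then show ?thesis using True by (simp add: lattice_green_0)
    next
      case False
      then have pos: "0 < \<epsilon> * \<tau>" using e t by simp
      have "emeasure (walk_pmf \<delta> \<epsilon> \<tau>) (- B) * ennreal (4 * (\<epsilon> * \<tau>)) = (\<integral>\<^sup>+z. ennreal (4 * (\<epsilon> * \<tau>)) * indicator (- B) z \<partial>walk_pmf \<delta> \<epsilon> \<tau>)"
        by (subst nn_integral_cmult_indicator) (auto simp: mult.commute)
      also have "\<dots> \<le> (\<integral>\<^sup>+z. ennreal (z\<^sup>2) \<partial>walk_pmf \<delta> \<epsilon> \<tau>)"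
      proof (rule nn_integral_mono_AE, use AE in eventually_elim)
        fix z assume z: "z \<in> lattice \<delta>"
        show "ennreal (4 * (\<epsilon> * \<tau>)) * indicator (- B) z \<le> ennreal (z\<^sup>2)"
        proof (cases "z \<in> B")
          case False
          then have "?R < \<bar>z\<bar>" using inB[OF z] by force
          then have "?R\<^sup>2 \<le> \<bar>z\<bar>\<^sup>2" using et by (intro power_mono) auto
          then show ?thesis using False et by (simp add: power_mult_distrib ennreal_leI)
        qed simp
      qed
      also have "\<dots> = ennreal (\<epsilon> * \<tau>)" by (rule mom)
      finally have "measure (walk_pmf \<delta> \<epsilon> \<tau>) (- B) * (4 * (\<epsilon> * \<tau>)) \<le> \<epsilon> * \<tau>"
        using pos by (simp add: measure_pmf.emeasure_eq_measure flip: ennreal_mult')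
      then have "measure (walk_pmf \<delta> \<epsilon> \<tau>) (- B) * (4 * (\<epsilon> * \<tau>)) \<le> 1/4 * (4 * (\<epsilon> * \<tau>))" by simp
      then have "measure (walk_pmf \<delta> \<epsilon> \<tau>) (- B) \<le> 1/4"
        by (rule mult_right_le_imp_le) (use pos in simp)
      moreover have "measure (walk_pmf \<delta> \<epsilon> \<tau>) (- B) = 1 - measure (walk_pmf \<delta> \<epsilon> \<tau>) B"
        using measure_pmf.prob_compl[of B "walk_pmf \<delta> \<epsilon> \<tau>"] by (simp add: Compl_eq_Diff_UNIV)
      ultimately show ?thesis unfolding sumB by simp
    qed
  qed
  have "(3/4)\<^sup>2 \<le> (\<Sum>z\<in>B. ?Q z)\<^sup>2" using mass by (intro power_mono) auto
  also have "\<dots> \<le> (\<Sum>z\<in>B. (?Q z)\<^sup>2) * (\<Sum>z\<in>B. 1\<^sup>2)"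
    using Cauchy_Schwarz_ineq_sum[of ?Q "\<lambda>_. 1" B] by simp
  also have "\<dots> \<le> (\<Sum>z\<in>B. (?Q z)\<^sup>2) * (4 * sqrt (\<epsilon> * \<tau>) / \<delta> + 1)"
    using cB by (intro mult_left_mono) (auto intro: sum_nonneg)
  finally have "9/16 \<le> (\<Sum>z\<in>B. (?Q z)\<^sup>2) * ((4 * sqrt (\<epsilon> * \<tau>) + \<delta>) / \<delta>)" using d
    by (simp add: power2_eq_square add_divide_distrib)
  moreover have "0 < 4 * sqrt (\<epsilon> * \<tau>) + \<delta>" using d et by (simp add: add_nonneg_pos)
  ultimately have lowsum: "9/16 * \<delta> / (4 * sqrt (\<epsilon> * \<tau>) + \<delta>) \<le> (\<Sum>z\<in>B. (?Q z)\<^sup>2)"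
    using d by (simp add: field_simps)
  have "ennreal (\<Sum>z\<in>B. (?Q z)\<^sup>2) = (\<integral>\<^sup>+y. ennreal ((?Q (0 - y))\<^sup>2) * indicator (uminus ` B) y \<partial>count_space (lattice \<delta>))"
  proof -
    have U: "uminus ` B \<subseteq> lattice \<delta>" using B by (auto intro: lattice_uminus)
    have "(\<integral>\<^sup>+y. ennreal ((?Q (0 - y))\<^sup>2) * indicator (uminus ` B) y \<partial>count_space (lattice \<delta>))
       = (\<Sum>y\<in>uminus ` B. ennreal ((?Q (0 - y))\<^sup>2))"
      using B U by (subst nn_integral_count_space'[of "uminus ` B"]) (auto simp: indicator_def)
    also have "\<dots> = (\<Sum>z\<in>B. ennreal ((?Q z)\<^sup>2))"
      by (subst sum.reindex) auto
    finally show ?thesis by (simp add: sum_ennreal)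
  qed
  also have "\<dots> \<le> (\<integral>\<^sup>+y. ennreal ((?Q (0 - y))\<^sup>2) \<partial>count_space (lattice \<delta>))"
    by (intro nn_integral_mono) (auto simp: indicator_def)
  also have "\<dots> = green_square \<delta> \<epsilon> \<tau>" by (rule green_square_eq[OF zero_in_lattice et])
  finally show ?thesis using lowsum by (meson ennreal_leI order_trans)
qed

text \<open>\<open>q y\<close> is the squared norm in time of the kernel at site \<open>y\<close>.
  The bound by \<open>t\<close> rests on \<open>lattice_green <= 1\<close> and suits a fixed
  lattice. The other two bounds carry a factor \<open>\<delta>\<close>, which cancels the
  \<open>1 / \<delta>\<close> of the squared noise coefficient when the mesh shrinks.\<close>

lemma green_square_sum:
  assumes d: "0 < \<delta>" and e: "0 < \<epsilon>" and t: "0 \<le> t" and x: "x \<in> lattice \<delta>"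
  obtains q qs where
    "\<And>y. y \<in> lattice \<delta> \<Longrightarrow> (\<integral>\<^sup>+s\<in>{0..t}. ennreal ((lattice_green \<delta> \<epsilon> (t - s) (x - y))\<^sup>2) \<partial>lborel) = ennreal (q y)"
    "\<And>y. y \<in> lattice \<delta> \<Longrightarrow> 0 \<le> q y" "(q has_sum qs) (lattice \<delta>)"
    "qs \<le> t" "qs \<le> \<delta> * (2 * sqrt t / sqrt \<epsilon>)" "\<delta> * (9/16 * t / (4 * sqrt (\<epsilon> * t) + \<delta>)) \<le> qs"
proof -
  let ?N = "\<lambda>y. (\<integral>\<^sup>+s\<in>{0..t}. ennreal ((lattice_green \<delta> \<epsilon> (t - s) (x - y))\<^sup>2) \<partial>lborel)"
  have [measurable]: "(\<lambda>s. lattice_green \<delta> \<epsilon> (t - s) z) \<in> borel_measurable lborel" for z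
    using measurable_compose[OF _ lattice_green_measurable[of \<delta> \<epsilon> z], of "\<lambda>s. t - s" lborel] d by simp
  define T where "T = (\<integral>\<^sup>+y. ?N y \<partial>count_space (lattice \<delta>))"
  have "T = (\<integral>\<^sup>+y. \<integral>\<^sup>+s. ennreal ((lattice_green \<delta> \<epsilon> (t - s) (x - y))\<^sup>2) * indicator {0..t} s \<partial>lborel \<partial>count_space (lattice \<delta>))"
    by (simp add: T_def)
  also have "\<dots> = (\<integral>\<^sup>+s. \<integral>\<^sup>+y. ennreal ((lattice_green \<delta> \<epsilon> (t - s) (x - y))\<^sup>2) * indicator {0..t} s \<partial>count_space (lattice \<delta>) \<partial>lborel)"
    by (subst nn_integral_count_space_nn_integral[OF countable_lattice]) auto
  also have "\<dots> = (\<integral>\<^sup>+s. green_square \<delta> \<epsilon> (t - s) * indicator {0..t} s \<partial>lborel)"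
    using e by (intro nn_integral_cong) (auto simp: indicator_def green_square_eq[OF x])
  finally have T: "T = (\<integral>\<^sup>+s. green_square \<delta> \<epsilon> (t - s) * indicator {0..t} s \<partial>lborel)" .
  have T1: "T \<le> ennreal t"
  proof -
    have "T \<le> (\<integral>\<^sup>+s. indicator {0..t} s \<partial>lborel)" unfolding T
      using green_square_upper(1)[OF d e] by (intro nn_integral_mono) (auto simp: indicator_def)
    then show ?thesis using t by simp
  qed
  have T2: "T \<le> ennreal (\<delta> * (2 * sqrt t / sqrt \<epsilon>))"
  proof -
    have "AE s in lborel. s \<noteq> t" by (rule AE_lborel_singleton)
    then have "T \<le> (\<integral>\<^sup>+s. ennreal (\<delta> / sqrt \<epsilon>) * (ennreal (1 / sqrt (t - s)) * indicator {0..t} s) \<partial>lborel)"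
      unfolding T
    proof (intro nn_integral_mono_AE, eventually_elim)
      fix s assume "s \<noteq> t"
      then show "green_square \<delta> \<epsilon> (t - s) * indicator {0..t} s \<le> ennreal (\<delta> / sqrt \<epsilon>) * (ennreal (1 / sqrt (t - s)) * indicator {0..t} s)"
        using green_square_upper(2)[OF d e, of "t - s"] d e
        by (auto simp: indicator_def real_sqrt_mult ennreal_mult'[symmetric])
    qed
    also have "\<dots> = ennreal (\<delta> / sqrt \<epsilon>) * ennreal (2 * sqrt t)"
      using nn_integral_inverse_sqrt[OF t] by (subst nn_integral_cmult) auto
    also have "\<dots> = ennreal (\<delta> * (2 * sqrt t / sqrt \<epsilon>))" using d e by (simp flip: ennreal_mult')
    finally show ?thesis .
  qed
  have T3: "ennreal (\<delta> * (9/16 * t / (4 * sqrt (\<epsilon> * t) + \<delta>))) \<le> T"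
  proof -
    have "ennreal (\<delta> * (9/16 * t / (4 * sqrt (\<epsilon> * t) + \<delta>))) = ennreal (9/16 * \<delta> / (4 * sqrt (\<epsilon> * t) + \<delta>)) * ennreal t"
      using d e t by (simp add: mult_ac flip: ennreal_mult'')
    also have "\<dots> = (\<integral>\<^sup>+s. ennreal (9/16 * \<delta> / (4 * sqrt (\<epsilon> * t) + \<delta>)) * indicator {0..t} s \<partial>lborel)"
      using t by (simp add: nn_integral_cmult_indicator)
    also have "\<dots> \<le> T" unfolding T
    proof (intro nn_integral_mono)
      fix s
      show "ennreal (9/16 * \<delta> / (4 * sqrt (\<epsilon> * t) + \<delta>)) * indicator {0..t} s \<le> green_square \<delta> \<epsilon> (t - s) * indicator {0..t} s"
      proof (cases "s \<in> {0..t}")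
        case True
        \<comment> \<open>Elapsed times are at most \<open>t\<close>, so the largest denominator is
          the one at \<open>t\<close>.\<close>
        have "9/16 * \<delta> / (4 * sqrt (\<epsilon> * t) + \<delta>) \<le> 9/16 * \<delta> / (4 * sqrt (\<epsilon> * (t - s)) + \<delta>)"
          using True d e by (intro divide_left_mono add_mono mult_left_mono real_sqrt_le_mono mult_pos_pos add_nonneg_pos) auto
        then show ?thesis using green_square_lower[OF d e, of "t - s"] True by (auto intro: order_trans ennreal_leI)
      qed simp
    qed
    finally show ?thesis .
  qed
  have Tfin: "T < \<infinity>" using T1 by (rule le_less_trans) simp
  define q where "q y = enn2real (?N y)" for y
  have N: "?N y = ennreal (q y)" if "y \<in> lattice \<delta>" for y
  proof -
    have "?N y \<le> (\<integral>\<^sup>+s. indicator {0..t} s \<partial>lborel)"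
      using e lattice_green_nonneg[of \<epsilon> _ \<delta>] lattice_green_le_1[of \<epsilon> _ \<delta>]
      by (intro nn_integral_mono) (auto simp: indicator_def power_le_one ennreal_le_1)
    then have "?N y < \<infinity>" using t by (simp add: le_less_trans)
    then show ?thesis by (simp add: q_def)
  qed
  have "(q has_sum enn2real T) (lattice \<delta>)"
  proof (rule has_sum_of_nn_integral)
    show "0 \<le> q y" for y by (simp add: q_def)
    have "(\<integral>\<^sup>+y. ennreal (q y) \<partial>count_space (lattice \<delta>)) = T"
      unfolding T_def by (intro nn_integral_cong) (simp add: N)
    then show "(\<integral>\<^sup>+y. ennreal (q y) \<partial>count_space (lattice \<delta>)) = ennreal (enn2real T)" using Tfin by simp
  qed simp
  moreover have "enn2real T \<le> t" using T1 t by (simp add: enn2real_leI)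
  moreover have "enn2real T \<le> \<delta> * (2 * sqrt t / sqrt \<epsilon>)" using T2 t d e by (simp add: enn2real_leI)
  moreover have "\<delta> * (9/16 * t / (4 * sqrt (\<epsilon> * t) + \<delta>)) \<le> enn2real T"
  proof -
    have "ennreal (\<delta> * (9/16 * t / (4 * sqrt (\<epsilon> * t) + \<delta>))) \<le> ennreal (enn2real T)" using T3 Tfin by simp
    then show ?thesis by (subst (asm) ennreal_le_iff) simp_all
  qed
  moreover have "0 \<le> q y" for y by (simp add: q_def)
  ultimately show thesis by (intro that[of q "enn2real T"] N)
qed

section \<open>Duhamel integrals\<close>

text \<open>Positive part minus negative part. Since \<open>enn2real\<close> sends infinity to
  \<open>0\<close>, the value has its intended meaning when the Duhamel integral of the absolute
  value is finite.\<close>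

definition dur :: "(real \<Rightarrow> real measure) \<Rightarrow> (real \<Rightarrow> real \<Rightarrow> real) \<Rightarrow> real \<Rightarrow> real \<Rightarrow> real" where
  "dur \<nu> f t x = enn2real (duh \<nu> (\<lambda>r y. ennreal (f r y)) t x) - enn2real (duh \<nu> (\<lambda>r y. ennreal (- f r y)) t x)"

context conv_kernel
begin

text \<open>An infinite right-hand side is allowed, so pathwise estimates can use this before
  finiteness is known.\<close>

lemma dur_bound:
  assumes f: "(\<lambda>(r, y). f r y) \<in> borel_measurable (borel \<Otimes>\<^sub>M borel)"
  shows "ennreal \<bar>dur \<nu> f t x\<bar> \<le> duh \<nu> (\<lambda>r y. ennreal \<bar>f r y\<bar>) t x"
proof -
  note [measurable] = f
  have p: "duh \<nu> (\<lambda>r y. ennreal (f r y)) t x \<le> duh \<nu> (\<lambda>r y. ennreal \<bar>f r y\<bar>) t x"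
    and n: "duh \<nu> (\<lambda>r y. ennreal (- f r y)) t x \<le> duh \<nu> (\<lambda>r y. ennreal \<bar>f r y\<bar>) t x"
    by (intro duh_mono ennreal_leI; simp)+
  show ?thesis
  proof (cases "duh \<nu> (\<lambda>r y. ennreal \<bar>f r y\<bar>) t x")
    case (real m)
    then have "enn2real (duh \<nu> (\<lambda>r y. ennreal (f r y)) t x) \<le> m" "enn2real (duh \<nu> (\<lambda>r y. ennreal (- f r y)) t x) \<le> m"
      using p n by (auto intro: enn2real_leI)
    then have "\<bar>dur \<nu> f t x\<bar> \<le> m"
      using enn2real_nonneg[of "duh \<nu> (\<lambda>r y. ennreal (f r y)) t x"] enn2real_nonneg[of "duh \<nu> (\<lambda>r y. ennreal (- f r y)) t x"]
      unfolding dur_def by linarith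
    then show ?thesis unfolding real(2) by (rule ennreal_leI)
  qed simp
qed

lemma dur_diff:
  assumes f: "(\<lambda>(r, y). f r y) \<in> borel_measurable (borel \<Otimes>\<^sub>M borel)"
    and g: "(\<lambda>(r, y). g r y) \<in> borel_measurable (borel \<Otimes>\<^sub>M borel)"
    and ff: "duh \<nu> (\<lambda>r y. ennreal \<bar>f r y\<bar>) t x < \<infinity>" and gf: "duh \<nu> (\<lambda>r y. ennreal \<bar>g r y\<bar>) t x < \<infinity>"
  shows "dur \<nu> f t x - dur \<nu> g t x = dur \<nu> (\<lambda>r y. f r y - g r y) t x"
proof -
  have m: "(\<lambda>(r, y). ennreal (f r y)) \<in> borel_measurable (borel \<Otimes>\<^sub>M borel)"
    "(\<lambda>(r, y). ennreal (- f r y)) \<in> borel_measurable (borel \<Otimes>\<^sub>M borel)"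
    "(\<lambda>(r, y). ennreal (g r y)) \<in> borel_measurable (borel \<Otimes>\<^sub>M borel)"
    "(\<lambda>(r, y). ennreal (- g r y)) \<in> borel_measurable (borel \<Otimes>\<^sub>M borel)"
    "(\<lambda>(r, y). ennreal (f r y - g r y)) \<in> borel_measurable (borel \<Otimes>\<^sub>M borel)"
    "(\<lambda>(r, y). ennreal (- (f r y - g r y))) \<in> borel_measurable (borel \<Otimes>\<^sub>M borel)"
    "(\<lambda>(r, y). ennreal \<bar>f r y\<bar>) \<in> borel_measurable (borel \<Otimes>\<^sub>M borel)"
    "(\<lambda>(r, y). ennreal \<bar>g r y\<bar>) \<in> borel_measurable (borel \<Otimes>\<^sub>M borel)"
    using f g by (auto simp: case_prod_unfold)
  define A1 where "A1 = duh \<nu> (\<lambda>r y. ennreal (f r y)) t x"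
  define A2 where "A2 = duh \<nu> (\<lambda>r y. ennreal (- f r y)) t x"
  define B1 where "B1 = duh \<nu> (\<lambda>r y. ennreal (g r y)) t x"
  define B2 where "B2 = duh \<nu> (\<lambda>r y. ennreal (- g r y)) t x"
  define C1 where "C1 = duh \<nu> (\<lambda>r y. ennreal (f r y - g r y)) t x"
  define C2 where "C2 = duh \<nu> (\<lambda>r y. ennreal (- (f r y - g r y))) t x"
  have fg: "duh \<nu> (\<lambda>r y. ennreal \<bar>f r y\<bar>) t x + duh \<nu> (\<lambda>r y. ennreal \<bar>g r y\<bar>) t x < \<infinity>"
    using ff gf by simp
  have "C1 \<le> duh \<nu> (\<lambda>r y. ennreal \<bar>f r y\<bar> + ennreal \<bar>g r y\<bar>) t x" "C2 \<le> duh \<nu> (\<lambda>r y. ennreal \<bar>f r y\<bar> + ennreal \<bar>g r y\<bar>) t x"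
    unfolding C1_def C2_def by (intro duh_mono; simp flip: ennreal_plus add: ennreal_leI)+
  then have "C1 < \<infinity>" "C2 < \<infinity>" using fg unfolding duh_add[OF m(7,8)] by (auto intro: le_less_trans)
  moreover have "A1 < \<infinity>" "A2 < \<infinity>" unfolding A1_def A2_def
    by (rule le_less_trans[OF duh_mono ff]; simp add: ennreal_leI)+
  moreover have "B1 < \<infinity>" "B2 < \<infinity>" unfolding B1_def B2_def
    by (rule le_less_trans[OF duh_mono gf]; simp add: ennreal_leI)+
  ultimately have fin: "A1 < \<infinity>" "A2 < \<infinity>" "B1 < \<infinity>" "B2 < \<infinity>" "C1 < \<infinity>" "C2 < \<infinity>" by auto
  obtain a1 where a1: "A1 = ennreal a1" "0 \<le> a1" using fin(1) by (cases A1) auto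
  obtain a2 where a2: "A2 = ennreal a2" "0 \<le> a2" using fin(2) by (cases A2) auto
  obtain b1 where b1: "B1 = ennreal b1" "0 \<le> b1" using fin(3) by (cases B1) auto
  obtain b2 where b2: "B2 = ennreal b2" "0 \<le> b2" using fin(4) by (cases B2) auto
  obtain c1 where c1: "C1 = ennreal c1" "0 \<le> c1" using fin(5) by (cases C1) auto
  obtain c2 where c2: "C2 = ennreal c2" "0 \<le> c2" using fin(6) by (cases C2) auto
  note r = a1(1) a2(1) b1(1) b2(1) c1(1) c2(1)
  note nn = a1(2) a2(2) b1(2) b2(2) c1(2) c2(2)
  have "A1 + (B2 + C2) = A2 + (B1 + C1)"
  proof -
    \<comment> \<open>Collecting positive and negative parts on two sides avoids subtraction in
      \<open>ennreal\<close>; pointwise this is the identity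
      \<open>u - v - (u - v) = 0\<close>.\<close>
    have pt: "ennreal u + (ennreal (- v) + ennreal (- (u - v))) = ennreal (- u) + (ennreal v + ennreal (u - v))" for u v :: real
    proof -
      have e: "ennreal w = ennreal (max 0 w)" for w by (simp add: max_def ennreal_neg)
      have a: "ennreal x + (ennreal y + ennreal z) = ennreal (max 0 x + (max 0 y + max 0 z))" for x y z
        by (subst (1 2 3) e) (simp del: ennreal_max_0 add: add_nonneg_nonneg)
      have "max 0 u + (max 0 (- v) + max 0 (- (u - v))) = max 0 (- u) + (max 0 v + max 0 (u - v))"
        by linarith
      then show ?thesis unfolding a by (rule arg_cong)
    qed
    have m2: "(\<lambda>(r, y). ennreal (- g r y) + ennreal (- (f r y - g r y))) \<in> borel_measurable (borel \<Otimes>\<^sub>M borel)"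
      "(\<lambda>(r, y). ennreal (g r y) + ennreal (f r y - g r y)) \<in> borel_measurable (borel \<Otimes>\<^sub>M borel)"
      using f g by (auto simp: case_prod_unfold)
    show ?thesis
      unfolding A1_def A2_def B1_def B2_def C1_def C2_def
        duh_add[OF m(4) m(6), symmetric] duh_add[OF m(3) m(5), symmetric]
        duh_add[OF m(1) m2(1), symmetric] duh_add[OF m(2) m2(2), symmetric]
      by (simp only: pt)
  qed
  then have "a1 + (b2 + c2) = a2 + (b1 + c1)" unfolding r using nn by (simp flip: ennreal_plus)
  then show ?thesis
    unfolding dur_def A1_def[symmetric] A2_def[symmetric] B1_def[symmetric] B2_def[symmetric] C1_def[symmetric] C2_def[symmetric] r
    using nn by simp
qed

lemma dur_diff_bound:
  assumes f: "(\<lambda>(r, y). f r y) \<in> borel_measurable (borel \<Otimes>\<^sub>M borel)"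
    and g: "(\<lambda>(r, y). g r y) \<in> borel_measurable (borel \<Otimes>\<^sub>M borel)"
    and ff: "duh \<nu> (\<lambda>r y. ennreal \<bar>f r y\<bar>) t x < \<infinity>" and gf: "duh \<nu> (\<lambda>r y. ennreal \<bar>g r y\<bar>) t x < \<infinity>"
  shows "ennreal \<bar>dur \<nu> f t x - dur \<nu> g t x\<bar> \<le> duh \<nu> (\<lambda>r y. ennreal \<bar>f r y - g r y\<bar>) t x"
proof -
  have "(\<lambda>(r, y). f r y - g r y) \<in> borel_measurable (borel \<Otimes>\<^sub>M borel)"
    using f g by (auto simp: case_prod_unfold)
  then show ?thesis unfolding dur_diff[OF assms] by (rule dur_bound)
qed

lemma measurable_dur:
  assumes f: "(\<lambda>(w, r, y). f w r y) \<in> borel_measurable (N \<Otimes>\<^sub>M (borel \<Otimes>\<^sub>M borel))"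
    and \<tau>: "\<tau> \<in> borel_measurable N" and \<xi>: "\<xi> \<in> borel_measurable N"
  shows "(\<lambda>w. dur \<nu> (f w) (\<tau> w) (\<xi> w)) \<in> borel_measurable N"
proof -
  have "(\<lambda>(w, r, y). ennreal (f w r y)) \<in> borel_measurable (N \<Otimes>\<^sub>M (borel \<Otimes>\<^sub>M borel))"
    "(\<lambda>(w, r, y). ennreal (- f w r y)) \<in> borel_measurable (N \<Otimes>\<^sub>M (borel \<Otimes>\<^sub>M borel))"
    using f by (auto simp: case_prod_unfold)
  from measurable_duh[OF this(1) \<tau> \<xi>] measurable_duh[OF this(2) \<tau> \<xi>]
  show ?thesis unfolding dur_def by measurable
qed

end

section \<open>Convergence in law along varying functionals\<close>

text \<open>A continuous mapping theorem for functionals that change with \<open>k\<close>. The tail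
  supremum \<open>\<Phi> m\<close> of the truncated distances to the limit functional is itself
  bounded and continuous, thanks to the common modulus in \<open>equi\<close>, so convergence in law
  applies to it. Pointwise and dominated convergence make its expectation under the limit small,
  which takes the place of tightness.\<close>

lemma converges_in_law_functionals:
  fixes F :: "(real \<times> real \<Rightarrow> real) \<Rightarrow> real" and Fk :: "nat \<Rightarrow> (real \<times> real \<Rightarrow> real) \<Rightarrow> real"
  assumes N: "prob_space N" and M: "prob_space M"
    and law: "converges_in_law T N Y M V"
    and V: "\<And>\<omega>. \<omega> \<in> space M \<Longrightarrow> continuous_on ({0..T} \<times> UNIV) (\<lambda>(t, x). V t x \<omega>)"
    and equi: "\<And>fs f \<eta>. (\<And>j. continuous_on ({0..T} \<times> UNIV) (fs j)) \<Longrightarrow> continuous_on ({0..T} \<times> UNIV) f \<Longrightarrow>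
        (\<And>R. uniform_limit ({0..T} \<times> {-R..R}) fs f sequentially) \<Longrightarrow> 0 < \<eta> \<Longrightarrow>
        eventually (\<lambda>j. \<bar>F (fs j) - F f\<bar> \<le> \<eta> \<and> (\<forall>k. \<bar>Fk k (fs j) - Fk k f\<bar> \<le> \<eta>)) sequentially"
    and ptw: "\<And>f. continuous_on ({0..T} \<times> UNIV) f \<Longrightarrow> (\<lambda>k. Fk k f) \<longlonglongrightarrow> F f"
    and mY [measurable]: "\<And>j. (\<lambda>\<omega>. F (\<lambda>(t, x). Y j t x \<omega>)) \<in> borel_measurable N"
      "\<And>j k. (\<lambda>\<omega>. Fk k (\<lambda>(t, x). Y j t x \<omega>)) \<in> borel_measurable N"
    and mV [measurable]: "(\<lambda>\<omega>. F (\<lambda>(t, x). V t x \<omega>)) \<in> borel_measurable M"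
      "\<And>k. (\<lambda>\<omega>. Fk k (\<lambda>(t, x). V t x \<omega>)) \<in> borel_measurable M"
    and g: "\<And>a. \<bar>g a\<bar> \<le> C" "\<And>a b. \<bar>g a - g b\<bar> \<le> L * min 1 \<bar>a - b\<bar>" "0 < L"
  shows "(\<lambda>k. \<integral>\<omega>. g (Fk k (\<lambda>(t, x). Y k t x \<omega>)) \<partial>N) \<longlonglongrightarrow> (\<integral>\<omega>. g (F (\<lambda>(t, x). V t x \<omega>)) \<partial>M)"
proof -
  interpret N: prob_space N by fact
  interpret M: prob_space M by fact
  let ?Y = "\<lambda>j \<omega>. (\<lambda>(t, x). Y j t x \<omega>)" and ?V = "\<lambda>\<omega>. (\<lambda>(t, x). V t x \<omega>)"
  have gcont: "isCont g a" for a
  proof -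
    have "((\<lambda>b. g b - g a) \<longlongrightarrow> 0) (at a)"
    proof (rule Lim_null_comparison)
      show "eventually (\<lambda>b. norm (g b - g a) \<le> L * \<bar>b - a\<bar>) (at a)"
        using g by (intro always_eventually) (auto intro: order_trans[OF g(2)] mult_left_mono)
      have "((\<lambda>b. L * \<bar>b - a\<bar>) \<longlongrightarrow> L * \<bar>a - a\<bar>) (at a)" by (intro tendsto_intros)
      then show "((\<lambda>b. L * \<bar>b - a\<bar>) \<longlongrightarrow> 0) (at a)" by simp
    qed
    then show ?thesis by (simp add: isCont_def LIM_zero_iff)
  qed
  have [measurable]: "g \<in> borel_measurable borel"
    using gcont by (intro borel_measurable_continuous_onI) (simp add: continuous_at_imp_continuous_on)
  define \<Phi> where "\<Phi> m f = (SUP k\<in>{m..}. min 1 \<bar>Fk k f - F f\<bar>)" for m :: nat and f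
  have bdd: "bdd_above ((\<lambda>k. min 1 \<bar>Fk k f - F f\<bar>) ` {m..})" for m f by (intro bdd_aboveI[of _ 1]) auto
  have \<Phi>le: "min 1 \<bar>Fk k f - F f\<bar> \<le> \<Phi> m f" if "m \<le> k" for k m f
    unfolding \<Phi>_def using that by (intro cSUP_upper bdd) auto
  have \<Phi>1: "\<Phi> m f \<le> 1" for m f unfolding \<Phi>_def by (intro cSUP_least) auto
  have \<Phi>0: "0 \<le> \<Phi> m f" for m f by (rule order_trans[OF _ \<Phi>le[OF order_refl]]) simp
  have [measurable]: "(\<lambda>\<omega>. \<Phi> m (?Y j \<omega>)) \<in> borel_measurable N" "(\<lambda>\<omega>. \<Phi> m (?V \<omega>)) \<in> borel_measurable M" for m j
    unfolding \<Phi>_def by (intro borel_measurable_cSUP bdd; measurable)+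
  have bcf\<Phi>: "bounded_continuous_functional T (\<Phi> m)" for m
    unfolding bounded_continuous_functional_def
  proof (intro conjI allI impI)
    show "bounded (\<Phi> m ` {f. continuous_on ({0..T} \<times> UNIV) f})"
      using \<Phi>0 \<Phi>1 by (intro boundedI[of _ 1]) auto
    fix fs :: "nat \<Rightarrow> real \<times> real \<Rightarrow> real" and f assume as: "(\<forall>k. continuous_on ({0..T} \<times> UNIV) (fs k)) \<and> continuous_on ({0..T} \<times> UNIV) f \<and>
        (\<forall>R. uniform_limit ({0..T} \<times> {-R..R}) fs f sequentially)"
    show "(\<lambda>j. \<Phi> m (fs j)) \<longlonglongrightarrow> \<Phi> m f"
    proof (rule LIMSEQ_I)
      fix e :: real assume "0 < e"
      then have "eventually (\<lambda>j. \<bar>F (fs j) - F f\<bar> \<le> e/4 \<and> (\<forall>k. \<bar>Fk k (fs j) - Fk k f\<bar> \<le> e/4)) sequentially"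
        using as by (intro equi) auto
      then have "eventually (\<lambda>j. norm (\<Phi> m (fs j) - \<Phi> m f) < e) sequentially"
      proof eventually_elim
        case (elim j)
        have d: "\<bar>min 1 \<bar>Fk k (fs j) - F (fs j)\<bar> - min 1 \<bar>Fk k f - F f\<bar>\<bar> \<le> e / 2" for k
        proof -
          have "\<bar>Fk k (fs j) - Fk k f\<bar> \<le> e / 4" "\<bar>F (fs j) - F f\<bar> \<le> e / 4" using elim by auto
          moreover have "\<bar>min 1 \<bar>a - b\<bar> - min 1 \<bar>c - d\<bar>\<bar> \<le> \<bar>a - c\<bar> + \<bar>b - d\<bar>" for a b c d :: real
            by linarith
          from this[of "Fk k (fs j)" "F (fs j)" "Fk k f" "F f"] calculation show ?thesis by linarith
        qed
        have "\<Phi> m (fs j) \<le> \<Phi> m f + e / 2"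
          unfolding \<Phi>_def[of m "fs j"]
        proof (intro cSUP_least)
          fix k assume "k \<in> {m..}"
          then show "min 1 \<bar>Fk k (fs j) - F (fs j)\<bar> \<le> \<Phi> m f + e / 2" using d[of k] \<Phi>le[of m k f, OF atLeast_iff[THEN iffD1]] by linarith
        qed auto
        moreover have "\<Phi> m f \<le> \<Phi> m (fs j) + e / 2"
          unfolding \<Phi>_def[of m f]
        proof (intro cSUP_least)
          fix k assume "k \<in> {m..}"
          then show "min 1 \<bar>Fk k f - F f\<bar> \<le> \<Phi> m (fs j) + e / 2" using d[of k] \<Phi>le[of m k "fs j", OF atLeast_iff[THEN iffD1]] by linarith
        qed auto
        ultimately show ?case using \<open>0 < e\<close> by (simp add: abs_less_iff)
      qed
      then show "\<exists>no. \<forall>n\<ge>no. norm (\<Phi> m (fs n) - \<Phi> m f) < e" by (simp add: eventually_sequentially)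
    qed
  qed
  have bcfg: "bounded_continuous_functional T (\<lambda>f. g (F f))"
    unfolding bounded_continuous_functional_def
  proof (intro conjI allI impI)
    show "bounded ((\<lambda>f. g (F f)) ` {f. continuous_on ({0..T} \<times> UNIV) f})"
      using g(1) by (intro boundedI[of _ C]) auto
    fix fs :: "nat \<Rightarrow> real \<times> real \<Rightarrow> real" and f assume as: "(\<forall>k. continuous_on ({0..T} \<times> UNIV) (fs k)) \<and> continuous_on ({0..T} \<times> UNIV) f \<and>
        (\<forall>R. uniform_limit ({0..T} \<times> {-R..R}) fs f sequentially)"
    have "(\<lambda>j. F (fs j)) \<longlonglongrightarrow> F f"
    proof (rule LIMSEQ_I)
      fix e :: real assume "0 < e"
      then have "eventually (\<lambda>j. \<bar>F (fs j) - F f\<bar> \<le> e/2 \<and> (\<forall>k. \<bar>Fk k (fs j) - Fk k f\<bar> \<le> e/2)) sequentially"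
        using as by (intro equi) auto
      then have "eventually (\<lambda>j. norm (F (fs j) - F f) < e) sequentially"
        by eventually_elim (use \<open>0 < e\<close> in auto)
      then show "\<exists>no. \<forall>n\<ge>no. norm (F (fs n) - F f) < e" by (simp add: eventually_sequentially)
    qed
    then show "(\<lambda>j. g (F (fs j))) \<longlonglongrightarrow> g (F f)" by (rule isCont_tendsto_compose[OF gcont])
  qed
  have lim\<Phi>: "(\<lambda>m. \<integral>\<omega>. \<Phi> m (?V \<omega>) \<partial>M) \<longlonglongrightarrow> (\<integral>\<omega>. 0 \<partial>M)"
  proof (rule integral_dominated_convergence[where w="\<lambda>_. 1"])
    show "AE \<omega> in M. (\<lambda>m. \<Phi> m (?V \<omega>)) \<longlonglongrightarrow> 0"
    proof (rule AE_I2)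
      fix \<omega> assume "\<omega> \<in> space M"
      show "(\<lambda>m. \<Phi> m (?V \<omega>)) \<longlonglongrightarrow> 0"
      proof (rule LIMSEQ_I)
        fix e :: real assume e: "0 < e"
        from LIMSEQ_D[OF ptw[OF V[OF \<open>\<omega> \<in> space M\<close>]], of "e/2"] e
        obtain m0 where m0: "\<And>k. m0 \<le> k \<Longrightarrow> \<bar>Fk k (?V \<omega>) - F (?V \<omega>)\<bar> < e / 2" by auto
        have "norm (\<Phi> m (?V \<omega>) - 0) < e" if "m0 \<le> m" for m
        proof -
          have "\<Phi> m (?V \<omega>) \<le> e / 2" unfolding \<Phi>_def
          proof (intro cSUP_least)
            fix k assume "k \<in> {m..}"
            then have "m0 \<le> k" using that by simp
            from m0[OF this] show "min 1 \<bar>Fk k (?V \<omega>) - F (?V \<omega>)\<bar> \<le> e / 2" by linarith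
          qed simp
          then show ?thesis using \<Phi>0[of m "?V \<omega>"] e by simp
        qed
        then show "\<exists>no. \<forall>n\<ge>no. norm (\<Phi> n (?V \<omega>) - 0) < e" by blast
      qed
    qed
    show "AE \<omega> in M. norm (\<Phi> m (?V \<omega>)) \<le> 1" for m using \<Phi>0 \<Phi>1 by (intro AE_I2) auto
  qed auto
  have iN: "integrable N (\<lambda>\<omega>. \<Phi> m (?Y k \<omega>))" "integrable N (\<lambda>\<omega>. g (Fk j (?Y k \<omega>)))" "integrable N (\<lambda>\<omega>. g (F (?Y k \<omega>)))" for m j k
    using \<Phi>0 \<Phi>1 g(1) by (auto intro!: N.integrable_const_bound[where B="max 1 C"] simp: le_max_iff_disj)
  have diff0: "(\<lambda>k. (\<integral>\<omega>. g (Fk k (?Y k \<omega>)) \<partial>N) - (\<integral>\<omega>. g (F (?Y k \<omega>)) \<partial>N)) \<longlonglongrightarrow> 0"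
  proof (rule LIMSEQ_I)
    fix e :: real assume e: "0 < e"
    have eL: "0 < e / (2 * L)" using e g by simp
    \<comment> \<open>\<open>m\<close> is fixed first, through the limit law; for
      \<open>k >= m\<close> the truncated distance at index \<open>k\<close> is dominated by
      \<open>\<Phi> m\<close>.\<close>
    from LIMSEQ_D[OF lim\<Phi> eL] obtain m where m: "(\<integral>\<omega>. \<Phi> m (?V \<omega>) \<partial>M) < e / (2 * L)"
      by (auto simp: abs_less_iff)
    have "(\<lambda>k. \<integral>\<omega>. \<Phi> m (?Y k \<omega>) \<partial>N) \<longlonglongrightarrow> (\<integral>\<omega>. \<Phi> m (?V \<omega>) \<partial>M)"
      using law bcf\<Phi>[of m] unfolding converges_in_law_def by blast
    then have "eventually (\<lambda>k. (\<integral>\<omega>. \<Phi> m (?Y k \<omega>) \<partial>N) < e / (2 * L)) sequentially"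
      using m by (rule order_tendstoD(2))
    then have "eventually (\<lambda>k. norm ((\<integral>\<omega>. g (Fk k (?Y k \<omega>)) \<partial>N) - (\<integral>\<omega>. g (F (?Y k \<omega>)) \<partial>N) - 0) < e) sequentially"
      using eventually_ge_at_top[of m]
    proof eventually_elim
      case (elim k)
      have "\<bar>(\<integral>\<omega>. g (Fk k (?Y k \<omega>)) \<partial>N) - (\<integral>\<omega>. g (F (?Y k \<omega>)) \<partial>N)\<bar> = \<bar>\<integral>\<omega>. g (Fk k (?Y k \<omega>)) - g (F (?Y k \<omega>)) \<partial>N\<bar>"
        using iN by (subst Bochner_Integration.integral_diff) auto
      also have "\<dots> \<le> (\<integral>\<omega>. \<bar>g (Fk k (?Y k \<omega>)) - g (F (?Y k \<omega>))\<bar> \<partial>N)" by (rule integral_abs_bound)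
      also have "\<dots> \<le> (\<integral>\<omega>. L * \<Phi> m (?Y k \<omega>) \<partial>N)"
      proof (intro integral_mono)
        show "integrable N (\<lambda>\<omega>. \<bar>g (Fk k (?Y k \<omega>)) - g (F (?Y k \<omega>))\<bar>)" using iN by auto
        show "integrable N (\<lambda>\<omega>. L * \<Phi> m (?Y k \<omega>))" using iN by auto
        fix \<omega>
        show "\<bar>g (Fk k (?Y k \<omega>)) - g (F (?Y k \<omega>))\<bar> \<le> L * \<Phi> m (?Y k \<omega>)"
          using g(2)[of "Fk k (?Y k \<omega>)" "F (?Y k \<omega>)"] \<Phi>le[OF elim(2), of "?Y k \<omega>"] g(3)
          by (meson mult_left_mono order_trans less_imp_le)
      qed
      also have "\<dots> = L * (\<integral>\<omega>. \<Phi> m (?Y k \<omega>) \<partial>N)" by simp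
      also have "\<dots> \<le> L * (e / (2 * L))" using elim g(3) by (intro mult_left_mono) auto
      also have "\<dots> < e" using g(3) e by simp
      finally show ?case by simp
    qed
    then show "\<exists>no. \<forall>n\<ge>no. norm ((\<integral>\<omega>. g (Fk n (?Y n \<omega>)) \<partial>N) - (\<integral>\<omega>. g (F (?Y n \<omega>)) \<partial>N) - 0) < e"
      by (simp add: eventually_sequentially)
  qed
  have "(\<lambda>k. \<integral>\<omega>. g (F (?Y k \<omega>)) \<partial>N) \<longlonglongrightarrow> (\<integral>\<omega>. g (F (?V \<omega>)) \<partial>M)"
    using law bcfg unfolding converges_in_law_def by blast
  from tendsto_add[OF diff0 this] show ?thesis by simp
qed

section \<open>Joint measurability of path-continuous processes\<close>

text \<open>Processes are specified on \<open>[0, T]\<close>; composing with this continuous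
  projection makes them functions on the whole line, as measurability on product spaces
  requires.\<close>

definition clamp_time :: "real \<Rightarrow> real \<Rightarrow> real" where
  "clamp_time T t = min T (max 0 t)"

lemma clamp_time_in: "0 \<le> T \<Longrightarrow> clamp_time T t \<in> {0..T}"
  by (auto simp: clamp_time_def)

lemma clamp_time_eq [simp]: "0 \<le> t \<Longrightarrow> t \<le> T \<Longrightarrow> clamp_time T t = t"
  by (simp add: clamp_time_def)

lemma clamp_time_measurable [measurable]: "clamp_time T \<in> borel_measurable borel"
  unfolding clamp_time_def by measurable

lemma isCont_clamp_time: "isCont (clamp_time T) t"
  unfolding clamp_time_def by (intro continuous_intros)

text \<open>By continuity the process is the limit of its values on time grids of mesh
  \<open>1 / Suc n\<close>, and each approximation uses countably many times.\<close>

lemma measurable_continuous_time: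
  fixes X :: "real \<Rightarrow> 'a \<Rightarrow> real"
  assumes T: "0 \<le> T" and m: "\<And>t. t \<in> {0..T} \<Longrightarrow> X t \<in> borel_measurable M"
    and c: "\<And>\<omega>. \<omega> \<in> space M \<Longrightarrow> continuous_on {0..T} (\<lambda>t. X t \<omega>)"
  shows "(\<lambda>p. X (clamp_time T (snd p)) (fst p)) \<in> borel_measurable (M \<Otimes>\<^sub>M borel)"
proof (rule borel_measurable_LIMSEQ_metric)
  define g where "g n t = of_int \<lfloor>real (Suc n) * t\<rfloor> / real (Suc n)" for n :: nat and t :: real
  show "(\<lambda>p. X (clamp_time T (g n (snd p))) (fst p)) \<in> borel_measurable (M \<Otimes>\<^sub>M borel)" for n
  proof -
    have f: "(\<lambda>p. X (clamp_time T (of_int i / real (Suc n))) (fst p)) \<in> borel_measurable (M \<Otimes>\<^sub>M borel)" for i :: int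
      using measurable_compose[OF measurable_fst m[OF clamp_time_in[OF T]]] by simp
    have g: "(\<lambda>p. \<lfloor>real (Suc n) * snd p\<rfloor>) \<in> M \<Otimes>\<^sub>M borel \<rightarrow>\<^sub>M count_space UNIV" by measurable
    have "(\<lambda>p. X (clamp_time T (of_int \<lfloor>real (Suc n) * snd p\<rfloor> / real (Suc n))) (fst p)) \<in> borel_measurable (M \<Otimes>\<^sub>M borel)"
      by (rule measurable_compose_countable[OF f g])
    then show ?thesis by (simp add: g_def)
  qed
  fix p assume p: "p \<in> space (M \<Otimes>\<^sub>M (borel :: real measure))"
  then have w: "fst p \<in> space M" by (auto simp: space_pair_measure)
  have gl: "(\<lambda>n. g n t) \<longlonglongrightarrow> t" for t
  proof (rule real_tendsto_sandwich)
    have "t - 1 / real (Suc n) \<le> g n t \<and> g n t \<le> t" for n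
    proof -
      have "real (Suc n) * t - 1 \<le> of_int \<lfloor>real (Suc n) * t\<rfloor>" "of_int \<lfloor>real (Suc n) * t\<rfloor> \<le> real (Suc n) * t"
        by linarith+
      then have "(real (Suc n) * t - 1) / real (Suc n) \<le> g n t" "g n t \<le> (real (Suc n) * t) / real (Suc n)"
        unfolding g_def by (intro divide_right_mono; simp)+
      then show ?thesis by (simp add: diff_divide_distrib del: of_nat_Suc)
    qed
    then show "eventually (\<lambda>n. t - 1 / real (Suc n) \<le> g n t) sequentially" "eventually (\<lambda>n. g n t \<le> t) sequentially"
      by auto
    have "(\<lambda>n. t - 1 / real (Suc n)) \<longlonglongrightarrow> t - 0"
      by (intro tendsto_diff tendsto_const LIMSEQ_Suc[OF lim_const_over_n])
    then show "(\<lambda>n. t - 1 / real (Suc n)) \<longlonglongrightarrow> t" by simp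
  qed auto
  have "(\<lambda>n. clamp_time T (g n (snd p))) \<longlonglongrightarrow> clamp_time T (snd p)"
    by (rule isCont_tendsto_compose[OF isCont_clamp_time gl])
  then show "(\<lambda>n. X (clamp_time T (g n (snd p))) (fst p)) \<longlonglongrightarrow> X (clamp_time T (snd p)) (fst p)"
    by (rule continuous_on_tendsto_compose[OF c[OF w]]) (simp_all only: clamp_time_in[OF T] eventually_True)
qed

lemma lin_interp_lattice:
  assumes "0 < \<delta>" "y \<in> lattice \<delta>" shows "lin_interp \<delta> f y = f y"
  using assms by (auto simp: lin_interp_def lattice_def)

definition interp_path :: "real \<Rightarrow> real \<Rightarrow> (real \<Rightarrow> real \<Rightarrow> 'a \<Rightarrow> real) \<Rightarrow> 'a \<Rightarrow> real \<Rightarrow> real \<Rightarrow> real" where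
  "interp_path \<delta> T X \<omega> t x = lin_interp \<delta> (\<lambda>y. X y (clamp_time T t) \<omega>) x"

lemma measurable_interp_path:
  fixes X :: "real \<Rightarrow> real \<Rightarrow> 'a \<Rightarrow> real"
  assumes T: "0 \<le> T" and m: "\<And>y t. y \<in> lattice \<delta> \<Longrightarrow> t \<in> {0..T} \<Longrightarrow> X y t \<in> borel_measurable M"
    and c: "\<And>y \<omega>. y \<in> lattice \<delta> \<Longrightarrow> \<omega> \<in> space M \<Longrightarrow> continuous_on {0..T} (\<lambda>t. X y t \<omega>)"
  shows "(\<lambda>(\<omega>, t, x). interp_path \<delta> T X \<omega> t x) \<in> borel_measurable (M \<Otimes>\<^sub>M (borel \<Otimes>\<^sub>M borel))"
proof -
  let ?N = "M \<Otimes>\<^sub>M (borel \<Otimes>\<^sub>M (borel :: real measure)) :: ('a \<times> real \<times> real) measure"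
  have node: "(\<lambda>p. X (of_int (\<lfloor>snd (snd p) / \<delta>\<rfloor> + j) * \<delta>) (clamp_time T (fst (snd p))) (fst p)) \<in> borel_measurable ?N" for j :: int
  proof -
    have f: "(\<lambda>p. X (of_int (i + j) * \<delta>) (clamp_time T (fst (snd p))) (fst p)) \<in> borel_measurable ?N" for i :: int
    proof -
      have l: "of_int (i + j) * \<delta> \<in> lattice \<delta>" unfolding lattice_def by blast
      have "(\<lambda>p. (fst p, fst (snd p))) \<in> ?N \<rightarrow>\<^sub>M M \<Otimes>\<^sub>M borel" by measurable
      from measurable_compose[OF this measurable_continuous_time[OF T m[OF l] c[OF l]]]
      show ?thesis by simp
    qed
    have g: "(\<lambda>p. \<lfloor>snd (snd p) / \<delta>\<rfloor>) \<in> ?N \<rightarrow>\<^sub>M count_space UNIV" by measurable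
    show ?thesis by (rule measurable_compose_countable[OF f g])
  qed
  note [measurable] = node[of 0, simplified] node[of 1]
  show ?thesis
    unfolding interp_path_def lin_interp_def case_prod_unfold frac_def by measurable
qed

section \<open>Lattice drift and initial term as kernel integrals\<close>

lemma walk_AE_lattice: "AE z in walk \<delta> \<epsilon> t. z \<in> lattice \<delta>"
proof -
  have "lattice \<delta> \<in> sets borel" using countable_lattice by (rule sets.countable[rotated]) auto
  then show ?thesis unfolding walk_def using set_walk_pmf[of \<delta> \<epsilon> t]
    by (subst AE_distr_iff) (auto simp: AE_measure_pmf_iff)
qed

text \<open>Started at a site, the walk stays on the lattice, so the values of a source between
  sites may be chosen freely.\<close>

lemma duh_walk_cong:
  assumes x: "x \<in> lattice \<delta>" and eq: "\<And>r y. 0 \<le> r \<Longrightarrow> r \<le> t \<Longrightarrow> y \<in> lattice \<delta> \<Longrightarrow> f r y = g r y"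
  shows "duh (walk \<delta> \<epsilon>) f t x = duh (walk \<delta> \<epsilon>) g t x"
proof -
  have "(\<integral>\<^sup>+z. f r (x - z) \<partial>walk \<delta> \<epsilon> (t - r)) = (\<integral>\<^sup>+z. g r (x - z) \<partial>walk \<delta> \<epsilon> (t - r))" if "0 \<le> r" "r \<le> t" for r
  proof (rule nn_integral_cong_AE)
    show "AE z in walk \<delta> \<epsilon> (t - r). f r (x - z) = g r (x - z)"
      using walk_AE_lattice[of \<delta> \<epsilon> "t - r"] by eventually_elim (rule eq[OF that lattice_diff[OF x]])
  qed
  then show ?thesis unfolding duh_def by (intro nn_integral_cong) (auto simp: indicator_def)
qed

text \<open>Tonelli exchanges the time integral with the sum over sites, which is the order of
  summation in \<open>has_green_drift\<close>.\<close>

lemma duh_walk_sum: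
  assumes d: "0 < \<delta>" and e: "0 < \<epsilon>" and x: "x \<in> lattice \<delta>"
    and h: "(\<lambda>(r, y). h r y) \<in> borel_measurable (borel \<Otimes>\<^sub>M borel)"
  shows "duh (walk \<delta> \<epsilon>) h t x =
    (\<integral>\<^sup>+y. (\<integral>\<^sup>+r\<in>{0..t}. ennreal (lattice_green \<delta> \<epsilon> (t - r) (x - y)) * h r y \<partial>lborel) \<partial>count_space (lattice \<delta>))"
proof -
  interpret conv_kernel "walk \<delta> \<epsilon>" by (rule conv_kernel_walk[OF e d])
  have [measurable]: "(\<lambda>s. lattice_green \<delta> \<epsilon> (t - s) z) \<in> borel_measurable lborel" for z
    using measurable_compose[OF _ lattice_green_measurable[of \<delta> \<epsilon> z], of "\<lambda>s. t - s" lborel] d by simp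
  have [measurable]: "(\<lambda>r. h r y) \<in> borel_measurable lborel" for y
    using measurable_compose[OF measurable_Pair2'[of y borel borel] h] by simp
  have "duh (walk \<delta> \<epsilon>) h t x = (\<integral>\<^sup>+r. \<integral>\<^sup>+y. ennreal (lattice_green \<delta> \<epsilon> (t - r) (x - y)) * h r y * indicator {0..t} r \<partial>count_space (lattice \<delta>) \<partial>lborel)"
    unfolding duh_def using e measurable_slice[OF h]
    by (intro nn_integral_cong) (auto simp: indicator_def nn_integral_walk_lattice[OF _ x])
  also have "\<dots> = (\<integral>\<^sup>+y. \<integral>\<^sup>+r. ennreal (lattice_green \<delta> \<epsilon> (t - r) (x - y)) * h r y * indicator {0..t} r \<partial>lborel \<partial>count_space (lattice \<delta>))"
    by (subst nn_integral_count_space_nn_integral[OF countable_lattice]) auto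
  finally show ?thesis .
qed

lemma abs_summable_iff_integrable_count_space:
  fixes f :: "'a \<Rightarrow> real"
  shows "(\<lambda>y. \<bar>f y\<bar>) summable_on A \<longleftrightarrow> integrable (count_space A) f"
proof -
  have "(\<lambda>y. \<bar>f y\<bar>) summable_on A \<longleftrightarrow> Infinite_Sum.abs_summable_on f A" by simp
  also have "\<dots> \<longleftrightarrow> integrable (count_space A) f"
    unfolding abs_summable_equivalent Infinite_Set_Sum.abs_summable_on_def ..
  finally show ?thesis .
qed

lemma infsum_eq_integral_count_space:
  fixes f :: "'a \<Rightarrow> real"
  assumes "integrable (count_space A) f"
  shows "infsum f A = (LINT y|count_space A. f y)"
proof -
  have "Infinite_Set_Sum.abs_summable_on f A"
    using assms unfolding Infinite_Set_Sum.abs_summable_on_def .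
  then have "infsetsum f A = infsum f A" by (rule infsetsum_infsum)
  then show ?thesis by (simp add: infsetsum_def)
qed

text \<open>\<open>f\<close> extends the drift off the lattice to a jointly measurable field, as the
  kernel calculus requires. The absolute summability in \<open>has_green_drift\<close> becomes
  finiteness of the Duhamel integral, and this justifies the split into positive and negative
  parts.\<close>

lemma lattice_drift:
  assumes d: "0 < \<delta>" and e: "0 < \<epsilon>" and x: "x \<in> lattice \<delta>" and t: "0 \<le> t" "t \<le> T"
    and b: "continuous_on UNIV b"
    and v: "\<And>y. y \<in> lattice \<delta> \<Longrightarrow> continuous_on {0..T} (v y)"
    and f: "(\<lambda>(r, y). f r y) \<in> borel_measurable (borel \<Otimes>\<^sub>M borel)"
    and fv: "\<And>r y. 0 \<le> r \<Longrightarrow> r \<le> t \<Longrightarrow> y \<in> lattice \<delta> \<Longrightarrow> f r y = b (v y r)"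
    and gd: "has_green_drift \<delta> \<epsilon> b v t x D"
  shows "duh (walk \<delta> \<epsilon>) (\<lambda>r y. ennreal \<bar>f r y\<bar>) t x < \<infinity>" "D = dur (walk \<delta> \<epsilon>) f t x"
proof -
  let ?Q = "\<lambda>r y. lattice_green \<delta> \<epsilon> (t - r) (x - y)"
  let ?C = "count_space (lattice \<delta>)"
  have Qc: "continuous_on {0..t} (\<lambda>r. ?Q r y)" for y
  proof -
    have "isCont (\<lambda>t. lattice_green \<delta> \<epsilon> t z) s" for s z
      using lattice_green_solves[of \<delta> \<epsilon> z s] d by (auto intro: DERIV_isCont)
    then have "continuous_on UNIV (\<lambda>s. lattice_green \<delta> \<epsilon> s z)" for z by (simp add: continuous_at_imp_continuous_on)
    moreover have "continuous_on {0..t} (\<lambda>r. t - r)" by (intro continuous_intros)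
    ultimately show ?thesis by (rule continuous_on_compose2) simp
  qed
  have Q0: "0 \<le> ?Q r y" if "r \<in> {0..t}" for r y using lattice_green_nonneg[of \<epsilon> "t - r"] that e by auto
  have bv: "continuous_on {0..t} (\<lambda>r. b (v y r))" if "y \<in> lattice \<delta>" for y
    using continuous_on_compose2[OF b continuous_on_subset[OF v[OF that]], of "{0..t}"] t by auto
  have gi: "set_integrable lborel {0..t} (\<lambda>r. ?Q r y * b (v y r))"
    "set_integrable lborel {0..t} (\<lambda>r. ?Q r y * \<bar>b (v y r)\<bar>)" if "y \<in> lattice \<delta>" for y
    by (intro borel_integrable_atLeastAtMost' continuous_intros Qc bv that)+
  define A where "A y = (LBINT s:{0..t}. ?Q s y * \<bar>b (v y s)\<bar>)" for y
  define P where "P y = (\<integral>\<^sup>+r\<in>{0..t}. ennreal (?Q r y) * ennreal (f r y) \<partial>lborel)" for y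
  define N where "N y = (\<integral>\<^sup>+r\<in>{0..t}. ennreal (?Q r y) * ennreal (- f r y) \<partial>lborel)" for y
  have A0: "0 \<le> A y" for y unfolding A_def set_lebesgue_integral_def
    using Q0 by (intro Bochner_Integration.integral_nonneg) (auto simp: indicator_def)
  have absA: "(\<integral>\<^sup>+r\<in>{0..t}. ennreal (?Q r y) * ennreal \<bar>f r y\<bar> \<partial>lborel) = ennreal (A y)" if y: "y \<in> lattice \<delta>" for y
  proof -
    have "(\<integral>\<^sup>+r\<in>{0..t}. ennreal (?Q r y) * ennreal \<bar>f r y\<bar> \<partial>lborel) = (\<integral>\<^sup>+r. ennreal (indicator {0..t} r *\<^sub>R (?Q r y * \<bar>b (v y r)\<bar>)) \<partial>lborel)"
      using Q0 fv y by (intro nn_integral_cong) (auto simp: indicator_def ennreal_mult')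
    also have "\<dots> = ennreal (A y)" unfolding A_def set_lebesgue_integral_def
      using gi(2)[OF y] Q0 unfolding set_integrable_def
      by (intro nn_integral_eq_integral) (auto simp: indicator_def)
    finally show ?thesis .
  qed
  have dpn: "(LBINT s:{0..t}. ?Q s y * b (v y s)) = enn2real (P y) - enn2real (N y)" if y: "y \<in> lattice \<delta>" for y
  proof -
    have 1: "P y = (\<integral>\<^sup>+r. ennreal (indicator {0..t} r *\<^sub>R (?Q r y * b (v y r))) \<partial>lborel)" unfolding P_def
      using Q0 fv y by (intro nn_integral_cong) (auto simp: indicator_def ennreal_mult')
    have 2: "N y = (\<integral>\<^sup>+r. ennreal (- (indicator {0..t} r *\<^sub>R (?Q r y * b (v y r)))) \<partial>lborel)" unfolding N_def
      using Q0 fv y by (intro nn_integral_cong) (auto simp: indicator_def ennreal_mult'[symmetric])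
    show ?thesis unfolding set_lebesgue_integral_def 1 2
      using gi(1)[OF y] unfolding set_integrable_def by (rule real_lebesgue_integral_def)
  qed
  have PA: "P y \<le> ennreal (A y)" "N y \<le> ennreal (A y)" if "y \<in> lattice \<delta>" for y
    unfolding absA[OF that, symmetric] P_def N_def
    by (intro nn_integral_mono mult_right_mono mult_left_mono ennreal_leI; simp)+
  have PNfin: "P y < top" "N y < top" if "y \<in> lattice \<delta>" for y
    using PA[OF that] by (auto intro: le_less_trans)
  have summA: "integrable ?C A"
  proof -
    have "A summable_on lattice \<delta>" using gd unfolding has_green_drift_def A_def by simp
    then have "(\<lambda>y. \<bar>A y\<bar>) summable_on lattice \<delta>" using A0 by simp
    then show ?thesis unfolding abs_summable_iff_integrable_count_space .
  qed
  have D: "D = (\<Sum>\<^sub>\<infinity>y\<in>lattice \<delta>. enn2real (P y) - enn2real (N y))"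
    using gd dpn unfolding has_green_drift_def by (simp cong: infsum_cong)
  have Pr: "enn2real (P y) \<le> A y" "enn2real (N y) \<le> A y" if "y \<in> lattice \<delta>" for y
    using PA[OF that] A0 by (auto intro: enn2real_leI)
  have ip: "integrable ?C (\<lambda>y. enn2real (P y))" "integrable ?C (\<lambda>y. enn2real (N y))"
    using Pr by (auto intro!: Bochner_Integration.integrable_bound[OF summA] AE_I2 simp: A0)
  have "D = (LINT y|?C. enn2real (P y) - enn2real (N y))"
    unfolding D by (intro infsum_eq_integral_count_space Bochner_Integration.integrable_diff ip)
  also have "\<dots> = (LINT y|?C. enn2real (P y)) - (LINT y|?C. enn2real (N y))"
    by (rule Bochner_Integration.integral_diff[OF ip])
  also have "(LINT y|?C. enn2real (P y)) = enn2real (\<integral>\<^sup>+y. P y \<partial>?C)"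
    using PNfin by (intro enn2real_nn_integral_eq_integral[symmetric] AE_I2) auto
  also have "(LINT y|?C. enn2real (N y)) = enn2real (\<integral>\<^sup>+y. N y \<partial>?C)"
    using PNfin by (intro enn2real_nn_integral_eq_integral[symmetric] AE_I2) auto
  also have "(\<integral>\<^sup>+y. P y \<partial>?C) = duh (walk \<delta> \<epsilon>) (\<lambda>r y. ennreal (f r y)) t x"
    unfolding P_def using f by (intro duh_walk_sum[OF d e x, symmetric]) (auto simp: case_prod_unfold)
  also have "(\<integral>\<^sup>+y. N y \<partial>?C) = duh (walk \<delta> \<epsilon>) (\<lambda>r y. ennreal (- f r y)) t x"
    unfolding N_def using f by (intro duh_walk_sum[OF d e x, symmetric]) (auto simp: case_prod_unfold)
  finally show "D = dur (walk \<delta> \<epsilon>) f t x" by (simp add: dur_def)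
  have "duh (walk \<delta> \<epsilon>) (\<lambda>r y. ennreal \<bar>f r y\<bar>) t x = (\<integral>\<^sup>+y. (\<integral>\<^sup>+r\<in>{0..t}. ennreal (?Q r y) * ennreal \<bar>f r y\<bar> \<partial>lborel) \<partial>?C)"
    using f by (intro duh_walk_sum[OF d e x]) (auto simp: case_prod_unfold)
  also have "\<dots> = (\<integral>\<^sup>+y. ennreal (A y) \<partial>?C)" by (intro nn_integral_cong) (simp add: absA)
  also have "\<dots> = ennreal (LINT y|?C. A y)" using summA A0 by (intro nn_integral_eq_integral) auto
  finally show "duh (walk \<delta> \<epsilon>) (\<lambda>r y. ennreal \<bar>f r y\<bar>) t x < \<infinity>" by simp
qed

text \<open>Boundedness of \<open>\<xi>\<close> makes the sum absolutely convergent, so positive and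
  negative parts can be compared separately.\<close>

lemma green_initial_eq:
  assumes d: "0 < \<delta>" and e: "0 < \<epsilon>" and x: "x \<in> lattice \<delta>" and t: "0 \<le> t"
    and \<xi>: "continuous_on UNIV \<xi>" "\<And>y. \<bar>\<xi> y\<bar> \<le> C"
  shows "green_initial \<delta> \<epsilon> \<xi> t x = (LINT z|walk \<delta> \<epsilon> t. \<xi> (x - z))"
proof -
  let ?C = "count_space (lattice \<delta>)" and ?Q = "\<lambda>y. lattice_green \<delta> \<epsilon> t (x - y)"
  interpret real_distribution "walk \<delta> \<epsilon> t" by (rule real_distribution_walk)
  have et: "0 \<le> \<epsilon> * t" using e t by simp
  have [measurable]: "\<xi> \<in> borel_measurable borel" using \<xi>(1) by (rule borel_measurable_continuous_onI)
  have nn: "(\<integral>\<^sup>+z. ennreal (h (x - z)) \<partial>walk \<delta> \<epsilon> t) = (\<integral>\<^sup>+y. ennreal (?Q y * h y) \<partial>?C)"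
    if "h \<in> borel_measurable borel" for h :: "real \<Rightarrow> real"
    using nn_integral_walk_lattice[of "\<lambda>y. ennreal (h y)", OF _ x et] that lattice_green_nonneg[OF et, of \<delta>]
    by (simp add: ennreal_mult')
  have i1: "integrable (walk \<delta> \<epsilon> t) (\<lambda>z. \<xi> (x - z))"
    using \<xi>(2) by (intro integrable_const_bound[where B=C]) auto
  have "(\<integral>\<^sup>+z. ennreal \<bar>\<xi> (x - z)\<bar> \<partial>walk \<delta> \<epsilon> t) < \<infinity>"
    using i1 by (simp add: integrable_iff_bounded)
  then have i2: "integrable ?C (\<lambda>y. ?Q y * \<xi> y)"
    using nn[of "\<lambda>y. \<bar>\<xi> y\<bar>"] lattice_green_nonneg[OF et, of \<delta>]
    by (intro integrableI_bounded) (auto simp: abs_mult)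
  have "green_initial \<delta> \<epsilon> \<xi> t x = (LINT y|?C. ?Q y * \<xi> y)"
    unfolding green_initial_def by (rule infsum_eq_integral_count_space[OF i2])
  also have "\<dots> = (LINT z|walk \<delta> \<epsilon> t. \<xi> (x - z))"
    unfolding real_lebesgue_integral_def[OF i1] real_lebesgue_integral_def[OF i2]
    using nn[of \<xi>] nn[of "\<lambda>y. - \<xi> y"] by simp
  finally show ?thesis .
qed

lemma sub_exp_cong_AE:
  assumes "sub_exp M X v L" "AE \<omega> in M. X \<omega> = Y \<omega>" "Y \<in> borel_measurable M"
  shows "sub_exp M Y v L"
proof -
  have "(\<integral>\<^sup>+\<omega>. ennreal (exp (l * Y \<omega>)) \<partial>M) = (\<integral>\<^sup>+\<omega>. ennreal (exp (l * X \<omega>)) \<partial>M)" for l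
  proof (rule nn_integral_cong_AE)
    show "AE \<omega> in M. ennreal (exp (l * Y \<omega>)) = ennreal (exp (l * X \<omega>))"
      using assms(2) by eventually_elim simp
  qed
  then show ?thesis using assms unfolding sub_exp_def by simp
qed

section \<open>Gronwall's inequality for moments\<close>

text \<open>The tangent at \<open>m\<close> lies below the graph of the convex function
  \<open>x powr p\<close>; Young's inequality with exponents \<open>p\<close> and
  \<open>p / (p - 1)\<close> gives this without derivatives.\<close>

lemma powr_tangent:
  fixes g m p :: real
  assumes "0 \<le> g" "0 \<le> m" "1 \<le> p"
  shows "p * m powr (p - 1) * g \<le> g powr p + (p - 1) * m powr p"
proof (cases "p = 1")
  case True
  then show ?thesis using assms by (cases "m = 0") auto
next
  case False
  then have p: "1 < p" using assms by simp
  define q where "q = p / (p - 1)"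
  have q: "1 < q" "1 / p + 1 / q = 1" using p by (auto simp: q_def field_simps)
  have "g * m powr (p - 1) \<le> g powr p / p + (m powr (p - 1)) powr q / q"
    using p q assms by (intro Youngs_inequality) auto
  also have "(m powr (p - 1)) powr q = m powr p" using p by (simp add: powr_powr q_def)
  finally have "p * (g * m powr (p - 1)) \<le> p * (g powr p / p + m powr p / q)" using p by (intro mult_left_mono) auto
  also have "\<dots> = g powr p + (p / q) * m powr p" using p by (simp add: distrib_left)
  also have "p / q = p - 1" using p by (simp add: q_def)
  finally show ?thesis by (simp add: mult_ac)
qed

lemma powr_add_le:
  fixes a b p :: real
  assumes "0 \<le> a" "0 \<le> b" "0 \<le> p"
  shows "(a + b) powr p \<le> 2 powr p * (a powr p + b powr p)"
proof -
  have "(a + b) powr p \<le> (2 * max a b) powr p" using assms by (intro powr_mono2) auto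
  also have "\<dots> = 2 powr p * (max a b) powr p" using assms by (simp add: powr_mult)
  also have "\<dots> \<le> 2 powr p * (a powr p + b powr p)" by (intro mult_left_mono) (auto simp: max_def)
  finally show ?thesis .
qed

context conv_kernel
begin

lemma measurable_section_pair:
  assumes "(\<lambda>(\<omega>, r, y). f \<omega> r y) \<in> N \<Otimes>\<^sub>M (borel \<Otimes>\<^sub>M borel) \<rightarrow>\<^sub>M K" "\<omega> \<in> space N"
  shows "(\<lambda>(r, y). f \<omega> r y) \<in> borel \<Otimes>\<^sub>M borel \<rightarrow>\<^sub>M K"
  using measurable_compose[OF measurable_Pair1'[OF assms(2)] assms(1)] by (simp add: case_prod_unfold)

text \<open>Tonelli for a random source: the expectation is moved first past the time integral, then
  past the displacement.\<close>

lemma nn_integral_duh: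
  assumes M: "prob_space M"
    and f: "(\<lambda>(\<omega>, r, y). f \<omega> r y) \<in> borel_measurable (M \<Otimes>\<^sub>M (borel \<Otimes>\<^sub>M borel))"
  shows "(\<integral>\<^sup>+\<omega>. duh \<nu> (f \<omega>) t x \<partial>M) = duh \<nu> (\<lambda>r y. \<integral>\<^sup>+\<omega>. f \<omega> r y \<partial>M) t x"
proof -
  interpret M: prob_space M by fact
  have f': "(\<lambda>p. f (fst p) (fst (snd p)) (snd (snd p))) \<in> borel_measurable (M \<Otimes>\<^sub>M (borel \<Otimes>\<^sub>M borel))"
    using f by (simp add: case_prod_unfold)
  have f2: "(\<lambda>p. f (fst (fst p)) (snd (fst p)) (snd p)) \<in> borel_measurable ((M \<Otimes>\<^sub>M borel) \<Otimes>\<^sub>M borel)"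
    using measurable_compose[OF _ f', of "\<lambda>p. (fst (fst p), snd (fst p), snd p)" "(M \<Otimes>\<^sub>M borel) \<Otimes>\<^sub>M borel"] by simp
  have "(\<lambda>(p, y). f (fst p) (snd p) y) \<in> borel_measurable ((M \<Otimes>\<^sub>M borel) \<Otimes>\<^sub>M borel)"
    using f2 by (simp add: case_prod_unfold)
  from measurable_kernel_integral[OF this, of "\<lambda>p. t - snd p" "\<lambda>_. x"]
  have m1: "(\<lambda>p. \<integral>\<^sup>+z. f (fst p) (snd p) (x - z) \<partial>\<nu> (t - snd p)) \<in> borel_measurable (M \<Otimes>\<^sub>M borel)" by simp
  then have m2: "(\<lambda>(\<omega>, r). (\<integral>\<^sup>+z. f \<omega> r (x - z) \<partial>\<nu> (t - r)) * indicator {0..t} r) \<in> borel_measurable (M \<Otimes>\<^sub>M lborel)"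
    by (simp add: case_prod_unfold cong: measurable_cong_sets[OF sets_pair_measure_cong[OF refl sets_lborel] refl])
  interpret P: pair_sigma_finite M lborel
    by (intro pair_sigma_finite.intro M.sigma_finite_measure_axioms sigma_finite_lborel)
  have "(\<integral>\<^sup>+\<omega>. duh \<nu> (f \<omega>) t x \<partial>M) = (\<integral>\<^sup>+r. \<integral>\<^sup>+\<omega>. (\<integral>\<^sup>+z. f \<omega> r (x - z) \<partial>\<nu> (t - r)) * indicator {0..t} r \<partial>M \<partial>lborel)"
    unfolding duh_def by (rule P.Fubini'[symmetric]) (rule m2)
  also have "\<dots> = duh \<nu> (\<lambda>r y. \<integral>\<^sup>+\<omega>. f \<omega> r y \<partial>M) t x"
    unfolding duh_def
  proof (intro nn_integral_cong)
    fix r :: real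
    interpret Q: pair_sigma_finite M "\<nu> (t - r)"
      by (intro pair_sigma_finite.intro M.sigma_finite_measure_axioms prob_space_imp_sigma_finite prob_space_kernel)
    have "(\<lambda>p. f (fst p) r (x - snd p)) \<in> borel_measurable (M \<Otimes>\<^sub>M borel)"
      using measurable_compose[OF _ f', of "\<lambda>p. (fst p, r, x - snd p)" "M \<Otimes>\<^sub>M borel"] by simp
    then have "(\<lambda>(\<omega>, z). f \<omega> r (x - z)) \<in> borel_measurable (M \<Otimes>\<^sub>M \<nu> (t - r))"
      by (simp add: case_prod_unfold cong: measurable_cong_sets[OF sets_pair_measure_cong[OF refl sets_kernel] refl])
    then have sw: "(\<integral>\<^sup>+\<omega>. (\<integral>\<^sup>+z. f \<omega> r (x - z) \<partial>\<nu> (t - r)) \<partial>M) = (\<integral>\<^sup>+z. (\<integral>\<^sup>+\<omega>. f \<omega> r (x - z) \<partial>M) \<partial>\<nu> (t - r))"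
      by (rule Q.Fubini'[symmetric])
    have "(\<lambda>\<omega>. \<integral>\<^sup>+z. f \<omega> r (x - z) \<partial>\<nu> (t - r)) \<in> borel_measurable M"
      using measurable_compose[OF measurable_Pair2'[of r borel M] m1] by simp
    then show "(\<integral>\<^sup>+\<omega>. (\<integral>\<^sup>+z. f \<omega> r (x - z) \<partial>\<nu> (t - r)) * indicator {0..t} r \<partial>M) =
      (\<integral>\<^sup>+z. (\<integral>\<^sup>+\<omega>. f \<omega> r (x - z) \<partial>M) \<partial>\<nu> (t - r)) * indicator {0..t} r"
      by (simp add: nn_integral_multc sw)
  qed
  finally show ?thesis .
qed

text \<open>Jensen's inequality for an average of total mass \<open>t\<close>: the tangent at the
  mean \<open>m\<close> is integrated, so no normalised measure has to be built.\<close>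

lemma duh_powr:
  assumes g: "(\<lambda>(r, y). g r y) \<in> borel_measurable (borel \<Otimes>\<^sub>M borel)" and g0: "\<And>r y. 0 \<le> g r y"
    and p: "1 \<le> p" and t: "0 \<le> t" and fin: "duh \<nu> (\<lambda>r y. ennreal (g r y)) t x < \<infinity>"
  shows "ennreal (enn2real (duh \<nu> (\<lambda>r y. ennreal (g r y)) t x) powr p)
     \<le> ennreal (t powr (p - 1)) * duh \<nu> (\<lambda>r y. ennreal (g r y powr p)) t x"
proof (cases "t = 0")
  case True
  then show ?thesis by (simp add: duh_0)
next
  case False
  then have t0: "0 < t" using t by simp
  let ?d = "enn2real (duh \<nu> (\<lambda>r y. ennreal (g r y)) t x)"
  define m where "m = ?d / t"
  have m0: "0 \<le> m" using t by (simp add: m_def)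
  have mg: "(\<lambda>(r, y). ennreal (g r y)) \<in> borel_measurable (borel \<Otimes>\<^sub>M borel)"
    "(\<lambda>(r, y). ennreal (g r y powr p)) \<in> borel_measurable (borel \<Otimes>\<^sub>M borel)"
    "(\<lambda>(r::real, y::real). ennreal ((p - 1) * m powr p)) \<in> borel_measurable (borel \<Otimes>\<^sub>M borel)"
    using g by (auto simp: case_prod_unfold)
  have dm: "duh \<nu> (\<lambda>r y. ennreal (g r y)) t x = ennreal (m * t)"
    using fin t0 by (simp add: m_def)
  show ?thesis
  proof (cases "duh \<nu> (\<lambda>r y. ennreal (g r y powr p)) t x")
    case (real D)
    have "ennreal (p * m powr (p - 1)) * duh \<nu> (\<lambda>r y. ennreal (g r y)) t x = duh \<nu> (\<lambda>r y. ennreal (p * m powr (p - 1)) * ennreal (g r y)) t x"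
      by (rule duh_cmult[OF mg(1), symmetric])
    also have "\<dots> \<le> duh \<nu> (\<lambda>r y. ennreal (g r y powr p) + ennreal ((p - 1) * m powr p)) t x"
    proof (rule duh_mono)
      fix r y
      have "ennreal (p * m powr (p - 1)) * ennreal (g r y) = ennreal (p * m powr (p - 1) * g r y)"
        using p by (intro ennreal_mult'[symmetric]) auto
      also have "\<dots> \<le> ennreal (g r y powr p + (p - 1) * m powr p)"
        by (intro ennreal_leI powr_tangent g0 m0 p)
      also have "\<dots> = ennreal (g r y powr p) + ennreal ((p - 1) * m powr p)" using p by (intro ennreal_plus) auto
      finally show "ennreal (p * m powr (p - 1)) * ennreal (g r y) \<le> \<dots>" .
    qed
    also have "\<dots> = ennreal D + ennreal ((p - 1) * m powr p) * ennreal t"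
      unfolding duh_add[OF mg(2,3)] real(2) duh_const[OF t] ..
    also have "\<dots> = ennreal (D + (p - 1) * m powr p * t)"
      using real(1) p t by (simp add: ennreal_mult')
    also have "ennreal (p * m powr (p - 1)) * duh \<nu> (\<lambda>r y. ennreal (g r y)) t x = ennreal (p * m powr (p - 1) * (m * t))"
      unfolding dm using p by (intro ennreal_mult'[symmetric]) auto
    finally have "p * m powr (p - 1) * (m * t) \<le> D + (p - 1) * m powr p * t"
      using real(1) p t by (subst (asm) ennreal_le_iff) auto
    moreover have "m powr (p - 1) * m = m powr p" using m0 p
      by (cases "m = 0") (auto simp: powr_mult_base[symmetric] mult.commute powr_diff)
    moreover have "p * m powr (p - 1) * (m * t) = p * (m powr (p - 1) * m) * t" by simp
    moreover have "(p - 1) * m powr p * t = p * m powr p * t - m powr p * t" by (simp add: left_diff_distrib)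
    ultimately have le: "m powr p * t \<le> D" by simp
    have "?d powr p = (m * t) powr p" using t0 by (simp add: m_def)
    also have "\<dots> = t powr (p - 1) * (m powr p * t)" using t0 m0 by (simp add: powr_mult powr_diff)
    also have "\<dots> \<le> t powr (p - 1) * D" using le by (intro mult_left_mono) auto
    finally have "ennreal (?d powr p) \<le> ennreal (t powr (p - 1) * D)" by (rule ennreal_leI)
    then show ?thesis unfolding real(2) by (simp add: ennreal_mult')
  next
    case top
    then show ?thesis using t0 by (simp add: ennreal_mult_top)
  qed
qed

text \<open>Gronwall for each path, then Jensen to put the power under the Duhamel integral, then
  Tonelli to bring in the moments of \<open>R\<close>. \<open>B\<close> is the quantity fed back by
  the equation and \<open>Z\<close> the one to be estimated: in the comparisons, the difference of
  drifts and the difference of solutions.\<close>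

lemma gronwall_moment:
  assumes M: "prob_space M"
    and B: "(\<lambda>(\<omega>, r, y). B \<omega> r y) \<in> borel_measurable (M \<Otimes>\<^sub>M (borel \<Otimes>\<^sub>M borel))"
    and R: "(\<lambda>(\<omega>, r, y). R \<omega> r y) \<in> borel_measurable (M \<Otimes>\<^sub>M (borel \<Otimes>\<^sub>M borel))"
    and c: "0 < c" and t: "0 \<le> t" and p: "1 \<le> p" and m: "0 \<le> m"
    and le: "\<And>\<omega> s y. \<omega> \<in> space M \<Longrightarrow> 0 \<le> s \<Longrightarrow> s \<le> t \<Longrightarrow> B \<omega> s y \<le> ennreal c * ennreal \<bar>R \<omega> s y\<bar> + ennreal c * duh \<nu> (B \<omega>) s y"
    and fin: "AE \<omega> in M. duh \<nu> (B \<omega>) t x < \<infinity>"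
    and mom: "\<And>s y. 0 \<le> s \<Longrightarrow> s \<le> t \<Longrightarrow> (\<integral>\<^sup>+\<omega>. ennreal (\<bar>R \<omega> s y\<bar> powr p) \<partial>M) \<le> ennreal m"
    and Z: "Z \<in> borel_measurable M" "AE \<omega> in M. ennreal \<bar>Z \<omega>\<bar> \<le> ennreal \<bar>R \<omega> t x\<bar> + duh \<nu> (B \<omega>) t x"
  shows "(\<integral>\<^sup>+\<omega>. ennreal (\<bar>Z \<omega>\<bar> powr p) \<partial>M) \<le> ennreal (2 powr p * (1 + (2 * exp (2 * c * t) * c * t) powr p) * m)"
proof -
  interpret M: prob_space M by fact
  \<comment> \<open>The factor \<open>2 * exp (2 * c * t)\<close> comes from
    \<open>gronwall\<close>, the further \<open>c\<close> from the coefficient in front of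
    \<open>R\<close>.\<close>
  define k where "k = 2 * exp (2 * c * t) * c"
  have k0: "0 \<le> k" using c by (simp add: k_def)
  have R1: "(\<lambda>(\<omega>, r, y). ennreal \<bar>R \<omega> r y\<bar>) \<in> borel_measurable (M \<Otimes>\<^sub>M (borel \<Otimes>\<^sub>M borel))"
    "(\<lambda>(\<omega>, r, y). ennreal (\<bar>R \<omega> r y\<bar> powr p)) \<in> borel_measurable (M \<Otimes>\<^sub>M (borel \<Otimes>\<^sub>M borel))"
    "(\<lambda>(\<omega>, r, y). ennreal (1 + \<bar>R \<omega> r y\<bar> powr p)) \<in> borel_measurable (M \<Otimes>\<^sub>M (borel \<Otimes>\<^sub>M borel))"
    using R by (auto simp: case_prod_unfold)
  have Rt: "(\<lambda>\<omega>. R \<omega> t x) \<in> borel_measurable M"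
    using measurable_compose[OF _ R, of "\<lambda>\<omega>. (\<omega>, t, x)" M] by simp
  define d where "d \<omega> = duh \<nu> (\<lambda>r y. ennreal \<bar>R \<omega> r y\<bar>) t x" for \<omega>
  define dp where "dp \<omega> = duh \<nu> (\<lambda>r y. ennreal (\<bar>R \<omega> r y\<bar> powr p)) t x" for \<omega>
  have [measurable]: "d \<in> borel_measurable M" "dp \<in> borel_measurable M"
    unfolding d_def[abs_def] dp_def[abs_def] by (rule measurable_duh[OF R1(1)] measurable_duh[OF R1(2)]; simp)+
  have Edp: "(\<integral>\<^sup>+\<omega>. dp \<omega> \<partial>M) \<le> ennreal (m * t)"
  proof -
    have "(\<integral>\<^sup>+\<omega>. dp \<omega> \<partial>M) = duh \<nu> (\<lambda>r y. \<integral>\<^sup>+\<omega>. ennreal (\<bar>R \<omega> r y\<bar> powr p) \<partial>M) t x"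
      unfolding dp_def by (rule nn_integral_duh[OF M R1(2)])
    also have "\<dots> \<le> duh \<nu> (\<lambda>r y. ennreal m) t x" by (rule duh_mono) (rule mom)
    finally show ?thesis using m by (simp add: duh_const[OF t] ennreal_mult')
  qed
  \<comment> \<open>Finiteness for almost every path follows from the moment bound through
    \<open>|R| <= 1 + |R|^p\<close>.\<close>
  have dfin: "AE \<omega> in M. d \<omega> < \<infinity>"
  proof -
    have "(\<integral>\<^sup>+\<omega>. d \<omega> \<partial>M) \<le> (\<integral>\<^sup>+\<omega>. ennreal t + dp \<omega> \<partial>M)"
    proof (rule nn_integral_mono)
      fix \<omega> assume w: "\<omega> \<in> space M"
      have "d \<omega> \<le> duh \<nu> (\<lambda>r y. 1 + ennreal (\<bar>R \<omega> r y\<bar> powr p)) t x"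
        unfolding d_def
      proof (rule duh_mono)
        fix r y
        have "\<bar>R \<omega> r y\<bar> \<le> 1 + \<bar>R \<omega> r y\<bar> powr p"
        proof (cases "\<bar>R \<omega> r y\<bar> \<le> 1")
          case False
          then have "\<bar>R \<omega> r y\<bar> powr 1 \<le> \<bar>R \<omega> r y\<bar> powr p" using p by (intro powr_mono) auto
          then show ?thesis using False by simp
        qed (simp add: add_increasing2)
        then have "ennreal \<bar>R \<omega> r y\<bar> \<le> ennreal (1 + \<bar>R \<omega> r y\<bar> powr p)" by (rule ennreal_leI)
        then show "ennreal \<bar>R \<omega> r y\<bar> \<le> 1 + ennreal (\<bar>R \<omega> r y\<bar> powr p)" by simp
      qed
      also have "\<dots> = ennreal t + dp \<omega>"
        using duh_add[OF _ measurable_section_pair[OF R1(2) w], of "\<lambda>_ _. 1"] duh_const[OF t, of 1]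
        by (simp add: dp_def)
      finally show "d \<omega> \<le> ennreal t + dp \<omega>" .
    qed
    also have "\<dots> \<le> ennreal t + ennreal (m * t)"
      using Edp by (subst nn_integral_add) (auto simp: M.emeasure_space_1)
    also have "\<dots> < \<infinity>" by simp
    finally have "(\<integral>\<^sup>+\<omega>. d \<omega> \<partial>M) \<noteq> \<infinity>" by simp
    then show ?thesis using nn_integral_noteq_infinite[of d M] by (simp add: less_top)
  qed
  have "(\<integral>\<^sup>+\<omega>. ennreal (\<bar>Z \<omega>\<bar> powr p) \<partial>M) \<le>
     (\<integral>\<^sup>+\<omega>. ennreal (2 powr p) * (ennreal (\<bar>R \<omega> t x\<bar> powr p) + ennreal (k powr p * t powr (p - 1)) * dp \<omega>) \<partial>M)"
  proof (rule nn_integral_mono_AE, use fin dfin Z(2) AE_space in eventually_elim)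
    fix \<omega> assume 1: "duh \<nu> (B \<omega>) t x < \<infinity>" and 2: "d \<omega> < \<infinity>"
      and 3: "ennreal \<bar>Z \<omega>\<bar> \<le> ennreal \<bar>R \<omega> t x\<bar> + duh \<nu> (B \<omega>) t x" and w: "\<omega> \<in> space M"
    note mB = measurable_section_pair[OF B w]
    have mR: "(\<lambda>(r, y). ennreal c * ennreal \<bar>R \<omega> r y\<bar>) \<in> borel_measurable (borel \<Otimes>\<^sub>M borel)"
      using measurable_section_pair[OF R1(1) w] by (simp add: case_prod_unfold)
    define e where "e = enn2real (d \<omega>)"
    have e: "d \<omega> = ennreal e" "0 \<le> e" using 2 by (auto simp: e_def)
    have "duh \<nu> (B \<omega>) t x \<le> ennreal (2 * exp (2 * c * t)) * duh \<nu> (\<lambda>r y. ennreal c * ennreal \<bar>R \<omega> r y\<bar>) t x"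
      by (rule gronwall[OF mB mR c t _ 1]) (rule le[OF w])
    also have "\<dots> = ennreal (k * e)"
      unfolding duh_cmult[OF measurable_section_pair[OF R1(1) w]] d_def[symmetric] e(1)
      using c e(2) by (simp add: k_def ennreal_mult' mult.assoc)
    finally have "ennreal \<bar>Z \<omega>\<bar> \<le> ennreal (\<bar>R \<omega> t x\<bar> + k * e)"
      using 3 k0 e(2) by (simp add: ennreal_plus) (meson add_left_mono order_trans)
    then have "\<bar>Z \<omega>\<bar> \<le> \<bar>R \<omega> t x\<bar> + k * e" using k0 e(2) by (subst (asm) ennreal_le_iff) auto
    then have "\<bar>Z \<omega>\<bar> powr p \<le> (\<bar>R \<omega> t x\<bar> + k * e) powr p" using p by (intro powr_mono2) auto
    also have "\<dots> \<le> 2 powr p * (\<bar>R \<omega> t x\<bar> powr p + (k * e) powr p)" using k0 e(2) p by (intro powr_add_le) auto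
    finally have "ennreal (\<bar>Z \<omega>\<bar> powr p) \<le> ennreal (2 powr p * (\<bar>R \<omega> t x\<bar> powr p + k powr p * e powr p))"
      using k0 e(2) by (intro ennreal_leI) (simp add: powr_mult)
    also have "\<dots> = ennreal (2 powr p) * (ennreal (\<bar>R \<omega> t x\<bar> powr p) + ennreal (k powr p) * ennreal (e powr p))"
      by (simp add: ennreal_mult')
    also have "\<dots> \<le> ennreal (2 powr p) * (ennreal (\<bar>R \<omega> t x\<bar> powr p) + ennreal (k powr p) * (ennreal (t powr (p - 1)) * dp \<omega>))"
    proof (intro mult_left_mono add_left_mono)
      have mr: "(\<lambda>(r, y). \<bar>R \<omega> r y\<bar>) \<in> borel_measurable (borel \<Otimes>\<^sub>M borel)"
        using measurable_section_pair[OF R w] by (simp add: case_prod_unfold)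
      show "ennreal (e powr p) \<le> ennreal (t powr (p - 1)) * dp \<omega>"
        using duh_powr[OF mr _ p t] 2 by (simp add: e_def d_def dp_def)
    qed auto
    finally show "ennreal (\<bar>Z \<omega>\<bar> powr p) \<le> ennreal (2 powr p) * (ennreal (\<bar>R \<omega> t x\<bar> powr p) + ennreal (k powr p * t powr (p - 1)) * dp \<omega>)"
      by (simp add: ennreal_mult' mult.assoc)
  qed
  also have "\<dots> = ennreal (2 powr p) * ((\<integral>\<^sup>+\<omega>. ennreal (\<bar>R \<omega> t x\<bar> powr p) \<partial>M) + ennreal (k powr p * t powr (p - 1)) * (\<integral>\<^sup>+\<omega>. dp \<omega> \<partial>M))"
    using Rt by (simp add: nn_integral_cmult nn_integral_add)
  also have "\<dots> \<le> ennreal (2 powr p) * (ennreal m + ennreal (k powr p * t powr (p - 1)) * ennreal (m * t))"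
    by (intro mult_left_mono add_mono mom Edp t) auto
  also have "\<dots> = ennreal (2 powr p * (m + k powr p * t powr (p - 1) * (m * t)))"
    using m t by (simp add: ennreal_mult')
  also have "2 powr p * (m + k powr p * t powr (p - 1) * (m * t)) = 2 powr p * (1 + (k * t) powr p) * m"
  proof -
    have "t powr (p - 1) * t = t powr p" using t p by (cases "t = 0") (auto simp: powr_diff)
    then have "k powr p * t powr (p - 1) * (m * t) = (k powr p * t powr p) * m" by (simp add: mult_ac)
    then show ?thesis using k0 t by (simp add: powr_mult algebra_simps)
  qed
  finally show ?thesis by (simp add: k_def)
qed

end

section \<open>The lattice system\<close>

definition kernel_initial :: "(real \<Rightarrow> real measure) \<Rightarrow> (real \<Rightarrow> real) \<Rightarrow> real \<Rightarrow> real \<Rightarrow> real" where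
  "kernel_initial \<nu> \<xi> t x = (LINT z|\<nu> t. \<xi> (x - z))"

lemma (in conv_kernel) measurable_kernel_initial:
  assumes \<xi>: "continuous_on UNIV \<xi>" "\<And>y. \<bar>\<xi> y\<bar> \<le> C"
    and [measurable]: "\<tau> \<in> borel_measurable N" "\<eta> \<in> borel_measurable N"
  shows "(\<lambda>w. kernel_initial \<nu> \<xi> (\<tau> w) (\<eta> w)) \<in> borel_measurable N"
proof -
  have [measurable]: "\<xi> \<in> borel_measurable borel" using \<xi>(1) by (rule borel_measurable_continuous_onI)
  have i: "integrable (\<nu> t) (\<lambda>z. \<xi> (x - z))" for t x
    using \<xi>(2) by (intro finite_measure.integrable_const_bound[where B=C])
      (auto intro: prob_space.finite_measure prob_space_kernel)
  have "(\<lambda>w. \<integral>\<^sup>+z. ennreal (\<xi> (\<eta> w - z)) \<partial>\<nu> (\<tau> w)) \<in> borel_measurable N"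
    "(\<lambda>w. \<integral>\<^sup>+z. ennreal (- \<xi> (\<eta> w - z)) \<partial>\<nu> (\<tau> w)) \<in> borel_measurable N"
    using measurable_kernel_integral[of "\<lambda>_ y. ennreal (\<xi> y)" N \<tau> \<eta>] measurable_kernel_integral[of "\<lambda>_ y. ennreal (- \<xi> y)" N \<tau> \<eta>]
    by (simp_all add: case_prod_unfold)
  then show ?thesis unfolding kernel_initial_def real_lebesgue_integral_def[OF i] by measurable
qed

lemma (in conv_kernel) kernel_initial_bound:
  assumes \<xi>: "continuous_on UNIV \<xi>" "\<And>y. \<bar>\<xi> y\<bar> \<le> C"
  shows "\<bar>kernel_initial \<nu> \<xi> t x\<bar> \<le> C"
proof -
  interpret prob_space "\<nu> t" by (rule prob_space_kernel)
  have [measurable]: "\<xi> \<in> borel_measurable borel" using \<xi>(1) by (rule borel_measurable_continuous_onI)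
  have i: "integrable (\<nu> t) (\<lambda>z. \<bar>\<xi> (x - z)\<bar>)"
    using \<xi>(2) by (intro integrable_const_bound[where B=C]) auto
  have "\<bar>LINT z|\<nu> t. \<xi> (x - z)\<bar> \<le> (LINT z|\<nu> t. \<bar>\<xi> (x - z)\<bar>)" by (rule integral_abs_bound)
  also have "\<dots> \<le> C" using \<xi>(2) by (intro integral_le_const[OF i]) auto
  finally show ?thesis unfolding kernel_initial_def .
qed

text \<open>One level of the system. The bounds on \<open>a^2\<close> serve both parts of the
  theorem: \<open>gl\<close> is \<open>Kl^2\<close> for the lower bound and \<open>0\<close> in the
  comparison with the deterministic equation.\<close>

locale lattice_solution =
  fixes M :: "'a measure" and F :: "real \<Rightarrow> 'a measure" and W :: "real \<Rightarrow> real \<Rightarrow> 'a \<Rightarrow> real"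
    and \<delta> \<epsilon>1 \<epsilon>2 T :: real and a b \<xi> :: "real \<Rightarrow> real" and X :: "real \<Rightarrow> real \<Rightarrow> 'a \<Rightarrow> real"
    and c C gl gu :: real
  assumes fps: "filtered_prob_space M F" and bf: "brownian_family M F (lattice \<delta>) W"
    and \<delta>: "0 < \<delta>" and \<epsilon>1: "0 < \<epsilon>1" and \<epsilon>2: "0 < \<epsilon>2" and T: "0 < T"
    and b: "continuous_on UNIV b" and growth: "\<And>u. \<bar>b u\<bar> \<le> c * (1 + \<bar>u\<bar>)" and c: "0 < c"
    and \<xi>: "continuous_on UNIV \<xi>" "\<And>y. \<bar>\<xi> y\<bar> \<le> C"
    and a: "\<And>u. gl \<le> (a u)\<^sup>2" "\<And>u. (a u)\<^sup>2 \<le> gu" "0 \<le> gl"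
    and cont: "\<And>x \<omega>. x \<in> lattice \<delta> \<Longrightarrow> \<omega> \<in> space M \<Longrightarrow> continuous_on {0..T} (\<lambda>t. X x t \<omega>)"
    and adapted: "\<And>x t. x \<in> lattice \<delta> \<Longrightarrow> t \<in> {0..T} \<Longrightarrow> X x t \<in> borel_measurable (F t)"
    and sol: "\<And>x t. x \<in> lattice \<delta> \<Longrightarrow> t \<in> {0..T} \<Longrightarrow> \<exists>S.
           has_green_noise M F W \<delta> \<epsilon>1 (\<lambda>u. \<epsilon>2 * a u / sqrt \<delta>) X t x S \<and>
           (AE \<omega> in M. has_green_drift \<delta> \<epsilon>1 b (\<lambda>y s. X y s \<omega>) t x
              (X x t \<omega> - S \<omega> - green_initial \<delta> \<epsilon>1 \<xi> t x))"
begin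

sublocale prob_space M using fps by (simp add: filtered_prob_space_def)

sublocale kern: conv_kernel "walk \<delta> \<epsilon>1" by (rule conv_kernel_walk[OF \<epsilon>1 \<delta>])

lemma C0: "0 \<le> C" using \<xi>(2)[of 0] by linarith

lemma gu0: "0 \<le> gu" using a(2)[of 0] by (rule order_trans[rotated]) simp

lemma measurable_X: "x \<in> lattice \<delta> \<Longrightarrow> t \<in> {0..T} \<Longrightarrow> X x t \<in> borel_measurable M"
  using measurable_filtration_space[OF fps adapted] by auto

definition path :: "'a \<Rightarrow> real \<Rightarrow> real \<Rightarrow> real" where "path = interp_path \<delta> T X"

lemma path_lattice: "x \<in> lattice \<delta> \<Longrightarrow> t \<in> {0..T} \<Longrightarrow> path \<omega> t x = X x t \<omega>"
  by (simp add: path_def interp_path_def lin_interp_lattice[OF \<delta>])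

lemma measurable_path: "(\<lambda>(\<omega>, t, x). path \<omega> t x) \<in> borel_measurable (M \<Otimes>\<^sub>M (borel \<Otimes>\<^sub>M borel))"
  unfolding path_def using T measurable_X cont by (intro measurable_interp_path) auto

lemma measurable_b: "b \<in> borel_measurable borel"
  using b by (rule borel_measurable_continuous_onI)

lemma measurable_b_path: "(\<lambda>(\<omega>, t, x). b (path \<omega> t x)) \<in> borel_measurable (M \<Otimes>\<^sub>M (borel \<Otimes>\<^sub>M borel))"
  using measurable_compose[OF measurable_path measurable_b] by (simp add: case_prod_unfold)

text \<open>The stochastic convolution recovered from the path. The variables \<open>S\<close> of
  \<open>has_green_noise\<close> are given for one \<open>(t, x)\<close> at a time; this version is
  jointly measurable, which Gronwall and Tonelli need.\<close>

definition res :: "'a \<Rightarrow> real \<Rightarrow> real \<Rightarrow> real" where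
  "res \<omega> t x = path \<omega> t x - kernel_initial (walk \<delta> \<epsilon>1) \<xi> t x - dur (walk \<delta> \<epsilon>1) (\<lambda>r y. b (path \<omega> r y)) t x"

lemma measurable_res: "(\<lambda>(\<omega>, t, x). res \<omega> t x) \<in> borel_measurable (M \<Otimes>\<^sub>M (borel \<Otimes>\<^sub>M borel))"
proof -
  let ?N = "M \<Otimes>\<^sub>M (borel \<Otimes>\<^sub>M (borel :: real measure)) :: ('a \<times> real \<times> real) measure"
  have "(\<lambda>(w, r, y). b (path (fst w) r y)) \<in> borel_measurable (?N \<Otimes>\<^sub>M (borel \<Otimes>\<^sub>M borel))"
    using measurable_compose[OF _ measurable_b_path, of "\<lambda>p. (fst (fst p), snd p)" "?N \<Otimes>\<^sub>M (borel \<Otimes>\<^sub>M borel)"]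
    by (simp add: case_prod_unfold)
  from kern.measurable_dur[OF this, of "\<lambda>p. fst (snd p)" "\<lambda>p. snd (snd p)"]
  have [measurable]: "(\<lambda>p. dur (walk \<delta> \<epsilon>1) (\<lambda>r y. b (path (fst p) r y)) (fst (snd p)) (snd (snd p))) \<in> borel_measurable ?N"
    by simp
  have [measurable]: "(\<lambda>p. kernel_initial (walk \<delta> \<epsilon>1) \<xi> (fst (snd p)) (snd (snd p))) \<in> borel_measurable ?N"
    by (intro kern.measurable_kernel_initial[OF \<xi>]) measurable
  have [measurable]: "(\<lambda>p. path (fst p) (fst (snd p)) (snd (snd p))) \<in> borel_measurable ?N"
    using measurable_path by (simp add: case_prod_unfold)
  show ?thesis unfolding res_def case_prod_unfold by measurable
qed

text \<open>The exceptional set may depend on the site and the time; the estimates apply this at one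
  point at a time.\<close>

lemma res_at:
  assumes x: "x \<in> lattice \<delta>" and t: "t \<in> {0..T}"
  obtains S where "has_green_noise M F W \<delta> \<epsilon>1 (\<lambda>u. \<epsilon>2 * a u / sqrt \<delta>) X t x S" "AE \<omega> in M. S \<omega> = res \<omega> t x"
    "AE \<omega> in M. duh (walk \<delta> \<epsilon>1) (\<lambda>r y. ennreal \<bar>b (path \<omega> r y)\<bar>) t x < \<infinity>"
proof -
  obtain S where S: "has_green_noise M F W \<delta> \<epsilon>1 (\<lambda>u. \<epsilon>2 * a u / sqrt \<delta>) X t x S"
    "AE \<omega> in M. has_green_drift \<delta> \<epsilon>1 b (\<lambda>y s. X y s \<omega>) t x (X x t \<omega> - S \<omega> - green_initial \<delta> \<epsilon>1 \<xi> t x)"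
    using sol[OF x t] by blast
  have "AE \<omega> in M. S \<omega> = res \<omega> t x \<and> duh (walk \<delta> \<epsilon>1) (\<lambda>r y. ennreal \<bar>b (path \<omega> r y)\<bar>) t x < \<infinity>"
    using S(2) AE_space
  proof eventually_elim
    case (elim \<omega>)
    have m: "(\<lambda>(r, y). b (path \<omega> r y)) \<in> borel_measurable (borel \<Otimes>\<^sub>M borel)"
      by (rule kern.measurable_section_pair[OF measurable_b_path elim(2)])
    have eq: "b (path \<omega> r y) = b (X y r \<omega>)" if "0 \<le> r" "r \<le> t" "y \<in> lattice \<delta>" for r y
      using that t path_lattice by simp
    note ld = lattice_drift[where T = T, OF \<delta> \<epsilon>1 x _ _ b cont[OF _ elim(2)] m eq elim(1)]
    have "green_initial \<delta> \<epsilon>1 \<xi> t x = kernel_initial (walk \<delta> \<epsilon>1) \<xi> t x"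
      unfolding kernel_initial_def using t by (intro green_initial_eq[OF \<delta> \<epsilon>1 x _ \<xi>]) auto
    then show ?case using ld t path_lattice[OF x t] by (simp add: res_def)
  qed
  then show thesis using that[OF S(1)] by auto
qed

text \<open>The squared noise coefficient \<open>\<epsilon>2^2 / \<delta>\<close> meets the kernel
  bounds. The ceiling keeps the minimum of the two upper bounds, because the fixed lattice uses one
  and the vanishing mesh the other.\<close>

lemma res_sub_exp:
  assumes x: "x \<in> lattice \<delta>" and t: "t \<in> {0..T}"
    and L: "gu * \<epsilon>2\<^sup>2 / \<delta> * min T (\<delta> * (2 * sqrt T / sqrt \<epsilon>1)) \<le> L"
  shows "sub_exp M (\<lambda>\<omega>. res \<omega> t x) (gl * \<epsilon>2\<^sup>2 * (9/16 * t / (4 * sqrt (\<epsilon>1 * t) + \<delta>))) L"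
proof -
  have t': "0 \<le> t" "t \<le> T" using t by auto
  obtain q qs where q: "\<And>y. y \<in> lattice \<delta> \<Longrightarrow> (\<integral>\<^sup>+s\<in>{0..t}. ennreal ((lattice_green \<delta> \<epsilon>1 (t - s) (x - y))\<^sup>2) \<partial>lborel) = ennreal (q y)"
    "\<And>y. y \<in> lattice \<delta> \<Longrightarrow> 0 \<le> q y" "(q has_sum qs) (lattice \<delta>)"
    and qs: "qs \<le> t" "qs \<le> \<delta> * (2 * sqrt t / sqrt \<epsilon>1)" "\<delta> * (9/16 * t / (4 * sqrt (\<epsilon>1 * t) + \<delta>)) \<le> qs"
    by (rule green_square_sum[OF \<delta> \<epsilon>1 t'(1) x]) blast
  obtain S where S: "has_green_noise M F W \<delta> \<epsilon>1 (\<lambda>u. \<epsilon>2 * a u / sqrt \<delta>) X t x S" "AE \<omega> in M. S \<omega> = res \<omega> t x"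
    by (rule res_at[OF x t]) blast
  have sq: "(\<epsilon>2 * a u / sqrt \<delta>)\<^sup>2 = \<epsilon>2\<^sup>2 / \<delta> * (a u)\<^sup>2" for u
    using \<delta> by (simp add: power_divide power_mult_distrib)
  have e: "0 \<le> \<epsilon>2\<^sup>2 / \<delta>" using \<delta> by simp
  have "sub_exp M S (\<epsilon>2\<^sup>2 / \<delta> * gl * qs) (\<epsilon>2\<^sup>2 / \<delta> * gu * qs)"
  proof (rule green_noise_sub_exp[OF fps bf _ S(1) _ _ _ q])
    show "\<epsilon>2\<^sup>2 / \<delta> * gl \<le> (\<epsilon>2 * a u / sqrt \<delta>)\<^sup>2" "(\<epsilon>2 * a u / sqrt \<delta>)\<^sup>2 \<le> \<epsilon>2\<^sup>2 / \<delta> * gu" for u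
      unfolding sq by (intro mult_left_mono a e)+
    show "0 \<le> \<epsilon>2\<^sup>2 / \<delta> * gl" by (rule mult_nonneg_nonneg[OF e a(3)])
  qed (use \<delta> in auto)
  moreover have "(\<lambda>\<omega>. res \<omega> t x) \<in> borel_measurable M"
    using measurable_compose[OF _ measurable_res, of "\<lambda>\<omega>. (\<omega>, t, x)" M] by simp
  ultimately have "sub_exp M (\<lambda>\<omega>. res \<omega> t x) (\<epsilon>2\<^sup>2 / \<delta> * gl * qs) (\<epsilon>2\<^sup>2 / \<delta> * gu * qs)"
    by (rule sub_exp_cong_AE[OF _ S(2)])
  then show ?thesis
  proof (rule sub_exp_mono)
    have "gl * \<epsilon>2\<^sup>2 * (9/16 * t / (4 * sqrt (\<epsilon>1 * t) + \<delta>)) = \<epsilon>2\<^sup>2 / \<delta> * gl * (\<delta> * (9/16 * t / (4 * sqrt (\<epsilon>1 * t) + \<delta>)))"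
      using \<delta> by simp
    also have "\<dots> \<le> \<epsilon>2\<^sup>2 / \<delta> * gl * qs" by (intro mult_left_mono qs mult_nonneg_nonneg e a(3))
    finally show "gl * \<epsilon>2\<^sup>2 * (9/16 * t / (4 * sqrt (\<epsilon>1 * t) + \<delta>)) \<le> \<epsilon>2\<^sup>2 / \<delta> * gl * qs" .
    have "\<delta> * (2 * sqrt t / sqrt \<epsilon>1) \<le> \<delta> * (2 * sqrt T / sqrt \<epsilon>1)"
      using \<delta> \<epsilon>1 t' by (intro mult_left_mono divide_right_mono) auto
    then have "qs \<le> min T (\<delta> * (2 * sqrt T / sqrt \<epsilon>1))" using qs(1,2) t' by simp
    then have "\<epsilon>2\<^sup>2 / \<delta> * gu * qs \<le> \<epsilon>2\<^sup>2 / \<delta> * gu * min T (\<delta> * (2 * sqrt T / sqrt \<epsilon>1))"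
      using e gu0 by (intro mult_left_mono mult_nonneg_nonneg)
    then show "\<epsilon>2\<^sup>2 / \<delta> * gu * qs \<le> L" using L by (simp add: mult_ac)
  qed
qed

text \<open>Linear growth turns the Duhamel formula into a Gronwall inequality for
  \<open>|b|\<close> with source \<open>1 + C + |res|\<close>, whose first moment is under control.
  The bound does not depend on the site, and on the mesh through \<open>L\<close> alone, which later
  allows the cutoff to be removed uniformly.\<close>

lemma first_moment:
  assumes x: "x \<in> lattice \<delta>" and t: "t \<in> {0..T}" and L0: "0 < L"
    and L: "gu * \<epsilon>2\<^sup>2 / \<delta> * min T (\<delta> * (2 * sqrt T / sqrt \<epsilon>1)) \<le> L"
  shows "(\<integral>\<^sup>+\<omega>. ennreal \<bar>b (path \<omega> t x)\<bar> \<partial>M) \<le>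
    ennreal (2 * (1 + c) * (1 + (2 * exp (2 * c * T) * c * T)) * (1 + C + moment_const 1 * L powr (1/2)))"
proof -
  have t': "0 \<le> t" "t \<le> T" using t by auto
  \<comment> \<open>Noise estimates are known at sites, so source and drift are multiplied by the
    indicator of the lattice; the walk does not see the change.\<close>
  define R where "R \<omega> s y = indicator (lattice \<delta>) y * (1 + C + \<bar>res \<omega> s y\<bar>)" for \<omega> s y
  define B where "B \<omega> s y = ennreal (indicator (lattice \<delta>) y * \<bar>b (path \<omega> s y)\<bar>)" for \<omega> s y
  have lat: "lattice \<delta> \<in> sets borel" by (rule sets.countable[OF _ countable_lattice]) simp
  let ?N = "M \<Otimes>\<^sub>M (borel \<Otimes>\<^sub>M (borel :: real measure)) :: ('a \<times> real \<times> real) measure"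
  have [measurable]: "(\<lambda>p. indicator (lattice \<delta>) (snd (snd p)) :: real) \<in> borel_measurable ?N"
    using lat by measurable
  have [measurable]: "(\<lambda>p. res (fst p) (fst (snd p)) (snd (snd p))) \<in> borel_measurable ?N"
    "(\<lambda>p. b (path (fst p) (fst (snd p)) (snd (snd p)))) \<in> borel_measurable ?N"
    using measurable_res measurable_b_path by (simp_all add: case_prod_unfold)
  have mR: "(\<lambda>(\<omega>, r, y). R \<omega> r y) \<in> borel_measurable ?N" and mB: "(\<lambda>(\<omega>, r, y). B \<omega> r y) \<in> borel_measurable ?N"
    unfolding R_def B_def case_prod_unfold by measurable
  have dB: "duh (walk \<delta> \<epsilon>1) (B \<omega>) s y = duh (walk \<delta> \<epsilon>1) (\<lambda>r y. ennreal \<bar>b (path \<omega> r y)\<bar>) s y" if "y \<in> lattice \<delta>" for \<omega> s y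
    by (rule duh_walk_cong[OF that]) (simp add: B_def)
  have R0: "0 \<le> R \<omega> s y" for \<omega> s y using C0 by (simp add: R_def)
  \<comment> \<open>Dividing by \<open>1 + c\<close> brings the coefficient
    \<open>c / (1 + c)\<close> below \<open>1\<close>, as the bound on \<open>Z\<close> in
    \<open>gronwall_moment\<close> demands; the factor is restored at the end.\<close>
  define Z where "Z \<omega> = b (path \<omega> t x) / (1 + c)" for \<omega>
  have key: "ennreal \<bar>b (path \<omega> s y)\<bar> \<le> ennreal c * ennreal \<bar>R \<omega> s y\<bar> + ennreal c * duh (walk \<delta> \<epsilon>1) (B \<omega>) s y"
    if w: "\<omega> \<in> space M" and y: "y \<in> lattice \<delta>" for \<omega> s y
  proof -
    let ?D = "dur (walk \<delta> \<epsilon>1) (\<lambda>r y. b (path \<omega> r y)) s y"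
    have "\<bar>path \<omega> s y\<bar> \<le> C + \<bar>res \<omega> s y\<bar> + \<bar>?D\<bar>"
      using kern.kernel_initial_bound[OF \<xi>, of s y] unfolding res_def by linarith
    then have "\<bar>b (path \<omega> s y)\<bar> \<le> c * (R \<omega> s y + \<bar>?D\<bar>)"
      using growth[of "path \<omega> s y"] c y by (simp add: R_def) (smt (verit) mult_left_mono)
    then have "ennreal \<bar>b (path \<omega> s y)\<bar> \<le> ennreal (c * (R \<omega> s y + \<bar>?D\<bar>))" by (rule ennreal_leI)
    also have "\<dots> = ennreal c * ennreal \<bar>R \<omega> s y\<bar> + ennreal c * ennreal \<bar>?D\<bar>"
      using c R0 by (simp add: ennreal_mult' distrib_left)
    also have "ennreal \<bar>?D\<bar> \<le> duh (walk \<delta> \<epsilon>1) (B \<omega>) s y"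
      unfolding dB[OF y] by (rule kern.dur_bound[OF kern.measurable_section_pair[OF measurable_b_path w]])
    finally show ?thesis by (simp add: mult_left_mono)
  qed
  have "(\<integral>\<^sup>+\<omega>. ennreal (\<bar>Z \<omega>\<bar> powr 1) \<partial>M) \<le> ennreal (2 powr 1 * (1 + (2 * exp (2 * c * t) * c * t) powr 1) * (1 + C + moment_const 1 * L powr (1/2)))"
  proof (rule kern.gronwall_moment[OF prob_space_axioms mB mR c t'(1)])
    show "(1::real) \<le> 1" by simp
    show "0 \<le> 1 + C + moment_const 1 * L powr (1/2)" using C0 by (simp add: moment_const_def)
    show "B \<omega> s y \<le> ennreal c * ennreal \<bar>R \<omega> s y\<bar> + ennreal c * duh (walk \<delta> \<epsilon>1) (B \<omega>) s y" if "\<omega> \<in> space M" for \<omega> s y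
      using key[OF that, of y s] by (cases "y \<in> lattice \<delta>") (auto simp: B_def)
    show "AE \<omega> in M. duh (walk \<delta> \<epsilon>1) (B \<omega>) t x < \<infinity>"
      unfolding dB[OF x] by (rule res_at[OF x t])
    show "(\<integral>\<^sup>+\<omega>. ennreal (\<bar>R \<omega> s y\<bar> powr 1) \<partial>M) \<le> ennreal (1 + C + moment_const 1 * L powr (1/2))" if "0 \<le> s" "s \<le> t" for s y
    proof (cases "y \<in> lattice \<delta>")
      case True
      have [measurable]: "(\<lambda>\<omega>. res \<omega> s y) \<in> borel_measurable M"
        using measurable_compose[OF _ measurable_res, of "\<lambda>\<omega>. (\<omega>, s, y)" M] by simp
      have s: "s \<in> {0..T}" using that t' by auto
      have "(\<integral>\<^sup>+\<omega>. ennreal (\<bar>R \<omega> s y\<bar> powr 1) \<partial>M) = (\<integral>\<^sup>+\<omega>. ennreal (1 + C) + ennreal (\<bar>res \<omega> s y\<bar> powr 1) \<partial>M)"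
        using True C0 by (intro nn_integral_cong) (simp add: R_def ennreal_plus[symmetric] del: ennreal_plus)
      also have "\<dots> = ennreal (1 + C) + (\<integral>\<^sup>+\<omega>. ennreal (\<bar>res \<omega> s y\<bar> powr 1) \<partial>M)"
        by (subst nn_integral_add) (auto simp: emeasure_space_1)
      also have "\<dots> \<le> ennreal (1 + C) + ennreal (moment_const 1 * L powr (1/2))"
        by (intro add_left_mono sub_exp_moment[OF res_sub_exp[OF True s L] L0]) simp
      also have "\<dots> = ennreal (1 + C + moment_const 1 * L powr (1/2))"
        using C0 by (intro ennreal_plus[symmetric]) (auto simp: moment_const_def)
      finally show ?thesis .
    qed (simp add: R_def)
    show "Z \<in> borel_measurable M" unfolding Z_def[abs_def]
      using measurable_compose[OF _ measurable_b_path, of "\<lambda>\<omega>. (\<omega>, t, x)" M] by simp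
    show "AE \<omega> in M. ennreal \<bar>Z \<omega>\<bar> \<le> ennreal \<bar>R \<omega> t x\<bar> + duh (walk \<delta> \<epsilon>1) (B \<omega>) t x"
    proof (rule AE_I2)
      fix \<omega> assume w: "\<omega> \<in> space M"
      have "ennreal \<bar>Z \<omega>\<bar> = ennreal (1 / (1 + c)) * ennreal \<bar>b (path \<omega> t x)\<bar>"
        using c by (simp add: Z_def flip: ennreal_mult')
      also have "\<dots> \<le> ennreal (1 / (1 + c)) * (ennreal c * ennreal \<bar>R \<omega> t x\<bar> + ennreal c * duh (walk \<delta> \<epsilon>1) (B \<omega>) t x)"
        by (intro mult_left_mono key w x) simp
      also have "\<dots> = ennreal (1 / (1 + c) * c) * (ennreal \<bar>R \<omega> t x\<bar> + duh (walk \<delta> \<epsilon>1) (B \<omega>) t x)"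
      proof -
        have "ennreal (1 / (1 + c) * c) = ennreal (1 / (1 + c)) * ennreal c" using c by (intro ennreal_mult') auto
        then show ?thesis by (simp only: distrib_left mult.assoc)
      qed
      also have "\<dots> \<le> ennreal 1 * (ennreal \<bar>R \<omega> t x\<bar> + duh (walk \<delta> \<epsilon>1) (B \<omega>) t x)"
        using c by (intro mult_right_mono ennreal_leI) (auto simp: field_simps)
      finally show "ennreal \<bar>Z \<omega>\<bar> \<le> ennreal \<bar>R \<omega> t x\<bar> + duh (walk \<delta> \<epsilon>1) (B \<omega>) t x" by simp
    qed
  qed
  also have "\<dots> \<le> ennreal (2 * (1 + (2 * exp (2 * c * T) * c * T)) * (1 + C + moment_const 1 * L powr (1/2)))"
    using c C0 t' by (intro ennreal_leI mult_mono add_mono) (auto simp: moment_const_def intro!: mult_mono add_nonneg_nonneg)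
  finally have 1: "(\<integral>\<^sup>+\<omega>. ennreal (\<bar>Z \<omega>\<bar> powr 1) \<partial>M) \<le> ennreal (2 * (1 + (2 * exp (2 * c * T) * c * T)) * (1 + C + moment_const 1 * L powr (1/2)))" .
  have "(\<integral>\<^sup>+\<omega>. ennreal \<bar>b (path \<omega> t x)\<bar> \<partial>M) = (\<integral>\<^sup>+\<omega>. ennreal (1 + c) * ennreal (\<bar>Z \<omega>\<bar> powr 1) \<partial>M)"
  proof (intro nn_integral_cong)
    fix \<omega>
    have "\<bar>b (path \<omega> t x)\<bar> = (1 + c) * (\<bar>Z \<omega>\<bar> powr 1)" using c by (simp add: Z_def)
    then show "ennreal \<bar>b (path \<omega> t x)\<bar> = ennreal (1 + c) * ennreal (\<bar>Z \<omega>\<bar> powr 1)"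
      using c by (simp only: ennreal_mult' powr_ge_zero)
  qed
  also have "\<dots> = ennreal (1 + c) * (\<integral>\<^sup>+\<omega>. ennreal (\<bar>Z \<omega>\<bar> powr 1) \<partial>M)"
    using measurable_compose[OF _ measurable_b_path, of "\<lambda>\<omega>. (\<omega>, t, x)" M]
    by (intro nn_integral_cmult) (simp add: Z_def[abs_def])
  also have "\<dots> \<le> ennreal (1 + c) * ennreal (2 * (1 + (2 * exp (2 * c * T) * c * T)) * (1 + C + moment_const 1 * L powr (1/2)))"
    by (intro mult_left_mono 1) simp
  also have "\<dots> = ennreal (2 * (1 + c) * (1 + (2 * exp (2 * c * T) * c * T)) * (1 + C + moment_const 1 * L powr (1/2)))"
    using c by (subst ennreal_mult'[symmetric]) (auto simp only: mult_ac)
  finally show ?thesis .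
qed

end

section \<open>Passage to the limit\<close>

lemma cos_quotient_tendsto:
  fixes d :: "nat \<Rightarrow> real"
  assumes d: "\<And>k. 0 < d k" "d \<longlonglongrightarrow> 0"
  shows "(\<lambda>k. (1 - cos (u * d k)) / (d k)\<^sup>2) \<longlonglongrightarrow> u\<^sup>2 / 2"
proof (cases "u = 0")
  case False
  have "((\<lambda>h::real. sin h / h) \<longlongrightarrow> 1) (at 0)"
    using DERIV_sin[of "0::real"] by (simp add: DERIV_def)
  moreover have "filterlim (\<lambda>k. u * d k / 2) (at 0) sequentially"
  proof (rule filterlim_atI)
    have "(\<lambda>k. u * d k / 2) \<longlonglongrightarrow> u * 0 / 2" by (intro tendsto_intros d) simp
    then show "(\<lambda>k. u * d k / 2) \<longlonglongrightarrow> 0" by simp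
    show "\<forall>\<^sub>F k in sequentially. u * d k / 2 \<noteq> 0" 
    proof (intro always_eventually allI)
      fix k show "u * d k / 2 \<noteq> 0" using False d(1)[of k] by simp
    qed
  qed
  ultimately have "(\<lambda>k. sin (u * d k / 2) / (u * d k / 2)) \<longlonglongrightarrow> 1" by (rule filterlim_compose)
  then have "(\<lambda>k. u\<^sup>2 / 2 * (sin (u * d k / 2) / (u * d k / 2))\<^sup>2) \<longlonglongrightarrow> u\<^sup>2 / 2 * 1\<^sup>2" by (intro tendsto_intros)
  moreover have "u\<^sup>2 / 2 * (sin (u * d k / 2) / (u * d k / 2))\<^sup>2 = (1 - cos (u * d k)) / (d k)\<^sup>2" for k
  proof -
    have "cos (2 * (u * d k / 2)) = 1 - 2 * (sin (u * d k / 2))\<^sup>2" by (rule cos_double_sin)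
    then have "1 - cos (u * d k) = 2 * (sin (u * d k / 2))\<^sup>2" by simp
    then show ?thesis using False d(1)[of k] by (simp add: power_divide power_mult_distrib field_simps)
  qed
  ultimately show ?thesis by (simp only: power_one mult_1_right)
qed simp

text \<open>The central limit theorem for the walk at a fixed time, by Levy continuity:
  \<open>(1 - cos (u * d)) / d^2\<close> tends to \<open>u^2 / 2\<close>. The moving starting points
  enter the characteristic functions as phase factors.\<close>

lemma walk_weak_limit:
  fixes d y :: "nat \<Rightarrow> real"
  assumes d: "\<And>k. 0 < d k" "d \<longlonglongrightarrow> 0" and e: "0 < \<epsilon>" and s: "0 \<le> s" and y: "y \<longlonglongrightarrow> x"
    and f: "continuous_on UNIV f" "\<And>z. \<bar>f z\<bar> \<le> (B :: real)"
  shows "(\<lambda>k. LINT z|walk (d k) \<epsilon> s. f (y k - z)) \<longlonglongrightarrow> (LINT z|gauss \<epsilon> s. f (x - z))"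
proof -
  have [measurable]: "f \<in> borel_measurable borel" using f(1) by (rule borel_measurable_continuous_onI)
  define A where "A k = distr (walk (d k) \<epsilon> s) borel (\<lambda>z. y k - z)" for k
  define A' where "A' = distr (gauss \<epsilon> s) borel (\<lambda>z. x - z)"
  have ms: "sets (walk (d k) \<epsilon> s) = sets borel" "sets (gauss \<epsilon> s) = sets borel" for k
    by (simp_all add: walk_def gauss_def)
  note [measurable_cong] = ms
  have rd: "real_distribution (A k)" for k
    unfolding A_def using real_distribution_walk[of "d k" \<epsilon> s]
    by (intro prob_space.real_distribution_distr) (auto simp: real_distribution_def)
  have rd': "real_distribution A'"
    unfolding A'_def using real_distribution_gauss[of \<epsilon> s]
    by (intro prob_space.real_distribution_distr) (auto simp: real_distribution_def)
  have ch: "char (distr K borel (\<lambda>z. w - z)) u = iexp (u * w) * char K (- u)"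
    if "sets K = sets borel" for K :: "real measure" and w u
  proof -
    note [measurable_cong] = that
    have "char (distr K borel (\<lambda>z. w - z)) u = (CLINT z|K. iexp (u * w) * iexp (- u * z))"
      unfolding char_def by (subst integral_distr) (auto simp: algebra_simps exp_diff exp_minus divide_inverse simp flip: exp_add
          intro!: Bochner_Integration.integral_cong)
    then show ?thesis unfolding char_def by simp
  qed
  have "weak_conv_m A A'"
  proof (rule levy_continuity[OF rd rd'])
    fix u
    have "(\<lambda>k. iexp (u * y k) * complex_of_real (exp (- (\<epsilon> * s * ((1 - cos (u * d k)) / (d k)\<^sup>2)))))
      \<longlonglongrightarrow> iexp (u * x) * complex_of_real (exp (- (\<epsilon> * s * (u\<^sup>2 / 2))))"
      by (intro tendsto_intros y cos_quotient_tendsto d)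
    then show "(\<lambda>k. char (A k) u) \<longlonglongrightarrow> char A' u"
      using e s unfolding A_def A'_def ch[OF ms(1)] ch[OF ms(2)]
      by (simp add: char_walk char_gauss)
  qed
  then have "(\<lambda>k. integral\<^sup>L (A k) f) \<longlonglongrightarrow> integral\<^sup>L A' f"
    using f by (intro weak_conv_imp_integral_bdd_continuous_conv[where B=B] rd rd')
      (auto simp: continuous_on_eq_continuous_at)
  then show ?thesis unfolding A_def A'_def by (simp add: integral_distr)
qed

text \<open>Weak convergence at each time, with the constant \<open>B\<close> as dominating function
  in the time integral.\<close>

lemma dur_walk_tendsto:
  fixes d y :: "nat \<Rightarrow> real" and g :: "real \<Rightarrow> real \<Rightarrow> real"
  assumes d: "\<And>k. 0 < d k" "d \<longlonglongrightarrow> 0" and e: "0 < \<epsilon>" and t: "0 \<le> t" and y: "y \<longlonglongrightarrow> x"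
    and g: "continuous_on UNIV (\<lambda>(r, z). g r z)" "\<And>r z. \<bar>g r z\<bar> \<le> B"
  shows "(\<lambda>k. dur (walk (d k) \<epsilon>) g t (y k)) \<longlonglongrightarrow> dur (gauss \<epsilon>) g t x"
proof -
  \<comment> \<open>Proved for the positive part, then applied to \<open>g\<close> and to
    \<open>- g\<close>.\<close>
  have main: "(\<lambda>k. enn2real (duh (walk (d k) \<epsilon>) (\<lambda>r z. ennreal (g r z)) t (y k))) \<longlonglongrightarrow>
      enn2real (duh (gauss \<epsilon>) (\<lambda>r z. ennreal (g r z)) t x)"
    if g: "continuous_on UNIV (\<lambda>(r, z). g r z)" "\<And>r z. \<bar>g r z\<bar> \<le> B" for g :: "real \<Rightarrow> real \<Rightarrow> real"
  proof -
    interpret G: conv_kernel "gauss \<epsilon>" by (rule conv_kernel_gauss[OF e])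
    have B0: "0 \<le> B" using g(2)[of 0 0] by linarith
    have gm: "(\<lambda>(r, z). ennreal (g r z)) \<in> borel_measurable (borel \<Otimes>\<^sub>M borel)"
      using borel_measurable_continuous_onI[OF g(1)] by (simp add: borel_prod case_prod_unfold)
    have gs: "continuous_on UNIV (g r)" for r
      using continuous_on_compose2[OF g(1) continuous_on_Pair[OF continuous_on_const[of UNIV r] continuous_on_id]] by simp
    have pos: "(\<integral>\<^sup>+z. ennreal (g r (w - z)) \<partial>K) = ennreal (LINT z|K. max 0 (g r (w - z)))"
      if K: "prob_space K" "sets K = sets borel" for K :: "real measure" and r w
    proof -
      interpret K: prob_space K by fact
      note [measurable_cong] = K(2)
      have [measurable]: "g r \<in> borel_measurable borel" by (rule borel_measurable_continuous_onI[OF gs])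
      have "(\<integral>\<^sup>+z. ennreal (g r (w - z)) \<partial>K) = (\<integral>\<^sup>+z. ennreal (max 0 (g r (w - z))) \<partial>K)"
        by (intro nn_integral_cong) (simp add: max_def ennreal_neg)
      also have "\<dots> = ennreal (LINT z|K. max 0 (g r (w - z)))"
        using g(2) B0 by (intro nn_integral_eq_integral K.integrable_const_bound[where B=B]) (auto simp: abs_le_iff)
      finally show ?thesis .
    qed
    have "(\<lambda>k. duh (walk (d k) \<epsilon>) (\<lambda>r z. ennreal (g r z)) t (y k)) \<longlonglongrightarrow> duh (gauss \<epsilon>) (\<lambda>r z. ennreal (g r z)) t x"
      unfolding duh_def
    proof (rule nn_integral_dominated_convergence[where w="\<lambda>r. ennreal B * indicator {0..t} r"])
      show "(\<lambda>r. (\<integral>\<^sup>+z. ennreal (g r (y k - z)) \<partial>walk (d k) \<epsilon> (t - r)) * indicator {0..t} r) \<in> borel_measurable lborel" for k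
      proof -
        interpret Wk: conv_kernel "walk (d k) \<epsilon>" by (rule conv_kernel_walk[OF e d(1)])
        have "(\<lambda>r. \<integral>\<^sup>+z. ennreal (g r (y k - z)) \<partial>walk (d k) \<epsilon> (t - r)) \<in> borel_measurable borel"
          by (rule Wk.measurable_kernel_slice[OF gm]) simp
        then show ?thesis by simp
      qed
      show "(\<lambda>r. (\<integral>\<^sup>+z. ennreal (g r (x - z)) \<partial>gauss \<epsilon> (t - r)) * indicator {0..t} r) \<in> borel_measurable lborel"
      proof -
        have "(\<lambda>r. \<integral>\<^sup>+z. ennreal (g r (x - z)) \<partial>gauss \<epsilon> (t - r)) \<in> borel_measurable borel"
          by (rule G.measurable_kernel_slice[OF gm]) simp
        then show ?thesis by simp
      qed
      show "(\<lambda>r. ennreal B * indicator {0..t} r) \<in> borel_measurable lborel" by simp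
      show "AE r in lborel. (\<integral>\<^sup>+z. ennreal (g r (y k - z)) \<partial>walk (d k) \<epsilon> (t - r)) * indicator {0..t} r \<le> ennreal B * indicator {0..t} r" for k
      proof (rule AE_I2, rule mult_right_mono)
        fix r
        interpret K: real_distribution "walk (d k) \<epsilon> (t - r)" by (rule real_distribution_walk)
        have "(\<integral>\<^sup>+z. ennreal (g r (y k - z)) \<partial>walk (d k) \<epsilon> (t - r)) \<le> (\<integral>\<^sup>+z. ennreal B \<partial>walk (d k) \<epsilon> (t - r))"
          using g(2) by (intro nn_integral_mono ennreal_leI) (simp add: abs_le_iff)
        then show "(\<integral>\<^sup>+z. ennreal (g r (y k - z)) \<partial>walk (d k) \<epsilon> (t - r)) \<le> ennreal B"
          using K.emeasure_space_1 by (simp add: K.space_eq_univ)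
      qed simp
      show "(\<integral>\<^sup>+r. ennreal B * indicator {0..t} r \<partial>lborel) < \<infinity>"
        using t by (simp add: nn_integral_cmult_indicator ennreal_mult_less_top)
      show "AE r in lborel. (\<lambda>k. (\<integral>\<^sup>+z. ennreal (g r (y k - z)) \<partial>walk (d k) \<epsilon> (t - r)) * indicator {0..t} r)
          \<longlonglongrightarrow> (\<integral>\<^sup>+z. ennreal (g r (x - z)) \<partial>gauss \<epsilon> (t - r)) * indicator {0..t} r"
      proof (rule AE_I2)
        fix r
        show "(\<lambda>k. (\<integral>\<^sup>+z. ennreal (g r (y k - z)) \<partial>walk (d k) \<epsilon> (t - r)) * indicator {0..t} r)
          \<longlonglongrightarrow> (\<integral>\<^sup>+z. ennreal (g r (x - z)) \<partial>gauss \<epsilon> (t - r)) * indicator {0..t} r"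
        proof (cases "r \<in> {0..t}")
          case True
          have "(\<lambda>k. LINT z|walk (d k) \<epsilon> (t - r). max 0 (g r (y k - z))) \<longlonglongrightarrow> (LINT z|gauss \<epsilon> (t - r). max 0 (g r (x - z)))"
          proof (rule walk_weak_limit[OF d e _ y, of "t - r" "\<lambda>z. max 0 (g r z)" B])
            show "\<bar>max 0 (g r z)\<bar> \<le> B" for z using g(2)[of r z] B0 by auto
          qed (use True gs in \<open>auto intro!: continuous_intros\<close>)
          then show ?thesis using True real_distribution_walk real_distribution_gauss
            by (simp add: pos real_distribution_def real_distribution_axioms_def tendsto_ennrealI)
        qed simp
      qed
    qed
    moreover have "duh (gauss \<epsilon>) (\<lambda>r z. ennreal (g r z)) t x < top"
    proof -
      have "duh (gauss \<epsilon>) (\<lambda>r z. ennreal (g r z)) t x \<le> duh (gauss \<epsilon>) (\<lambda>r z. ennreal B) t x"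
        using g(2) by (intro G.duh_mono ennreal_leI) (simp add: abs_le_iff)
      also have "\<dots> < top" by (simp add: G.duh_const[OF t] ennreal_mult_less_top)
      finally show ?thesis .
    qed
    ultimately show ?thesis by (intro tendsto_enn2real) auto
  qed
  have "continuous_on UNIV (\<lambda>(r, z). - g r z)"
    using continuous_on_minus[OF g(1)] by (simp add: case_prod_unfold)
  from main[OF g] main[OF this] g(2) show ?thesis unfolding dur_def by (intro tendsto_diff) auto
qed

text \<open>The grid argument of \<open>measurable_continuous_time\<close>, repeated in
  space.\<close>

lemma measurable_continuous_field:
  fixes V :: "real \<Rightarrow> real \<Rightarrow> 'a \<Rightarrow> real"
  assumes T: "0 \<le> T" and m: "\<And>t x. t \<in> {0..T} \<Longrightarrow> V t x \<in> borel_measurable M"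
    and c: "\<And>\<omega>. \<omega> \<in> space M \<Longrightarrow> continuous_on ({0..T} \<times> UNIV) (\<lambda>(t, x). V t x \<omega>)"
  shows "(\<lambda>(\<omega>, t, x). V (clamp_time T t) x \<omega>) \<in> borel_measurable (M \<Otimes>\<^sub>M (borel \<Otimes>\<^sub>M borel))"
proof -
  let ?N = "M \<Otimes>\<^sub>M (borel \<Otimes>\<^sub>M (borel :: real measure)) :: ('a \<times> real \<times> real) measure"
  define g where "g n x = of_int \<lfloor>real (Suc n) * x\<rfloor> / real (Suc n)" for n :: nat and x :: real
  have gl: "(\<lambda>n. g n x) \<longlonglongrightarrow> x" for x
  proof (rule real_tendsto_sandwich)
    have "x - 1 / real (Suc n) \<le> g n x \<and> g n x \<le> x" for n
    proof -
      have "real (Suc n) * x - 1 \<le> of_int \<lfloor>real (Suc n) * x\<rfloor>" "of_int \<lfloor>real (Suc n) * x\<rfloor> \<le> real (Suc n) * x"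
        by linarith+
      then have "(real (Suc n) * x - 1) / real (Suc n) \<le> g n x" "g n x \<le> (real (Suc n) * x) / real (Suc n)"
        unfolding g_def by (intro divide_right_mono; simp)+
      then show ?thesis by (simp add: diff_divide_distrib del: of_nat_Suc)
    qed
    then show "eventually (\<lambda>n. x - 1 / real (Suc n) \<le> g n x) sequentially" "eventually (\<lambda>n. g n x \<le> x) sequentially"
      by auto
    have "(\<lambda>n. x - 1 / real (Suc n)) \<longlonglongrightarrow> x - 0"
      by (intro tendsto_diff tendsto_const LIMSEQ_Suc[OF lim_const_over_n])
    then show "(\<lambda>n. x - 1 / real (Suc n)) \<longlonglongrightarrow> x" by simp
  qed auto
  have "(\<lambda>p. V (clamp_time T (fst (snd p))) (snd (snd p)) (fst p)) \<in> borel_measurable ?N"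
  proof (rule borel_measurable_LIMSEQ_metric)
    show "(\<lambda>p. V (clamp_time T (fst (snd p))) (g n (snd (snd p))) (fst p)) \<in> borel_measurable ?N" for n
    proof -
      have f: "(\<lambda>p. V (clamp_time T (fst (snd p))) (of_int i / real (Suc n)) (fst p)) \<in> borel_measurable ?N" for i :: int
      proof -
        have "continuous_on {0..T} (\<lambda>t. V t z \<omega>)" if "\<omega> \<in> space M" for \<omega> z
          using continuous_on_compose2[OF c[OF that] continuous_on_Pair[OF continuous_on_id[of "{0..T}"] continuous_on_const[of _ z]]] by auto
        from measurable_continuous_time[OF T m this]
        have 1: "(\<lambda>p. V (clamp_time T (snd p)) (of_int i / real (Suc n)) (fst p)) \<in> borel_measurable (M \<Otimes>\<^sub>M borel)" by simp
        have "(\<lambda>p. (fst p, fst (snd p))) \<in> ?N \<rightarrow>\<^sub>M M \<Otimes>\<^sub>M borel" by measurable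
        from measurable_compose[OF this 1] show ?thesis by simp
      qed
      have h: "(\<lambda>p. \<lfloor>real (Suc n) * snd (snd p)\<rfloor>) \<in> ?N \<rightarrow>\<^sub>M count_space UNIV" by measurable
      show ?thesis unfolding g_def by (rule measurable_compose_countable[OF f h])
    qed
    fix p assume "p \<in> space ?N"
    then have w: "fst p \<in> space M" by (auto simp: space_pair_measure)
    have "continuous_on UNIV (\<lambda>x. V (clamp_time T (fst (snd p))) x (fst p))"
      using continuous_on_compose2[OF c[OF w] continuous_on_Pair[OF continuous_on_const[of UNIV "clamp_time T (fst (snd p))"] continuous_on_id]]
        clamp_time_in[OF T, of "fst (snd p)"] by (simp add: image_subset_iff)
    then show "(\<lambda>n. V (clamp_time T (fst (snd p))) (g n (snd (snd p))) (fst p)) \<longlonglongrightarrow> V (clamp_time T (fst (snd p))) (snd (snd p)) (fst p)"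
      by (rule continuous_on_tendsto_compose[OF _ gl]) auto
  qed
  then show ?thesis by (simp add: case_prod_unfold)
qed

section \<open>Localised drift functionals\<close>

text \<open>Locally uniform convergence says nothing about a field far away. Localising the drift by
  this continuous trapezoid makes it bounded for each path and its Duhamel integral continuous in
  the path.\<close>

definition cutoff :: "real \<Rightarrow> real \<Rightarrow> real" where
  "cutoff R y = max 0 (min 1 (R + 1 - \<bar>y\<bar>))"

lemma cutoff_bounds: "0 \<le> cutoff R y" "cutoff R y \<le> 1"
  by (auto simp: cutoff_def)

lemma cutoff_eq_0: "R + 1 \<le> \<bar>y\<bar> \<Longrightarrow> cutoff R y = 0"
  and cutoff_eq_1: "\<bar>y\<bar> \<le> R \<Longrightarrow> cutoff R y = 1"
  by (auto simp: cutoff_def)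

lemma continuous_on_cutoff: "continuous_on S (cutoff R)"
  unfolding cutoff_def[abs_def] by (intro continuous_intros)

lemma measurable_cutoff [measurable]: "cutoff R \<in> borel_measurable borel"
  by (intro borel_measurable_continuous_onI continuous_on_cutoff)

definition local_drift :: "real \<Rightarrow> (real \<Rightarrow> real) \<Rightarrow> real \<Rightarrow> (real \<times> real \<Rightarrow> real) \<Rightarrow> real \<Rightarrow> real \<Rightarrow> real" where
  "local_drift T b R f r y = cutoff R y * b (f (clamp_time T r, y))"

lemma continuous_on_local_drift:
  assumes "0 \<le> T" "continuous_on UNIV b" "continuous_on ({0..T} \<times> UNIV) f"
  shows "continuous_on UNIV (\<lambda>(r, y). local_drift T b R f r y)"
proof -
  have "continuous_on UNIV (\<lambda>p. (clamp_time T (fst p), snd p) :: real \<times> real)"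
    unfolding clamp_time_def by (intro continuous_intros)
  then have "continuous_on UNIV (\<lambda>p. f (clamp_time T (fst p), snd p))"
    by (rule continuous_on_compose2[OF assms(3)]) (use clamp_time_in[OF assms(1)] in \<open>simp add: image_subset_iff\<close>)
  then have "continuous_on UNIV (\<lambda>p. b (f (clamp_time T (fst p), snd p)))"
    by (rule continuous_on_compose2[OF assms(2)]) simp
  moreover have "continuous_on UNIV (\<lambda>p :: real \<times> real. cutoff R (snd p))"
    unfolding cutoff_def by (intro continuous_intros)
  ultimately show ?thesis unfolding local_drift_def case_prod_unfold by (intro continuous_on_mult)
qed

lemma local_drift_bounded:
  assumes T: "0 \<le> T" and b: "continuous_on UNIV b" and f: "continuous_on ({0..T} \<times> UNIV) f"
  obtains B where "0 \<le> B" "\<And>r y. \<bar>local_drift T b R f r y\<bar> \<le> B"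
proof -
  let ?K = "{0..T} \<times> {-(R+1)..R+1}"
  have "continuous_on ?K (\<lambda>p. b (f p))"
    by (rule continuous_on_compose2[OF b continuous_on_subset[OF f]]) auto
  then have "bounded ((\<lambda>p. b (f p)) ` ?K)"
    by (intro compact_imp_bounded compact_continuous_image compact_Times) auto
  then obtain B where B: "\<And>p. p \<in> ?K \<Longrightarrow> \<bar>b (f p)\<bar> \<le> B" unfolding bounded_iff by auto
  have "\<bar>local_drift T b R f r y\<bar> \<le> max 0 B" for r y
  proof (cases "\<bar>y\<bar> \<le> R + 1")
    case True
    then have "\<bar>b (f (clamp_time T r, y))\<bar> \<le> B" using clamp_time_in[OF T, of r] by (intro B) auto
    moreover have "\<bar>local_drift T b R f r y\<bar> \<le> 1 * \<bar>b (f (clamp_time T r, y))\<bar>"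
      unfolding local_drift_def abs_mult using cutoff_bounds[of R y] by (intro mult_right_mono) auto
    ultimately show ?thesis by simp
  next
    case False
    then show ?thesis by (simp add: local_drift_def cutoff_eq_0)
  qed
  then show thesis using that[of "max 0 B"] by simp
qed

text \<open>\<open>b\<close> is uniformly continuous on compact sets of values: on \<open>K\<close>
  the limit stays within \<open>[-m, m]\<close>, and the margin \<open>1\<close> catches the
  approximations.\<close>

lemma uniform_limit_compose_compact:
  fixes fs :: "nat \<Rightarrow> 'a::metric_space \<Rightarrow> real" and b :: "real \<Rightarrow> real"
  assumes u: "uniform_limit K fs f sequentially" and K: "compact K" and f: "continuous_on K f"
    and b: "continuous_on UNIV b" and \<eta>: "0 < \<eta>"
  shows "eventually (\<lambda>j. \<forall>x\<in>K. \<bar>b (fs j x) - b (f x)\<bar> \<le> \<eta>) sequentially"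
proof -
  have "bounded (f ` K)" by (intro compact_imp_bounded compact_continuous_image f K)
  then obtain m where m: "\<And>x. x \<in> K \<Longrightarrow> \<bar>f x\<bar> \<le> m" unfolding bounded_iff by auto
  have "uniformly_continuous_on {-(m+1)..m+1} b"
    by (intro compact_uniformly_continuous continuous_on_subset[OF b]) auto
  then obtain e where e: "0 < e" "\<And>u v. u \<in> {-(m+1)..m+1} \<Longrightarrow> v \<in> {-(m+1)..m+1} \<Longrightarrow> dist u v < e \<Longrightarrow> dist (b u) (b v) < \<eta>"
    using \<eta> unfolding uniformly_continuous_on_def by metis
  have "eventually (\<lambda>j. \<forall>x\<in>K. dist (fs j x) (f x) < min 1 e) sequentially"
  proof -
    have "0 < min 1 e" using e(1) by simp
    then show ?thesis using u unfolding uniform_limit_iff by blast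
  qed
  then show ?thesis
  proof eventually_elim
    case (elim j)
    show ?case
    proof
      fix x assume x: "x \<in> K"
      have "dist (fs j x) (f x) < min 1 e" using elim x by blast
      then have 1: "\<bar>fs j x - f x\<bar> < 1" "dist (fs j x) (f x) < e" by (auto simp: dist_real_def)
      have "fs j x \<in> {-(m+1)..m+1}" "f x \<in> {-(m+1)..m+1}" using m[OF x] 1(1) by (auto simp: abs_le_iff abs_less_iff)
      from e(2)[OF this 1(2)] show "\<bar>b (fs j x) - b (f x)\<bar> \<le> \<eta>" by (simp add: dist_real_def)
    qed
  qed
qed

text \<open>The estimate is free of the kernel and of \<open>x\<close>, so it is a common modulus of
  continuity for the lattice functionals and their limit.\<close>

lemma (in conv_kernel) dur_local_drift_diff:
  assumes T: "0 \<le> T" and b: "continuous_on UNIV b"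
    and f: "continuous_on ({0..T} \<times> UNIV) f" and g: "continuous_on ({0..T} \<times> UNIV) g"
    and t: "0 \<le> t" and \<eta>: "0 \<le> \<eta>"
    and le: "\<And>p. p \<in> {0..T} \<times> {-(R+1)..R+1} \<Longrightarrow> \<bar>b (f p) - b (g p)\<bar> \<le> \<eta>"
  shows "\<bar>dur \<nu> (local_drift T b R f) t x - dur \<nu> (local_drift T b R g) t x\<bar> \<le> \<eta> * t"
proof -
  have m: "(\<lambda>(r, y). local_drift T b R h r y) \<in> borel_measurable (borel \<Otimes>\<^sub>M borel)"
    if "continuous_on ({0..T} \<times> UNIV) h" for h
    using borel_measurable_continuous_onI[OF continuous_on_local_drift[OF T b that]] by (simp add: borel_prod)
  have fin: "duh \<nu> (\<lambda>r y. ennreal \<bar>local_drift T b R h r y\<bar>) t x < \<infinity>"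
    if h: "continuous_on ({0..T} \<times> UNIV) h" for h
  proof -
    obtain B where "0 \<le> B" "\<And>r y. \<bar>local_drift T b R h r y\<bar> \<le> B" by (rule local_drift_bounded[where R = R, OF T b h]) blast
    then have "duh \<nu> (\<lambda>r y. ennreal \<bar>local_drift T b R h r y\<bar>) t x \<le> duh \<nu> (\<lambda>r y. ennreal B) t x"
      by (intro duh_mono ennreal_leI)
    also have "\<dots> < \<infinity>" by (simp add: duh_const[OF t] ennreal_mult_less_top)
    finally show ?thesis .
  qed
  have "ennreal \<bar>dur \<nu> (local_drift T b R f) t x - dur \<nu> (local_drift T b R g) t x\<bar> \<le>
     duh \<nu> (\<lambda>r y. ennreal \<bar>local_drift T b R f r y - local_drift T b R g r y\<bar>) t x"
    by (rule dur_diff_bound[OF m[OF f] m[OF g] fin[OF f] fin[OF g]])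
  also have "\<dots> \<le> duh \<nu> (\<lambda>r y. ennreal \<eta>) t x"
  proof (intro duh_mono ennreal_leI)
    fix r y
    show "\<bar>local_drift T b R f r y - local_drift T b R g r y\<bar> \<le> \<eta>"
    proof (cases "\<bar>y\<bar> \<le> R + 1")
      case True
      then have l: "\<bar>b (f (clamp_time T r, y)) - b (g (clamp_time T r, y))\<bar> \<le> \<eta>"
        using clamp_time_in[OF T, of r] by (intro le) auto
      have "\<bar>local_drift T b R f r y - local_drift T b R g r y\<bar> = cutoff R y * \<bar>b (f (clamp_time T r, y)) - b (g (clamp_time T r, y))\<bar>"
        unfolding local_drift_def using cutoff_bounds[of R y] by (simp add: abs_mult flip: right_diff_distrib)
      also have "\<dots> \<le> 1 * \<eta>" using cutoff_bounds[of R y] l by (intro mult_mono) auto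
      finally show ?thesis by simp
    next
      case False
      then show ?thesis using \<eta> by (simp add: local_drift_def cutoff_eq_0)
    qed
  qed
  also have "\<dots> = ennreal (\<eta> * t)" using \<eta> by (simp add: duh_const[OF t] ennreal_mult')
  finally show ?thesis using \<eta> t by (subst (asm) ennreal_le_iff) auto
qed

text \<open>Seen from \<open>x\<close>, the cutoff acts after a displacement of at least
  \<open>R - Rx\<close>, which Chebyshev's inequality bounds through the second moment of the
  kernel.\<close>

lemma (in conv_kernel) duh_cutoff_tail:
  assumes mom: "\<And>s. 0 \<le> s \<Longrightarrow> s \<le> t \<Longrightarrow> (\<integral>\<^sup>+z. ennreal (z\<^sup>2) \<partial>\<nu> s) \<le> ennreal (\<epsilon> * t)"
    and t: "0 \<le> t" and R: "\<bar>x\<bar> \<le> Rx" "Rx < R" and A: "0 \<le> A" and e: "0 \<le> \<epsilon>"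
  shows "duh \<nu> (\<lambda>r y. ennreal (1 - cutoff R y) * ennreal A) t x \<le> ennreal (A * t * (\<epsilon> * t / (R - Rx)\<^sup>2))"
proof -
  have "(\<integral>\<^sup>+z. ennreal (1 - cutoff R (x - z)) * ennreal A \<partial>\<nu> (t - r)) \<le> ennreal (A * (\<epsilon> * t / (R - Rx)\<^sup>2))"
    if r: "0 \<le> r" "r \<le> t" for r
  proof -
    have "(\<integral>\<^sup>+z. ennreal (1 - cutoff R (x - z)) * ennreal A \<partial>\<nu> (t - r)) \<le> (\<integral>\<^sup>+z. ennreal (A / (R - Rx)\<^sup>2) * ennreal (z\<^sup>2) \<partial>\<nu> (t - r))"
    proof (rule nn_integral_mono)
      fix z
      have "(1 - cutoff R (x - z)) * A \<le> A / (R - Rx)\<^sup>2 * z\<^sup>2"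
      proof (cases "\<bar>x - z\<bar> \<le> R")
        case True
        then show ?thesis using A by (simp add: cutoff_eq_1)
      next
        case False
        then have "R - Rx \<le> \<bar>z\<bar>" using R by linarith
        then have "(R - Rx)\<^sup>2 \<le> \<bar>z\<bar>\<^sup>2" using R by (intro power_mono) auto
        then have "1 \<le> z\<^sup>2 / (R - Rx)\<^sup>2" using R by (simp add: field_simps)
        then have "A * 1 \<le> A * (z\<^sup>2 / (R - Rx)\<^sup>2)" using A by (intro mult_left_mono)
        moreover have "(1 - cutoff R (x - z)) * A \<le> 1 * A" using A cutoff_bounds[of R] by (intro mult_right_mono) auto
        ultimately show ?thesis by simp
      qed
      then show "ennreal (1 - cutoff R (x - z)) * ennreal A \<le> ennreal (A / (R - Rx)\<^sup>2) * ennreal (z\<^sup>2)"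
        using A cutoff_bounds[of R] by (simp add: ennreal_leI flip: ennreal_mult')
    qed
    also have "\<dots> = ennreal (A / (R - Rx)\<^sup>2) * (\<integral>\<^sup>+z. ennreal (z\<^sup>2) \<partial>\<nu> (t - r))"
      by (rule nn_integral_cmult) measurable
    also have "\<dots> \<le> ennreal (A / (R - Rx)\<^sup>2) * ennreal (\<epsilon> * t)"
      using r by (intro mult_left_mono mom) auto
    also have "\<dots> = ennreal (A * (\<epsilon> * t / (R - Rx)\<^sup>2))" using A by (simp flip: ennreal_mult')
    finally show ?thesis .
  qed
  then have "duh \<nu> (\<lambda>r y. ennreal (1 - cutoff R y) * ennreal A) t x \<le> (\<integral>\<^sup>+r. ennreal (A * (\<epsilon> * t / (R - Rx)\<^sup>2)) * indicator {0..t} r \<partial>lborel)"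
    unfolding duh_def by (intro nn_integral_mono) (auto simp: indicator_def)
  also have "\<dots> = ennreal (A * (\<epsilon> * t / (R - Rx)\<^sup>2)) * ennreal t"
    using t by (subst nn_integral_cmult_indicator) auto
  also have "\<dots> = ennreal (A * (\<epsilon> * t / (R - Rx)\<^sup>2) * t)"
    using t by (intro ennreal_mult''[symmetric])
  also have "A * (\<epsilon> * t / (R - Rx)\<^sup>2) * t = A * t * (\<epsilon> * t / (R - Rx)\<^sup>2)" by simp
  finally show ?thesis .
qed

text \<open>Once the drift has a first moment, the Duhamel formula bounds the path directly: initial
  term, residual and integrated drift.\<close>

lemma (in lattice_solution) path_first_moment:
  assumes x: "x \<in> lattice \<delta>" and t: "t \<in> {0..T}" and L0: "0 < L"
    and L: "gu * \<epsilon>2\<^sup>2 / \<delta> * min T (\<delta> * (2 * sqrt T / sqrt \<epsilon>1)) \<le> L"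
    and A: "\<And>s y. s \<in> {0..T} \<Longrightarrow> y \<in> lattice \<delta> \<Longrightarrow> (\<integral>\<^sup>+\<omega>. ennreal \<bar>b (path \<omega> s y)\<bar> \<partial>M) \<le> ennreal A" and A0: "0 \<le> A"
  shows "(\<integral>\<^sup>+\<omega>. ennreal \<bar>path \<omega> t x\<bar> \<partial>M) \<le> ennreal (C + moment_const 1 * L powr (1/2) + A * T)"
proof -
  have t': "0 \<le> t" "t \<le> T" using t by auto
  let ?\<nu> = "walk \<delta> \<epsilon>1"
  have mb: "(\<lambda>(\<omega>, r, y). ennreal \<bar>b (path \<omega> r y)\<bar>) \<in> borel_measurable (M \<Otimes>\<^sub>M (borel \<Otimes>\<^sub>M borel))"
    using measurable_b_path by (simp add: case_prod_unfold)
  have [measurable]: "(\<lambda>\<omega>. duh ?\<nu> (\<lambda>r y. ennreal \<bar>b (path \<omega> r y)\<bar>) t x) \<in> borel_measurable M"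
    by (rule kern.measurable_duh[OF mb]) auto
  have [measurable]: "(\<lambda>\<omega>. res \<omega> t x) \<in> borel_measurable M"
    using measurable_compose[OF _ measurable_res, of "\<lambda>\<omega>. (\<omega>, t, x)" M] by simp
  have "(\<integral>\<^sup>+\<omega>. ennreal \<bar>path \<omega> t x\<bar> \<partial>M) \<le> (\<integral>\<^sup>+\<omega>. ennreal C + ennreal (\<bar>res \<omega> t x\<bar> powr 1) + duh ?\<nu> (\<lambda>r y. ennreal \<bar>b (path \<omega> r y)\<bar>) t x \<partial>M)"
  proof (rule nn_integral_mono)
    fix \<omega> assume w: "\<omega> \<in> space M"
    let ?D = "dur ?\<nu> (\<lambda>r y. b (path \<omega> r y)) t x"
    have "\<bar>path \<omega> t x\<bar> \<le> C + \<bar>res \<omega> t x\<bar> + \<bar>?D\<bar>"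
      using kern.kernel_initial_bound[OF \<xi>, of t x] unfolding res_def by linarith
    then have "ennreal \<bar>path \<omega> t x\<bar> \<le> ennreal C + ennreal \<bar>res \<omega> t x\<bar> + ennreal \<bar>?D\<bar>"
      using C0 by (simp add: ennreal_leI flip: ennreal_plus)
    also have "ennreal \<bar>?D\<bar> \<le> duh ?\<nu> (\<lambda>r y. ennreal \<bar>b (path \<omega> r y)\<bar>) t x"
      by (rule kern.dur_bound[OF kern.measurable_section_pair[OF measurable_b_path w]])
    finally show "ennreal \<bar>path \<omega> t x\<bar> \<le> ennreal C + ennreal (\<bar>res \<omega> t x\<bar> powr 1) + duh ?\<nu> (\<lambda>r y. ennreal \<bar>b (path \<omega> r y)\<bar>) t x"
      by (simp add: add_left_mono)
  qed
  also have "\<dots> = ennreal C + (\<integral>\<^sup>+\<omega>. ennreal (\<bar>res \<omega> t x\<bar> powr 1) \<partial>M) + (\<integral>\<^sup>+\<omega>. duh ?\<nu> (\<lambda>r y. ennreal \<bar>b (path \<omega> r y)\<bar>) t x \<partial>M)"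
    by (simp add: nn_integral_add emeasure_space_1)
  also have "\<dots> \<le> ennreal C + ennreal (moment_const 1 * L powr (1/2)) + ennreal (A * T)"
  proof (intro add_mono order_refl)
    show "(\<integral>\<^sup>+\<omega>. ennreal (\<bar>res \<omega> t x\<bar> powr 1) \<partial>M) \<le> ennreal (moment_const 1 * L powr (1/2))"
      by (rule sub_exp_moment[OF res_sub_exp[OF x t L] L0]) simp
    have "(\<integral>\<^sup>+\<omega>. duh ?\<nu> (\<lambda>r y. ennreal \<bar>b (path \<omega> r y)\<bar>) t x \<partial>M) = duh ?\<nu> (\<lambda>r y. \<integral>\<^sup>+\<omega>. ennreal \<bar>b (path \<omega> r y)\<bar> \<partial>M) t x"
      by (rule kern.nn_integral_duh[OF prob_space_axioms mb])
    also have "\<dots> = duh ?\<nu> (\<lambda>r y. indicator (lattice \<delta>) y * (\<integral>\<^sup>+\<omega>. ennreal \<bar>b (path \<omega> r y)\<bar> \<partial>M)) t x"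
      by (rule duh_walk_cong[OF x]) simp
    also have "\<dots> \<le> duh ?\<nu> (\<lambda>r y. ennreal A) t x"
      using A t' by (intro kern.duh_mono) (auto simp: indicator_def)
    also have "\<dots> = ennreal (A * t)" using A0 by (simp add: kern.duh_const[OF t'(1)] ennreal_mult')
    also have "\<dots> \<le> ennreal (A * T)" using A0 t' by (intro ennreal_leI mult_left_mono)
    finally show "(\<integral>\<^sup>+\<omega>. duh ?\<nu> (\<lambda>r y. ennreal \<bar>b (path \<omega> r y)\<bar>) t x \<partial>M) \<le> ennreal (A * T)" .
  qed
  also have "\<dots> = ennreal (C + moment_const 1 * L powr (1/2) + A * T)"
    using C0 A0 T by (simp add: moment_const_def)
  finally show ?thesis .
qed

section \<open>The limit field and its approximating functionals\<close>

text \<open>The subsequence is already absorbed into the index \<open>k\<close>. \<open>V\<close> is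
  the limit in law with all paths continuous, of which the solution is a modification; nothing is
  assumed about noise on its space \<open>M\<close>.\<close>

locale weak_limit =
  fixes N :: "'a measure" and F :: "real \<Rightarrow> 'a measure" and W :: "nat \<Rightarrow> real \<Rightarrow> real \<Rightarrow> 'a \<Rightarrow> real"
    and d :: "nat \<Rightarrow> real" and \<epsilon>1 \<epsilon>2 T :: real and a b \<xi> :: "real \<Rightarrow> real"
    and X :: "nat \<Rightarrow> real \<Rightarrow> real \<Rightarrow> 'a \<Rightarrow> real" and c C gl gu :: real
    and M :: "'b measure" and V :: "real \<Rightarrow> real \<Rightarrow> 'b \<Rightarrow> real"
  assumes ls: "\<And>k. lattice_solution N F (W k) (d k) \<epsilon>1 \<epsilon>2 T a b \<xi> (X k) c C gl gu"
    and d0: "d \<longlonglongrightarrow> 0" and M: "prob_space M"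
    and Vm: "\<And>t x. t \<in> {0..T} \<Longrightarrow> V t x \<in> borel_measurable M"
    and Vc: "\<And>\<omega>. \<omega> \<in> space M \<Longrightarrow> continuous_on ({0..T} \<times> UNIV) (\<lambda>(t, x). V t x \<omega>)"
    and law: "converges_in_law T N (\<lambda>k t x \<omega>. lin_interp (d k) (\<lambda>y. X k y t \<omega>) x) M V"
begin

sublocale prob_space M by (rule M)
sublocale L: lattice_solution N F "W k" "d k" \<epsilon>1 \<epsilon>2 T a b \<xi> "X k" c C gl gu for k by (rule ls)

lemma eps: "0 < \<epsilon>1" "0 < \<epsilon>2" and Tpos: "0 < T" and dpos: "0 < d k" and cpos: "0 < c"
  and b_cont: "continuous_on UNIV b" and b_growth: "\<bar>b u\<bar> \<le> c * (1 + \<bar>u\<bar>)"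
  and xi_cont: "continuous_on UNIV \<xi>" and xi_bound: "\<bar>\<xi> y\<bar> \<le> C"
  using L.\<epsilon>1 L.\<epsilon>2 L.T L.\<delta>[of k] L.c L.b L.growth[of u] L.\<xi> by auto

sublocale G: conv_kernel "gauss \<epsilon>1" by (rule conv_kernel_gauss[OF eps(1)])

definition field :: "'b \<Rightarrow> real \<Rightarrow> real \<Rightarrow> real" where
  "field \<omega> t x = V (clamp_time T t) x \<omega>"

lemma measurable_field: "(\<lambda>(\<omega>, t, x). field \<omega> t x) \<in> borel_measurable (M \<Otimes>\<^sub>M (borel \<Otimes>\<^sub>M borel))"
  unfolding field_def using Tpos Vm Vc by (intro measurable_continuous_field) auto

lemma measurable_b_field: "(\<lambda>(\<omega>, t, x). b (field \<omega> t x)) \<in> borel_measurable (M \<Otimes>\<^sub>M (borel \<Otimes>\<^sub>M borel))"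
  using measurable_compose[OF measurable_field L.measurable_b] by (simp add: case_prod_unfold)

text \<open>Noise estimates hold at lattice sites, so a point \<open>x\<close> is approached through
  the last site not above it.\<close>

definition node :: "real \<Rightarrow> nat \<Rightarrow> real" where
  "node x k = of_int \<lfloor>x / d k\<rfloor> * d k"

lemma node_lattice: "node x k \<in> lattice (d k)"
  unfolding node_def lattice_def by blast

lemma node_tendsto: "node x \<longlonglongrightarrow> x"
proof (rule real_tendsto_sandwich)
  have "x - d k \<le> node x k \<and> node x k \<le> x" for k
  proof -
    have "x / d k - 1 \<le> of_int \<lfloor>x / d k\<rfloor>" "of_int \<lfloor>x / d k\<rfloor> \<le> x / d k" by linarith+
    then have "(x / d k - 1) * d k \<le> node x k" "node x k \<le> x / d k * d k"
      unfolding node_def using dpos[of k] by (intro mult_right_mono; simp)+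
    then show ?thesis using dpos[of k] by (simp add: left_diff_distrib)
  qed
  then show "eventually (\<lambda>k. x - d k \<le> node x k) sequentially" "eventually (\<lambda>k. node x k \<le> x) sequentially" by auto
  show "(\<lambda>k. x - d k) \<longlonglongrightarrow> x" using tendsto_diff[OF tendsto_const d0, of x] by simp
qed auto

lemma node_bounded: "\<exists>Rx\<ge>0. \<bar>x\<bar> \<le> Rx \<and> (\<forall>k. \<bar>node x k\<bar> \<le> Rx)"
proof -
  have "Bseq (node x)" using node_tendsto convergentI convergent_imp_Bseq by blast
  then obtain K where "\<And>k. \<bar>node x k\<bar> \<le> K" unfolding Bseq_def by auto
  then show ?thesis by (intro exI[of _ "max \<bar>x\<bar> K"]) (auto simp: le_max_iff_disj)
qed

text \<open>With \<open>\<kappa> = 1\<close> this is the stochastic convolution with localised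
  drift, with \<open>\<kappa> = 0\<close> the evaluation of the path, so one limit lemma yields both
  Gaussian bounds and moments of the field.\<close>

definition functional ::
  "(real \<Rightarrow> real measure) \<Rightarrow> real \<Rightarrow> real \<Rightarrow> real \<Rightarrow> real \<Rightarrow> (real \<times> real \<Rightarrow> real) \<Rightarrow> real" where
  "functional \<nu> \<kappa> R t x f = f (t, x) - \<kappa> * (kernel_initial \<nu> \<xi> t x + dur \<nu> (local_drift T b R f) t x)"

lemma functional_path:
  assumes "t \<in> {0..T}"
  shows "functional \<nu> \<kappa> R t x (\<lambda>(t, x). lin_interp (d k) (\<lambda>y. X k y t \<omega>) x)
    = L.path k \<omega> t x - \<kappa> * (kernel_initial \<nu> \<xi> t x + dur \<nu> (\<lambda>r y. cutoff R y * b (L.path k \<omega> r y)) t x)"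
  using assms Tpos unfolding functional_def local_drift_def L.path_def interp_path_def by simp

lemma functional_field:
  assumes "t \<in> {0..T}"
  shows "functional \<nu> \<kappa> R t x (\<lambda>(t, x). V t x \<omega>)
    = field \<omega> t x - \<kappa> * (kernel_initial \<nu> \<xi> t x + dur \<nu> (\<lambda>r y. cutoff R y * b (field \<omega> r y)) t x)"
  using assms Tpos unfolding functional_def local_drift_def field_def by simp

lemma functional_measurable:
  assumes P: "(\<lambda>(\<omega>, r, y). f \<omega> r y) \<in> borel_measurable (K \<Otimes>\<^sub>M (borel \<Otimes>\<^sub>M borel))" and \<nu>: "conv_kernel \<nu>"
  shows "(\<lambda>\<omega>. f \<omega> t x - \<kappa> * (kernel_initial \<nu> \<xi> t x + dur \<nu> (\<lambda>r y. cutoff R y * b (f \<omega> r y)) t x)) \<in> borel_measurable K"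
proof -
  interpret conv_kernel \<nu> by fact
  have [measurable]: "(\<lambda>\<omega>. f \<omega> t x) \<in> borel_measurable K"
    using measurable_compose[OF _ P, of "\<lambda>\<omega>. (\<omega>, t, x)" K] by simp
  have "(\<lambda>p. b (f (fst p) (fst (snd p)) (snd (snd p)))) \<in> borel_measurable (K \<Otimes>\<^sub>M (borel \<Otimes>\<^sub>M borel))"
    using measurable_compose[OF P L.measurable_b] by (simp add: case_prod_unfold)
  then have "(\<lambda>(\<omega>, r, y). cutoff R y * b (f \<omega> r y)) \<in> borel_measurable (K \<Otimes>\<^sub>M (borel \<Otimes>\<^sub>M borel))"
    unfolding case_prod_unfold by measurable
  from measurable_dur[OF this, of "\<lambda>_. t" "\<lambda>_. x"] show ?thesis by measurable
qed

text \<open>The common modulus comes from \<open>dur_local_drift_diff\<close>, the pointwise limits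
  from the central limit theorem for the walk.\<close>

lemma functional_limit:
  assumes t: "t \<in> {0..T}" and R: "0 \<le> R"
    and g: "\<And>u. \<bar>g u\<bar> \<le> B" "\<And>u v. \<bar>g u - g v\<bar> \<le> K * min 1 \<bar>u - v\<bar>" "0 < K"
  shows "(\<lambda>k. \<integral>\<omega>. g (functional (walk (d k) \<epsilon>1) \<kappa> R t (node x k) (\<lambda>(t, x). lin_interp (d k) (\<lambda>y. X k y t \<omega>) x)) \<partial>N)
    \<longlonglongrightarrow> (\<integral>\<omega>. g (functional (gauss \<epsilon>1) \<kappa> R t x (\<lambda>(t, x). V t x \<omega>)) \<partial>M)"
proof (rule converges_in_law_functionals[OF L.prob_space_axioms M law Vc _ _ _ _ _ _ g])
  have t': "0 \<le> t" "t \<le> T" using t by auto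
  have T0: "0 \<le> T" using Tpos by simp
  \<comment> \<open>One compact interval contains \<open>x\<close> and all its nodes, so locally
    uniform convergence controls every evaluation at once.\<close>
  obtain Rx where Rx: "0 \<le> Rx" "\<bar>x\<bar> \<le> Rx" "\<And>k. \<bar>node x k\<bar> \<le> Rx" using node_bounded[of x] by blast
  show "(\<lambda>\<omega>. functional (gauss \<epsilon>1) \<kappa> R t x (\<lambda>(t, x). lin_interp (d j) (\<lambda>y. X j y t \<omega>) x)) \<in> borel_measurable N" for j
    unfolding functional_path[OF t] by (rule functional_measurable[OF L.measurable_path G.conv_kernel_axioms])
  show "(\<lambda>\<omega>. functional (walk (d k) \<epsilon>1) \<kappa> R t (node x k) (\<lambda>(t, x). lin_interp (d j) (\<lambda>y. X j y t \<omega>) x)) \<in> borel_measurable N" for j k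
    unfolding functional_path[OF t] by (rule functional_measurable[OF L.measurable_path L.kern.conv_kernel_axioms])
  show "(\<lambda>\<omega>. functional (gauss \<epsilon>1) \<kappa> R t x (\<lambda>(t, x). V t x \<omega>)) \<in> borel_measurable M"
    unfolding functional_field[OF t] by (rule functional_measurable[OF measurable_field G.conv_kernel_axioms])
  show "(\<lambda>\<omega>. functional (walk (d k) \<epsilon>1) \<kappa> R t (node x k) (\<lambda>(t, x). V t x \<omega>)) \<in> borel_measurable M" for k
    unfolding functional_field[OF t] by (rule functional_measurable[OF measurable_field L.kern.conv_kernel_axioms])
  show "(\<lambda>k. functional (walk (d k) \<epsilon>1) \<kappa> R t (node x k) f) \<longlonglongrightarrow> functional (gauss \<epsilon>1) \<kappa> R t x f"
    if f: "continuous_on ({0..T} \<times> UNIV) f" for f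
  proof -
    have "continuous_on UNIV (\<lambda>x. f (t, x))"
      using continuous_on_compose2[OF f continuous_on_Pair[OF continuous_on_const[of UNIV t] continuous_on_id]] t
      by (simp add: image_subset_iff)
    then have "(\<lambda>k. f (t, node x k)) \<longlonglongrightarrow> f (t, x)"
      by (rule continuous_on_tendsto_compose[OF _ node_tendsto]) auto
    moreover have "(\<lambda>k. kernel_initial (walk (d k) \<epsilon>1) \<xi> t (node x k)) \<longlonglongrightarrow> kernel_initial (gauss \<epsilon>1) \<xi> t x"
      unfolding kernel_initial_def
      by (rule walk_weak_limit[OF dpos d0 eps(1) t'(1) node_tendsto xi_cont xi_bound])
    moreover have "(\<lambda>k. dur (walk (d k) \<epsilon>1) (local_drift T b R f) t (node x k)) \<longlonglongrightarrow> dur (gauss \<epsilon>1) (local_drift T b R f) t x"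
    proof -
      obtain B where "\<And>r y. \<bar>local_drift T b R f r y\<bar> \<le> B" by (rule local_drift_bounded[where R = R, OF T0 b_cont f]) blast
      then show ?thesis
        by (rule dur_walk_tendsto[OF dpos d0 eps(1) t'(1) node_tendsto continuous_on_local_drift[OF T0 b_cont f]])
    qed
    ultimately show ?thesis unfolding functional_def by (intro tendsto_intros)
  qed
  show "\<forall>\<^sub>F j in sequentially. \<bar>functional (gauss \<epsilon>1) \<kappa> R t x (fs j) - functional (gauss \<epsilon>1) \<kappa> R t x f\<bar> \<le> \<eta> \<and>
      (\<forall>k. \<bar>functional (walk (d k) \<epsilon>1) \<kappa> R t (node x k) (fs j) - functional (walk (d k) \<epsilon>1) \<kappa> R t (node x k) f\<bar> \<le> \<eta>)"
    if fs: "\<And>j. continuous_on ({0..T} \<times> UNIV) (fs j)" and f: "continuous_on ({0..T} \<times> UNIV) f"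
      and ul: "\<And>R. uniform_limit ({0..T} \<times> {- R..R}) fs f sequentially" and \<eta>: "0 < \<eta>" for fs f \<eta>
  proof -
    \<comment> \<open>Half of \<open>\<eta>\<close> goes to the point evaluation, half to the drift;
      the added \<open>1\<close> keeps the denominator positive when
      \<open>\<kappa> = 0\<close>.\<close>
    define \<eta>' where "\<eta>' = \<eta> / (2 * (1 + \<bar>\<kappa>\<bar> * T))"
    have pos: "0 < 1 + \<bar>\<kappa>\<bar> * T" using Tpos by (simp add: add_pos_nonneg)
    then have \<eta>': "0 < \<eta>'" using \<eta> by (simp add: \<eta>'_def)
    have k\<eta>: "\<bar>\<kappa>\<bar> * (\<eta>' * t) \<le> \<eta> / 2"
    proof -
      have "\<bar>\<kappa>\<bar> * (\<eta>' * t) \<le> (1 + \<bar>\<kappa>\<bar> * T) * \<eta>'"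
      proof -
        have "\<bar>\<kappa>\<bar> * t \<le> 1 + \<bar>\<kappa>\<bar> * T" using mult_left_mono[OF t'(2), of "\<bar>\<kappa>\<bar>"] by simp
        then have "(\<bar>\<kappa>\<bar> * t) * \<eta>' \<le> (1 + \<bar>\<kappa>\<bar> * T) * \<eta>'" using \<eta>' by (intro mult_right_mono) auto
        then show ?thesis by (simp add: mult_ac)
      qed
      also have "\<dots> = \<eta> / 2"
      proof -
        have "p * (\<eta> / (2 * p)) = \<eta> / 2" if "0 < p" for p using that by simp
        from this[OF pos] show ?thesis unfolding \<eta>'_def .
      qed
      finally show ?thesis .
    qed
    let ?K = "{0..T} \<times> {-(R+1)..R+1}"
    have "eventually (\<lambda>j. \<forall>p\<in>{0..T} \<times> {-Rx..Rx}. dist (fs j p) (f p) < \<eta> / 2) sequentially"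
      using ul[of Rx] \<eta> unfolding uniform_limit_iff by (meson half_gt_zero)
    moreover have "eventually (\<lambda>j. \<forall>p\<in>?K. \<bar>b (fs j p) - b (f p)\<bar> \<le> \<eta>') sequentially"
      by (rule uniform_limit_compose_compact[OF ul _ continuous_on_subset[OF f] b_cont \<eta>']) (auto intro: compact_Times)
    ultimately show ?thesis
    proof eventually_elim
      case (elim j)
      have *: "\<bar>functional \<nu> \<kappa> R t w (fs j) - functional \<nu> \<kappa> R t w f\<bar> \<le> \<eta>"
        if \<nu>: "conv_kernel \<nu>" and w: "\<bar>w\<bar> \<le> Rx" for \<nu> w
      proof -
        interpret conv_kernel \<nu> by (rule \<nu>)
        have 1: "\<bar>fs j (t, w) - f (t, w)\<bar> < \<eta> / 2"
        proof -
          have "(t, w) \<in> {0..T} \<times> {-Rx..Rx}" using t w by (auto simp: abs_le_iff)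
          then show ?thesis using elim(1) by (auto simp: dist_real_def)
        qed
        have "\<bar>dur \<nu> (local_drift T b R (fs j)) t w - dur \<nu> (local_drift T b R f) t w\<bar> \<le> \<eta>' * t"
          by (rule dur_local_drift_diff[OF T0 b_cont fs f t'(1) less_imp_le[OF \<eta>']]) (use elim(2) in blast)
        then have "\<bar>\<kappa>\<bar> * \<bar>dur \<nu> (local_drift T b R (fs j)) t w - dur \<nu> (local_drift T b R f) t w\<bar> \<le> \<bar>\<kappa>\<bar> * (\<eta>' * t)"
          by (intro mult_left_mono) auto
        then have 2: "\<bar>\<kappa> * (dur \<nu> (local_drift T b R (fs j)) t w - dur \<nu> (local_drift T b R f) t w)\<bar> \<le> \<eta> / 2"
          using k\<eta> by (simp add: abs_mult)
        have "functional \<nu> \<kappa> R t w (fs j) - functional \<nu> \<kappa> R t w f = (fs j (t, w) - f (t, w))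
           - \<kappa> * (dur \<nu> (local_drift T b R (fs j)) t w - dur \<nu> (local_drift T b R f) t w)"
          by (simp add: functional_def algebra_simps)
        then show ?thesis using 1 2 by linarith
      qed
      show ?case using *[OF G.conv_kernel_axioms Rx(2)] *[OF L.kern.conv_kernel_axioms Rx(3)] by blast
    qed
  qed
qed

end

section \<open>Removal of the cutoff\<close>

text \<open>A Lipschitz test function sees the difference of the two Duhamel integrals in mean.
  There the first moments of the source, uniform in space, multiply the kernel tail beyond the
  cutoff.\<close>

lemma (in conv_kernel) cutoff_error:
  fixes g :: "real \<Rightarrow> real"
  assumes K: "prob_space K"
    and h: "(\<lambda>(\<omega>, r, y). h \<omega> r y) \<in> borel_measurable (K \<Otimes>\<^sub>M (borel \<Otimes>\<^sub>M borel))"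
    and A: "\<And>r y. 0 \<le> r \<Longrightarrow> r \<le> t \<Longrightarrow> (\<integral>\<^sup>+\<omega>. ennreal \<bar>h \<omega> r y\<bar> \<partial>K) \<le> ennreal A" "0 \<le> A"
    and mom: "\<And>s. 0 \<le> s \<Longrightarrow> s \<le> t \<Longrightarrow> (\<integral>\<^sup>+z. ennreal (z\<^sup>2) \<partial>\<nu> s) \<le> ennreal (\<epsilon> * t)"
    and t: "0 \<le> t" and R: "\<bar>x\<bar> \<le> Rx" "Rx < R" and e: "0 \<le> \<epsilon>"
    and g: "\<And>u. \<bar>g u\<bar> \<le> B" "\<And>u v. \<bar>g u - g v\<bar> \<le> L * min 1 \<bar>u - v\<bar>" "0 < L" "g \<in> borel_measurable borel"
    and Z: "Z \<in> borel_measurable K"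
  shows "\<bar>(\<integral>\<omega>. g (Z \<omega> - dur \<nu> (\<lambda>r y. cutoff R y * h \<omega> r y) t x) \<partial>K) - (\<integral>\<omega>. g (Z \<omega> - dur \<nu> (h \<omega>) t x) \<partial>K)\<bar>
    \<le> L * (A * t * (\<epsilon> * t / (R - Rx)\<^sup>2))"
proof -
  interpret K: prob_space K by fact
  have [measurable]: "(\<lambda>p. h (fst p) (fst (snd p)) (snd (snd p))) \<in> borel_measurable (K \<Otimes>\<^sub>M (borel \<Otimes>\<^sub>M borel))"
    using h by (simp add: case_prod_unfold)
  have m: "(\<lambda>(\<omega>, r, y). cutoff R y * h \<omega> r y) \<in> borel_measurable (K \<Otimes>\<^sub>M (borel \<Otimes>\<^sub>M borel))"
    "(\<lambda>(\<omega>, r, y). ennreal \<bar>h \<omega> r y\<bar>) \<in> borel_measurable (K \<Otimes>\<^sub>M (borel \<Otimes>\<^sub>M borel))"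
    "(\<lambda>(\<omega>, r, y). ennreal \<bar>cutoff R y * h \<omega> r y - h \<omega> r y\<bar>) \<in> borel_measurable (K \<Otimes>\<^sub>M (borel \<Otimes>\<^sub>M borel))"
    unfolding case_prod_unfold by measurable
  note [measurable] = Z g(4)
  have [measurable]: "(\<lambda>\<omega>. dur \<nu> (\<lambda>r y. cutoff R y * h \<omega> r y) t x) \<in> borel_measurable K"
    "(\<lambda>\<omega>. dur \<nu> (h \<omega>) t x) \<in> borel_measurable K"
    "(\<lambda>\<omega>. duh \<nu> (\<lambda>r y. ennreal \<bar>h \<omega> r y\<bar>) t x) \<in> borel_measurable K"
    "(\<lambda>\<omega>. duh \<nu> (\<lambda>r y. ennreal \<bar>cutoff R y * h \<omega> r y - h \<omega> r y\<bar>) t x) \<in> borel_measurable K"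
    by (rule measurable_dur[OF m(1)] measurable_dur[OF h] measurable_duh[OF m(2)] measurable_duh[OF m(3)]; simp)+
  define G1 where "G1 \<omega> = g (Z \<omega> - dur \<nu> (\<lambda>r y. cutoff R y * h \<omega> r y) t x)" for \<omega>
  define G2 where "G2 \<omega> = g (Z \<omega> - dur \<nu> (h \<omega>) t x)" for \<omega>
  have [measurable]: "G1 \<in> borel_measurable K" "G2 \<in> borel_measurable K"
    unfolding G1_def[abs_def] G2_def[abs_def] by measurable
  have i: "integrable K G1" "integrable K G2" "integrable K (\<lambda>\<omega>. \<bar>G1 \<omega> - G2 \<omega>\<bar>)"
  proof -
    show *: "integrable K G1" "integrable K G2"
      using g(1) by (intro K.integrable_const_bound[where B=B]; simp add: G1_def G2_def)+
    show "integrable K (\<lambda>\<omega>. \<bar>G1 \<omega> - G2 \<omega>\<bar>)" using * by (intro integrable_abs Bochner_Integration.integrable_diff)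
  qed
  have fin: "AE \<omega> in K. duh \<nu> (\<lambda>r y. ennreal \<bar>h \<omega> r y\<bar>) t x < \<infinity>"
  proof -
    have "(\<integral>\<^sup>+\<omega>. duh \<nu> (\<lambda>r y. ennreal \<bar>h \<omega> r y\<bar>) t x \<partial>K) = duh \<nu> (\<lambda>r y. \<integral>\<^sup>+\<omega>. ennreal \<bar>h \<omega> r y\<bar> \<partial>K) t x"
      by (rule nn_integral_duh[OF K m(2)])
    also have "\<dots> \<le> duh \<nu> (\<lambda>r y. ennreal A) t x" by (rule duh_mono) (rule A(1))
    also have "\<dots> < \<infinity>" by (simp add: duh_const[OF t] ennreal_mult_less_top)
    finally have "(\<integral>\<^sup>+\<omega>. duh \<nu> (\<lambda>r y. ennreal \<bar>h \<omega> r y\<bar>) t x \<partial>K) \<noteq> \<infinity>" by simp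
    from nn_integral_noteq_infinite[OF _ this] show ?thesis by (simp add: less_top)
  qed
  have "ennreal (\<integral>\<omega>. \<bar>G1 \<omega> - G2 \<omega>\<bar> \<partial>K) = (\<integral>\<^sup>+\<omega>. ennreal \<bar>G1 \<omega> - G2 \<omega>\<bar> \<partial>K)"
    using i(3) by (intro nn_integral_eq_integral[symmetric]) auto
  also have "\<dots> \<le> (\<integral>\<^sup>+\<omega>. ennreal L * duh \<nu> (\<lambda>r y. ennreal \<bar>cutoff R y * h \<omega> r y - h \<omega> r y\<bar>) t x \<partial>K)"
  proof (rule nn_integral_mono_AE, use fin AE_space in eventually_elim)
    fix \<omega> assume f: "duh \<nu> (\<lambda>r y. ennreal \<bar>h \<omega> r y\<bar>) t x < \<infinity>" and w: "\<omega> \<in> space K"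
    let ?a = "dur \<nu> (\<lambda>r y. cutoff R y * h \<omega> r y) t x" and ?b = "dur \<nu> (h \<omega>) t x"
    have f': "duh \<nu> (\<lambda>r y. ennreal \<bar>cutoff R y * h \<omega> r y\<bar>) t x < \<infinity>"
    proof (rule le_less_trans[OF duh_mono f], rule ennreal_leI)
      fix r y show "\<bar>cutoff R y * h \<omega> r y\<bar> \<le> \<bar>h \<omega> r y\<bar>"
        using cutoff_bounds[of R y] by (simp add: abs_mult mult_left_le_one_le)
    qed
    have "ennreal \<bar>G1 \<omega> - G2 \<omega>\<bar> \<le> ennreal (L * \<bar>?a - ?b\<bar>)"
    proof (rule ennreal_leI)
      have "\<bar>G1 \<omega> - G2 \<omega>\<bar> \<le> L * min 1 \<bar>(Z \<omega> - ?a) - (Z \<omega> - ?b)\<bar>" unfolding G1_def G2_def by (rule g(2))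
      also have "\<dots> \<le> L * \<bar>?a - ?b\<bar>" using g(3) by (intro mult_left_mono) auto
      finally show "\<bar>G1 \<omega> - G2 \<omega>\<bar> \<le> L * \<bar>?a - ?b\<bar>" .
    qed
    also have "\<dots> = ennreal L * ennreal \<bar>?a - ?b\<bar>" using g(3) by (intro ennreal_mult') auto
    also have "\<dots> \<le> ennreal L * duh \<nu> (\<lambda>r y. ennreal \<bar>cutoff R y * h \<omega> r y - h \<omega> r y\<bar>) t x"
      by (intro mult_left_mono dur_diff_bound f f' measurable_section_pair[OF m(1) w] measurable_section_pair[OF h w]) auto
    finally show "ennreal \<bar>G1 \<omega> - G2 \<omega>\<bar> \<le> ennreal L * duh \<nu> (\<lambda>r y. ennreal \<bar>cutoff R y * h \<omega> r y - h \<omega> r y\<bar>) t x" .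
  qed
  also have "\<dots> = ennreal L * duh \<nu> (\<lambda>r y. \<integral>\<^sup>+\<omega>. ennreal \<bar>cutoff R y * h \<omega> r y - h \<omega> r y\<bar> \<partial>K) t x"
    by (simp add: nn_integral_cmult nn_integral_duh[OF K m(3)])
  also have "\<dots> \<le> ennreal L * duh \<nu> (\<lambda>r y. ennreal (1 - cutoff R y) * ennreal A) t x"
  proof (intro mult_left_mono duh_mono)
    fix r y assume r: "0 \<le> r" "r \<le> t"
    have "(\<lambda>\<omega>. h \<omega> r y) \<in> borel_measurable K"
      using measurable_compose[OF _ h, of "\<lambda>\<omega>. (\<omega>, r, y)" K] by simp
    then have "(\<integral>\<^sup>+\<omega>. ennreal (1 - cutoff R y) * ennreal \<bar>h \<omega> r y\<bar> \<partial>K) = ennreal (1 - cutoff R y) * (\<integral>\<^sup>+\<omega>. ennreal \<bar>h \<omega> r y\<bar> \<partial>K)"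
      by (intro nn_integral_cmult) measurable
    moreover have "ennreal \<bar>cutoff R y * h \<omega> r y - h \<omega> r y\<bar> = ennreal (1 - cutoff R y) * ennreal \<bar>h \<omega> r y\<bar>" for \<omega>
    proof -
      have "cutoff R y * h \<omega> r y - h \<omega> r y = - ((1 - cutoff R y) * h \<omega> r y)" by (simp add: left_diff_distrib)
      then have "\<bar>cutoff R y * h \<omega> r y - h \<omega> r y\<bar> = (1 - cutoff R y) * \<bar>h \<omega> r y\<bar>"
        using cutoff_bounds[of R y] by (simp add: abs_mult)
      then show ?thesis using cutoff_bounds[of R y] by (simp add: ennreal_mult')
    qed
    ultimately show "(\<integral>\<^sup>+\<omega>. ennreal \<bar>cutoff R y * h \<omega> r y - h \<omega> r y\<bar> \<partial>K) \<le> ennreal (1 - cutoff R y) * ennreal A"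
      using A(1)[OF r] by (simp add: mult_left_mono)
  qed auto
  also have "\<dots> \<le> ennreal L * ennreal (A * t * (\<epsilon> * t / (R - Rx)\<^sup>2))"
    by (intro mult_left_mono duh_cutoff_tail mom t R A e) auto
  also have "\<dots> = ennreal (L * (A * t * (\<epsilon> * t / (R - Rx)\<^sup>2)))" using g(3) by (intro ennreal_mult'[symmetric]) auto
  finally have "(\<integral>\<omega>. \<bar>G1 \<omega> - G2 \<omega>\<bar> \<partial>K) \<le> L * (A * t * (\<epsilon> * t / (R - Rx)\<^sup>2))"
    using g(3) A t e by (subst (asm) ennreal_le_iff) (auto intro!: mult_nonneg_nonneg divide_nonneg_nonneg)
  moreover have "\<bar>(\<integral>\<omega>. G1 \<omega> \<partial>K) - (\<integral>\<omega>. G2 \<omega> \<partial>K)\<bar> \<le> (\<integral>\<omega>. \<bar>G1 \<omega> - G2 \<omega>\<bar> \<partial>K)"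
    using integral_abs_bound[of K "\<lambda>\<omega>. G1 \<omega> - G2 \<omega>"] i by simp
  ultimately show ?thesis unfolding G1_def G2_def by linarith
qed

lemma nn_integral_min_of_nat:
  fixes N :: nat and X :: "'a \<Rightarrow> real"
  assumes "prob_space K" "X \<in> borel_measurable K" "\<And>\<omega>. 0 \<le> X \<omega>"
  shows "(\<integral>\<^sup>+\<omega>. min (ennreal (X \<omega>)) (of_nat N) \<partial>K) = ennreal (\<integral>\<omega>. min (X \<omega>) (real N) \<partial>K)"
proof -
  interpret prob_space K by fact
  note [measurable] = assms(2)
  have "min (ennreal (X \<omega>)) (of_nat N) = ennreal (min (X \<omega>) (real N))" for \<omega>
    using assms(3)[of \<omega>] by (auto simp: min_def ennreal_of_nat_eq_real_of_nat)
  then have "(\<integral>\<^sup>+\<omega>. min (ennreal (X \<omega>)) (of_nat N) \<partial>K) = (\<integral>\<^sup>+\<omega>. ennreal (min (X \<omega>) (real N)) \<partial>K)" by simp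
  also have "\<dots> = ennreal (\<integral>\<omega>. min (X \<omega>) (real N) \<partial>K)"
    using assms(3) by (intro nn_integral_eq_integral integrable_const_bound[where B="real N"]) auto
  finally show ?thesis .
qed

text \<open>Makes capped exponentials admissible test functions for limits in law: below the cap the
  slope of \<open>exp (l * u)\<close> is at most \<open>N * |l|\<close> in absolute value.\<close>

lemma min_exp_lipschitz:
  fixes l N u v :: real
  assumes "0 < N"
  shows "\<bar>min (exp (l * u)) N - min (exp (l * v)) N\<bar> \<le> (N * (1 + \<bar>l\<bar>)) * min 1 \<bar>u - v\<bar>"
proof -
  have key: "min (exp (l * u)) N - min (exp (l * v)) N \<le> N * (\<bar>l\<bar> * \<bar>u - v\<bar>)" for u v
  proof (cases "exp (l * u) \<le> exp (l * v)")
    case True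
    then show ?thesis using assms by (smt (verit) mult_nonneg_nonneg abs_ge_zero min.mono order_refl)
  next
    case False
    show ?thesis
    proof (cases "N \<le> exp (l * v)")
      case True
      then show ?thesis using assms by (smt (verit) mult_nonneg_nonneg abs_ge_zero min_def)
    next
      case N: False
      \<comment> \<open>The exponent after capping, so that convexity of \<open>exp\<close> can be
        used at \<open>w\<close>.\<close>
      define w where "w = min (l * u) (ln N)"
      have e: "min (exp (l * u)) N = exp w" using assms by (auto simp: w_def min_def ln_ge_iff)
      have wN: "exp w \<le> N" unfolding e[symmetric] by simp
      have "1 + (l * v - w) \<le> exp (l * v - w)" by (rule exp_ge_add_one_self)
      then have "exp w * (1 + (l * v - w)) \<le> exp w * exp (l * v - w)" by (intro mult_left_mono) auto
      also have "\<dots> = exp (l * v)" by (simp flip: exp_add)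
      finally have "exp w - exp (l * v) \<le> exp w * (w - l * v)" by (simp add: algebra_simps)
      also have "\<dots> \<le> exp w * (\<bar>l\<bar> * \<bar>u - v\<bar>)"
      proof (rule mult_left_mono)
        have "w - l * v \<le> l * u - l * v" by (simp add: w_def)
        also have "\<dots> \<le> \<bar>l * (u - v)\<bar>" by (simp add: right_diff_distrib)
        finally show "w - l * v \<le> \<bar>l\<bar> * \<bar>u - v\<bar>" by (simp add: abs_mult)
      qed simp
      also have "\<dots> \<le> N * (\<bar>l\<bar> * \<bar>u - v\<bar>)" using wN by (intro mult_right_mono) auto
      finally show ?thesis unfolding e using N by simp
    qed
  qed
  have 1: "\<bar>min (exp (l * u)) N - min (exp (l * v)) N\<bar> \<le> N * (\<bar>l\<bar> * \<bar>u - v\<bar>)"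
    using key[of u v] key[of v u] by (simp add: abs_le_iff abs_minus_commute)
  have 2: "\<bar>min (exp (l * u)) N - min (exp (l * v)) N\<bar> \<le> N"
  proof -
    have "0 \<le> min (exp (l * w)) N \<and> min (exp (l * w)) N \<le> N" for w using assms by simp
    from this[of u] this[of v] show ?thesis by linarith
  qed
  show ?thesis
  proof (cases "\<bar>u - v\<bar> \<le> 1")
    case True
    have "N * (\<bar>l\<bar> * \<bar>u - v\<bar>) \<le> N * ((1 + \<bar>l\<bar>) * \<bar>u - v\<bar>)" using assms by (intro mult_left_mono mult_right_mono) auto
    then show ?thesis using 1 True by (simp add: mult.assoc)
  next
    case False
    have "N * 1 \<le> N * (1 + \<bar>l\<bar>)" using assms by (intro mult_left_mono) auto
    then show ?thesis using 2 False by simp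
  qed
qed

section \<open>Gaussian bounds for the residual of the limit field\<close>

context weak_limit
begin

definition vres :: "'b \<Rightarrow> real \<Rightarrow> real \<Rightarrow> real" where
  "vres \<omega> t x = field \<omega> t x - kernel_initial (gauss \<epsilon>1) \<xi> t x - dur (gauss \<epsilon>1) (\<lambda>r y. b (field \<omega> r y)) t x"

lemma measurable_vres: "(\<lambda>(\<omega>, t, x). vres \<omega> t x) \<in> borel_measurable (M \<Otimes>\<^sub>M (borel \<Otimes>\<^sub>M borel))"
proof -
  let ?N = "M \<Otimes>\<^sub>M (borel \<Otimes>\<^sub>M (borel :: real measure)) :: ('b \<times> real \<times> real) measure"
  have "(\<lambda>(w, r, y). b (field (fst w) r y)) \<in> borel_measurable (?N \<Otimes>\<^sub>M (borel \<Otimes>\<^sub>M borel))"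
    using measurable_compose[OF _ measurable_b_field, of "\<lambda>p. (fst (fst p), snd p)" "?N \<Otimes>\<^sub>M (borel \<Otimes>\<^sub>M borel)"]
    by (simp add: case_prod_unfold)
  from G.measurable_dur[OF this, of "\<lambda>p. fst (snd p)" "\<lambda>p. snd (snd p)"]
  have [measurable]: "(\<lambda>p. dur (gauss \<epsilon>1) (\<lambda>r y. b (field (fst p) r y)) (fst (snd p)) (snd (snd p))) \<in> borel_measurable ?N"
    by simp
  have [measurable]: "(\<lambda>p. kernel_initial (gauss \<epsilon>1) \<xi> (fst (snd p)) (snd (snd p))) \<in> borel_measurable ?N"
    by (intro G.measurable_kernel_initial[OF xi_cont xi_bound]) measurable
  have [measurable]: "(\<lambda>p. field (fst p) (fst (snd p)) (snd (snd p))) \<in> borel_measurable ?N"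
    using measurable_field by (simp add: case_prod_unfold)
  show ?thesis unfolding vres_def case_prod_unfold by measurable
qed

context
  fixes Lam :: real
  assumes Lam: "0 < Lam" "gu * \<epsilon>2\<^sup>2 * (2 * sqrt T / sqrt \<epsilon>1) \<le> Lam"
begin

text \<open>The mesh cancels, so one variance ceiling serves every lattice level.\<close>

lemma Lam': "gu * \<epsilon>2\<^sup>2 / d k * min T (d k * (2 * sqrt T / sqrt \<epsilon>1)) \<le> Lam"
proof -
  have "gu * \<epsilon>2\<^sup>2 / d k * min T (d k * (2 * sqrt T / sqrt \<epsilon>1)) \<le> gu * \<epsilon>2\<^sup>2 / d k * (d k * (2 * sqrt T / sqrt \<epsilon>1))"
    using L.gu0 dpos[of k] by (intro mult_left_mono) auto
  also have "\<dots> = gu * \<epsilon>2\<^sup>2 * (2 * sqrt T / sqrt \<epsilon>1)" using dpos[of k] by simp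
  finally show ?thesis using Lam(2) by simp
qed

definition bmom :: real where
  "bmom = 2 * (1 + c) * (1 + (2 * exp (2 * c * T) * c * T)) * (1 + C + moment_const 1 * Lam powr (1/2))"

definition fmom :: real where
  "fmom = C + moment_const 1 * Lam powr (1/2) + bmom * T"

lemma mom_nonneg: "0 \<le> bmom" "0 \<le> fmom"
proof -
  have C0: "0 \<le> C" by (rule L.C0)
  have m: "0 \<le> moment_const 1 * Lam powr (1/2)" by (simp add: moment_const_def)
  show "0 \<le> bmom" unfolding bmom_def using cpos Tpos C0 m
    by (intro mult_nonneg_nonneg[of "2 * (1 + c) * (1 + (2 * exp (2 * c * T) * c * T))" "1 + C + moment_const 1 * Lam powr (1/2)"]) auto
  then show "0 \<le> fmom" unfolding fmom_def using Tpos C0 m by (simp add: add_nonneg_nonneg)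
qed

lemma b_path_moment: "t \<in> {0..T} \<Longrightarrow> x \<in> lattice (d k) \<Longrightarrow> (\<integral>\<^sup>+\<omega>. ennreal \<bar>b (L.path k \<omega> t x)\<bar> \<partial>N) \<le> ennreal bmom"
  unfolding bmom_def by (rule L.first_moment[OF _ _ Lam(1) Lam'])

lemma path_moment: "t \<in> {0..T} \<Longrightarrow> x \<in> lattice (d k) \<Longrightarrow> (\<integral>\<^sup>+\<omega>. ennreal \<bar>L.path k \<omega> t x\<bar> \<partial>N) \<le> ennreal fmom"
  unfolding fmom_def by (rule L.path_first_moment[OF _ _ Lam(1) Lam' b_path_moment mom_nonneg(1)])

text \<open>Path evaluation is the case \<open>\<kappa> = 0\<close> of the functionals and truncated
  absolute values are admissible tests; the lattice bound survives by Fatou.\<close>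

lemma field_moment:
  assumes t: "t \<in> {0..T}"
  shows "(\<integral>\<^sup>+\<omega>. ennreal \<bar>field \<omega> t x\<bar> \<partial>M) \<le> ennreal fmom"
proof (rule truncated_limit_upper)
  have [measurable]: "(\<lambda>\<omega>. field \<omega> t x) \<in> borel_measurable M" for x
    using measurable_compose[OF _ measurable_field, of "\<lambda>\<omega>. (\<omega>, t, x)" M] by simp
  have [measurable]: "(\<lambda>\<omega>. L.path k \<omega> t x) \<in> borel_measurable N" for k x
    using measurable_compose[OF _ L.measurable_path, of "\<lambda>\<omega>. (\<omega>, t, x)" N k] by simp
  show "(\<lambda>\<omega>. ennreal \<bar>field \<omega> t x\<bar>) \<in> borel_measurable M" by measurable
  show "(\<integral>\<^sup>+\<omega>. ennreal \<bar>L.path k \<omega> t (node x k)\<bar> \<partial>N) \<le> ennreal fmom" for k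
    by (rule path_moment[OF t node_lattice])
  fix n :: nat
  show "(\<lambda>k. \<integral>\<^sup>+\<omega>. min (ennreal \<bar>L.path k \<omega> t (node x k)\<bar>) (of_nat n) \<partial>N) \<longlonglongrightarrow> (\<integral>\<^sup>+\<omega>. min (ennreal \<bar>field \<omega> t x\<bar>) (of_nat n) \<partial>M)"
  proof (cases "n = 0")
    case False
    have "(\<lambda>k. \<integral>\<omega>. min \<bar>functional (walk (d k) \<epsilon>1) 0 0 t (node x k) (\<lambda>(t, x). lin_interp (d k) (\<lambda>y. X k y t \<omega>) x)\<bar> (real n) \<partial>N)
      \<longlonglongrightarrow> (\<integral>\<omega>. min \<bar>functional (gauss \<epsilon>1) 0 0 t x (\<lambda>(t, x). V t x \<omega>)\<bar> (real n) \<partial>M)"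
    proof (rule functional_limit[OF t, where B = "real n" and K = "real n" and g = "\<lambda>u. min \<bar>u\<bar> (real n)"])
      fix u v :: real
      have n1: "1 \<le> real n" using False by simp
      show "\<bar>min \<bar>u\<bar> (real n) - min \<bar>v\<bar> (real n)\<bar> \<le> real n * min 1 \<bar>u - v\<bar>"
      proof (cases "\<bar>u - v\<bar> \<le> 1")
        case True
        have "\<bar>min \<bar>u\<bar> (real n) - min \<bar>v\<bar> (real n)\<bar> \<le> \<bar>u - v\<bar>" by (simp add: min_def abs_if)
        also have "\<dots> = 1 * \<bar>u - v\<bar>" by simp
        also have "\<dots> \<le> real n * \<bar>u - v\<bar>" using n1 by (intro mult_right_mono) auto
        finally show ?thesis using True by simp
      next
        case False
        have "\<bar>min \<bar>u\<bar> (real n) - min \<bar>v\<bar> (real n)\<bar> \<le> real n" using n1 by (simp add: min_def abs_if)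
        then show ?thesis using False by simp
      qed
    qed (use False in auto)
    then show ?thesis
      unfolding functional_path[OF t] functional_field[OF t]
      by (simp add: nn_integral_min_of_nat[OF L.prob_space_axioms] nn_integral_min_of_nat[OF prob_space_axioms] tendsto_ennrealI)
  qed simp
qed

lemma b_field_moment:
  assumes t: "t \<in> {0..T}"
  shows "(\<integral>\<^sup>+\<omega>. ennreal \<bar>b (field \<omega> t x)\<bar> \<partial>M) \<le> ennreal (c * (1 + fmom))"
proof -
  have [measurable]: "(\<lambda>\<omega>. field \<omega> t x) \<in> borel_measurable M"
    using measurable_compose[OF _ measurable_field, of "\<lambda>\<omega>. (\<omega>, t, x)" M] by simp
  have "(\<integral>\<^sup>+\<omega>. ennreal \<bar>b (field \<omega> t x)\<bar> \<partial>M) \<le> (\<integral>\<^sup>+\<omega>. ennreal c * (1 + ennreal \<bar>field \<omega> t x\<bar>) \<partial>M)"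
  proof (rule nn_integral_mono)
    fix \<omega>
    have "ennreal \<bar>b (field \<omega> t x)\<bar> \<le> ennreal (c * (1 + \<bar>field \<omega> t x\<bar>))" by (intro ennreal_leI b_growth)
    also have "\<dots> = ennreal c * (1 + ennreal \<bar>field \<omega> t x\<bar>)" using cpos by (simp add: ennreal_mult')
    finally show "ennreal \<bar>b (field \<omega> t x)\<bar> \<le> ennreal c * (1 + ennreal \<bar>field \<omega> t x\<bar>)" .
  qed
  also have "\<dots> = ennreal c * (1 + (\<integral>\<^sup>+\<omega>. ennreal \<bar>field \<omega> t x\<bar> \<partial>M))"
    by (simp add: nn_integral_cmult nn_integral_add emeasure_space_1)
  also have "\<dots> \<le> ennreal c * (1 + ennreal fmom)" by (intro mult_left_mono add_left_mono field_moment t) auto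
  also have "\<dots> = ennreal (c * (1 + fmom))" using cpos mom_nonneg by (simp add: ennreal_mult')
  finally show ?thesis .
qed

text \<open>In the limit no summability is part of a definition, so the finiteness for Gronwall has
  to come from the first moments of the field.\<close>

lemma duh_b_field_finite:
  assumes t: "t \<in> {0..T}"
  shows "AE \<omega> in M. duh (gauss \<epsilon>1) (\<lambda>r y. ennreal \<bar>b (field \<omega> r y)\<bar>) t x < \<infinity>"
proof -
  have m: "(\<lambda>(\<omega>, r, y). ennreal \<bar>b (field \<omega> r y)\<bar>) \<in> borel_measurable (M \<Otimes>\<^sub>M (borel \<Otimes>\<^sub>M borel))"
    using measurable_b_field by (simp add: case_prod_unfold)
  have t': "0 \<le> t" "t \<le> T" using t by auto
  have "(\<integral>\<^sup>+\<omega>. duh (gauss \<epsilon>1) (\<lambda>r y. ennreal \<bar>b (field \<omega> r y)\<bar>) t x \<partial>M) = duh (gauss \<epsilon>1) (\<lambda>r y. \<integral>\<^sup>+\<omega>. ennreal \<bar>b (field \<omega> r y)\<bar> \<partial>M) t x"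
    by (rule G.nn_integral_duh[OF M m])
  also have "\<dots> \<le> duh (gauss \<epsilon>1) (\<lambda>r y. ennreal (c * (1 + fmom))) t x"
    using t' by (intro G.duh_mono b_field_moment) auto
  also have "\<dots> < \<infinity>" by (simp add: G.duh_const[OF t'(1)] ennreal_mult_less_top)
  finally have "(\<integral>\<^sup>+\<omega>. duh (gauss \<epsilon>1) (\<lambda>r y. ennreal \<bar>b (field \<omega> r y)\<bar>) t x \<partial>M) \<noteq> \<infinity>" by simp
  moreover have "(\<lambda>\<omega>. duh (gauss \<epsilon>1) (\<lambda>r y. ennreal \<bar>b (field \<omega> r y)\<bar>) t x) \<in> borel_measurable M"
    by (rule G.measurable_duh[OF m]) auto
  ultimately show ?thesis using nn_integral_noteq_infinite by (simp add: less_top)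
qed

text \<open>Three errors below \<open>e / 3\<close>: removing the cutoff on the lattice, passing to
  the limit at a fixed radius, and removing the cutoff in the limit. One radius serves all
  \<open>k\<close> because the moment bounds and the range of the nodes are uniform.\<close>

lemma vres_limit:
  assumes t: "t \<in> {0..T}"
    and g: "\<And>u. \<bar>g u\<bar> \<le> B" "\<And>u v. \<bar>g u - g v\<bar> \<le> K * min 1 \<bar>u - v\<bar>" "0 < K" "g \<in> borel_measurable borel"
  shows "(\<lambda>k. \<integral>\<omega>. g (L.res k \<omega> t (node x k)) \<partial>N) \<longlonglongrightarrow> (\<integral>\<omega>. g (vres \<omega> t x) \<partial>M)"
proof (rule LIMSEQ_I)
  fix e :: real assume e: "0 < e"
  have t': "0 \<le> t" "t \<le> T" using t by auto
  obtain Rx where Rx: "0 \<le> Rx" "\<bar>x\<bar> \<le> Rx" "\<And>k. \<bar>node x k\<bar> \<le> Rx" using node_bounded[of x] by blast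
  define A where "A = max bmom (c * (1 + fmom))"
  have A0: "0 \<le> A" using mom_nonneg by (simp add: A_def le_max_iff_disj)
  define q where "q = K * (A * t * (\<epsilon>1 * t)) * 4"
  have q0: "0 \<le> q" unfolding q_def using g(3) A0 t' eps by (intro mult_nonneg_nonneg) auto
  \<comment> \<open>\<open>R - Rx\<close> is at least \<open>1\<close> and exceeds
    \<open>q / e\<close>, hence so does its square; the factor \<open>4\<close> in \<open>q\<close>
    leaves room for a strict bound by \<open>e / 3\<close>.\<close>
  define R where "R = Rx + 1 + q / e"
  have "0 \<le> q / e" using q0 e by simp
  then have R: "Rx < R" "0 \<le> R" "1 \<le> R - Rx" using Rx(1) unfolding R_def by linarith+
  have cR: "K * (A * t * (\<epsilon>1 * t / (R - Rx)\<^sup>2)) < e / 3"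
  proof -
    have "(R - Rx) * 1 \<le> (R - Rx) * (R - Rx)" using R by (intro mult_left_mono) auto
    moreover have "q / e < R - Rx" by (simp add: R_def)
    ultimately have "q / e < (R - Rx)\<^sup>2" by (simp add: power2_eq_square)
    then have "q < (R - Rx)\<^sup>2 * e" using e by (simp add: field_simps)
    then have "q / (R - Rx)\<^sup>2 < e" using R by (simp add: field_simps)
    moreover have "K * (A * t * (\<epsilon>1 * t / (R - Rx)\<^sup>2)) = q / (R - Rx)\<^sup>2 / 4" by (simp add: q_def)
    ultimately have "K * (A * t * (\<epsilon>1 * t / (R - Rx)\<^sup>2)) < e / 4" by simp
    also have "\<dots> < e / 3" using e by simp
    finally show ?thesis .
  qed
  have err1: "\<bar>(\<integral>\<omega>. g (functional (walk (d k) \<epsilon>1) 1 R t (node x k) (\<lambda>(t, x). lin_interp (d k) (\<lambda>y. X k y t \<omega>) x)) \<partial>N)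
     - (\<integral>\<omega>. g (L.res k \<omega> t (node x k)) \<partial>N)\<bar> < e / 3" for k
  proof -
    \<comment> \<open>Moments are bounded at sites, so the source is restricted to the lattice; a
      walk started at a node does not notice.\<close>
    let ?h = "\<lambda>\<omega> r y. indicator (lattice (d k)) y * b (L.path k \<omega> r y)"
    let ?Z = "\<lambda>\<omega>. L.path k \<omega> t (node x k) - kernel_initial (walk (d k) \<epsilon>1) \<xi> t (node x k)"
    have lat: "lattice (d k) \<in> sets borel" by (rule sets.countable[OF _ countable_lattice]) simp
    have "(\<lambda>p. indicator (lattice (d k)) (snd (snd p)) :: real) \<in> borel_measurable (N \<Otimes>\<^sub>M ((borel :: real measure) \<Otimes>\<^sub>M borel))"
      using lat by measurable
    then have mh: "(\<lambda>(\<omega>, r, y). ?h \<omega> r y) \<in> borel_measurable (N \<Otimes>\<^sub>M (borel \<Otimes>\<^sub>M borel))"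
      using L.measurable_b_path[of k] by (simp add: case_prod_unfold borel_measurable_times)
    have eq: "dur (walk (d k) \<epsilon>1) (\<lambda>r y. \<phi> y * ?h \<omega> r y) t (node x k) = dur (walk (d k) \<epsilon>1) (\<lambda>r y. \<phi> y * b (L.path k \<omega> r y)) t (node x k)" for \<phi> \<omega>
      unfolding dur_def by (intro arg_cong2[where f="(-)"] arg_cong[where f=enn2real] duh_walk_cong node_lattice) auto
    have "\<bar>(\<integral>\<omega>. g (?Z \<omega> - dur (walk (d k) \<epsilon>1) (\<lambda>r y. cutoff R y * ?h \<omega> r y) t (node x k)) \<partial>N)
        - (\<integral>\<omega>. g (?Z \<omega> - dur (walk (d k) \<epsilon>1) (?h \<omega>) t (node x k)) \<partial>N)\<bar> \<le> K * (A * t * (\<epsilon>1 * t / (R - Rx)\<^sup>2))"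
    proof (rule L.kern.cutoff_error[OF L.prob_space_axioms mh _ A0 _ t'(1) Rx(3) R(1) _ g])
      show "(\<integral>\<^sup>+\<omega>. ennreal \<bar>?h \<omega> r y\<bar> \<partial>N) \<le> ennreal A" if "0 \<le> r" "r \<le> t" for r y
      proof (cases "y \<in> lattice (d k)")
        case True
        then have "(\<integral>\<^sup>+\<omega>. ennreal \<bar>?h \<omega> r y\<bar> \<partial>N) \<le> ennreal bmom"
          using b_path_moment[of r y k] that t' by simp
        also have "\<dots> \<le> ennreal A" by (intro ennreal_leI) (simp add: A_def)
        finally show ?thesis .
      qed simp
      show "(\<integral>\<^sup>+z. ennreal (z\<^sup>2) \<partial>walk (d k) \<epsilon>1 s) \<le> ennreal (\<epsilon>1 * t)" if "0 \<le> s" "s \<le> t" for s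
        using walk_second_moment[of \<epsilon>1 s "d k"] that eps dpos[of k] by (simp add: ennreal_leI)
      show "?Z \<in> borel_measurable N"
        using measurable_compose[OF _ L.measurable_path, of "\<lambda>\<omega>. (\<omega>, t, node x k)" N k] by simp
    qed (use eps in auto)
    from le_less_trans[OF this cR] show ?thesis using eq[of "cutoff R"] eq[of "\<lambda>_. 1"]
      unfolding functional_path[OF t] L.res_def by (simp add: diff_diff_eq)
  qed
  have err2: "\<bar>(\<integral>\<omega>. g (functional (gauss \<epsilon>1) 1 R t x (\<lambda>(t, x). V t x \<omega>)) \<partial>M) - (\<integral>\<omega>. g (vres \<omega> t x) \<partial>M)\<bar> < e / 3"
  proof -
    let ?Z = "\<lambda>\<omega>. field \<omega> t x - kernel_initial (gauss \<epsilon>1) \<xi> t x"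
    have "\<bar>(\<integral>\<omega>. g (?Z \<omega> - dur (gauss \<epsilon>1) (\<lambda>r y. cutoff R y * b (field \<omega> r y)) t x) \<partial>M)
        - (\<integral>\<omega>. g (?Z \<omega> - dur (gauss \<epsilon>1) (\<lambda>r y. b (field \<omega> r y)) t x) \<partial>M)\<bar> \<le> K * (A * t * (\<epsilon>1 * t / (R - Rx)\<^sup>2))"
    proof (rule G.cutoff_error[OF M measurable_b_field _ A0 _ t'(1) Rx(2) R(1) _ g])
      show "(\<integral>\<^sup>+\<omega>. ennreal \<bar>b (field \<omega> r y)\<bar> \<partial>M) \<le> ennreal A" if "0 \<le> r" "r \<le> t" for r y
      proof -
        have "(\<integral>\<^sup>+\<omega>. ennreal \<bar>b (field \<omega> r y)\<bar> \<partial>M) \<le> ennreal (c * (1 + fmom))"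
          using that t' by (intro b_field_moment) auto
        also have "\<dots> \<le> ennreal A" by (intro ennreal_leI) (simp add: A_def)
        finally show ?thesis .
      qed
      show "(\<integral>\<^sup>+z. ennreal (z\<^sup>2) \<partial>gauss \<epsilon>1 s) \<le> ennreal (\<epsilon>1 * t)" if "0 \<le> s" "s \<le> t" for s
        using gauss_second_moment[of \<epsilon>1 s] that eps by (simp add: ennreal_leI)
      show "?Z \<in> borel_measurable M"
        using measurable_compose[OF _ measurable_field, of "\<lambda>\<omega>. (\<omega>, t, x)" M] by simp
    qed (use eps in auto)
    from le_less_trans[OF this cR] show ?thesis unfolding functional_field[OF t] vres_def by (simp add: diff_diff_eq)
  qed
  have "\<exists>k0. \<forall>k\<ge>k0. norm ((\<integral>\<omega>. g (functional (walk (d k) \<epsilon>1) 1 R t (node x k) (\<lambda>(t, x). lin_interp (d k) (\<lambda>y. X k y t \<omega>) x)) \<partial>N)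
     - (\<integral>\<omega>. g (functional (gauss \<epsilon>1) 1 R t x (\<lambda>(t, x). V t x \<omega>)) \<partial>M)) < e / 3"
    using e by (intro LIMSEQ_D[OF functional_limit[OF t R(2) g(1-3)]]) simp
  then obtain k0 where k0: "\<And>k. k0 \<le> k \<Longrightarrow> norm ((\<integral>\<omega>. g (functional (walk (d k) \<epsilon>1) 1 R t (node x k) (\<lambda>(t, x). lin_interp (d k) (\<lambda>y. X k y t \<omega>) x)) \<partial>N)
     - (\<integral>\<omega>. g (functional (gauss \<epsilon>1) 1 R t x (\<lambda>(t, x). V t x \<omega>)) \<partial>M)) < e / 3" by blast
  have "norm ((\<integral>\<omega>. g (L.res k \<omega> t (node x k)) \<partial>N) - (\<integral>\<omega>. g (vres \<omega> t x) \<partial>M)) < e" if "k0 \<le> k" for k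
    using k0[OF that] err1[of k] err2 unfolding real_norm_def by linarith
  then show "\<exists>no. \<forall>k\<ge>no. norm ((\<integral>\<omega>. g (L.res k \<omega> t (node x k)) \<partial>N) - (\<integral>\<omega>. g (vres \<omega> t x) \<partial>M)) < e" by blast
qed

text \<open>The lattice bounds at the nodes pass to the limit through \<open>vres_limit\<close> with
  capped exponentials as tests, while the mesh disappears from the lower variance.\<close>

lemma vres_sub_exp:
  assumes t: "t \<in> {0..T}"
  shows "sub_exp M (\<lambda>\<omega>. vres \<omega> t x) (gl * \<epsilon>2\<^sup>2 * (9/16 * t / (4 * sqrt (\<epsilon>1 * t)))) Lam"
proof (rule sub_exp_limit[where M = "\<lambda>_. N" and X = "\<lambda>k \<omega>. L.res k \<omega> t (node x k)"])
  have t': "0 \<le> t" "t \<le> T" using t by auto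
  have mr [measurable]: "(\<lambda>\<omega>. L.res k \<omega> t y) \<in> borel_measurable N" for k y
    using measurable_compose[OF _ L.measurable_res, of "\<lambda>\<omega>. (\<omega>, t, y)" N k] by simp
  show mv [measurable]: "(\<lambda>\<omega>. vres \<omega> t x) \<in> borel_measurable M"
    using measurable_compose[OF _ measurable_vres, of "\<lambda>\<omega>. (\<omega>, t, x)" M] by simp
  show "sub_exp N (\<lambda>\<omega>. L.res k \<omega> t (node x k)) (gl * \<epsilon>2\<^sup>2 * (9/16 * t / (4 * sqrt (\<epsilon>1 * t) + d k))) Lam" for k
    by (rule L.res_sub_exp[OF node_lattice t Lam'])
  show "(\<lambda>k. gl * \<epsilon>2\<^sup>2 * (9/16 * t / (4 * sqrt (\<epsilon>1 * t) + d k))) \<longlonglongrightarrow> gl * \<epsilon>2\<^sup>2 * (9/16 * t / (4 * sqrt (\<epsilon>1 * t)))"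
  \<comment> \<open>At \<open>t = 0\<close> all terms vanish; otherwise
    \<open>sqrt (\<epsilon>1 * t)\<close> keeps the limiting denominator away from
    \<open>0\<close>.\<close>
  proof (cases "t = 0")
    case False
    then have "(\<lambda>k. gl * \<epsilon>2\<^sup>2 * (9/16 * t / (4 * sqrt (\<epsilon>1 * t) + d k))) \<longlonglongrightarrow> gl * \<epsilon>2\<^sup>2 * (9/16 * t / (4 * sqrt (\<epsilon>1 * t) + 0))"
      using eps t' by (intro tendsto_intros d0) auto
    then show ?thesis by simp
  qed simp
  fix l :: real and n :: nat
  show "(\<lambda>k. \<integral>\<^sup>+\<omega>. min (ennreal (exp (l * L.res k \<omega> t (node x k)))) (of_nat n) \<partial>N)
    \<longlonglongrightarrow> (\<integral>\<^sup>+\<omega>. min (ennreal (exp (l * vres \<omega> t x))) (of_nat n) \<partial>M)"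
  proof (cases "n = 0")
    case False
    have "(\<lambda>k. \<integral>\<omega>. min (exp (l * L.res k \<omega> t (node x k))) (real n) \<partial>N) \<longlonglongrightarrow> (\<integral>\<omega>. min (exp (l * vres \<omega> t x)) (real n) \<partial>M)"
    proof (rule vres_limit[OF t, where B = "real n" and K = "real n * (1 + \<bar>l\<bar>)" and g = "\<lambda>u. min (exp (l * u)) (real n)"])
      show "\<bar>min (exp (l * u)) (real n)\<bar> \<le> real n" for u using exp_ge_zero[of "l * u"] by (simp add: abs_if min_def)
      show "\<bar>min (exp (l * u)) (real n) - min (exp (l * v)) (real n)\<bar> \<le> real n * (1 + \<bar>l\<bar>) * min 1 \<bar>u - v\<bar>" for u v
        using False by (intro min_exp_lipschitz) simp
      show "0 < real n * (1 + \<bar>l\<bar>)" using False by (intro mult_pos_pos) auto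
    qed measurable
    then show ?thesis
      by (simp add: nn_integral_min_of_nat[OF L.prob_space_axioms] nn_integral_min_of_nat[OF prob_space_axioms] tendsto_ennrealI)
  qed simp
qed

end

end

section \<open>The deterministic equation\<close>

lemma gauss_density:
  assumes "0 < \<epsilon>" "0 < t"
  shows "gauss \<epsilon> t = density lborel (\<lambda>z. ennreal (normal_density 0 (sqrt (\<epsilon> * t)) z))"
proof -
  have s: "0 < sqrt (\<epsilon> * t)" using assms by simp
  interpret S: prob_space std_normal_distribution by (rule real_distribution.axioms) (rule real_dist_normal_dist)
  have "distributed std_normal_distribution lborel (\<lambda>x. x) std_normal_density"
    unfolding distributed_def by (auto simp: distr_id2)
  from S.normal_density_affine[OF this _ less_imp_neq[OF s, symmetric], of 0] s
  have "distributed std_normal_distribution lborel (\<lambda>x. sqrt (\<epsilon> * t) * x) (normal_density 0 (sqrt (\<epsilon> * t)))" by simp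
  then have "distr std_normal_distribution lborel (\<lambda>x. sqrt (\<epsilon> * t) * x) = density lborel (\<lambda>z. ennreal (normal_density 0 (sqrt (\<epsilon> * t)) z))"
    by (simp add: distributed_def)
  moreover have "gauss \<epsilon> t = distr std_normal_distribution lborel (\<lambda>x. sqrt (\<epsilon> * t) * x)"
    unfolding gauss_def using assms by (intro distr_cong) auto
  ultimately show ?thesis by simp
qed

lemma nn_integral_gauss:
  assumes "0 < \<epsilon>" "0 < t" and [measurable]: "f \<in> borel_measurable borel"
  shows "(\<integral>\<^sup>+z. f (x - z) \<partial>gauss \<epsilon> t) = (\<integral>\<^sup>+y. ennreal (normal_density 0 (sqrt (\<epsilon> * t)) (x - y)) * f y \<partial>lborel)"
proof -
  have "(\<integral>\<^sup>+z. f (x - z) \<partial>gauss \<epsilon> t) = (\<integral>\<^sup>+z. ennreal (normal_density 0 (sqrt (\<epsilon> * t)) z) * f (x - z) \<partial>lborel)"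
    unfolding gauss_density[OF assms(1,2)] by (subst nn_integral_density) auto
  also have "\<dots> = (\<integral>\<^sup>+y. ennreal (normal_density 0 (sqrt (\<epsilon> * t)) (x - y)) * f y \<partial>lborel)"
    by (subst nn_integral_real_affine[where c = "-1" and t = x]) auto
  finally show ?thesis .
qed

lemma kernel_initial_gauss:
  assumes "0 < \<epsilon>" "0 < t" and \<xi>: "continuous_on UNIV \<xi>"
  shows "kernel_initial (gauss \<epsilon>) \<xi> t x = (LBINT y. normal_density 0 (sqrt (\<epsilon> * t)) (x - y) * \<xi> y)"
proof -
  have [measurable]: "\<xi> \<in> borel_measurable borel" using \<xi> by (rule borel_measurable_continuous_onI)
  have "kernel_initial (gauss \<epsilon>) \<xi> t x = (LBINT z. normal_density 0 (sqrt (\<epsilon> * t)) z * \<xi> (x - z))"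
    unfolding kernel_initial_def gauss_density[OF assms(1,2)] by (subst integral_density) auto
  also have "\<dots> = (LBINT y. normal_density 0 (sqrt (\<epsilon> * t)) (x - y) * \<xi> y)"
    by (subst lborel_integral_real_affine[where c = "-1" and t = x]) auto
  finally show ?thesis .
qed

lemma kernel_initial_gauss_0:
  assumes \<xi>: "continuous_on UNIV \<xi>"
  shows "kernel_initial (gauss \<epsilon>) \<xi> 0 x = \<xi> x"
proof -
  have [measurable]: "\<xi> \<in> borel_measurable borel" using \<xi> by (rule borel_measurable_continuous_onI)
  interpret S: prob_space std_normal_distribution by (rule real_distribution.axioms) (rule real_dist_normal_dist)
  have "measure std_normal_distribution UNIV = 1" using S.prob_space by simp
  then show ?thesis
    unfolding kernel_initial_def gauss_def by (subst integral_distr) auto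
qed

text \<open>The time endpoints are dropped as a null set: at \<open>r = t\<close> the kernel is a
  point mass and has no density.\<close>

lemma duh_gauss:
  assumes e: "0 < \<epsilon>" and t: "0 < t" and f: "(\<lambda>(r, y). f r y) \<in> borel_measurable (borel \<Otimes>\<^sub>M borel)"
  shows "duh (gauss \<epsilon>) f t x = (\<integral>\<^sup>+p. ennreal (normal_density 0 (sqrt (\<epsilon> * (t - fst p))) (x - snd p)) * f (fst p) (snd p)
    * indicator ({0<..<t} \<times> UNIV) p \<partial>lborel)"
proof -
  let ?h = "\<lambda>r y. ennreal (normal_density 0 (sqrt (\<epsilon> * (t - r))) (x - y)) * f r y * indicator {0<..<t} r"
  have f' [measurable]: "(\<lambda>p. f (fst p) (snd p)) \<in> borel_measurable (borel \<Otimes>\<^sub>M borel)" using f by (simp add: case_prod_unfold)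
  have fr [measurable]: "f r \<in> borel_measurable borel" for r
    using measurable_compose[OF measurable_Pair1'[of r borel borel] f] by simp
  have nd: "(\<lambda>p. normal_density 0 (sqrt (\<epsilon> * (t - fst p))) (x - snd p)) \<in> borel_measurable (borel \<Otimes>\<^sub>M borel)"
    unfolding normal_density_def by measurable
  note [measurable] = nd
  have h: "(\<lambda>p. ?h (fst p) (snd p)) \<in> borel_measurable (borel \<Otimes>\<^sub>M borel)" by measurable
  have ae: "AE r in lborel. r \<noteq> (0::real)" "AE r in lborel. r \<noteq> t" by (rule AE_lborel_singleton)+
  have "duh (gauss \<epsilon>) f t x = (\<integral>\<^sup>+r. (\<integral>\<^sup>+y. ?h r y \<partial>lborel) \<partial>lborel)"
    unfolding duh_def
  proof (rule nn_integral_cong_AE, use ae in eventually_elim)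
    fix r :: real assume r: "r \<noteq> 0" "r \<noteq> t"
    show "(\<integral>\<^sup>+z. f r (x - z) \<partial>gauss \<epsilon> (t - r)) * indicator {0..t} r = (\<integral>\<^sup>+y. ?h r y \<partial>lborel)"
      using nn_integral_gauss[OF e, of "t - r" "f r" x] r by (cases "0 < r \<and> r < t") (auto simp: indicator_def)
  qed
  also have "\<dots> = (\<integral>\<^sup>+p. ?h (fst p) (snd p) \<partial>(lborel \<Otimes>\<^sub>M lborel))"
    using h by (subst lborel.nn_integral_fst[symmetric]) (auto cong: measurable_cong_sets[OF sets_pair_measure_cong[OF sets_lborel sets_lborel] refl])
  also have "\<dots> = (\<integral>\<^sup>+p. ennreal (normal_density 0 (sqrt (\<epsilon> * (t - fst p))) (x - snd p)) * f (fst p) (snd p)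
    * indicator ({0<..<t} \<times> UNIV) p \<partial>lborel)"
    unfolding lborel_prod by (intro nn_integral_cong) (auto simp: indicator_def)
  finally show ?thesis .
qed

text \<open>Translates the density form of the definition into the kernel calculus; clamped time
  makes the drift a measurable field on the plane.\<close>

lemma pde_duhamel:
  assumes pde: "deterministic_pde_solution T \<epsilon> b \<xi> u" and e: "0 < \<epsilon>" and T: "0 < T"
    and b: "continuous_on UNIV b" and \<xi>: "continuous_on UNIV \<xi>" and t: "t \<in> {0..T}"
  defines "w \<equiv> \<lambda>r. u (clamp_time T r)"
  shows "(\<lambda>(r, y). b (w r y)) \<in> borel_measurable (borel \<Otimes>\<^sub>M borel)"
    "duh (gauss \<epsilon>) (\<lambda>r y. ennreal \<bar>b (w r y)\<bar>) t x < \<infinity>"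
    "u t x = kernel_initial (gauss \<epsilon>) \<xi> t x + dur (gauss \<epsilon>) (\<lambda>r y. b (w r y)) t x"
proof -
  have uc: "continuous_on ({0..T} \<times> UNIV) (\<lambda>(t, x). u t x)" using pde by (simp add: deterministic_pde_solution_def)
  have "continuous_on UNIV (\<lambda>p. (\<lambda>(t, x). u t x) (clamp_time T (fst p), snd p))"
  proof (rule continuous_on_compose2[OF uc])
    show "continuous_on UNIV (\<lambda>p. (clamp_time T (fst p), snd p :: real))"
      unfolding clamp_time_def by (intro continuous_intros)
    show "(\<lambda>p. (clamp_time T (fst p), snd p)) ` UNIV \<subseteq> {0..T} \<times> UNIV" using clamp_time_in[of T] T by auto
  qed
  then have "continuous_on UNIV (\<lambda>p. b (w (fst p) (snd p)))"
    unfolding w_def by (intro continuous_on_compose2[OF b]) auto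
  then have bm: "(\<lambda>p. b (w (fst p) (snd p))) \<in> borel_measurable borel" by (rule borel_measurable_continuous_onI)
  then show m: "(\<lambda>(r, y). b (w r y)) \<in> borel_measurable (borel \<Otimes>\<^sub>M borel)"
    by (simp add: case_prod_unfold borel_prod)
  show "duh (gauss \<epsilon>) (\<lambda>r y. ennreal \<bar>b (w r y)\<bar>) t x < \<infinity>"
    "u t x = kernel_initial (gauss \<epsilon>) \<xi> t x + dur (gauss \<epsilon>) (\<lambda>r y. b (w r y)) t x"
  proof -
    consider "t = 0" | "0 < t" using t by fastforce
    then have "duh (gauss \<epsilon>) (\<lambda>r y. ennreal \<bar>b (w r y)\<bar>) t x < \<infinity> \<and>
      u t x = kernel_initial (gauss \<epsilon>) \<xi> t x + dur (gauss \<epsilon>) (\<lambda>r y. b (w r y)) t x"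
    proof cases
      case 1
      then show ?thesis
        using pde by (simp add: duh_0 dur_def kernel_initial_gauss_0[OF \<xi>] deterministic_pde_solution_def)
    next
      case t0: 2
      let ?n = "\<lambda>p. normal_density 0 (sqrt (\<epsilon> * (t - fst p))) (x - snd p)"
      let ?g = "\<lambda>p. indicator ({0<..<t} \<times> UNIV) p *\<^sub>R (case p of (s, y) \<Rightarrow> normal_density 0 (sqrt (\<epsilon> * (t - s))) (x - y) * b (u s y))"
      have sol: "integrable lborel ?g"
        "u t x = (LBINT y. normal_density 0 (sqrt (\<epsilon> * t)) (x - y) * \<xi> y) + (LINT p|lborel. ?g p)"
        using pde t t0 by (auto simp: deterministic_pde_solution_def set_integrable_def set_lebesgue_integral_def)
      have eq: "?n p * b (w (fst p) (snd p)) * indicator ({0<..<t} \<times> UNIV) p = ?g p" for p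
        using t by (cases p) (auto simp: w_def indicator_def)
      \<comment> \<open>One computation for identity, negation and absolute value: positive
        homogeneity lets \<open>h\<close> pass through the nonnegative heat kernel.\<close>
      have D: "duh (gauss \<epsilon>) (\<lambda>r y. ennreal (h (b (w r y)))) t x = (\<integral>\<^sup>+p. ennreal (h (?g p)) \<partial>lborel)"
        if [measurable]: "h \<in> borel_measurable borel" and h: "\<And>c z. 0 \<le> c \<Longrightarrow> h (c * z) = c * h z" for h :: "real \<Rightarrow> real"
      proof -
        have hm: "(\<lambda>(r, y). ennreal (h (b (w r y)))) \<in> borel_measurable (borel \<Otimes>\<^sub>M borel)"
          using m by (auto simp: case_prod_unfold)
        show ?thesis
          unfolding duh_gauss[OF e t0 hm]
        proof (intro nn_integral_cong)
          fix p :: "real \<times> real"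
          have "h (?g p) = (?n p * indicator ({0<..<t} \<times> UNIV) p) * h (b (w (fst p) (snd p)))"
            unfolding eq[symmetric] by (subst h[symmetric]) (auto simp: mult_ac)
          then show "ennreal (?n p) * ennreal (h (b (w (fst p) (snd p)))) * indicator ({0<..<t} \<times> UNIV) p = ennreal (h (?g p))"
            by (auto simp: indicator_def ennreal_mult')
        qed
      qed
      have "duh (gauss \<epsilon>) (\<lambda>r y. ennreal \<bar>b (w r y)\<bar>) t x = (\<integral>\<^sup>+p. ennreal \<bar>?g p\<bar> \<partial>lborel)"
        by (rule D) (auto simp: abs_mult)
      also have "\<dots> < \<infinity>" using sol(1) unfolding integrable_iff_bounded by simp
      finally have fin: "duh (gauss \<epsilon>) (\<lambda>r y. ennreal \<bar>b (w r y)\<bar>) t x < \<infinity>" .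
      have "duh (gauss \<epsilon>) (\<lambda>r y. ennreal (b (w r y))) t x = (\<integral>\<^sup>+p. ennreal (?g p) \<partial>lborel)"
        "duh (gauss \<epsilon>) (\<lambda>r y. ennreal (- b (w r y))) t x = (\<integral>\<^sup>+p. ennreal (- ?g p) \<partial>lborel)"
        by (rule D; simp)+
      then have "dur (gauss \<epsilon>) (\<lambda>r y. b (w r y)) t x = (LINT p|lborel. ?g p)"
        unfolding dur_def real_lebesgue_integral_def[OF sol(1)] by simp
      then show ?thesis using fin sol(2) kernel_initial_gauss[OF e t0 \<xi>, of x] by simp
    qed
    then show "duh (gauss \<epsilon>) (\<lambda>r y. ennreal \<bar>b (w r y)\<bar>) t x < \<infinity>"
      "u t x = kernel_initial (gauss \<epsilon>) \<xi> t x + dur (gauss \<epsilon>) (\<lambda>r y. b (w r y)) t x" by auto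
  qed
qed

section \<open>Comparison with the deterministic PDE and growth of the second moment\<close>

lemma moment_const_nonneg: "0 \<le> moment_const p"
  by (simp add: moment_const_def)

definition gronwall_const :: "real \<Rightarrow> real \<Rightarrow> real \<Rightarrow> real" where
  "gronwall_const l T p = 2 powr p * (1 + (2 * exp (2 * l * T) * l * T) powr p)"

lemma gronwall_const_mono:
  assumes "0 < l" "0 \<le> t" "t \<le> T" "0 \<le> p"
  shows "gronwall_const l t p \<le> gronwall_const l T p"
proof -
  have "exp (2 * l * t) * (l * t) \<le> exp (2 * l * T) * (l * T)"
    using assms by (intro mult_mono) auto
  then have "(2 * exp (2 * l * t) * l * t) powr p \<le> (2 * exp (2 * l * T) * l * T) powr p"
    using assms by (intro powr_mono2) auto
  then show ?thesis unfolding gronwall_const_def by (intro mult_left_mono) auto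
qed

lemma gronwall_const_nonneg: "0 \<le> gronwall_const l T p"
  by (simp add: gronwall_const_def)

text \<open>If the drift \<open>f\<close> is not integrable, \<open>dur\<close> is a default value,
  but then the right-hand side is infinite. So the bound holds for every path, as the pathwise
  hypothesis of \<open>gronwall_moment\<close> requires.\<close>

lemma (in conv_kernel) duhamel_difference:
  assumes f: "(\<lambda>(r, y). f r y) \<in> borel_measurable (borel \<Otimes>\<^sub>M borel)"
    and g: "(\<lambda>(r, y). g r y) \<in> borel_measurable (borel \<Otimes>\<^sub>M borel)"
    and gf: "duh \<nu> (\<lambda>r y. ennreal \<bar>g r y\<bar>) t x < \<infinity>"
    and X: "X = R + k + dur \<nu> f t x" and Y: "Y = k + dur \<nu> g t x"
  shows "ennreal \<bar>X - Y\<bar> \<le> ennreal \<bar>R\<bar> + duh \<nu> (\<lambda>r y. ennreal \<bar>f r y - g r y\<bar>) t x"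
proof (cases "duh \<nu> (\<lambda>r y. ennreal \<bar>f r y\<bar>) t x < \<infinity>")
  case True
  have "ennreal \<bar>X - Y\<bar> \<le> ennreal (\<bar>R\<bar> + \<bar>dur \<nu> f t x - dur \<nu> g t x\<bar>)"
    unfolding X Y by (intro ennreal_leI) linarith
  also have "\<dots> = ennreal \<bar>R\<bar> + ennreal \<bar>dur \<nu> f t x - dur \<nu> g t x\<bar>" by (rule ennreal_plus) auto
  also have "\<dots> \<le> ennreal \<bar>R\<bar> + duh \<nu> (\<lambda>r y. ennreal \<bar>f r y - g r y\<bar>) t x"
    by (intro add_left_mono dur_diff_bound f g gf True)
  finally show ?thesis .
next
  case False
  have m: "(\<lambda>(r, y). ennreal \<bar>f r y - g r y\<bar>) \<in> borel_measurable (borel \<Otimes>\<^sub>M borel)"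
    "(\<lambda>(r, y). ennreal \<bar>g r y\<bar>) \<in> borel_measurable (borel \<Otimes>\<^sub>M borel)"
    using f g by (auto simp: case_prod_unfold)
  have "duh \<nu> (\<lambda>r y. ennreal \<bar>f r y\<bar>) t x \<le> duh \<nu> (\<lambda>r y. ennreal \<bar>f r y - g r y\<bar> + ennreal \<bar>g r y\<bar>) t x"
  proof (rule duh_mono)
    fix r y
    have "ennreal \<bar>f r y\<bar> \<le> ennreal (\<bar>f r y - g r y\<bar> + \<bar>g r y\<bar>)" by (intro ennreal_leI) linarith
    then show "ennreal \<bar>f r y\<bar> \<le> ennreal \<bar>f r y - g r y\<bar> + ennreal \<bar>g r y\<bar>" by simp
  qed
  also have "\<dots> = duh \<nu> (\<lambda>r y. ennreal \<bar>f r y - g r y\<bar>) t x + duh \<nu> (\<lambda>r y. ennreal \<bar>g r y\<bar>) t x"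
    by (rule duh_add[OF m])
  finally have "duh \<nu> (\<lambda>r y. ennreal \<bar>f r y - g r y\<bar>) t x = \<infinity>"
    using False gf by (auto simp: top_unique less_top[symmetric])
  then show ?thesis by simp
qed

lemma (in conv_kernel) duh_diff_finite:
  assumes f: "(\<lambda>(r, y). f r y) \<in> borel_measurable (borel \<Otimes>\<^sub>M borel)"
    and g: "(\<lambda>(r, y). g r y) \<in> borel_measurable (borel \<Otimes>\<^sub>M borel)"
    and ff: "duh \<nu> (\<lambda>r y. ennreal \<bar>f r y\<bar>) t x < \<infinity>" and gf: "duh \<nu> (\<lambda>r y. ennreal \<bar>g r y\<bar>) t x < \<infinity>"
  shows "duh \<nu> (\<lambda>r y. ennreal \<bar>f r y - g r y\<bar>) t x < \<infinity>"
proof -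
  have m: "(\<lambda>(r, y). ennreal \<bar>f r y\<bar>) \<in> borel_measurable (borel \<Otimes>\<^sub>M borel)"
    "(\<lambda>(r, y). ennreal \<bar>g r y\<bar>) \<in> borel_measurable (borel \<Otimes>\<^sub>M borel)"
    using f g by (auto simp: case_prod_unfold)
  have "duh \<nu> (\<lambda>r y. ennreal \<bar>f r y - g r y\<bar>) t x \<le> duh \<nu> (\<lambda>r y. ennreal \<bar>f r y\<bar> + ennreal \<bar>g r y\<bar>) t x"
  proof (rule duh_mono)
    fix r y
    have "ennreal \<bar>f r y - g r y\<bar> \<le> ennreal (\<bar>f r y\<bar> + \<bar>g r y\<bar>)" by (intro ennreal_leI) linarith
    then show "ennreal \<bar>f r y - g r y\<bar> \<le> ennreal \<bar>f r y\<bar> + ennreal \<bar>g r y\<bar>" by simp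
  qed
  also have "\<dots> = duh \<nu> (\<lambda>r y. ennreal \<bar>f r y\<bar>) t x + duh \<nu> (\<lambda>r y. ennreal \<bar>g r y\<bar>) t x"
    by (rule duh_add[OF m])
  also have "\<dots> < \<infinity>" using ff gf by simp
  finally show ?thesis .
qed

text \<open>The initial terms cancel, so the difference of the two solutions obeys a Duhamel
  inequality with source \<open>vres\<close>, which the Lipschitz condition closes.\<close>

lemma (in weak_limit) pde_moment:
  assumes pde: "deterministic_pde_solution T \<epsilon>1 b \<xi> u"
    and lip: "\<And>u v. \<bar>b u - b v\<bar> \<le> l * \<bar>u - v\<bar>" "0 < l" and p: "1 \<le> p"
    and Lam: "0 < Lam" "gu * \<epsilon>2\<^sup>2 * (2 * sqrt T / sqrt \<epsilon>1) \<le> Lam" and t: "t \<in> {0..T}"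
  shows "(\<integral>\<^sup>+\<omega>. ennreal (\<bar>V t x \<omega> - u t x\<bar> powr p) \<partial>M)
    \<le> ennreal (gronwall_const l T p * (moment_const p * Lam powr (p / 2)))"
proof -
  have t': "0 \<le> t" "t \<le> T" using t by auto
  define w where "w r = u (clamp_time T r)" for r
  note duhamel = pde_duhamel[OF pde eps(1) Tpos b_cont xi_cont, folded w_def]
  define B where "B \<omega> r y = ennreal \<bar>b (field \<omega> r y) - b (w r y)\<bar>" for \<omega> r y
  have wm: "(\<lambda>(r, y). b (w r y)) \<in> borel_measurable (borel \<Otimes>\<^sub>M borel)" by (rule duhamel(1)[OF t])
  let ?N = "M \<Otimes>\<^sub>M (borel \<Otimes>\<^sub>M (borel :: real measure)) :: ('b \<times> real \<times> real) measure"
  have [measurable]: "(\<lambda>p. b (w (fst (snd p)) (snd (snd p)))) \<in> borel_measurable ?N"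
    using measurable_compose[OF measurable_snd wm, of M] by (simp add: case_prod_unfold)
  have [measurable]: "(\<lambda>p. b (field (fst p) (fst (snd p)) (snd (snd p)))) \<in> borel_measurable ?N"
    using measurable_b_field by (simp add: case_prod_unfold)
  have mB: "(\<lambda>(\<omega>, r, y). B \<omega> r y) \<in> borel_measurable ?N"
    unfolding B_def case_prod_unfold by measurable
  have diff: "ennreal \<bar>field \<omega> s y - w s y\<bar> \<le> ennreal \<bar>vres \<omega> s y\<bar> + duh (gauss \<epsilon>1) (B \<omega>) s y"
    if w: "\<omega> \<in> space M" and s: "0 \<le> s" "s \<le> T" for \<omega> s y
    unfolding B_def
  proof (rule G.duhamel_difference[OF G.measurable_section_pair[OF measurable_b_field w] wm])
    have s': "s \<in> {0..T}" using s by simp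
    show "duh (gauss \<epsilon>1) (\<lambda>r y. ennreal \<bar>b (w r y)\<bar>) s y < \<infinity>" by (rule duhamel(2)[OF s'])
    show "field \<omega> s y = vres \<omega> s y + kernel_initial (gauss \<epsilon>1) \<xi> s y + dur (gauss \<epsilon>1) (\<lambda>r y. b (field \<omega> r y)) s y"
      by (simp add: vres_def)
    show "w s y = kernel_initial (gauss \<epsilon>1) \<xi> s y + dur (gauss \<epsilon>1) (\<lambda>r y. b (w r y)) s y"
      using duhamel(3)[OF s', of y] s by (simp add: w_def)
  qed
  have "(\<integral>\<^sup>+\<omega>. ennreal (\<bar>field \<omega> t x - w t x\<bar> powr p) \<partial>M)
    \<le> ennreal (2 powr p * (1 + (2 * exp (2 * l * t) * l * t) powr p) * (moment_const p * Lam powr (p / 2)))"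
  proof (rule G.gronwall_moment[OF M mB measurable_vres lip(2) t'(1) p])
    show "0 \<le> moment_const p * Lam powr (p / 2)" by (simp add: moment_const_nonneg)
    show "B \<omega> s y \<le> ennreal l * ennreal \<bar>vres \<omega> s y\<bar> + ennreal l * duh (gauss \<epsilon>1) (B \<omega>) s y"
      if "\<omega> \<in> space M" "0 \<le> s" "s \<le> t" for \<omega> s y
    proof -
      have "B \<omega> s y \<le> ennreal (l * \<bar>field \<omega> s y - w s y\<bar>)" unfolding B_def by (intro ennreal_leI lip)
      also have "\<dots> = ennreal l * ennreal \<bar>field \<omega> s y - w s y\<bar>" using lip(2) by (intro ennreal_mult') auto
      also have "\<dots> \<le> ennreal l * (ennreal \<bar>vres \<omega> s y\<bar> + duh (gauss \<epsilon>1) (B \<omega>) s y)"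
        using that t' by (intro mult_left_mono diff) auto
      finally show ?thesis by (simp add: distrib_left)
    qed
    show "AE \<omega> in M. duh (gauss \<epsilon>1) (B \<omega>) t x < \<infinity>"
      using duh_b_field_finite[OF Lam t, of x] AE_space
    proof eventually_elim
      case (elim \<omega>)
      show ?case
        unfolding B_def
        by (rule G.duh_diff_finite[OF G.measurable_section_pair[OF measurable_b_field elim(2)] wm elim(1) duhamel(2)[OF t]])
    qed
    show "(\<integral>\<^sup>+\<omega>. ennreal (\<bar>vres \<omega> s y\<bar> powr p) \<partial>M) \<le> ennreal (moment_const p * Lam powr (p / 2))"
      if "0 \<le> s" "s \<le> t" for s y
      using that t' p by (intro sub_exp_moment[OF vres_sub_exp[OF Lam] Lam(1)]) auto
    show "(\<lambda>\<omega>. field \<omega> t x - w t x) \<in> borel_measurable M"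
      using measurable_compose[OF _ measurable_field, of "\<lambda>\<omega>. (\<omega>, t, x)" M] by simp
    show "AE \<omega> in M. ennreal \<bar>field \<omega> t x - w t x\<bar> \<le> ennreal \<bar>vres \<omega> t x\<bar> + duh (gauss \<epsilon>1) (B \<omega>) t x"
      using diff t' by (intro AE_I2) auto
  qed
  also have "\<dots> \<le> ennreal (gronwall_const l T p * (moment_const p * Lam powr (p / 2)))"
    using gronwall_const_mono[OF lip(2) t', of p] p
    by (intro ennreal_leI mult_right_mono) (auto simp: gronwall_const_def moment_const_nonneg)
  finally show ?thesis using t' by (simp add: field_def w_def)
qed

text \<open>The Duhamel formula at \<open>(T, 0)\<close> read backwards: \<open>vres\<close> is the
  field minus a bounded initial term minus the drift, so second moments of the field bound the
  variance of the noise. Jensen's inequality with \<open>p = 2\<close> handles the drift, and an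
  infinite \<open>S\<close> is harmless.\<close>

lemma (in weak_limit) second_moment_lower:
  assumes K: "\<And>u. (b u)\<^sup>2 \<le> K * (1 + u\<^sup>2)" "0 \<le> K"
  defines "S \<equiv> SUP t\<in>{0..T}. SUP x. \<integral>\<^sup>+\<omega>. ennreal ((V t x \<omega>)\<^sup>2) \<partial>M"
  shows "ennreal (gl * \<epsilon>2\<^sup>2 * (9/16 * T / (4 * sqrt (\<epsilon>1 * T)))) \<le> 3 * (S + ennreal (C\<^sup>2) + ennreal T * (ennreal K * (1 + S) * ennreal T))"
proof -
  define Lam where "Lam = 1 + gu * \<epsilon>2\<^sup>2 * (2 * sqrt T / sqrt \<epsilon>1)"
  have "0 \<le> gu * \<epsilon>2\<^sup>2 * (2 * sqrt T / sqrt \<epsilon>1)" using L.gu0 eps Tpos by simp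
  then have Lam: "0 < Lam" "gu * \<epsilon>2\<^sup>2 * (2 * sqrt T / sqrt \<epsilon>1) \<le> Lam" unfolding Lam_def by linarith+
  have T: "T \<in> {0..T}" "0 \<le> T" using Tpos by auto
  let ?D = "\<lambda>\<omega>. dur (gauss \<epsilon>1) (\<lambda>r y. b (field \<omega> r y)) T 0"
  let ?E = "\<lambda>\<omega>. duh (gauss \<epsilon>1) (\<lambda>r y. ennreal (\<bar>b (field \<omega> r y)\<bar> powr 2)) T 0"
  have fm [measurable]: "(\<lambda>\<omega>. field \<omega> r y) \<in> borel_measurable M" for r y
    using measurable_compose[OF _ measurable_field, of "\<lambda>\<omega>. (\<omega>, r, y)" M] by simp
  have fS: "(\<integral>\<^sup>+\<omega>. ennreal ((field \<omega> r y)\<^sup>2) \<partial>M) \<le> S" for r y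
  proof -
    have "clamp_time T r \<in> {0..T}" using clamp_time_in Tpos by simp
    then have "(\<integral>\<^sup>+\<omega>. ennreal ((V (clamp_time T r) y \<omega>)\<^sup>2) \<partial>M) \<le> S"
      unfolding S_def by (rule SUP_upper2) (rule SUP_upper, simp)
    then show ?thesis by (simp add: field_def)
  qed
  have mE: "(\<lambda>(\<omega>, r, y). ennreal (\<bar>b (field \<omega> r y)\<bar> powr 2)) \<in> borel_measurable (M \<Otimes>\<^sub>M (borel \<Otimes>\<^sub>M borel))"
    using measurable_b_field by (simp add: case_prod_unfold)
  have [measurable]: "?E \<in> borel_measurable M" by (rule G.measurable_duh[OF mE]) auto
  have lin: "(\<integral>\<^sup>+\<omega>. 3 * (f \<omega> + k + c * E \<omega>) \<partial>M) = 3 * ((\<integral>\<^sup>+\<omega>. f \<omega> \<partial>M) + k + c * (\<integral>\<^sup>+\<omega>. E \<omega> \<partial>M))"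
    if [measurable]: "f \<in> borel_measurable M" "E \<in> borel_measurable M" for f E :: "'b \<Rightarrow> ennreal" and k c
    by (simp add: nn_integral_cmult nn_integral_add emeasure_space_1 del: distrib_left_numeral)
  have "ennreal (gl * \<epsilon>2\<^sup>2 * (9/16 * T / (4 * sqrt (\<epsilon>1 * T)))) \<le> (\<integral>\<^sup>+\<omega>. ennreal ((vres \<omega> T 0)\<^sup>2) \<partial>M)"
    by (rule sub_exp_second_moment[OF M vres_sub_exp[OF Lam T(1)]])
  also have "\<dots> \<le> (\<integral>\<^sup>+\<omega>. 3 * (ennreal ((field \<omega> T 0)\<^sup>2) + ennreal (C\<^sup>2) + ennreal T * ?E \<omega>) \<partial>M)"
  proof (rule nn_integral_mono_AE, use duh_b_field_finite[OF Lam T(1), of 0] AE_space in eventually_elim)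
    fix \<omega> assume fin: "duh (gauss \<epsilon>1) (\<lambda>r y. ennreal \<bar>b (field \<omega> r y)\<bar>) T 0 < \<infinity>" and w: "\<omega> \<in> space M"
    let ?d = "enn2real (duh (gauss \<epsilon>1) (\<lambda>r y. ennreal \<bar>b (field \<omega> r y)\<bar>) T 0)"
    note ms = G.measurable_section_pair[OF measurable_b_field w]
    have "\<bar>?D \<omega>\<bar> \<le> ?d"
      using G.dur_bound[OF ms, of T 0] fin by (subst ennreal_le_iff[symmetric]) (auto simp: ennreal_enn2real_if)
    then have "\<bar>?D \<omega>\<bar>\<^sup>2 \<le> ?d\<^sup>2" by (rule power_mono) simp
    then have "(?D \<omega>)\<^sup>2 \<le> ?d powr 2" by (simp add: powr_numeral)
    then have "ennreal ((?D \<omega>)\<^sup>2) \<le> ennreal (?d powr 2)" by (rule ennreal_leI)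
    also have "\<dots> \<le> ennreal (T powr (2 - 1)) * ?E \<omega>"
      using ms by (intro G.duh_powr T(2) fin) (auto simp: case_prod_unfold)
    finally have dE: "ennreal ((?D \<omega>)\<^sup>2) \<le> ennreal T * ?E \<omega>" using Tpos by simp
    have "(vres \<omega> T 0)\<^sup>2 \<le> 3 * ((field \<omega> T 0)\<^sup>2 + C\<^sup>2 + (?D \<omega>)\<^sup>2)"
    proof -
      have "(f - k - d)\<^sup>2 \<le> 3 * (f\<^sup>2 + k\<^sup>2 + d\<^sup>2)" for f k d :: real
      proof -
        \<comment> \<open>These three squares are exactly the difference of the two sides.\<close>
        have "0 \<le> (f + k)\<^sup>2 + (f + d)\<^sup>2 + (k - d)\<^sup>2" by simp
        then show ?thesis by (simp add: power2_eq_square algebra_simps)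
      qed
      from this[of "field \<omega> T 0" "kernel_initial (gauss \<epsilon>1) \<xi> T 0" "?D \<omega>"]
      have A: "(vres \<omega> T 0)\<^sup>2 \<le> 3 * ((field \<omega> T 0)\<^sup>2 + (kernel_initial (gauss \<epsilon>1) \<xi> T 0)\<^sup>2 + (?D \<omega>)\<^sup>2)"
        by (simp add: vres_def)
      have "(kernel_initial (gauss \<epsilon>1) \<xi> T 0)\<^sup>2 \<le> C\<^sup>2"
        using G.kernel_initial_bound[OF xi_cont xi_bound, of T 0] L.C0 by (intro abs_le_square_iff[THEN iffD1]) simp
      then show ?thesis by (intro order_trans[OF A]) simp
    qed
    then have "ennreal ((vres \<omega> T 0)\<^sup>2) \<le> ennreal (3 * ((field \<omega> T 0)\<^sup>2 + C\<^sup>2 + (?D \<omega>)\<^sup>2))" by (rule ennreal_leI)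
    also have "\<dots> = 3 * (ennreal ((field \<omega> T 0)\<^sup>2) + ennreal (C\<^sup>2) + ennreal ((?D \<omega>)\<^sup>2))"
      by (simp add: ennreal_mult')
    also have "\<dots> \<le> 3 * (ennreal ((field \<omega> T 0)\<^sup>2) + ennreal (C\<^sup>2) + ennreal T * ?E \<omega>)"
      by (intro mult_left_mono add_left_mono dE) simp
    finally show "ennreal ((vres \<omega> T 0)\<^sup>2) \<le> 3 * (ennreal ((field \<omega> T 0)\<^sup>2) + ennreal (C\<^sup>2) + ennreal T * ?E \<omega>)" .
  qed
  also have "\<dots> = 3 * ((\<integral>\<^sup>+\<omega>. ennreal ((field \<omega> T 0)\<^sup>2) \<partial>M) + ennreal (C\<^sup>2) + ennreal T * (\<integral>\<^sup>+\<omega>. ?E \<omega> \<partial>M))"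
    by (rule lin) measurable
  also have "(\<integral>\<^sup>+\<omega>. ?E \<omega> \<partial>M) = duh (gauss \<epsilon>1) (\<lambda>r y. \<integral>\<^sup>+\<omega>. ennreal (\<bar>b (field \<omega> r y)\<bar> powr 2) \<partial>M) T 0"
    by (rule G.nn_integral_duh[OF M mE])
  also have "3 * ((\<integral>\<^sup>+\<omega>. ennreal ((field \<omega> T 0)\<^sup>2) \<partial>M) + ennreal (C\<^sup>2) + ennreal T * duh (gauss \<epsilon>1) (\<lambda>r y. \<integral>\<^sup>+\<omega>. ennreal (\<bar>b (field \<omega> r y)\<bar> powr 2) \<partial>M) T 0)
     \<le> 3 * (S + ennreal (C\<^sup>2) + ennreal T * duh (gauss \<epsilon>1) (\<lambda>r y. ennreal K * (1 + S)) T 0)"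
  proof (intro mult_left_mono add_mono fS order_refl G.duh_mono)
    fix r y
    have "(\<integral>\<^sup>+\<omega>. ennreal (\<bar>b (field \<omega> r y)\<bar> powr 2) \<partial>M) \<le> (\<integral>\<^sup>+\<omega>. ennreal K * (1 + ennreal ((field \<omega> r y)\<^sup>2)) \<partial>M)"
    proof (rule nn_integral_mono)
      fix \<omega>
      have "ennreal (\<bar>b (field \<omega> r y)\<bar> powr 2) \<le> ennreal (K * (1 + (field \<omega> r y)\<^sup>2))"
        using K(1)[of "field \<omega> r y"] by (intro ennreal_leI) (simp add: powr_numeral)
      also have "\<dots> = ennreal K * (1 + ennreal ((field \<omega> r y)\<^sup>2))" using K(2) by (simp add: ennreal_mult')
      finally show "ennreal (\<bar>b (field \<omega> r y)\<bar> powr 2) \<le> ennreal K * (1 + ennreal ((field \<omega> r y)\<^sup>2))" .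
    qed
    also have "\<dots> = ennreal K * (1 + (\<integral>\<^sup>+\<omega>. ennreal ((field \<omega> r y)\<^sup>2) \<partial>M))"
      by (simp add: nn_integral_cmult nn_integral_add emeasure_space_1)
    also have "\<dots> \<le> ennreal K * (1 + S)" by (intro mult_left_mono add_left_mono fS) simp
    finally show "(\<integral>\<^sup>+\<omega>. ennreal (\<bar>b (field \<omega> r y)\<bar> powr 2) \<partial>M) \<le> ennreal K * (1 + S)" .
  qed auto
  also have "duh (gauss \<epsilon>1) (\<lambda>r y. ennreal K * (1 + S)) T 0 = ennreal K * (1 + S) * ennreal T" by (rule G.duh_const[OF T(2)])
  finally show ?thesis .
qed

section \<open>Comparison on a fixed lattice\<close>

text \<open>The argument of \<open>pde_moment\<close> with the walk as kernel. Source and drift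
  difference are restricted to sites, where the noise estimates hold, and the deterministic system
  is interpolated to a measurable field.\<close>

lemma (in lattice_solution) lattice_moment:
  assumes v: "\<And>y. y \<in> lattice \<delta> \<Longrightarrow> continuous_on {0..T} (v y)"
    and gd: "\<And>y s. y \<in> lattice \<delta> \<Longrightarrow> s \<in> {0..T} \<Longrightarrow> has_green_drift \<delta> \<epsilon>1 b v s y (v y s - green_initial \<delta> \<epsilon>1 \<xi> s y)"
    and lip: "\<And>u v. \<bar>b u - b v\<bar> \<le> l * \<bar>u - v\<bar>" "0 < l" and p: "1 \<le> p"
    and L: "0 < Lam" "gu * \<epsilon>2\<^sup>2 / \<delta> * min T (\<delta> * (2 * sqrt T / sqrt \<epsilon>1)) \<le> Lam"
    and t: "t \<in> {0..T}" and x: "x \<in> lattice \<delta>"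
  shows "(\<integral>\<^sup>+\<omega>. ennreal (\<bar>X x t \<omega> - v x t\<bar> powr p) \<partial>M)
    \<le> ennreal (gronwall_const l T p * (moment_const p * Lam powr (p / 2)))"
proof -
  have t': "0 \<le> t" "t \<le> T" using t by auto
  define w where "w r y = lin_interp \<delta> (\<lambda>z. v z (clamp_time T r)) y" for r y
  have w_lattice: "w r y = v y r" if "y \<in> lattice \<delta>" "0 \<le> r" "r \<le> T" for r y
    using that by (simp add: w_def lin_interp_lattice[OF \<delta>])
  let ?N = "M \<Otimes>\<^sub>M (borel \<Otimes>\<^sub>M (borel :: real measure)) :: ('a \<times> real \<times> real) measure"
  have "(\<lambda>(\<omega>, r, y). interp_path \<delta> T (\<lambda>y t \<omega>. v y t) \<omega> r y) \<in> borel_measurable ?N"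
    using T v by (intro measurable_interp_path) auto
  then have mw: "(\<lambda>(\<omega>, r, y). w r y) \<in> borel_measurable ?N" by (simp add: interp_path_def w_def)
  have mbw: "(\<lambda>(\<omega>, r, y). b (w r y)) \<in> borel_measurable ?N"
    using measurable_compose[OF mw measurable_b] by (simp add: case_prod_unfold)
  \<comment> \<open>Any sample point serves, since the deterministic field does not depend on
    it.\<close>
  obtain \<omega>0 where \<omega>0: "\<omega>0 \<in> space M" using not_empty by blast
  have wm: "(\<lambda>(r, y). b (w r y)) \<in> borel_measurable (borel \<Otimes>\<^sub>M borel)"
    by (rule kern.measurable_section_pair[OF mbw \<omega>0])
  define B where "B \<omega> r y = ennreal (indicator (lattice \<delta>) y * \<bar>b (path \<omega> r y) - b (w r y)\<bar>)" for \<omega> r y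
  define R where "R \<omega> s y = indicator (lattice \<delta>) y * res \<omega> s y" for \<omega> s y
  have lat: "lattice \<delta> \<in> sets borel" by (rule sets.countable[OF _ countable_lattice]) simp
  have [measurable]: "(\<lambda>p. indicator (lattice \<delta>) (snd (snd p)) :: real) \<in> borel_measurable ?N"
    using lat by measurable
  have [measurable]: "(\<lambda>p. res (fst p) (fst (snd p)) (snd (snd p))) \<in> borel_measurable ?N"
    "(\<lambda>p. b (path (fst p) (fst (snd p)) (snd (snd p)))) \<in> borel_measurable ?N"
    "(\<lambda>p. b (w (fst (snd p)) (snd (snd p)))) \<in> borel_measurable ?N"
    using measurable_res measurable_b_path mbw by (simp_all add: case_prod_unfold)
  have mR: "(\<lambda>(\<omega>, r, y). R \<omega> r y) \<in> borel_measurable ?N" and mB: "(\<lambda>(\<omega>, r, y). B \<omega> r y) \<in> borel_measurable ?N"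
    unfolding R_def B_def case_prod_unfold by measurable
  have dB: "duh (walk \<delta> \<epsilon>1) (B \<omega>) s y = duh (walk \<delta> \<epsilon>1) (\<lambda>r y. ennreal \<bar>b (path \<omega> r y) - b (w r y)\<bar>) s y" if "y \<in> lattice \<delta>" for \<omega> s y
    by (rule duh_walk_cong[OF that]) (simp add: B_def)
  have dw: "duh (walk \<delta> \<epsilon>1) (\<lambda>r y. ennreal \<bar>b (w r y)\<bar>) s y < \<infinity>"
    "w s y = kernel_initial (walk \<delta> \<epsilon>1) \<xi> s y + dur (walk \<delta> \<epsilon>1) (\<lambda>r y. b (w r y)) s y"
    if y: "y \<in> lattice \<delta>" and s: "0 \<le> s" "s \<le> T" for s y
  proof -
    have s': "s \<in> {0..T}" using s by simp
    have eq: "b (w r z) = b (v z r)" if "0 \<le> r" "r \<le> s" "z \<in> lattice \<delta>" for r z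
      using that s w_lattice by simp
    note ld = lattice_drift[where T = T, OF \<delta> \<epsilon>1 y s b v wm eq gd[OF y s']]
    show "duh (walk \<delta> \<epsilon>1) (\<lambda>r y. ennreal \<bar>b (w r y)\<bar>) s y < \<infinity>" by (rule ld(1))
    have "green_initial \<delta> \<epsilon>1 \<xi> s y = kernel_initial (walk \<delta> \<epsilon>1) \<xi> s y"
      unfolding kernel_initial_def by (rule green_initial_eq[OF \<delta> \<epsilon>1 y s(1) \<xi>])
    then show "w s y = kernel_initial (walk \<delta> \<epsilon>1) \<xi> s y + dur (walk \<delta> \<epsilon>1) (\<lambda>r y. b (w r y)) s y"
      using ld(2) w_lattice[OF y s] by simp
  qed
  have diff: "ennreal \<bar>path \<omega> s y - w s y\<bar> \<le> ennreal \<bar>R \<omega> s y\<bar> + duh (walk \<delta> \<epsilon>1) (B \<omega>) s y"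
    if w: "\<omega> \<in> space M" and s: "0 \<le> s" "s \<le> T" and y: "y \<in> lattice \<delta>" for \<omega> s y
    unfolding dB[OF y]
  proof (rule kern.duhamel_difference[OF kern.measurable_section_pair[OF measurable_b_path w] wm dw(1)[OF y s]])
    show "path \<omega> s y = R \<omega> s y + kernel_initial (walk \<delta> \<epsilon>1) \<xi> s y + dur (walk \<delta> \<epsilon>1) (\<lambda>r y. b (path \<omega> r y)) s y"
      using y by (simp add: R_def res_def)
  qed (rule dw(2)[OF y s])
  have "(\<integral>\<^sup>+\<omega>. ennreal (\<bar>path \<omega> t x - w t x\<bar> powr p) \<partial>M)
    \<le> ennreal (2 powr p * (1 + (2 * exp (2 * l * t) * l * t) powr p) * (moment_const p * Lam powr (p / 2)))"
  proof (rule kern.gronwall_moment[OF prob_space_axioms mB mR lip(2) t'(1) p])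
    show "0 \<le> moment_const p * Lam powr (p / 2)" by (simp add: moment_const_nonneg)
    show "B \<omega> s y \<le> ennreal l * ennreal \<bar>R \<omega> s y\<bar> + ennreal l * duh (walk \<delta> \<epsilon>1) (B \<omega>) s y"
      if "\<omega> \<in> space M" "0 \<le> s" "s \<le> t" for \<omega> s y
    proof (cases "y \<in> lattice \<delta>")
      case True
      have "B \<omega> s y \<le> ennreal (l * \<bar>path \<omega> s y - w s y\<bar>)" using True lip(1) by (simp add: B_def ennreal_leI)
      also have "\<dots> = ennreal l * ennreal \<bar>path \<omega> s y - w s y\<bar>" using lip(2) by (intro ennreal_mult') auto
      also have "\<dots> \<le> ennreal l * (ennreal \<bar>R \<omega> s y\<bar> + duh (walk \<delta> \<epsilon>1) (B \<omega>) s y)"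
        using that t' True by (intro mult_left_mono diff) auto
      finally show ?thesis by (simp add: distrib_left)
    qed (simp add: B_def)
    show "AE \<omega> in M. duh (walk \<delta> \<epsilon>1) (B \<omega>) t x < \<infinity>"
    proof -
      have "AE \<omega> in M. duh (walk \<delta> \<epsilon>1) (\<lambda>r y. ennreal \<bar>b (path \<omega> r y)\<bar>) t x < \<infinity>"
        by (rule res_at[OF x t]) blast
      then show ?thesis using AE_space
      proof eventually_elim
        case (elim \<omega>)
        show ?case
          unfolding dB[OF x]
          by (rule kern.duh_diff_finite[OF kern.measurable_section_pair[OF measurable_b_path elim(2)] wm elim(1) dw(1)[OF x t']])
      qed
    qed
    show "(\<integral>\<^sup>+\<omega>. ennreal (\<bar>R \<omega> s y\<bar> powr p) \<partial>M) \<le> ennreal (moment_const p * Lam powr (p / 2))"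
      if "0 \<le> s" "s \<le> t" for s y
    proof (cases "y \<in> lattice \<delta>")
      case True
      then show ?thesis
        using that t' p sub_exp_moment[OF res_sub_exp[OF True _ L(2), of s] L(1), of p] by (simp add: R_def)
    qed (use p in \<open>simp add: R_def\<close>)
    show "(\<lambda>\<omega>. path \<omega> t x - w t x) \<in> borel_measurable M"
      using measurable_compose[OF _ measurable_path, of "\<lambda>\<omega>. (\<omega>, t, x)" M] by simp
    show "AE \<omega> in M. ennreal \<bar>path \<omega> t x - w t x\<bar> \<le> ennreal \<bar>R \<omega> t x\<bar> + duh (walk \<delta> \<epsilon>1) (B \<omega>) t x"
      using diff[OF _ t' x] by (intro AE_I2) auto
  qed
  also have "\<dots> \<le> ennreal (gronwall_const l T p * (moment_const p * Lam powr (p / 2)))"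
    using gronwall_const_mono[OF lip(2) t', of p] p
    by (intro ennreal_leI mult_right_mono) (auto simp: gronwall_const_def moment_const_nonneg)
  finally show ?thesis using path_lattice[OF x t] w_lattice[OF x t'] by simp
qed

text \<open>The interpolated difference is a convex combination, hence at most the larger endpoint
  difference, and the larger of two powers is at most their sum.\<close>

lemma lin_interp_diff_powr:
  assumes "1 \<le> p"
  shows "\<bar>lin_interp \<delta> f x - lin_interp \<delta> g x\<bar> powr p
    \<le> \<bar>f (of_int \<lfloor>x / \<delta>\<rfloor> * \<delta>) - g (of_int \<lfloor>x / \<delta>\<rfloor> * \<delta>)\<bar> powr p
    + \<bar>f (of_int (\<lfloor>x / \<delta>\<rfloor> + 1) * \<delta>) - g (of_int (\<lfloor>x / \<delta>\<rfloor> + 1) * \<delta>)\<bar> powr p"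
proof -
  define \<theta> where "\<theta> = frac (x / \<delta>)"
  have \<theta>: "0 \<le> \<theta>" "\<theta> \<le> 1" unfolding \<theta>_def by (auto intro: less_imp_le frac_lt_1)
  have conv: "\<bar>(1 - \<theta>) * u + \<theta> * v\<bar> powr p \<le> \<bar>u\<bar> powr p + \<bar>v\<bar> powr p" for u v
  proof -
    define m where "m = max \<bar>u\<bar> \<bar>v\<bar>"
    have "\<bar>(1 - \<theta>) * u + \<theta> * v\<bar> \<le> \<bar>(1 - \<theta>) * u\<bar> + \<bar>\<theta> * v\<bar>" by (rule abs_triangle_ineq)
    also have "\<dots> = (1 - \<theta>) * \<bar>u\<bar> + \<theta> * \<bar>v\<bar>" using \<theta> by (simp add: abs_mult)
    also have "\<dots> \<le> (1 - \<theta>) * m + \<theta> * m" using \<theta> by (intro add_mono mult_left_mono) (auto simp: m_def)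
    also have "\<dots> = m" by (simp add: algebra_simps)
    finally have "\<bar>(1 - \<theta>) * u + \<theta> * v\<bar> powr p \<le> m powr p" using assms by (intro powr_mono2) auto
    also have "\<dots> \<le> \<bar>u\<bar> powr p + \<bar>v\<bar> powr p" by (simp add: m_def max_def)
    finally show ?thesis .
  qed
  have "lin_interp \<delta> f x - lin_interp \<delta> g x = (1 - \<theta>) * (f (of_int \<lfloor>x / \<delta>\<rfloor> * \<delta>) - g (of_int \<lfloor>x / \<delta>\<rfloor> * \<delta>))
     + \<theta> * (f (of_int (\<lfloor>x / \<delta>\<rfloor> + 1) * \<delta>) - g (of_int (\<lfloor>x / \<delta>\<rfloor> + 1) * \<delta>))"
    by (simp add: lin_interp_def \<theta>_def algebra_simps)
  then show ?thesis using conv by simp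
qed

lemma (in lattice_solution) interp_moment:
  assumes v: "\<And>y. y \<in> lattice \<delta> \<Longrightarrow> continuous_on {0..T} (v y)"
    and gd: "\<And>y s. y \<in> lattice \<delta> \<Longrightarrow> s \<in> {0..T} \<Longrightarrow> has_green_drift \<delta> \<epsilon>1 b v s y (v y s - green_initial \<delta> \<epsilon>1 \<xi> s y)"
    and lip: "\<And>u v. \<bar>b u - b v\<bar> \<le> l * \<bar>u - v\<bar>" "0 < l" and p: "1 \<le> p"
    and L: "0 < Lam" "gu * \<epsilon>2\<^sup>2 / \<delta> * min T (\<delta> * (2 * sqrt T / sqrt \<epsilon>1)) \<le> Lam"
    and t: "t \<in> {0..T}"
  shows "(\<integral>\<^sup>+\<omega>. ennreal (\<bar>lin_interp \<delta> (\<lambda>y. X y t \<omega>) x - lin_interp \<delta> (\<lambda>y. v y t) x\<bar> powr p) \<partial>M)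
    \<le> ennreal (2 * (gronwall_const l T p * (moment_const p * Lam powr (p / 2))))"
proof -
  define y1 y2 where "y1 = of_int \<lfloor>x / \<delta>\<rfloor> * \<delta>" and "y2 = of_int (\<lfloor>x / \<delta>\<rfloor> + 1) * \<delta>"
  have y: "y1 \<in> lattice \<delta>" "y2 \<in> lattice \<delta>" unfolding y1_def y2_def lattice_def by blast+
  note [measurable] = measurable_X[OF y(1) t] measurable_X[OF y(2) t]
  let ?m = "gronwall_const l T p * (moment_const p * Lam powr (p / 2))"
  have m0: "0 \<le> ?m" by (simp add: gronwall_const_nonneg moment_const_nonneg)
  have "(\<integral>\<^sup>+\<omega>. ennreal (\<bar>lin_interp \<delta> (\<lambda>y. X y t \<omega>) x - lin_interp \<delta> (\<lambda>y. v y t) x\<bar> powr p) \<partial>M)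
    \<le> (\<integral>\<^sup>+\<omega>. ennreal (\<bar>X y1 t \<omega> - v y1 t\<bar> powr p) + ennreal (\<bar>X y2 t \<omega> - v y2 t\<bar> powr p) \<partial>M)"
    using lin_interp_diff_powr[OF p, of \<delta> "\<lambda>y. X y t _" x "\<lambda>y. v y t"] unfolding y1_def y2_def
    by (intro nn_integral_mono) (simp flip: ennreal_plus)
  also have "\<dots> = (\<integral>\<^sup>+\<omega>. ennreal (\<bar>X y1 t \<omega> - v y1 t\<bar> powr p) \<partial>M) + (\<integral>\<^sup>+\<omega>. ennreal (\<bar>X y2 t \<omega> - v y2 t\<bar> powr p) \<partial>M)"
    by (rule nn_integral_add) auto
  also have "\<dots> \<le> ennreal ?m + ennreal ?m"
    by (intro add_mono lattice_moment[OF v gd lip p L t y(1)] lattice_moment[OF v gd lip p L t y(2)])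
  also have "\<dots> = ennreal (2 * ?m)" by (simp only: mult_2 ennreal_plus[OF m0 m0])
  finally show ?thesis .
qed

section \<open>From the definitions of solutions to the locales\<close>

text \<open>Square roots turn the quadratic growth bound into linear growth with constant
  \<open>sqrt K\<close>, because \<open>1 + u^2 <= (1 + |u|)^2\<close>.\<close>

lemma sdde_lattice_solution:
  assumes sol: "sdde_solution M F W \<delta> T \<epsilon>1 \<epsilon>2 a b \<xi> U"
    and d: "\<And>n. 0 < \<delta> n" and eps: "0 < \<epsilon>1" "0 < \<epsilon>2" "0 < T" and b: "continuous_on UNIV b"
    and K: "0 < K" "\<And>u. (b u)\<^sup>2 \<le> K * (1 + u\<^sup>2)" and \<xi>: "continuous_on UNIV \<xi>" "\<And>y. \<bar>\<xi> y\<bar> \<le> C"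
    and a: "\<And>u. gl \<le> (a u)\<^sup>2" "\<And>u. (a u)\<^sup>2 \<le> gu" "0 \<le> gl"
  shows "lattice_solution M F (W n) (\<delta> n) \<epsilon>1 \<epsilon>2 T a b \<xi> (U n) (sqrt K) C gl gu"
proof
  show "\<bar>b u\<bar> \<le> sqrt K * (1 + \<bar>u\<bar>)" for u
  proof -
    have "(b u)\<^sup>2 \<le> K * (1 + u\<^sup>2)" by (rule K(2))
    also have "\<dots> \<le> K * (1 + \<bar>u\<bar>)\<^sup>2" using K(1) by (intro mult_left_mono) (auto simp: power2_eq_square algebra_simps)
    finally have "sqrt ((b u)\<^sup>2) \<le> sqrt (K * (1 + \<bar>u\<bar>)\<^sup>2)" by (rule real_sqrt_le_mono)
    then show ?thesis by (simp add: real_sqrt_mult)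
  qed
qed (use sol d eps b K \<xi> a in \<open>auto simp: sdde_solution_def brownian_system_def\<close>)

lemma sdde_weak_limit:
  fixes U :: "real \<Rightarrow> real \<Rightarrow> 'w \<Rightarrow> real"
  assumes wl: "sdde_weak_limit_solution TYPE('v) \<delta> T \<epsilon>1 \<epsilon>2 a b \<xi> M U"
    and d: "\<And>n. 0 < \<delta> n" "\<delta> \<longlonglongrightarrow> 0" and eps: "0 < \<epsilon>1" "0 < \<epsilon>2" "0 < T" and b: "continuous_on UNIV b"
    and K: "0 < K" "\<And>u. (b u)\<^sup>2 \<le> K * (1 + u\<^sup>2)" and \<xi>: "continuous_on UNIV \<xi>" "\<And>y. \<bar>\<xi> y\<bar> \<le> C"
    and a: "\<And>u. gl \<le> (a u)\<^sup>2" "\<And>u. (a u)\<^sup>2 \<le> gu" "0 \<le> gl"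
  obtains N :: "'v measure" and F W d X V where "weak_limit N F W d \<epsilon>1 \<epsilon>2 T a b \<xi> X (sqrt K) C gl gu M V"
    "\<And>t x. t \<in> {0..T} \<Longrightarrow> AE \<omega> in M. U t x \<omega> = V t x \<omega>"
proof -
  obtain N :: "'v measure" and F W X r V where s: "sdde_solution N F W \<delta> T \<epsilon>1 \<epsilon>2 a b \<xi> X" "strict_mono r"
    "\<forall>t\<in>{0..T}. \<forall>x. V t x \<in> borel_measurable M"
    "\<forall>\<omega>\<in>space M. continuous_on ({0..T} \<times> UNIV) (\<lambda>(t, x). V t x \<omega>)"
    "\<forall>t\<in>{0..T}. \<forall>x. AE \<omega> in M. U t x \<omega> = V t x \<omega>"
    "converges_in_law T N (\<lambda>k t x \<omega>. lin_interp (\<delta> (r k)) (\<lambda>y. X (r k) y t \<omega>) x) M V"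
    and M: "prob_space M"
    using wl unfolding sdde_weak_limit_solution_def by blast
  have "weak_limit N F (\<lambda>k. W (r k)) (\<lambda>k. \<delta> (r k)) \<epsilon>1 \<epsilon>2 T a b \<xi> (\<lambda>k. X (r k)) (sqrt K) C gl gu M V"
  proof (rule weak_limit.intro)
    show "lattice_solution N F (W (r k)) (\<delta> (r k)) \<epsilon>1 \<epsilon>2 T a b \<xi> (X (r k)) (sqrt K) C gl gu" for k
      by (rule sdde_lattice_solution[OF s(1) d(1) eps b K \<xi> a])
    show "(\<lambda>k. \<delta> (r k)) \<longlonglongrightarrow> 0" using LIMSEQ_subseq_LIMSEQ[OF d(2) s(2)] by (simp add: comp_def)
  qed (use s M in auto)
  then show thesis using s(5) by (intro that) auto
qed

section \<open>Limits in the parameters\<close>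

lemma ratio_square:
  assumes "0 < (x :: real)" shows "(y / x powr (1/4))\<^sup>2 = y\<^sup>2 / sqrt x"
proof -
  have "(x powr (1/4))\<^sup>2 = x powr (1/2)" by (simp add: power2_eq_square flip: powr_add)
  then show ?thesis using assms by (simp add: power_divide powr_half_sqrt)
qed

lemma eventually_at_right_0_pos: "filterlim (f :: 'i \<Rightarrow> real) (at_right 0) G \<Longrightarrow> \<forall>\<^sub>F i in G. 0 < f i"
  by (rule eventually_compose_filterlim[OF eventually_at_right_less])

text \<open>At a level \<open>r\<close>: a supremum of at most \<open>r\<close> would bound the
  variance of the noise by a constant multiple of \<open>Y\<close>, while its lower bound is a
  multiple of the squared ratio of the parameters and diverges.\<close>

lemma weak_limit_second_moment_tendsto:
  fixes a b \<xi> :: "real \<Rightarrow> real" and K T :: real and \<delta> :: "nat \<Rightarrow> real" and G :: "'i filter"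
    and M :: "'i \<Rightarrow> 'w measure"
  assumes T: "0 < T" and delta: "\<And>n. 0 < \<delta> n" "\<delta> \<longlonglongrightarrow> 0" and b: "continuous_on UNIV b"
    and K: "0 < K" "\<And>u. (b u)\<^sup>2 \<le> K * (1 + u\<^sup>2)" and xi: "continuous_on UNIV \<xi>" "\<And>y. \<bar>\<xi> y\<bar> \<le> C"
    and a: "0 < Kl" "\<And>u. Kl \<le> a u" "\<And>u. a u \<le> KL"
    and pos: "\<forall>\<^sub>F i in G. 0 < \<epsilon>1 i" "\<forall>\<^sub>F i in G. 0 < \<epsilon>2 i"
    and ratio: "filterlim (\<lambda>i. \<epsilon>2 i / \<epsilon>1 i powr (1/4)) at_top G"
    and sol: "\<forall>\<^sub>F i in G. sdde_weak_limit_solution TYPE('v) \<delta> T (\<epsilon>1 i) (\<epsilon>2 i) a b \<xi> (M i) (U i)"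
  shows "((\<lambda>i. SUP s\<in>{0..T}. SUP x. \<integral>\<^sup>+\<omega>. ennreal ((U i s x \<omega>)\<^sup>2) \<partial>M i) \<longlongrightarrow> \<infinity>) G"
proof (rule order_tendstoI)
  fix y :: ennreal assume "y < \<infinity>"
  then obtain r where r: "y = ennreal r" "0 \<le> r" by (cases y) auto
  \<comment> \<open>\<open>9/64 * sqrt T\<close> is the kernel constant
    \<open>9/16 * T / (4 * sqrt T)\<close>.\<close>
  define k where "k = Kl\<^sup>2 * (9/64 * sqrt T)"
  have k: "0 < k" using a(1) T by (simp add: k_def)
  \<comment> \<open>The ratio will be required to exceed \<open>1\<close> and \<open>Y / k\<close>:
    above \<open>1\<close> it is below its own square, so the square exceeds \<open>Y / k\<close>
    too.\<close>
  define Y where "Y = 3 * (r + C\<^sup>2 + T * (K * (1 + r) * T))"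
  have "\<forall>\<^sub>F i in G. max 1 (Y / k) < \<epsilon>2 i / \<epsilon>1 i powr (1/4)"
    by (rule eventually_compose_filterlim[OF eventually_gt_at_top ratio])
  then show "\<forall>\<^sub>F i in G. y < (SUP s\<in>{0..T}. SUP x. \<integral>\<^sup>+\<omega>. ennreal ((U i s x \<omega>)\<^sup>2) \<partial>M i)"
    using pos sol
  proof eventually_elim
    case (elim i)
    obtain N :: "'v measure" and F W d X V where wl: "weak_limit N F W d (\<epsilon>1 i) (\<epsilon>2 i) T a b \<xi> X (sqrt K) C (Kl\<^sup>2) (KL\<^sup>2) (M i) V"
      and UV: "\<And>t x. t \<in> {0..T} \<Longrightarrow> AE \<omega> in M i. U i t x \<omega> = V t x \<omega>"
    proof (rule sdde_weak_limit[OF elim(4) delta elim(2,3) T b K xi])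
      show "Kl\<^sup>2 \<le> (a u)\<^sup>2" "(a u)\<^sup>2 \<le> KL\<^sup>2" for u
        using a(1) a(2)[of u] a(3)[of u] by (intro power_mono; linarith)+
    qed auto
    define S where "S = (SUP t\<in>{0..T}. SUP x. \<integral>\<^sup>+\<omega>. ennreal ((V t x \<omega>)\<^sup>2) \<partial>M i)"
    have SU: "(SUP t\<in>{0..T}. SUP x. \<integral>\<^sup>+\<omega>. ennreal ((U i t x \<omega>)\<^sup>2) \<partial>M i) = S"
      unfolding S_def
    proof (intro SUP_cong refl nn_integral_cong_AE)
      fix t x assume "t \<in> {0..T}"
      from UV[OF this, of x] show "AE \<omega> in M i. ennreal ((U i t x \<omega>)\<^sup>2) = ennreal ((V t x \<omega>)\<^sup>2)" by eventually_elim simp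
    qed
    have low: "ennreal (Kl\<^sup>2 * (\<epsilon>2 i)\<^sup>2 * (9/16 * T / (4 * sqrt (\<epsilon>1 i * T)))) \<le> 3 * (S + ennreal (C\<^sup>2) + ennreal T * (ennreal K * (1 + S) * ennreal T))"
      unfolding S_def using K by (intro weak_limit.second_moment_lower[OF wl]) auto
    have v: "Kl\<^sup>2 * (\<epsilon>2 i)\<^sup>2 * (9/16 * T / (4 * sqrt (\<epsilon>1 i * T))) = k * (\<epsilon>2 i / \<epsilon>1 i powr (1/4))\<^sup>2"
    proof -
      have "9/16 * T / (4 * sqrt (\<epsilon>1 i * T)) = 9/16 * (T / sqrt T) / (4 * sqrt (\<epsilon>1 i))"
        by (simp add: real_sqrt_mult mult_ac)
      also have "T / sqrt T = sqrt T" using T by (simp add: real_div_sqrt)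
      finally show ?thesis unfolding ratio_square[OF elim(2)] k_def by simp
    qed
    have "\<not> S \<le> ennreal r"
    proof
      assume S: "S \<le> ennreal r"
      note low
      also have "3 * (S + ennreal (C\<^sup>2) + ennreal T * (ennreal K * (1 + S) * ennreal T)) \<le>
          3 * (ennreal r + ennreal (C\<^sup>2) + ennreal T * (ennreal K * (1 + ennreal r) * ennreal T))"
        using S by (intro mult_left_mono mult_right_mono add_mono) auto
      also have "\<dots> = ennreal Y"
      proof -
        have "0 \<le> K * (1 + r)" "0 \<le> T * (K * (1 + r) * T)" "0 \<le> K * (1 + r) * T" using K r T by auto
        then show ?thesis
          using r T K by (simp add: Y_def ennreal_mult' ennreal_mult'' mult.assoc del: distrib_left_numeral)
      qed
      finally have "k * (\<epsilon>2 i / \<epsilon>1 i powr (1/4))\<^sup>2 \<le> Y"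
        unfolding v using r T K by (subst (asm) ennreal_le_iff) (auto simp: Y_def)
      moreover have "Y < k * (\<epsilon>2 i / \<epsilon>1 i powr (1/4))\<^sup>2"
      proof -
        let ?q = "\<epsilon>2 i / \<epsilon>1 i powr (1/4)"
        have q: "1 < ?q" "Y / k < ?q" using elim(1) by auto
        then have "?q * 1 \<le> ?q * ?q" by (intro mult_left_mono) auto
        then have "Y / k < ?q\<^sup>2" using q unfolding power2_eq_square by linarith
        then show ?thesis using k by (simp add: pos_divide_less_eq mult.commute)
      qed
      ultimately show False by simp
    qed
    then show ?case unfolding SU r(1) by simp
  qed
qed simp

lemma powr_ennreal_tendsto_0:
  fixes f :: "'i \<Rightarrow> real"
  assumes f: "(f \<longlongrightarrow> 0) G" "\<forall>\<^sub>F i in G. 0 \<le> f i" and q: "0 < q"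
    and le: "\<forall>\<^sub>F i in G. g i \<le> ennreal (k * (m * f i powr q))"
  shows "(g \<longlongrightarrow> 0) G"
proof (rule tendsto_sandwich[OF _ le tendsto_const])
  have "((\<lambda>i. f i powr q) \<longlongrightarrow> 0) G"
    using f q by (intro tendsto_zero_powrI[OF f(1) tendsto_const]) auto
  then have "((\<lambda>i. k * (m * f i powr q)) \<longlongrightarrow> k * (m * 0)) G" by (intro tendsto_intros)
  then show "((\<lambda>i. ennreal (k * (m * f i powr q))) \<longlongrightarrow> 0) G" using tendsto_ennrealI by fastforce
qed simp

lemma weak_limit_pde_moment_tendsto:
  fixes a b \<xi> :: "real \<Rightarrow> real" and K T :: real and \<delta> :: "nat \<Rightarrow> real" and G :: "'i filter"
    and M :: "'i \<Rightarrow> 'w measure"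
  assumes T: "0 < T" and delta: "\<And>n. 0 < \<delta> n" "\<delta> \<longlonglongrightarrow> 0" and b: "continuous_on UNIV b"
    and K: "0 < K" "\<And>u. (b u)\<^sup>2 \<le> K * (1 + u\<^sup>2)" and xi: "continuous_on UNIV \<xi>" "\<And>y. \<bar>\<xi> y\<bar> \<le> C"
    and a: "\<And>u. \<bar>a u\<bar> \<le> A" and lip: "\<And>u v. \<bar>b u - b v\<bar> \<le> l * \<bar>u - v\<bar>" "0 < l"
    and pos: "\<forall>\<^sub>F i in G. 0 < \<epsilon>1 i" "\<forall>\<^sub>F i in G. 0 < \<epsilon>2 i"
    and ratio: "((\<lambda>i. \<epsilon>2 i / \<epsilon>1 i powr (1/4)) \<longlongrightarrow> 0) G" and q: "1 \<le> q"
    and sol: "\<forall>\<^sub>F i in G. sdde_weak_limit_solution TYPE('v) \<delta> T (\<epsilon>1 i) (\<epsilon>2 i) a b \<xi> (M i) (U i)"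
    and pde: "\<forall>\<^sub>F i in G. deterministic_pde_solution T (\<epsilon>1 i) b \<xi> (u i)"
  shows "((\<lambda>i. SUP t\<in>{0..T}. SUP x. \<integral>\<^sup>+\<omega>. ennreal (\<bar>U i t x \<omega> - u i t x\<bar> powr (2 * q)) \<partial>M i) \<longlongrightarrow> 0) G"
proof (rule powr_ennreal_tendsto_0)
  \<comment> \<open>By \<open>ratio_square\<close> this is the variance ceiling; the added
    \<open>1\<close> keeps it positive even if \<open>a\<close> vanishes, as scaling by its square
    root requires.\<close>
  let ?L = "\<lambda>i. (A\<^sup>2 + 1) * (2 * sqrt T) * (\<epsilon>2 i / \<epsilon>1 i powr (1/4))\<^sup>2"
  have "(?L \<longlongrightarrow> (A\<^sup>2 + 1) * (2 * sqrt T) * 0\<^sup>2) G" by (intro tendsto_intros ratio)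
  then show "(?L \<longlongrightarrow> 0) G" by simp
  show "\<forall>\<^sub>F i in G. 0 \<le> ?L i" using T by (intro always_eventually) simp
  show "0 < q" using q by simp
  show "\<forall>\<^sub>F i in G. (SUP t\<in>{0..T}. SUP x. \<integral>\<^sup>+\<omega>. ennreal (\<bar>U i t x \<omega> - u i t x\<bar> powr (2 * q)) \<partial>M i)
      \<le> ennreal (gronwall_const l T (2 * q) * (moment_const (2 * q) * ?L i powr q))"
    using pos sol pde
  proof eventually_elim
    case (elim i)
    obtain N :: "'v measure" and F W d X V where wl: "weak_limit N F W d (\<epsilon>1 i) (\<epsilon>2 i) T a b \<xi> X (sqrt K) C 0 (A\<^sup>2 + 1) (M i) V"
      and UV: "\<And>t x. t \<in> {0..T} \<Longrightarrow> AE \<omega> in M i. U i t x \<omega> = V t x \<omega>"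
    proof (rule sdde_weak_limit[where gl = 0 and gu = "A\<^sup>2 + 1", OF elim(3) delta elim(1,2) T b K xi])
      show "(a u)\<^sup>2 \<le> A\<^sup>2 + 1" for u
        using power_mono[OF a[of u], of 2] by simp
    qed auto
    have L: "?L i = (A\<^sup>2 + 1) * (\<epsilon>2 i)\<^sup>2 * (2 * sqrt T / sqrt (\<epsilon>1 i))"
      unfolding ratio_square[OF elim(1)] by simp
    have "0 < A\<^sup>2 + 1" by (rule add_nonneg_pos) auto
    then have L0: "0 < ?L i" unfolding L using elim(1,2) T by simp
    show ?case
    proof (intro SUP_least)
      fix t x assume t: "t \<in> {0..T}"
      have "(\<integral>\<^sup>+\<omega>. ennreal (\<bar>U i t x \<omega> - u i t x\<bar> powr (2 * q)) \<partial>M i) = (\<integral>\<^sup>+\<omega>. ennreal (\<bar>V t x \<omega> - u i t x\<bar> powr (2 * q)) \<partial>M i)"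
        by (rule nn_integral_cong_AE, use UV[OF t, of x] in eventually_elim) simp
      also have "\<dots> \<le> ennreal (gronwall_const l T (2 * q) * (moment_const (2 * q) * ?L i powr (2 * q / 2)))"
        using q by (intro weak_limit.pde_moment[OF wl elim(4) lip _ L0 _ t]) (auto simp: L)
      finally show "(\<integral>\<^sup>+\<omega>. ennreal (\<bar>U i t x \<omega> - u i t x\<bar> powr (2 * q)) \<partial>M i)
        \<le> ennreal (gronwall_const l T (2 * q) * (moment_const (2 * q) * ?L i powr q))" by simp
    qed
  qed
qed

lemma lattice_moment_tendsto:
  fixes a b \<xi> :: "real \<Rightarrow> real" and K T :: real and \<delta> :: "nat \<Rightarrow> real" and G :: "'i filter"
    and M :: "'i \<Rightarrow> 'w measure"
  assumes T: "0 < T" and delta: "\<And>n. 0 < \<delta> n" and b: "continuous_on UNIV b"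
    and K: "0 < K" "\<And>u. (b u)\<^sup>2 \<le> K * (1 + u\<^sup>2)" and xi: "continuous_on UNIV \<xi>" "\<And>y. \<bar>\<xi> y\<bar> \<le> C"
    and a: "\<And>u. \<bar>a u\<bar> \<le> A" and lip: "\<And>u v. \<bar>b u - b v\<bar> \<le> l * \<bar>u - v\<bar>" "0 < l"
    and pos: "\<forall>\<^sub>F i in G. 0 < \<epsilon>1 i" "\<forall>\<^sub>F i in G. 0 < \<epsilon>2 i"
    and e2: "(\<epsilon>2 \<longlongrightarrow> 0) G" and q: "1 \<le> q"
    and sol: "\<forall>\<^sub>F i in G. sdde_solution (M i) (F i) (W i) \<delta> T (\<epsilon>1 i) (\<epsilon>2 i) a b \<xi> (U i)"
    and det: "\<forall>\<^sub>F i in G. deterministic_system_solution \<delta> T (\<epsilon>1 i) b \<xi> (v i)"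
  shows "((\<lambda>i. SUP t\<in>{0..T}. SUP x. \<integral>\<^sup>+\<omega>. ennreal (\<bar>lin_interp (\<delta> n) (\<lambda>y. U i n y t \<omega>) x
      - lin_interp (\<delta> n) (\<lambda>y. v i n y t) x\<bar> powr (2 * q)) \<partial>M i) \<longlongrightarrow> 0) G"
proof (rule powr_ennreal_tendsto_0)
  \<comment> \<open>The ceiling for a fixed mesh, resting on \<open>lattice_green <= 1\<close>: it
    is proportional to \<open>\<epsilon>2^2\<close>.\<close>
  let ?L = "\<lambda>i. (A\<^sup>2 + 1) * (\<epsilon>2 i)\<^sup>2 / \<delta> n * T"
  have "(?L \<longlongrightarrow> (A\<^sup>2 + 1) * 0\<^sup>2 / \<delta> n * T) G" using delta[of n] by (intro tendsto_intros e2) auto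
  then show "(?L \<longlongrightarrow> 0) G" by simp
  have A: "0 < A\<^sup>2 + 1" by (rule add_nonneg_pos) auto
  then show "\<forall>\<^sub>F i in G. 0 \<le> ?L i" using T delta[of n] by (intro always_eventually) simp
  show "0 < q" using q by simp
  show "\<forall>\<^sub>F i in G. (SUP t\<in>{0..T}. SUP x. \<integral>\<^sup>+\<omega>. ennreal (\<bar>lin_interp (\<delta> n) (\<lambda>y. U i n y t \<omega>) x
      - lin_interp (\<delta> n) (\<lambda>y. v i n y t) x\<bar> powr (2 * q)) \<partial>M i)
      \<le> ennreal (2 * gronwall_const l T (2 * q) * (moment_const (2 * q) * ?L i powr q))"
    using pos sol det
  proof eventually_elim
    case (elim i)
    have ls: "lattice_solution (M i) (F i) (W i n) (\<delta> n) (\<epsilon>1 i) (\<epsilon>2 i) T a b \<xi> (U i n) (sqrt K) C 0 (A\<^sup>2 + 1)"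
    proof (rule sdde_lattice_solution[OF elim(3) delta elim(1,2) T b K xi])
      show "(a u)\<^sup>2 \<le> A\<^sup>2 + 1" for u
        using power_mono[OF a[of u], of 2] by simp
    qed auto
    have L0: "0 < ?L i" using A elim(2) T delta[of n] by simp
    have L: "(A\<^sup>2 + 1) * (\<epsilon>2 i)\<^sup>2 / \<delta> n * min T (\<delta> n * (2 * sqrt T / sqrt (\<epsilon>1 i))) \<le> ?L i"
      using A delta[of n] by (intro mult_left_mono) auto
    have q2: "1 \<le> 2 * q" using q by simp
    have dc: "\<And>y. y \<in> lattice (\<delta> n) \<Longrightarrow> continuous_on {0..T} (v i n y)"
      "\<And>y s. y \<in> lattice (\<delta> n) \<Longrightarrow> s \<in> {0..T} \<Longrightarrow> has_green_drift (\<delta> n) (\<epsilon>1 i) b (v i n) s y (v i n y s - green_initial (\<delta> n) (\<epsilon>1 i) \<xi> s y)"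
      using elim(4) by (auto simp: deterministic_system_solution_def)
    show ?case
    proof (intro SUP_least)
      fix t x assume t: "t \<in> {0..T}"
      from lattice_solution.interp_moment[OF ls dc lip q2 L0 L t, of x]
      show "(\<integral>\<^sup>+\<omega>. ennreal (\<bar>lin_interp (\<delta> n) (\<lambda>y. U i n y t \<omega>) x - lin_interp (\<delta> n) (\<lambda>y. v i n y t) x\<bar> powr (2 * q)) \<partial>M i)
        \<le> ennreal (2 * gronwall_const l T (2 * q) * (moment_const (2 * q) * ?L i powr q))" by (simp add: mult.assoc)
    qed
  qed
qed

text \<open>Parameters and solutions are indexed along a filter \<open>G\<close>, which covers
  sequences and continuous limits and any choice of solutions on the way. Moments are nonnegative
  integrals and may be infinite.\<close>

theorem theorem1p8:
  fixes a b \<xi> :: "real \<Rightarrow> real" and K T :: real and \<delta> :: "nat \<Rightarrow> real"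
  assumes T: "0 < T"
    and delta: "\<And>n. 0 < \<delta> n" "\<delta> \<longlonglongrightarrow> 0"
    and cont: "continuous_on UNIV a" "continuous_on UNIV b"
    and K: "0 < K"
    and growth: "\<And>u. (a u)\<^sup>2 \<le> K * (1 + u\<^sup>2)" "\<And>u. (b u)\<^sup>2 \<le> K * (1 + u\<^sup>2)"
    and xi: "continuous_on UNIV \<xi>" "bounded (range \<xi>)"
  shows
    "(\<forall>Kl KL (G :: 'i filter) \<epsilon>1 \<epsilon>2 (M :: 'i \<Rightarrow> 'w measure) U.
        0 < Kl \<and> 0 < KL \<and> (\<forall>u. Kl \<le> a u \<and> a u \<le> KL) \<and>
        (filterlim \<epsilon>1 (at_right 0) G \<and> filterlim \<epsilon>2 (at_right 0) G \<or>
         filterlim \<epsilon>1 at_top G \<and> filterlim \<epsilon>2 at_top G) \<and>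
        filterlim (\<lambda>i. \<epsilon>2 i / \<epsilon>1 i powr (1/4)) at_top G \<and>
        (\<forall>\<^sub>F i in G. sdde_weak_limit_solution TYPE('v) \<delta> T (\<epsilon>1 i) (\<epsilon>2 i) a b \<xi> (M i) (U i)) \<longrightarrow>
        ((\<lambda>i. SUP s\<in>{0..T}. SUP x. \<integral>\<^sup>+\<omega>. ennreal ((U i s x \<omega>)\<^sup>2) \<partial>M i) \<longlongrightarrow> \<infinity>) G)
     \<and>
     ((\<exists>L. L-lipschitz_on UNIV b) \<and> bounded (range a) \<longrightarrow>
      (\<forall>(G :: 'i filter) \<epsilon>1 \<epsilon>2.
        filterlim \<epsilon>1 (at_right 0) G \<and> filterlim \<epsilon>2 (at_right 0) G \<and>
        ((\<lambda>i. \<epsilon>2 i / \<epsilon>1 i powr (1/4)) \<longlongrightarrow> 0) G \<longrightarrow>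
        (\<forall>(M :: 'i \<Rightarrow> 'w measure) U u. \<forall>q\<ge>(1::real).
          (\<forall>\<^sub>F i in G. sdde_weak_limit_solution TYPE('v) \<delta> T (\<epsilon>1 i) (\<epsilon>2 i) a b \<xi> (M i) (U i)) \<and>
          (\<forall>\<^sub>F i in G. deterministic_pde_solution T (\<epsilon>1 i) b \<xi> (u i)) \<longrightarrow>
          ((\<lambda>i. SUP t\<in>{0..T}. SUP x.
              \<integral>\<^sup>+\<omega>. ennreal (\<bar>U i t x \<omega> - u i t x\<bar> powr (2 * q)) \<partial>M i) \<longlongrightarrow> 0) G)
        \<and>
        (\<forall>(M :: 'i \<Rightarrow> 'w measure) F W U v. \<forall>q\<ge>(1::real). \<forall>n.
          (\<forall>\<^sub>F i in G. sdde_solution (M i) (F i) (W i) \<delta> T (\<epsilon>1 i) (\<epsilon>2 i) a b \<xi> (U i)) \<and>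
          (\<forall>\<^sub>F i in G. deterministic_system_solution \<delta> T (\<epsilon>1 i) b \<xi> (v i)) \<longrightarrow>
          ((\<lambda>i. SUP t\<in>{0..T}. SUP x.
              \<integral>\<^sup>+\<omega>. ennreal (\<bar>lin_interp (\<delta> n) (\<lambda>y. U i n y t \<omega>) x
                               - lin_interp (\<delta> n) (\<lambda>y. v i n y t) x\<bar> powr (2 * q)) \<partial>M i)
             \<longlongrightarrow> 0) G)))"
proof -
  obtain C where "\<forall>z\<in>range \<xi>. norm z \<le> C" using xi(2) unfolding bounded_iff by blast
  then have C: "\<bar>\<xi> y\<bar> \<le> C" for y by simp
  show ?thesis
  proof (intro conjI allI impI; elim conjE exE)
    fix Kl KL :: real and G :: "'i filter" and \<epsilon>1 \<epsilon>2 and M :: "'i \<Rightarrow> 'w measure" and U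
    assume a: "0 < Kl" "\<forall>u. Kl \<le> a u \<and> a u \<le> KL"
      and lim: "filterlim \<epsilon>1 (at_right 0) G \<and> filterlim \<epsilon>2 (at_right 0) G \<or>
         filterlim \<epsilon>1 at_top G \<and> filterlim \<epsilon>2 at_top G"
      and ratio: "filterlim (\<lambda>i. \<epsilon>2 i / \<epsilon>1 i powr (1/4)) at_top G"
      and sol: "\<forall>\<^sub>F i in G. sdde_weak_limit_solution TYPE('v) \<delta> T (\<epsilon>1 i) (\<epsilon>2 i) a b \<xi> (M i) (U i)"
    \<comment> \<open>Either regime makes both parameters eventually positive.\<close>
    have pos: "\<forall>\<^sub>F i in G. 0 < \<epsilon>1 i" "\<forall>\<^sub>F i in G. 0 < \<epsilon>2 i"
      using lim eventually_at_right_0_pos eventually_compose_filterlim[OF eventually_gt_at_top[of 0]] by blast+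
    show "((\<lambda>i. SUP s\<in>{0..T}. SUP x. \<integral>\<^sup>+\<omega>. ennreal ((U i s x \<omega>)\<^sup>2) \<partial>M i) \<longlongrightarrow> \<infinity>) G"
      using a by (intro weak_limit_second_moment_tendsto[OF T delta cont(2) K growth(2) xi(1) C _ _ _ pos ratio sol]) auto
  next
    fix L :: real and G :: "'i filter" and \<epsilon>1 \<epsilon>2
      and M :: "'i \<Rightarrow> 'w measure" and U u and q :: real
    assume L: "L-lipschitz_on UNIV b" and "bounded (range a)"
      and e: "filterlim \<epsilon>1 (at_right 0) G" "filterlim \<epsilon>2 (at_right 0) G"
      and ratio: "((\<lambda>i. \<epsilon>2 i / \<epsilon>1 i powr (1/4)) \<longlongrightarrow> 0) G" and q: "1 \<le> q"
      and sol: "\<forall>\<^sub>F i in G. sdde_weak_limit_solution TYPE('v) \<delta> T (\<epsilon>1 i) (\<epsilon>2 i) a b \<xi> (M i) (U i)"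
        "\<forall>\<^sub>F i in G. deterministic_pde_solution T (\<epsilon>1 i) b \<xi> (u i)"
    then obtain A where "\<forall>z\<in>range a. norm z \<le> A" unfolding bounded_iff by blast
    then have A: "\<bar>a u\<bar> \<le> A" for u by simp
    have "0 \<le> L" by (rule lipschitz_on_nonneg[OF L])
    \<comment> \<open>\<open>L + 1\<close> replaces \<open>L\<close> because the Gronwall constant
      has to be positive.\<close>
    then have lip: "\<bar>b u - b v\<bar> \<le> (L + 1) * \<bar>u - v\<bar>" "0 < L + 1" for u v
      using lipschitz_onD[OF L, of u v] by (auto simp: dist_real_def algebra_simps)
    show "((\<lambda>i. SUP t\<in>{0..T}. SUP x. \<integral>\<^sup>+\<omega>. ennreal (\<bar>U i t x \<omega> - u i t x\<bar> powr (2 * q)) \<partial>M i) \<longlongrightarrow> 0) G"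
      by (rule weak_limit_pde_moment_tendsto[OF T delta cont(2) K growth(2) xi(1) C A lip
            eventually_at_right_0_pos[OF e(1)] eventually_at_right_0_pos[OF e(2)] ratio q sol])
  next
    fix L :: real and G :: "'i filter" and \<epsilon>1 \<epsilon>2
      and M :: "'i \<Rightarrow> 'w measure" and F W U v and q :: real and n
    assume L: "L-lipschitz_on UNIV b" and "bounded (range a)"
      and e: "filterlim \<epsilon>1 (at_right 0) G" "filterlim \<epsilon>2 (at_right 0) G" and q: "1 \<le> q"
      and sol: "\<forall>\<^sub>F i in G. sdde_solution (M i) (F i) (W i) \<delta> T (\<epsilon>1 i) (\<epsilon>2 i) a b \<xi> (U i)"
        "\<forall>\<^sub>F i in G. deterministic_system_solution \<delta> T (\<epsilon>1 i) b \<xi> (v i)"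
    then obtain A where "\<forall>z\<in>range a. norm z \<le> A" unfolding bounded_iff by blast
    then have A: "\<bar>a u\<bar> \<le> A" for u by simp
    have e2: "(\<epsilon>2 \<longlongrightarrow> 0) G" using e(2) by (simp add: filterlim_at)
    have "0 \<le> L" by (rule lipschitz_on_nonneg[OF L])
    then have lip: "\<bar>b u - b v\<bar> \<le> (L + 1) * \<bar>u - v\<bar>" "0 < L + 1" for u v
      using lipschitz_onD[OF L, of u v] by (auto simp: dist_real_def algebra_simps)
    show "((\<lambda>i. SUP t\<in>{0..T}. SUP x. \<integral>\<^sup>+\<omega>. ennreal (\<bar>lin_interp (\<delta> n) (\<lambda>y. U i n y t \<omega>) x
      - lin_interp (\<delta> n) (\<lambda>y. v i n y t) x\<bar> powr (2 * q)) \<partial>M i) \<longlongrightarrow> 0) G"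
      by (rule lattice_moment_tendsto[OF T delta(1) cont(2) K growth(2) xi(1) C A lip
            eventually_at_right_0_pos[OF e(1)] eventually_at_right_0_pos[OF e(2)] e2 q sol])
  qed
qed

end
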